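(* Let $Q$ be a quiver, $TQ_0:=\{i\in Q_0: \{i\}^+\text{ is finite}\}$, $\kappa\geq\mathrm{rccn}(Q)$ an infinite cardinal and $\mathcal{C}$ an $AB3(\kappa)$ abelian category. Then: (a) $f_i(X)\in\mathrm{Rep}^{ft}(Q,\mathcal{C})$ for all $i\in TQ_0$ and $X\in\mathcal{C}$. (b) Let $\kappa\geq\mathrm{ltccn}(Q)$. Then, for any $F\in\mathrm{Rep}^{ft}(Q,\mathcal{C})$, the canonical presentation $$\eta_F:\quad 0\to\coprod_{\rho\in Q_1}f_{t(\rho)}e_{s(\rho)}(F)\to\coprod_{i\in Q_0}f_ie_i(F)\to F\to0$$ is in $\mathrm{Rep}^{ft}(Q,\mathcal{C})$. (c) $f_i:\mathcal{C}\to\mathrm{Rep}^{ft}(Q,\mathcal{C})$ is left adjoint to $e_i:\mathrm{Rep}^{ft}(Q,\mathcal{C})\to\mathcal{C}$ for all $i\in TQ_0$. (d) Let $f_i$ be exact for all $i\in TQ_0$. Then, for each $i\in TQ_0$, there are natural isomorphisms $\mathrm{Ext}^n_{\mathrm{Rep}^{ft}(Q,\mathcal{C})}(f_i(?),-)\cong\mathrm{Ext}^n_{\mathcal{C}}(?,e_i(-))$ for all $n\geq1$.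
   Context: A quiver $Q$ consists of (possibly infinite) sets $Q_0$ of vertices and $Q_1$ of arrows with source and target maps $s,t$. $Q(i,j)$ is the set of paths from $i$ to $j$ (including the trivial path if $i=j$), $Q(-,j)=\bigcup_iQ(i,j)$. $\mathrm{Rep}(Q,\mathcal{C})$ is the abelian category of $\mathcal{C}$-valued representations of $Q$; $\mathrm{Supp}(F)=\{i\in Q_0:F_i\neq0\}$; $e_i$ is evaluation at $i$. Full subquivers are identified with their vertex sets. For $S\subseteq Q_0$, $S^{+}:=\{i\in Q_0\setminus S:\text{there is a path from a vertex of }S\text{ to }i\}$. $\mathrm{Rep}^{ft}(Q,\mathcal{C})$ is the full subcategory of $\mathrm{Rep}(Q,\mathcal{C})$ of finite-top-support representations: those $F$ with $\mathrm{Supp}(F)$ and $\mathrm{Supp}(F)^+$ both finite (including $F=0$); it is a full abelian subcategory closed under extensions, subobjects and quotients. $\mathrm{Ext}$ denotes Yoneda Ext in the indicated abelian category. For a set $X$ of cardinals, $\mathrm{size}(X):=\sup X$ if $x<\sup X$ for all $x\in X$, and $\mathrm{size}(X):=(\sup X)^+$ otherwise. $\mathrm{rccn}(Q):=\sup_{i}\mathrm{size}(\{|Q(i,j)|\}_{j\in Q_0})$, $\mathrm{ltccn}(Q):=\mathrm{size}(\{|Q(-,i)|\}_{i\in Q_0})$. $AB3(\kappa)$: coproducts of families indexed by sets of cardinality $<\kappa$ exist. $f_i:\mathcal{C}\to\mathrm{Rep}(Q,\mathcal{C})$: $(f_i(C))_j:=C^{(Q(i,j))}$ with inclusions $\mu_\rho^C$,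 and $(f_i(C))_\alpha\circ\mu^C_\rho=\mu^C_{\alpha\rho}$ for arrows $\alpha:k\to l$ and $\rho\in Q(i,k)$; it is left adjoint to $e_i$. For an arrow $\rho:j\to i$, $f_\rho(C):f_i(C)\to f_j(C)$ is the morphism with $(f_\rho(C))_k\circ\mu^C_\lambda=\mu^C_{\lambda\rho}$ for $\lambda\in Q(i,k)$. For $\kappa\geq\max\{\mathrm{rccn}(Q),\mathrm{ltccn}(Q)\}$ and $F\in\mathrm{Rep}(Q,\mathcal{C})$ the coproducts in $\eta_F$ exist in $\mathrm{Rep}(Q,\mathcal{C})$ and $\eta_F$ is an exact sequence there: the first map restricted to the summand of $\rho:j\to i$ is $\mu_{j}\circ f_\rho(F_j)-\mu_i\circ f_i(F_\rho)$ (with $\mu_k$ the inclusion of the summand $f_k(F_k)$), and the second map is induced by the counits $f_ie_i(F)\to F$. "$\eta_F$ is in $\mathrm{Rep}^{ft}(Q,\mathcal{C})$" means all its terms belong to $\mathrm{Rep}^{ft}(Q,\mathcal{C})$. *)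

theory Defs
  imports Main "HOL-Library.FuncSet" "HOL-Algebra.Group"
begin

unbundle cardinal_syntax

section \<open>Categories\<close>

text \<open>
  Categories are given by a set of objects and a set of arrows with domain and codomain, \<open>g \<cdot> f\<close>
  being the composite ``first \<open>f\<close>, then \<open>g\<close>''. The fields \<open>Add\<close> and \<open>Zer\<close> (sum of parallel arrows,
  zero arrow between two objects) only matter for preadditive categories.
\<close>

record ('o, 'm) cat =
  Obj :: "'o set"
  Arr :: "'m set"
  Dom :: "'m \<Rightarrow> 'o"
  Cod :: "'m \<Rightarrow> 'o"
  Ide :: "'o \<Rightarrow> 'm"
  Comp :: "'m \<Rightarrow> 'm \<Rightarrow> 'm" (infixr \<open>\<cdot>\<index>\<close> 70)
  Add :: "'m \<Rightarrow> 'm \<Rightarrow> 'm"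
  Zer :: "'o \<Rightarrow> 'o \<Rightarrow> 'm"

definition Hom :: "('o, 'm) cat \<Rightarrow> 'o \<Rightarrow> 'o \<Rightarrow> 'm set" where
  "Hom C a b = {f \<in> Arr C. Dom C f = a \<and> Cod C f = b}"

locale category =
  fixes C :: "('o, 'm) cat" (structure)
  assumes Dom_in_Obj: "f \<in> Arr C \<Longrightarrow> Dom C f \<in> Obj C"
    and Cod_in_Obj: "f \<in> Arr C \<Longrightarrow> Cod C f \<in> Obj C"
    and Ide_in_Hom: "a \<in> Obj C \<Longrightarrow> Ide C a \<in> Hom C a a"
    and Comp_in_Hom: "f \<in> Hom C a b \<Longrightarrow> g \<in> Hom C b c \<Longrightarrow> g \<cdot> f \<in> Hom C a c"
    and Comp_assoc: "f \<in> Hom C a b \<Longrightarrow> g \<in> Hom C b c \<Longrightarrow> h \<in> Hom C c d \<Longrightarrow>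
      (h \<cdot> g) \<cdot> f = h \<cdot> (g \<cdot> f)"
    and Comp_Ide_left: "f \<in> Hom C a b \<Longrightarrow> Ide C b \<cdot> f = f"
    and Comp_Ide_right: "f \<in> Hom C a b \<Longrightarrow> f \<cdot> Ide C a = f"

definition full_subcat :: "('o, 'm) cat \<Rightarrow> 'o set \<Rightarrow> ('o, 'm) cat" where
  "full_subcat C S =
     C\<lparr>Obj := Obj C \<inter> S, Arr := {f \<in> Arr C. Dom C f \<in> S \<and> Cod C f \<in> S}\<rparr>"

definition is_monic :: "('o, 'm) cat \<Rightarrow> 'm \<Rightarrow> bool" where
  "is_monic C f \<longleftrightarrow> f \<in> Arr C \<and>
     (\<forall>a. \<forall>g\<in>Hom C a (Dom C f). \<forall>h\<in>Hom C a (Dom C f). f \<cdot>\<^bsub>C\<^esub> g = f \<cdot>\<^bsub>C\<^esub> h \<longrightarrow> g = h)"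

definition is_epic :: "('o, 'm) cat \<Rightarrow> 'm \<Rightarrow> bool" where
  "is_epic C f \<longleftrightarrow> f \<in> Arr C \<and>
     (\<forall>a. \<forall>g\<in>Hom C (Cod C f) a. \<forall>h\<in>Hom C (Cod C f) a. g \<cdot>\<^bsub>C\<^esub> f = h \<cdot>\<^bsub>C\<^esub> f \<longrightarrow> g = h)"

definition is_zero_object :: "('o, 'm) cat \<Rightarrow> 'o \<Rightarrow> bool" where
  "is_zero_object C z \<longleftrightarrow> z \<in> Obj C \<and>
     (\<forall>a\<in>Obj C. (\<exists>!f. f \<in> Hom C z a) \<and> (\<exists>!f. f \<in> Hom C a z))"

definition is_coproduct ::
  "('o, 'm) cat \<Rightarrow> 'i set \<Rightarrow> ('i \<Rightarrow> 'o) \<Rightarrow> 'o \<Rightarrow> ('i \<Rightarrow> 'm) \<Rightarrow> bool" where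
  "is_coproduct C I X P \<iota> \<longleftrightarrow> P \<in> Obj C \<and> (\<forall>i\<in>I. \<iota> i \<in> Hom C (X i) P) \<and>
     (\<forall>T\<in>Obj C. \<forall>g. (\<forall>i\<in>I. g i \<in> Hom C (X i) T) \<longrightarrow>
        (\<exists>!h. h \<in> Hom C P T \<and> (\<forall>i\<in>I. h \<cdot>\<^bsub>C\<^esub> \<iota> i = g i)))"

definition is_pushout :: "('o, 'm) cat \<Rightarrow> 'm \<Rightarrow> 'm \<Rightarrow> 'm \<Rightarrow> 'm \<Rightarrow> bool" where
  "is_pushout C f g p q \<longleftrightarrow>
     f \<in> Arr C \<and> g \<in> Arr C \<and> p \<in> Arr C \<and> q \<in> Arr C \<and>
     Dom C f = Dom C g \<and> Dom C p = Cod C f \<and> Dom C q = Cod C g \<and> Cod C p = Cod C q \<and>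
     p \<cdot>\<^bsub>C\<^esub> f = q \<cdot>\<^bsub>C\<^esub> g \<and>
     (\<forall>T\<in>Obj C. \<forall>u\<in>Hom C (Cod C f) T. \<forall>v\<in>Hom C (Cod C g) T. u \<cdot>\<^bsub>C\<^esub> f = v \<cdot>\<^bsub>C\<^esub> g \<longrightarrow>
        (\<exists>!h. h \<in> Hom C (Cod C p) T \<and> h \<cdot>\<^bsub>C\<^esub> p = u \<and> h \<cdot>\<^bsub>C\<^esub> q = v))"

definition is_pullback :: "('o, 'm) cat \<Rightarrow> 'm \<Rightarrow> 'm \<Rightarrow> 'm \<Rightarrow> 'm \<Rightarrow> bool" where
  "is_pullback C f g p q \<longleftrightarrow>
     f \<in> Arr C \<and> g \<in> Arr C \<and> p \<in> Arr C \<and> q \<in> Arr C \<and>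
     Cod C f = Cod C g \<and> Cod C p = Dom C f \<and> Cod C q = Dom C g \<and> Dom C p = Dom C q \<and>
     f \<cdot>\<^bsub>C\<^esub> p = g \<cdot>\<^bsub>C\<^esub> q \<and>
     (\<forall>T\<in>Obj C. \<forall>u\<in>Hom C T (Dom C f). \<forall>v\<in>Hom C T (Dom C g). f \<cdot>\<^bsub>C\<^esub> u = g \<cdot>\<^bsub>C\<^esub> v \<longrightarrow>
        (\<exists>!h. h \<in> Hom C T (Dom C p) \<and> p \<cdot>\<^bsub>C\<^esub> h = u \<and> q \<cdot>\<^bsub>C\<^esub> h = v))"


subsection \<open>Functors and adjunctions\<close>

record ('o, 'm, 'p, 'n) func =
  fob :: "'o \<Rightarrow> 'p"
  far :: "'m \<Rightarrow> 'n"

definition is_functor :: "('o, 'm) cat \<Rightarrow> ('p, 'n) cat \<Rightarrow> ('o, 'm, 'p, 'n) func \<Rightarrow> bool" where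
  "is_functor C D F \<longleftrightarrow>
     (\<forall>a\<in>Obj C. fob F a \<in> Obj D \<and> far F (Ide C a) = Ide D (fob F a)) \<and>
     (\<forall>f\<in>Arr C. far F f \<in> Hom D (fob F (Dom C f)) (fob F (Cod C f))) \<and>
     (\<forall>f\<in>Arr C. \<forall>g\<in>Arr C. Dom C g = Cod C f \<longrightarrow> far F (g \<cdot>\<^bsub>C\<^esub> f) = far F g \<cdot>\<^bsub>D\<^esub> far F f)"

definition is_left_adjoint ::
  "('o, 'm) cat \<Rightarrow> ('p, 'n) cat \<Rightarrow> ('o, 'm, 'p, 'n) func \<Rightarrow> ('p, 'n, 'o, 'm) func \<Rightarrow> bool" where
  "is_left_adjoint C D L R \<longleftrightarrow> is_functor C D L \<and> is_functor D C R \<and>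
     (\<exists>\<Phi>.
        (\<forall>X\<in>Obj C. \<forall>Y\<in>Obj D. bij_betw (\<Phi> X Y) (Hom D (fob L X) Y) (Hom C X (fob R Y))) \<and>
        (\<forall>x\<in>Arr C. \<forall>y\<in>Arr D. \<forall>h\<in>Hom D (fob L (Cod C x)) (Dom D y).
           \<Phi> (Dom C x) (Cod D y) (y \<cdot>\<^bsub>D\<^esub> h \<cdot>\<^bsub>D\<^esub> far L x)
             = far R y \<cdot>\<^bsub>C\<^esub> \<Phi> (Cod C x) (Dom D y) h \<cdot>\<^bsub>C\<^esub> x))"


subsection \<open>Abelian categories\<close>

definition hom_group :: "('o, 'm) cat \<Rightarrow> 'o \<Rightarrow> 'o \<Rightarrow> 'm monoid" where
  "hom_group C a b = \<lparr>carrier = Hom C a b, mult = Add C, one = Zer C a b\<rparr>"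

definition Diff :: "('o, 'm) cat \<Rightarrow> 'm \<Rightarrow> 'm \<Rightarrow> 'm" where
  "Diff C f g = Add C f (inv\<^bsub>hom_group C (Dom C g) (Cod C g)\<^esub> g)"

locale preadditive_category = category +
  assumes hom_comm_group: "a \<in> Obj C \<Longrightarrow> b \<in> Obj C \<Longrightarrow> comm_group (hom_group C a b)"
    and Comp_Add_left: "f \<in> Hom C a b \<Longrightarrow> f' \<in> Hom C a b \<Longrightarrow> g \<in> Hom C b c \<Longrightarrow>
      g \<cdot> Add C f f' = Add C (g \<cdot> f) (g \<cdot> f')"
    and Comp_Add_right: "f \<in> Hom C a b \<Longrightarrow> g \<in> Hom C b c \<Longrightarrow> g' \<in> Hom C b c \<Longrightarrow>
      Add C g g' \<cdot> f = Add C (g \<cdot> f) (g' \<cdot> f)"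

definition is_biproduct ::
  "('o, 'm) cat \<Rightarrow> 'o \<Rightarrow> 'o \<Rightarrow> 'o \<Rightarrow> 'm \<Rightarrow> 'm \<Rightarrow> 'm \<Rightarrow> 'm \<Rightarrow> bool" where
  "is_biproduct C a b P i1 i2 p1 p2 \<longleftrightarrow>
     i1 \<in> Hom C a P \<and> i2 \<in> Hom C b P \<and> p1 \<in> Hom C P a \<and> p2 \<in> Hom C P b \<and>
     p1 \<cdot>\<^bsub>C\<^esub> i1 = Ide C a \<and> p2 \<cdot>\<^bsub>C\<^esub> i2 = Ide C b \<and>
     p2 \<cdot>\<^bsub>C\<^esub> i1 = Zer C a b \<and> p1 \<cdot>\<^bsub>C\<^esub> i2 = Zer C b a \<and>
     Add C (i1 \<cdot>\<^bsub>C\<^esub> p1) (i2 \<cdot>\<^bsub>C\<^esub> p2) = Ide C P"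

definition is_kernel :: "('o, 'm) cat \<Rightarrow> 'm \<Rightarrow> 'm \<Rightarrow> bool" where
  "is_kernel C f k \<longleftrightarrow> f \<in> Arr C \<and> k \<in> Arr C \<and> Cod C k = Dom C f \<and>
     f \<cdot>\<^bsub>C\<^esub> k = Zer C (Dom C k) (Cod C f) \<and>
     (\<forall>T\<in>Obj C. \<forall>g\<in>Hom C T (Dom C f). f \<cdot>\<^bsub>C\<^esub> g = Zer C T (Cod C f) \<longrightarrow>
        (\<exists>!h. h \<in> Hom C T (Dom C k) \<and> k \<cdot>\<^bsub>C\<^esub> h = g))"

definition is_cokernel :: "('o, 'm) cat \<Rightarrow> 'm \<Rightarrow> 'm \<Rightarrow> bool" where
  "is_cokernel C f p \<longleftrightarrow> f \<in> Arr C \<and> p \<in> Arr C \<and> Dom C p = Cod C f \<and>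
     p \<cdot>\<^bsub>C\<^esub> f = Zer C (Dom C f) (Cod C p) \<and>
     (\<forall>T\<in>Obj C. \<forall>g\<in>Hom C (Cod C f) T. g \<cdot>\<^bsub>C\<^esub> f = Zer C (Dom C f) T \<longrightarrow>
        (\<exists>!h. h \<in> Hom C (Cod C p) T \<and> h \<cdot>\<^bsub>C\<^esub> p = g))"

locale abelian_category = preadditive_category +
  assumes has_zero_object: "\<exists>z. is_zero_object C z"
    and has_biproducts: "a \<in> Obj C \<Longrightarrow> b \<in> Obj C \<Longrightarrow>
      \<exists>P i1 i2 p1 p2. is_biproduct C a b P i1 i2 p1 p2"
    and has_kernels: "f \<in> Arr C \<Longrightarrow> \<exists>k. is_kernel C f k"
    and has_cokernels: "f \<in> Arr C \<Longrightarrow> \<exists>p. is_cokernel C f p"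
    and monic_is_kernel: "is_monic C f \<Longrightarrow> \<exists>g. is_kernel C g f"
    and epic_is_cokernel: "is_epic C f \<Longrightarrow> \<exists>g. is_cokernel C g f"

text \<open>Exactness at the middle: the image of \<open>f\<close>, i.e. the kernel of its cokernel, is a kernel of \<open>g\<close>.\<close>

definition is_exact :: "('o, 'm) cat \<Rightarrow> 'm \<Rightarrow> 'm \<Rightarrow> bool" where
  "is_exact C f g \<longleftrightarrow> (\<exists>p k. is_cokernel C f p \<and> is_kernel C p k \<and> is_kernel C g k)"

definition is_short_exact :: "('o, 'm) cat \<Rightarrow> 'm \<Rightarrow> 'm \<Rightarrow> bool" where
  "is_short_exact C f g \<longleftrightarrow> is_monic C f \<and> is_exact C f g \<and> is_epic C g"

definition is_exact_functor ::
  "('o, 'm) cat \<Rightarrow> ('p, 'n) cat \<Rightarrow> ('o, 'm, 'p, 'n) func \<Rightarrow> bool" where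
  "is_exact_functor C D F \<longleftrightarrow> is_functor C D F \<and>
     (\<forall>f g. is_short_exact C f g \<longrightarrow> is_short_exact D (far F f) (far F g))"


section \<open>Yoneda Ext\<close>

text \<open>
  An \<open>n\<close>-extension \<open>0 \<rightarrow> B \<rightarrow> E\<^sub>n \<rightarrow> \<dots> \<rightarrow> E\<^sub>1 \<rightarrow> A \<rightarrow> 0\<close> of \<open>A\<close> by \<open>B\<close> (\<open>n \<ge> 1\<close>) is the list of its
  \<open>n + 1\<close> nontrivial arrows, read from left to right. A morphism of extensions is the list of its
  \<open>n + 2\<close> components, again from left (at \<open>B\<close>) to right (at \<open>A\<close>).
\<close>

definition is_extension :: "('o, 'm) cat \<Rightarrow> nat \<Rightarrow> 'o \<Rightarrow> 'o \<Rightarrow> 'm list \<Rightarrow> bool" where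
  "is_extension C n A B xs \<longleftrightarrow> length xs = Suc n \<and> set xs \<subseteq> Arr C \<and>
     Dom C (xs ! 0) = B \<and> Cod C (xs ! n) = A \<and>
     is_monic C (xs ! 0) \<and> is_epic C (xs ! n) \<and> (\<forall>i<n. is_exact C (xs ! i) (xs ! Suc i))"

definition is_ext_morphism :: "('o, 'm) cat \<Rightarrow> 'm list \<Rightarrow> 'm list \<Rightarrow> 'm list \<Rightarrow> bool" where
  "is_ext_morphism C xs ys \<phi>s \<longleftrightarrow> length ys = length xs \<and> length \<phi>s = Suc (length xs) \<and>
     \<phi>s ! 0 \<in> Hom C (Dom C (xs ! 0)) (Dom C (ys ! 0)) \<and>
     (\<forall>i<length xs. \<phi>s ! Suc i \<in> Hom C (Cod C (xs ! i)) (Cod C (ys ! i)) \<and>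
        \<phi>s ! Suc i \<cdot>\<^bsub>C\<^esub> xs ! i = ys ! i \<cdot>\<^bsub>C\<^esub> \<phi>s ! i)"

definition ext_step :: "('o, 'm) cat \<Rightarrow> nat \<Rightarrow> 'o \<Rightarrow> 'o \<Rightarrow> 'm list rel" where
  "ext_step C n A B = {(xs, ys). is_extension C n A B xs \<and> is_extension C n A B ys \<and>
     (\<exists>\<phi>s. is_ext_morphism C xs ys \<phi>s \<and> \<phi>s ! 0 = Ide C B \<and> \<phi>s ! Suc n = Ide C A)}"

definition ext_equiv :: "('o, 'm) cat \<Rightarrow> nat \<Rightarrow> 'o \<Rightarrow> 'o \<Rightarrow> 'm list rel" where
  "ext_equiv C n A B = {(xs, ys). is_extension C n A B xs \<and> is_extension C n A B ys \<and>
     (xs, ys) \<in> (ext_step C n A B \<union> (ext_step C n A B)\<inverse>)\<^sup>*}"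

text \<open>\<open>is_ext_pushout C b xs ys\<close>: \<open>ys\<close> is the pushout of the extension \<open>xs\<close> along \<open>b : B \<rightarrow> B'\<close>,
  obtained by pushing out the leftmost arrow.\<close>

definition is_ext_pushout :: "('o, 'm) cat \<Rightarrow> 'm \<Rightarrow> 'm list \<Rightarrow> 'm list \<Rightarrow> bool" where
  "is_ext_pushout C b xs ys \<longleftrightarrow> (\<exists>x0 x1 y0 y1 rest k.
     xs = x0 # x1 # rest \<and> ys = y0 # y1 # rest \<and> is_pushout C x0 b k y0 \<and>
     y1 \<in> Hom C (Cod C y0) (Cod C x1) \<and> y1 \<cdot>\<^bsub>C\<^esub> k = x1 \<and>
     y1 \<cdot>\<^bsub>C\<^esub> y0 = Zer C (Dom C y0) (Cod C x1))"

definition is_ext_pullback :: "('o, 'm) cat \<Rightarrow> 'm list \<Rightarrow> 'm \<Rightarrow> 'm list \<Rightarrow> bool" where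
  "is_ext_pullback C xs a ys \<longleftrightarrow> (\<exists>x0 x1 y0 y1 rest k.
     xs = rest @ [x1, x0] \<and> ys = rest @ [y1, y0] \<and> is_pullback C x0 a k y0 \<and>
     y1 \<in> Hom C (Dom C x1) (Dom C y0) \<and> k \<cdot>\<^bsub>C\<^esub> y1 = x1 \<and>
     y0 \<cdot>\<^bsub>C\<^esub> y1 = Zer C (Dom C x1) (Cod C y0))"

text \<open>\<open>zs\<close> is the (termwise) direct sum of \<open>xs\<close> and \<open>ys\<close>, with injections \<open>is\<close>, \<open>js\<close> and projections
  \<open>ps\<close>, \<open>qs\<close>.\<close>

definition is_ext_direct_sum ::
  "('o, 'm) cat \<Rightarrow> 'm list \<Rightarrow> 'm list \<Rightarrow> 'm list \<Rightarrow> 'm list \<Rightarrow> 'm list \<Rightarrow> 'm list \<Rightarrow> 'm list \<Rightarrow> bool"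
where
  "is_ext_direct_sum C xs ys zs is js ps qs \<longleftrightarrow>
     is_ext_morphism C xs zs is \<and> is_ext_morphism C ys zs js \<and>
     is_ext_morphism C zs xs ps \<and> is_ext_morphism C zs ys qs \<and>
     (\<forall>k\<le>length zs. is_biproduct C (Dom C (is ! k)) (Dom C (js ! k)) (Cod C (is ! k))
        (is ! k) (js ! k) (ps ! k) (qs ! k))"

text \<open>Baer sum of representatives: pull \<open>xs \<oplus> ys\<close> back along the diagonal of \<open>A\<close>, then push out along
  the codiagonal of \<open>B\<close>.\<close>

definition is_baer_sum ::
  "('o, 'm) cat \<Rightarrow> nat \<Rightarrow> 'o \<Rightarrow> 'o \<Rightarrow> 'm list \<Rightarrow> 'm list \<Rightarrow> 'm list \<Rightarrow> bool" where
  "is_baer_sum C n A B xs ys ws \<longleftrightarrow> (\<exists>zs is js ps qs diag codiag us.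
     is_ext_direct_sum C xs ys zs is js ps qs \<and>
     diag \<in> Hom C A (Cod C (zs ! n)) \<and> ps ! Suc n \<cdot>\<^bsub>C\<^esub> diag = Ide C A \<and> qs ! Suc n \<cdot>\<^bsub>C\<^esub> diag = Ide C A \<and>
     codiag \<in> Hom C (Dom C (zs ! 0)) B \<and> codiag \<cdot>\<^bsub>C\<^esub> is ! 0 = Ide C B \<and> codiag \<cdot>\<^bsub>C\<^esub> js ! 0 = Ide C B \<and>
     is_ext_pullback C zs diag us \<and> is_ext_pushout C codiag us ws)"

text \<open>
  Representatives of the zero class: the split extension for \<open>n = 1\<close>, and for \<open>n \<ge> 2\<close> the sequence
  \<open>B = B \<rightarrow> 0 \<rightarrow> \<dots> \<rightarrow> 0 \<rightarrow> A = A\<close> (exactness forces everything between the two identities to be zero).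
\<close>

definition is_zero_extension :: "('o, 'm) cat \<Rightarrow> nat \<Rightarrow> 'o \<Rightarrow> 'o \<Rightarrow> 'm list \<Rightarrow> bool" where
  "is_zero_extension C n A B xs \<longleftrightarrow> is_extension C n A B xs \<and>
     (if n = 1 then \<exists>P i1 i2 p1 p2. is_biproduct C B A P i1 i2 p1 p2 \<and> xs = [i1, p2]
      else xs ! 0 = Ide C B \<and> xs ! n = Ide C A)"

text \<open>
  \<open>Ext\<^sup>n(A, B)\<close> with the Baer sum. On classes, all operations are the saturations under \<open>ext_equiv\<close> of
  the operations on representatives.
\<close>

definition Ext :: "('o, 'm) cat \<Rightarrow> nat \<Rightarrow> 'o \<Rightarrow> 'o \<Rightarrow> 'm list set monoid" where
  "Ext C n A B =
     \<lparr>carrier = {xs. is_extension C n A B xs} // ext_equiv C n A B,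
      mult = (\<lambda>\<xi> \<zeta>. ext_equiv C n A B `` {ws. \<exists>xs\<in>\<xi>. \<exists>ys\<in>\<zeta>. is_baer_sum C n A B xs ys ws}),
      one = ext_equiv C n A B `` {xs. is_zero_extension C n A B xs}\<rparr>"

text \<open>\<open>Ext\<^sup>n(A, b) : Ext\<^sup>n(A, B) \<rightarrow> Ext\<^sup>n(A, B')\<close> for \<open>b : B \<rightarrow> B'\<close>, and
  \<open>Ext\<^sup>n(a, B) : Ext\<^sup>n(A, B) \<rightarrow> Ext\<^sup>n(A', B)\<close> for \<open>a : A' \<rightarrow> A\<close>.\<close>

definition Ext_push :: "('o, 'm) cat \<Rightarrow> nat \<Rightarrow> 'o \<Rightarrow> 'm \<Rightarrow> 'm list set \<Rightarrow> 'm list set" where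
  "Ext_push C n A b \<xi> = ext_equiv C n A (Cod C b) `` {ys. \<exists>xs\<in>\<xi>. is_ext_pushout C b xs ys}"

definition Ext_pull :: "('o, 'm) cat \<Rightarrow> nat \<Rightarrow> 'm \<Rightarrow> 'o \<Rightarrow> 'm list set \<Rightarrow> 'm list set" where
  "Ext_pull C n a B \<xi> = ext_equiv C n (Dom C a) B `` {ys. \<exists>xs\<in>\<xi>. is_ext_pullback C xs a ys}"


section \<open>Cardinals\<close>

text \<open>
  Cardinals are \<open>Card_order\<close> relations, compared up to order isomorphism. \<open>card_sup X\<close> is the least
  upper bound of a set of cardinals living on the type \<open>'a\<close>; it exists on the same type, since
  \<open>|UNIV :: 'a set|\<close> is an upper bound.
\<close>

definition card_sup :: "'a rel set \<Rightarrow> 'a rel" where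
  "card_sup X = (SOME r. Card_order r \<and> (\<forall>x\<in>X. x \<le>o r) \<and>
     (\<forall>s::'a rel. Card_order s \<and> (\<forall>x\<in>X. x \<le>o s) \<longrightarrow> r \<le>o s))"

text \<open>The first branch is \<open>card_sup X\<close> itself, transported to \<open>'a set\<close>, the type on which its successor
  lives.\<close>

definition card_size :: "'a rel set \<Rightarrow> 'a set rel" where
  "card_size X = (if \<forall>x\<in>X. x <o card_sup X then |(\<lambda>a. {a}) ` Field (card_sup X)|
     else cardSuc (card_sup X))"

text \<open>Every set of cardinality \<open><\<close> \<open>\<kappa>\<close> is equipotent to a subset of the type \<open>'k\<close> on which \<open>\<kappa>\<close> lives,
  so it suffices to let the index sets range over subsets of \<open>'k\<close>.\<close>

definition AB3 :: "'k rel \<Rightarrow> ('o, 'm) cat \<Rightarrow> bool" where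
  "AB3 \<kappa> C \<longleftrightarrow> (\<forall>I::'k set. |I| <o \<kappa> \<longrightarrow>
     (\<forall>X. (\<forall>i\<in>I. X i \<in> Obj C) \<longrightarrow> (\<exists>P \<iota>. is_coproduct C I X P \<iota>)))"


section \<open>Quivers and their representations\<close>

record ('v, 'e) quiver =
  verts :: "'v set"
  arrows :: "'e set"
  src :: "'e \<Rightarrow> 'v"
  tgt :: "'e \<Rightarrow> 'v"

definition is_quiver :: "('v, 'e) quiver \<Rightarrow> bool" where
  "is_quiver Q \<longleftrightarrow> (\<forall>\<rho>\<in>arrows Q. src Q \<rho> \<in> verts Q \<and> tgt Q \<rho> \<in> verts Q)"

text \<open>
  The path \<open>\<alpha>\<^sub>m \<dots> \<alpha>\<^sub>1\<close> starting at \<open>i\<close> (first \<open>\<alpha>\<^sub>1\<close>, last \<open>\<alpha>\<^sub>m\<close>) is the pair \<open>(i, [\<alpha>\<^sub>m, \<dots>, \<alpha>\<^sub>1])\<close>; the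
  starting vertex keeps the trivial paths at different vertices apart.
\<close>

fun walk :: "('v, 'e) quiver \<Rightarrow> 'v \<Rightarrow> 'e list \<Rightarrow> 'v \<Rightarrow> bool" where
  "walk Q i [] j \<longleftrightarrow> i \<in> verts Q \<and> j = i"
| "walk Q i (\<alpha> # as) j \<longleftrightarrow> \<alpha> \<in> arrows Q \<and> tgt Q \<alpha> = j \<and> walk Q i as (src Q \<alpha>)"

definition paths :: "('v, 'e) quiver \<Rightarrow> 'v \<Rightarrow> 'v \<Rightarrow> ('v \<times> 'e list) set" where
  "paths Q i j = {(i, as) | as. walk Q i as j}"

definition paths_to :: "('v, 'e) quiver \<Rightarrow> 'v \<Rightarrow> ('v \<times> 'e list) set" where
  "paths_to Q j = (\<Union>i\<in>verts Q. paths Q i j)"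

definition after_path :: "'e \<Rightarrow> 'v \<times> 'e list \<Rightarrow> 'v \<times> 'e list" where
  "after_path \<alpha> \<rho> = (fst \<rho>, \<alpha> # snd \<rho>)"

definition before_path :: "('v, 'e) quiver \<Rightarrow> 'v \<times> 'e list \<Rightarrow> 'e \<Rightarrow> 'v \<times> 'e list" where
  "before_path Q \<rho> \<alpha> = (src Q \<alpha>, snd \<rho> @ [\<alpha>])"

definition rccn :: "('v, 'e) quiver \<Rightarrow> ('v \<times> 'e list) set rel" where
  "rccn Q = card_sup ((\<lambda>i. card_size ((\<lambda>j. |paths Q i j| ) ` verts Q)) ` verts Q)"

definition ltccn :: "('v, 'e) quiver \<Rightarrow> ('v \<times> 'e list) set rel" where
  "ltccn Q = card_size ((\<lambda>j. |paths_to Q j| ) ` verts Q)"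

definition plus_set :: "('v, 'e) quiver \<Rightarrow> 'v set \<Rightarrow> 'v set" where
  "plus_set Q S = {i \<in> verts Q - S. \<exists>s\<in>S. paths Q s i \<noteq> {}}"

definition TQ0 :: "('v, 'e) quiver \<Rightarrow> 'v set" where
  "TQ0 Q = {i \<in> verts Q. finite (plus_set Q {i})}"

datatype ('v, 'e, 'o, 'm) qrep = QRep (rv: "'v \<Rightarrow> 'o") (ra: "'e \<Rightarrow> 'm")

datatype ('v, 'e, 'o, 'm) qmor =
  QMor (qdom: "('v, 'e, 'o, 'm) qrep") (qcod: "('v, 'e, 'o, 'm) qrep") (qcmp: "'v \<Rightarrow> 'm")

text \<open>Families over the vertices (arrows) are extensional, i.e. \<open>undefined\<close> off \<open>verts Q\<close>
  (\<open>arrows Q\<close>), so that equality of representations and of morphisms is the intended one.\<close>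

definition is_rep :: "('v, 'e) quiver \<Rightarrow> ('o, 'm) cat \<Rightarrow> ('v, 'e, 'o, 'm) qrep \<Rightarrow> bool" where
  "is_rep Q C F \<longleftrightarrow> rv F \<in> verts Q \<rightarrow>\<^sub>E Obj C \<and>
     ra F \<in> (\<Pi>\<^sub>E \<rho>\<in>arrows Q. Hom C (rv F (src Q \<rho>)) (rv F (tgt Q \<rho>)))"

definition is_rep_mor :: "('v, 'e) quiver \<Rightarrow> ('o, 'm) cat \<Rightarrow> ('v, 'e, 'o, 'm) qmor \<Rightarrow> bool" where
  "is_rep_mor Q C \<phi> \<longleftrightarrow> is_rep Q C (qdom \<phi>) \<and> is_rep Q C (qcod \<phi>) \<and>
     qcmp \<phi> \<in> (\<Pi>\<^sub>E i\<in>verts Q. Hom C (rv (qdom \<phi>) i) (rv (qcod \<phi>) i)) \<and>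
     (\<forall>\<rho>\<in>arrows Q. qcmp \<phi> (tgt Q \<rho>) \<cdot>\<^bsub>C\<^esub> ra (qdom \<phi>) \<rho> = ra (qcod \<phi>) \<rho> \<cdot>\<^bsub>C\<^esub> qcmp \<phi> (src Q \<rho>))"

definition Rep :: "('v, 'e) quiver \<Rightarrow> ('o, 'm) cat \<Rightarrow>
    (('v, 'e, 'o, 'm) qrep, ('v, 'e, 'o, 'm) qmor) cat" where
  "Rep Q C =
     \<lparr>Obj = {F. is_rep Q C F}, Arr = {\<phi>. is_rep_mor Q C \<phi>}, Dom = qdom, Cod = qcod,
      Ide = (\<lambda>F. QMor F F (\<lambda>i\<in>verts Q. Ide C (rv F i))),
      Comp = (\<lambda>\<psi> \<phi>. QMor (qdom \<phi>) (qcod \<psi>) (\<lambda>i\<in>verts Q. qcmp \<psi> i \<cdot>\<^bsub>C\<^esub> qcmp \<phi> i)),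
      Add = (\<lambda>\<phi> \<psi>. QMor (qdom \<phi>) (qcod \<phi>) (\<lambda>i\<in>verts Q. Add C (qcmp \<phi> i) (qcmp \<psi> i))),
      Zer = (\<lambda>F G. QMor F G (\<lambda>i\<in>verts Q. Zer C (rv F i) (rv G i)))\<rparr>"

definition Supp :: "('v, 'e) quiver \<Rightarrow> ('o, 'm) cat \<Rightarrow> ('v, 'e, 'o, 'm) qrep \<Rightarrow> 'v set" where
  "Supp Q C F = {i \<in> verts Q. \<not> is_zero_object C (rv F i)}"

definition Rep_ft :: "('v, 'e) quiver \<Rightarrow> ('o, 'm) cat \<Rightarrow>
    (('v, 'e, 'o, 'm) qrep, ('v, 'e, 'o, 'm) qmor) cat" where
  "Rep_ft Q C = full_subcat (Rep Q C) {F. finite (Supp Q C F) \<and> finite (plus_set Q (Supp Q C F))}"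

definition eval_functor ::
  "'v \<Rightarrow> (('v, 'e, 'o, 'm) qrep, ('v, 'e, 'o, 'm) qmor, 'o, 'm) func" where
  "eval_functor i = \<lparr>fob = (\<lambda>F. rv F i), far = (\<lambda>\<phi>. qcmp \<phi> i)\<rparr>"


subsection \<open>The functors \<open>f\<^sub>i\<close>\<close>

text \<open>A chosen coproduct \<open>X\<^bsup>(I)\<^esup>\<close> of copies of \<open>X\<close>, together with its inclusions.\<close>

definition copower :: "('o, 'm) cat \<Rightarrow> 'o \<Rightarrow> 'i set \<Rightarrow> 'o \<times> ('i \<Rightarrow> 'm)" where
  "copower C X I = (SOME (P, \<iota>). is_coproduct C I (\<lambda>_. X) P \<iota>)"

definition free_ob :: "('v, 'e) quiver \<Rightarrow> ('o, 'm) cat \<Rightarrow> 'v \<Rightarrow> 'o \<Rightarrow> 'v \<Rightarrow> 'o" where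
  "free_ob Q C i X j = fst (copower C X (paths Q i j))"

text \<open>The inclusion \<open>\<mu>\<^sub>\<rho> : X \<rightarrow> f\<^sub>i(X)\<^sub>j\<close> of the summand of \<open>\<rho> \<in> Q(i, j)\<close>.\<close>

definition incl ::
  "('v, 'e) quiver \<Rightarrow> ('o, 'm) cat \<Rightarrow> 'v \<Rightarrow> 'o \<Rightarrow> 'v \<Rightarrow> 'v \<times> 'e list \<Rightarrow> 'm" where
  "incl Q C i X j \<rho> = snd (copower C X (paths Q i j)) \<rho>"

definition free_rep ::
  "('v, 'e) quiver \<Rightarrow> ('o, 'm) cat \<Rightarrow> 'v \<Rightarrow> 'o \<Rightarrow> ('v, 'e, 'o, 'm) qrep" where
  "free_rep Q C i X = QRep
     (\<lambda>j\<in>verts Q. free_ob Q C i X j)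
     (\<lambda>\<alpha>\<in>arrows Q. THE h.
        h \<in> Hom C (free_ob Q C i X (src Q \<alpha>)) (free_ob Q C i X (tgt Q \<alpha>)) \<and>
        (\<forall>\<rho>\<in>paths Q i (src Q \<alpha>).
           h \<cdot>\<^bsub>C\<^esub> incl Q C i X (src Q \<alpha>) \<rho> = incl Q C i X (tgt Q \<alpha>) (after_path \<alpha> \<rho>)))"

definition free_mor ::
  "('v, 'e) quiver \<Rightarrow> ('o, 'm) cat \<Rightarrow> 'v \<Rightarrow> 'm \<Rightarrow> ('v, 'e, 'o, 'm) qmor" where
  "free_mor Q C i x = QMor (free_rep Q C i (Dom C x)) (free_rep Q C i (Cod C x))
     (\<lambda>j\<in>verts Q. THE h.
        h \<in> Hom C (free_ob Q C i (Dom C x) j) (free_ob Q C i (Cod C x) j) \<and>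
        (\<forall>\<rho>\<in>paths Q i j. h \<cdot>\<^bsub>C\<^esub> incl Q C i (Dom C x) j \<rho> = incl Q C i (Cod C x) j \<rho> \<cdot>\<^bsub>C\<^esub> x))"

definition free_functor :: "('v, 'e) quiver \<Rightarrow> ('o, 'm) cat \<Rightarrow> 'v \<Rightarrow>
    ('o, 'm, ('v, 'e, 'o, 'm) qrep, ('v, 'e, 'o, 'm) qmor) func" where
  "free_functor Q C i = \<lparr>fob = free_rep Q C i, far = free_mor Q C i\<rparr>"

text \<open>\<open>f\<^sub>\<rho>(X) : f\<^sub>i(X) \<rightarrow> f\<^sub>j(X)\<close> for an arrow \<open>\<rho> : j \<rightarrow> i\<close>.\<close>

definition free_arrow ::
  "('v, 'e) quiver \<Rightarrow> ('o, 'm) cat \<Rightarrow> 'e \<Rightarrow> 'o \<Rightarrow> ('v, 'e, 'o, 'm) qmor" where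
  "free_arrow Q C \<rho> X = QMor (free_rep Q C (tgt Q \<rho>) X) (free_rep Q C (src Q \<rho>) X)
     (\<lambda>k\<in>verts Q. THE h.
        h \<in> Hom C (free_ob Q C (tgt Q \<rho>) X k) (free_ob Q C (src Q \<rho>) X k) \<and>
        (\<forall>\<sigma>\<in>paths Q (tgt Q \<rho>) k.
           h \<cdot>\<^bsub>C\<^esub> incl Q C (tgt Q \<rho>) X k \<sigma> = incl Q C (src Q \<rho>) X k (before_path Q \<sigma> \<rho>)))"

text \<open>The composite \<open>F\<^sub>\<rho> : F\<^sub>i \<rightarrow> F\<^sub>j\<close> of \<open>F\<close> along a path \<open>\<rho> \<in> Q(i, j)\<close>.\<close>

fun rep_walk :: "('o, 'm) cat \<Rightarrow> ('v, 'e, 'o, 'm) qrep \<Rightarrow> 'v \<Rightarrow> 'e list \<Rightarrow> 'm" where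
  "rep_walk C F i [] = Ide C (rv F i)"
| "rep_walk C F i (\<alpha> # as) = ra F \<alpha> \<cdot>\<^bsub>C\<^esub> rep_walk C F i as"

text \<open>The counit \<open>f\<^sub>i(e\<^sub>i(F)) \<rightarrow> F\<close>, given on the summand of \<open>\<rho> \<in> Q(i, j)\<close> by \<open>F\<^sub>\<rho>\<close>.\<close>

definition counit ::
  "('v, 'e) quiver \<Rightarrow> ('o, 'm) cat \<Rightarrow> 'v \<Rightarrow> ('v, 'e, 'o, 'm) qrep \<Rightarrow> ('v, 'e, 'o, 'm) qmor" where
  "counit Q C i F = QMor (free_rep Q C i (rv F i)) F
     (\<lambda>j\<in>verts Q. THE h. h \<in> Hom C (free_ob Q C i (rv F i) j) (rv F j) \<and>
        (\<forall>\<rho>\<in>paths Q i j. h \<cdot>\<^bsub>C\<^esub> incl Q C i (rv F i) j \<rho> = rep_walk C F i (snd \<rho>)))"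

text \<open>
  \<open>P1 \<rightarrow> P0 \<rightarrow> F\<close>, with maps \<open>d\<close> and \<open>p\<close>, is (the nonzero part of) the canonical presentation \<open>\<eta>\<^sub>F\<close>,
  for some choice of the two coproducts in \<open>Rep Q C\<close>.
\<close>

definition is_canonical_presentation ::
  "('v, 'e) quiver \<Rightarrow> ('o, 'm) cat \<Rightarrow> ('v, 'e, 'o, 'm) qrep \<Rightarrow>
    ('v, 'e, 'o, 'm) qrep \<Rightarrow> ('v, 'e, 'o, 'm) qrep \<Rightarrow>
    ('v, 'e, 'o, 'm) qmor \<Rightarrow> ('v, 'e, 'o, 'm) qmor \<Rightarrow> bool" where
  "is_canonical_presentation Q C F P1 P0 d p \<longleftrightarrow> (\<exists>\<iota> \<mu>.
     is_coproduct (Rep Q C) (arrows Q) (\<lambda>\<rho>. free_rep Q C (tgt Q \<rho>) (rv F (src Q \<rho>))) P1 \<iota> \<and>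
     is_coproduct (Rep Q C) (verts Q) (\<lambda>i. free_rep Q C i (rv F i)) P0 \<mu> \<and>
     d \<in> Hom (Rep Q C) P1 P0 \<and>
     (\<forall>\<rho>\<in>arrows Q. d \<cdot>\<^bsub>Rep Q C\<^esub> \<iota> \<rho> =
        Diff (Rep Q C) (\<mu> (src Q \<rho>) \<cdot>\<^bsub>Rep Q C\<^esub> free_arrow Q C \<rho> (rv F (src Q \<rho>)))
                       (\<mu> (tgt Q \<rho>) \<cdot>\<^bsub>Rep Q C\<^esub> free_mor Q C (tgt Q \<rho>) (ra F \<rho>))) \<and>
     p \<in> Hom (Rep Q C) P0 F \<and>
     (\<forall>i\<in>verts Q. p \<cdot>\<^bsub>Rep Q C\<^esub> \<mu> i = counit Q C i F))"


section \<open>Natural isomorphisms of Ext along a pair of functors\<close>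

text \<open>\<open>Ext\<^sup>n\<^sub>D(L(?), -) \<cong> Ext\<^sup>n\<^sub>C(?, R(-))\<close>: group isomorphisms, natural in both variables.\<close>

definition Ext_naturally_isomorphic ::
  "('o, 'm) cat \<Rightarrow> ('p, 'n) cat \<Rightarrow> ('o, 'm, 'p, 'n) func \<Rightarrow> ('p, 'n, 'o, 'm) func \<Rightarrow> nat \<Rightarrow> bool"
where
  "Ext_naturally_isomorphic C D L R n \<longleftrightarrow> (\<exists>\<Phi>.
     (\<forall>X\<in>Obj C. \<forall>Y\<in>Obj D. \<Phi> X Y \<in> iso (Ext D n (fob L X) Y) (Ext C n X (fob R Y))) \<and>
     (\<forall>X\<in>Obj C. \<forall>y\<in>Arr D. \<forall>\<xi>\<in>carrier (Ext D n (fob L X) (Dom D y)).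
        \<Phi> X (Cod D y) (Ext_push D n (fob L X) y \<xi>)
          = Ext_push C n X (far R y) (\<Phi> X (Dom D y) \<xi>)) \<and>
     (\<forall>x\<in>Arr C. \<forall>Y\<in>Obj D. \<forall>\<xi>\<in>carrier (Ext D n (fob L (Cod C x)) Y).
        \<Phi> (Dom C x) Y (Ext_pull D n (far L x) Y \<xi>)
          = Ext_pull C n x (fob R Y) (\<Phi> (Cod C x) Y \<xi>)))"

end

theory Submission
  imports Defs
begin

text \<open>
  Everything reduces to two observations. First, morphisms out of \<open>f\<^sub>i(X)\<close> are determined by their
  value on the summand of the trivial path, which gives the adjunction and shows that the
  presentation is a cokernel; at each vertex \<open>k\<close> its first map even has a retraction, defined by
  recursion on the length of paths ending in \<open>k\<close>, so no exactness of coproducts is needed.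

  Second, let \<open>L \<stileturn> R\<close> be exact functors. A morphism \<open>z \<rightarrow> R x\<close> of extensions with ends \<open>1\<close> and the
  unit is, by transposing its components, the same as a morphism \<open>L z \<rightarrow> x\<close> with ends the counit
  and \<open>1\<close>. Reading it in the first way and pulling back along the unit, \<open>x\<close> determines the class
  of \<open>z\<close>; reading it in the second way and pushing out along the counit, \<open>z\<close> determines the class
  of \<open>x\<close>. This correspondence is the isomorphism on Yoneda Ext. It respects Baer sums, and the
  same statement for the identity adjunction shows that Baer sums of classes are well defined.
\<close>

section \<open>Abelian categories\<close>

text \<open>Size shapes the coproducts. \<open>C\<close> has only coproducts of fewer than \<kappa>
  summands, while vertices and arrows may be more numerous, so a sum of free representations is not
  formed summand by summand: at a vertex \<open>k\<close> it is a coproduct over pairs of a summand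
  and a path from it to \<open>k\<close>. These pairs embed into Q(-,k), which \<open>ltccn\<close>
  bounds, just as \<open>rccn\<close> bounds the sets Q(i,j) behind a single free representation. No
  projectives or injectives are at hand, so Ext is accessible only through zigzags of extensions,
  and operations on classes are saturations of relations between representatives. Facts about them
  are therefore proved for relations that are total and compatible with single steps. Exactness of
  evaluation is a real point as well: a kernel among representations of finite top support is known
  only by its universal property there, and has to be compared with the pointwise kernel, which
  stays in the subcategory because its support is contained in that of the domain.\<close>

lemma in_Hom_iff [simp]: "f \<in> Hom C a b \<longleftrightarrow> f \<in> Arr C \<and> Dom C f = a \<and> Cod C f = b"
  by (simp add: Hom_def)

section \<open>Composition, monomorphisms and epimorphisms\<close>

context category
begin

lemma obj_of_arr [simp]:
  "f \<in> Arr C \<Longrightarrow> Dom C f \<in> Obj C" "f \<in> Arr C \<Longrightarrow> Cod C f \<in> Obj C"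
  by (rule Dom_in_Obj Cod_in_Obj, assumption)+

lemma comp_arr [simp]:
  assumes "f \<in> Arr C" "g \<in> Arr C" "Dom C g = Cod C f"
  shows "g \<cdot> f \<in> Arr C" "Dom C (g \<cdot> f) = Dom C f" "Cod C (g \<cdot> f) = Cod C g"
  using Comp_in_Hom[of f "Dom C f" "Cod C f" g "Cod C g"] assms by auto

lemma ide_arr [simp]:
  assumes "a \<in> Obj C"
  shows "Ide C a \<in> Arr C" "Dom C (Ide C a) = a" "Cod C (Ide C a) = a"
  using Ide_in_Hom[OF assms] by auto

text \<open>Fixes right-nested composites as the normal form of the simplifier.\<close>

lemma comp_assoc [simp]:
  assumes "f \<in> Arr C" "g \<in> Arr C" "h \<in> Arr C" "Dom C g = Cod C f" "Dom C h = Cod C g"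
  shows "(h \<cdot> g) \<cdot> f = h \<cdot> (g \<cdot> f)"
  using Comp_assoc[of f "Dom C f" "Cod C f" g "Cod C g" h "Cod C h"] assms by simp

lemma comp_ide [simp]:
  "f \<in> Arr C \<Longrightarrow> Cod C f = b \<Longrightarrow> Ide C b \<cdot> f = f"
  "f \<in> Arr C \<Longrightarrow> Dom C f = a \<Longrightarrow> f \<cdot> Ide C a = f"
  using Comp_Ide_left[of f] Comp_Ide_right[of f] by auto

text \<open>In the right-nested form \<open>h \<cdot> (g \<cdot> f)\<close> the factor
  \<open>h \<cdot> g\<close> is hidden, so a known value of it no longer rewrites. This lemma, and
  \<open>comp_square\<close> for commuting squares, bring it back.\<close>

lemma comp_shift:
  assumes "h \<cdot> g = k" "f \<in> Arr C" "g \<in> Arr C" "h \<in> Arr C" "Dom C g = Cod C f" "Dom C h = Cod C g"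
  shows "h \<cdot> (g \<cdot> f) = k \<cdot> f"
  using comp_assoc[OF assms(2-6)] assms(1) by simp

lemma comp_square:
  assumes "h \<cdot> g = h' \<cdot> g'" "f \<in> Arr C" "g \<in> Arr C" "h \<in> Arr C" "Dom C g = Cod C f"
    "Dom C h = Cod C g"
    "g' \<in> Arr C" "h' \<in> Arr C" "Dom C g' = Cod C f" "Dom C h' = Cod C g'"
  shows "h \<cdot> (g \<cdot> f) = h' \<cdot> (g' \<cdot> f)"
  using comp_assoc[OF assms(2-6)] comp_assoc[of f g' h'] assms by simp

lemma monicD:
  assumes "is_monic C f" "f \<cdot> g = f \<cdot> h" "g \<in> Arr C" "h \<in> Arr C"
    "Cod C g = Dom C f" "Cod C h = Dom C f" "Dom C g = Dom C h"
  shows "g = h"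
  using assms unfolding is_monic_def by auto

lemma epicD:
  assumes "is_epic C f" "g \<cdot> f = h \<cdot> f" "g \<in> Arr C" "h \<in> Arr C"
    "Dom C g = Cod C f" "Dom C h = Cod C f" "Cod C g = Cod C h"
  shows "g = h"
  using assms unfolding is_epic_def by auto

lemma monic_arr: "is_monic C f \<Longrightarrow> f \<in> Arr C"
  and epic_arr: "is_epic C f \<Longrightarrow> f \<in> Arr C"
  by (simp_all add: is_monic_def is_epic_def)

lemma monic_ide: "a \<in> Obj C \<Longrightarrow> is_monic C (Ide C a)"
  by (auto simp: is_monic_def)

lemma epic_comp:
  assumes f: "is_epic C f" and g: "is_epic C g" and [simp]: "Dom C g = Cod C f"
  shows "is_epic C (g \<cdot> f)"
  unfolding is_epic_def
proof (intro conjI allI ballI impI)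
  note [simp] = epic_arr[OF f] epic_arr[OF g]
  show "g \<cdot> f \<in> Arr C" by simp
  fix a u v assume "u \<in> Hom C (Cod C (g \<cdot> f)) a" "v \<in> Hom C (Cod C (g \<cdot> f)) a"
    "u \<cdot> g \<cdot> f = v \<cdot> g \<cdot> f"
  then have "(u \<cdot> g) \<cdot> f = (v \<cdot> g) \<cdot> f" and [simp]: "u \<in> Arr C" "v \<in> Arr C" "Dom C u = Cod C g"
    "Dom C v = Cod C g" "Cod C u = a" "Cod C v = a" by auto
  from epicD[OF f this(1)] have "u \<cdot> g = v \<cdot> g" by simp
  from epicD[OF g this] show "u = v" by simp
qed

lemma epic_cancel:
  assumes "is_epic C (g \<cdot> f)" and [simp]: "f \<in> Arr C" "g \<in> Arr C" "Dom C g = Cod C f"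
  shows "is_epic C g"
  unfolding is_epic_def
proof (intro conjI allI ballI impI)
  fix a u v assume h: "u \<in> Hom C (Cod C g) a" "v \<in> Hom C (Cod C g) a" "u \<cdot> g = v \<cdot> g"
  then have [simp]: "u \<in> Arr C" "v \<in> Arr C" "Dom C u = Cod C g" "Dom C v = Cod C g" "Cod C u = a"
    "Cod C v = a" by auto
  from h(3) have "u \<cdot> g \<cdot> f = v \<cdot> g \<cdot> f" by (intro comp_square) simp_all
  from epicD[OF assms(1) this] show "u = v" by simp
qed simp

lemma zero_object_arr_eq:
  assumes "is_zero_object C z" "f \<in> Arr C" "g \<in> Arr C" "Dom C f = Dom C g" "Cod C f = Cod C g"
    "Dom C f = z \<or> Cod C f = z"
  shows "f = g"
proof (cases "Dom C f = z")
  case True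
  then have "\<exists>!h. h \<in> Hom C z (Cod C f)"
    using assms(1) obj_of_arr(2)[OF assms(2)] unfolding is_zero_object_def by blast
  then show ?thesis using assms True by (metis in_Hom_iff)
next
  case False
  then have "\<exists>!h. h \<in> Hom C (Dom C f) z"
    using assms(1) obj_of_arr(1)[OF assms(2)] unfolding is_zero_object_def by blast
  then show ?thesis using assms False by (metis in_Hom_iff)
qed

end

section \<open>Zero, sums and differences of arrows\<close>

context preadditive_category
begin

lemma zer_arr [simp]:
  assumes "a \<in> Obj C" "b \<in> Obj C"
  shows "Zer C a b \<in> Arr C" "Dom C (Zer C a b) = a" "Cod C (Zer C a b) = b"
proof -
  interpret G: comm_group "hom_group C a b" using hom_comm_group assms .
  show "Zer C a b \<in> Arr C" "Dom C (Zer C a b) = a" "Cod C (Zer C a b) = b"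
    using G.one_closed by (simp_all add: hom_group_def)
qed

lemma add_arr [simp]:
  assumes "f \<in> Arr C" "g \<in> Arr C" "Dom C g = Dom C f" "Cod C g = Cod C f"
  shows "Add C f g \<in> Arr C" "Dom C (Add C f g) = Dom C f" "Cod C (Add C f g) = Cod C f"
proof -
  interpret G: comm_group "hom_group C (Dom C f) (Cod C f)" using hom_comm_group assms by simp
  show "Add C f g \<in> Arr C" "Dom C (Add C f g) = Dom C f" "Cod C (Add C f g) = Cod C f"
    using G.m_closed[of f g] assms by (simp_all add: hom_group_def)
qed

lemma add_laws:
  assumes "f \<in> Arr C" "g \<in> Arr C" "h \<in> Arr C" "Dom C g = Dom C f" "Cod C g = Cod C f"
    "Dom C h = Dom C f" "Cod C h = Cod C f"
  shows add_assoc: "Add C (Add C f g) h = Add C f (Add C g h)"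
    and add_right_cancel: "Add C f h = Add C g h \<longleftrightarrow> f = g"
proof -
  interpret G: comm_group "hom_group C (Dom C f) (Cod C f)" using hom_comm_group assms by simp
  have [simp]: "f \<in> carrier (hom_group C (Dom C f) (Cod C f))"
    "g \<in> carrier (hom_group C (Dom C f) (Cod C f))"
    "h \<in> carrier (hom_group C (Dom C f) (Cod C f))" "mult (hom_group C (Dom C f) (Cod C f)) = Add C"
    using assms by (simp_all add: hom_group_def)
  show "Add C (Add C f g) h = Add C f (Add C g h)" using G.m_assoc[of f g h] by simp
  show "Add C f h = Add C g h \<longleftrightarrow> f = g" using G.right_cancel[of h f g] by simp
qed

lemma add_commute:
  assumes "f \<in> Arr C" "g \<in> Arr C" "Dom C g = Dom C f" "Cod C g = Cod C f"
  shows "Add C f g = Add C g f"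
proof -
  interpret G: comm_group "hom_group C (Dom C f) (Cod C f)" using hom_comm_group assms by simp
  show ?thesis using G.m_comm[of f g] assms by (simp add: hom_group_def)
qed

lemma add_zer [simp]:
  assumes "f \<in> Arr C" "Dom C f = a" "Cod C f = b"
  shows "Add C (Zer C a b) f = f" "Add C f (Zer C a b) = f"
proof -
  interpret G: comm_group "hom_group C a b" using hom_comm_group assms by auto
  show "Add C (Zer C a b) f = f" "Add C f (Zer C a b) = f"
    using G.l_one[of f] G.r_one[of f] assms by (simp_all add: hom_group_def)
qed

lemma comp_add [simp]:
  assumes "f \<in> Arr C" "g \<in> Arr C" "h \<in> Arr C" "Dom C g = Dom C f" "Cod C g = Cod C f"
  shows "Dom C h = Cod C f \<Longrightarrow> h \<cdot> Add C f g = Add C (h \<cdot> f) (h \<cdot> g)"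
    "Cod C h = Dom C f \<Longrightarrow> Add C f g \<cdot> h = Add C (f \<cdot> h) (g \<cdot> h)"
  using Comp_Add_left[of f "Dom C f" "Cod C f" g h "Cod C h"]
    Comp_Add_right[of h "Dom C h" "Cod C h" f "Cod C f" g] assms
  by auto

lemma add_idem_zer:
  assumes "f \<in> Arr C" "Add C f f = f"
  shows "f = Zer C (Dom C f) (Cod C f)"
  using add_right_cancel[of f "Zer C (Dom C f) (Cod C f)" f] assms by simp

text \<open>Composition with a fixed arrow is additive, so it sends zero to an element of a group
  that equals its own double, and such an element is zero.\<close>

lemma comp_zer [simp]:
  assumes "f \<in> Arr C"
  shows "b \<in> Obj C \<Longrightarrow> Cod C f = a \<Longrightarrow> Zer C a b \<cdot> f = Zer C (Dom C f) b"
    "a \<in> Obj C \<Longrightarrow> Dom C f = b \<Longrightarrow> f \<cdot> Zer C a b = Zer C a (Cod C f)"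
proof -
  assume [simp]: "b \<in> Obj C" "Cod C f = a"
  have [simp]: "f \<in> Arr C" "a \<in> Obj C" using assms obj_of_arr(2)[of f] by auto
  have "Add C (Zer C a b \<cdot> f) (Zer C a b \<cdot> f) = Add C (Zer C a b) (Zer C a b) \<cdot> f"
    by (subst comp_add(2)) simp_all
  also have "\<dots> = Zer C a b \<cdot> f" by simp
  finally show "Zer C a b \<cdot> f = Zer C (Dom C f) b" using add_idem_zer[of "Zer C a b \<cdot> f"] by simp
next
  assume [simp]: "a \<in> Obj C" "Dom C f = b"
  have [simp]: "f \<in> Arr C" "b \<in> Obj C" using assms obj_of_arr(1)[of f] by auto
  have "Add C (f \<cdot> Zer C a b) (f \<cdot> Zer C a b) = f \<cdot> Add C (Zer C a b) (Zer C a b)"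
    by (subst comp_add(1)) simp_all
  also have "\<dots> = f \<cdot> Zer C a b" by simp
  finally show "f \<cdot> Zer C a b = Zer C a (Cod C f)" using add_idem_zer[of "f \<cdot> Zer C a b"] by simp
qed

lemma diff_arr [simp]:
  assumes "f \<in> Arr C" "g \<in> Arr C" "Dom C g = Dom C f" "Cod C g = Cod C f"
  shows "Diff C f g \<in> Arr C" "Dom C (Diff C f g) = Dom C f" "Cod C (Diff C f g) = Cod C f"
    and diff_add: "Add C (Diff C f g) g = f"
proof -
  let ?G = "hom_group C (Dom C f) (Cod C f)"
  interpret G: comm_group ?G using hom_comm_group assms by simp
  have m: "mult ?G = Add C" "one ?G = Zer C (Dom C f) (Cod C f)" "g \<in> carrier ?G" using assms
    by (simp_all add: hom_group_def)
  have "inv\<^bsub>?G\<^esub> g \<in> carrier ?G" using m by simp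
  then have i [simp]: "inv\<^bsub>?G\<^esub> g \<in> Arr C" "Dom C (inv\<^bsub>?G\<^esub> g) = Dom C f"
    "Cod C (inv\<^bsub>?G\<^esub> g) = Cod C f" by (auto simp: hom_group_def)
  have l: "Add C (inv\<^bsub>?G\<^esub> g) g = Zer C (Dom C f) (Cod C f)" using G.l_inv[of g] m by simp
  show "Diff C f g \<in> Arr C" "Dom C (Diff C f g) = Dom C f" "Cod C (Diff C f g) = Cod C f"
    using assms by (simp_all add: Diff_def)
  show "Add C (Diff C f g) g = f" using assms l by (simp add: Diff_def add_assoc)
qed

text \<open>Characterises differences by their defining property, so that later computations avoid
  inverses in hom groups.\<close>

lemma diff_unique:
  assumes "h \<in> Arr C" "Add C h g = f" "f \<in> Arr C" "g \<in> Arr C" "Dom C g = Dom C f"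
    "Cod C g = Cod C f"
    "Dom C h = Dom C f" "Cod C h = Cod C f"
  shows "Diff C f g = h"
  using add_right_cancel[of "Diff C f g" h g] diff_add[of f g] assms by simp

lemma comp_diff [simp]:
  assumes [simp]: "f \<in> Arr C" "g \<in> Arr C" "h \<in> Arr C" "Dom C g = Dom C f" "Cod C g = Cod C f"
  shows "Dom C h = Cod C f \<Longrightarrow> h \<cdot> Diff C f g = Diff C (h \<cdot> f) (h \<cdot> g)"
    "Cod C h = Dom C f \<Longrightarrow> Diff C f g \<cdot> h = Diff C (f \<cdot> h) (g \<cdot> h)"
proof -
  assume [simp]: "Dom C h = Cod C f"
  have "Add C (h \<cdot> Diff C f g) (h \<cdot> g) = h \<cdot> Add C (Diff C f g) g" by (subst comp_add(1)) simp_all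
  then show "h \<cdot> Diff C f g = Diff C (h \<cdot> f) (h \<cdot> g)"
    by (intro diff_unique[symmetric]) (simp_all add: diff_add)
next
  assume [simp]: "Cod C h = Dom C f"
  have "Add C (Diff C f g \<cdot> h) (g \<cdot> h) = Add C (Diff C f g) g \<cdot> h" by (subst comp_add(2)) simp_all
  then show "Diff C f g \<cdot> h = Diff C (f \<cdot> h) (g \<cdot> h)"
    by (intro diff_unique[symmetric]) (simp_all add: diff_add)
qed

lemma diff_eq_zer_iff:
  assumes "f \<in> Arr C" "g \<in> Arr C" "Dom C g = Dom C f" "Cod C g = Cod C f"
  shows "Diff C f g = Zer C (Dom C f) (Cod C f) \<longleftrightarrow> f = g"
proof
  assume "Diff C f g = Zer C (Dom C f) (Cod C f)"
  then have "Add C (Zer C (Dom C f) (Cod C f)) g = f" using diff_add[OF assms] by simp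
  then show "f = g" using assms by simp
next
  assume "f = g"
  then show "Diff C f g = Zer C (Dom C f) (Cod C f)"
    using assms by (intro diff_unique) auto
qed

lemma diff_zer [simp]:
  assumes "f \<in> Arr C" "Dom C f = a" "Cod C f = b"
  shows "Diff C f (Zer C a b) = f"
  using assms obj_of_arr[OF assms(1)] by (intro diff_unique) auto

text \<open>Subtracting two competitors turns left cancellation into the vanishing of a single
  arrow.\<close>

lemma monic_iff_zer:
  "is_monic C f \<longleftrightarrow> f \<in> Arr C \<and>
    (\<forall>t\<in>Arr C. Cod C t = Dom C f \<and> f \<cdot> t = Zer C (Dom C t) (Cod C f) \<longrightarrow> t = Zer C (Dom C t) (Dom C
      f))"
proof safe
  assume m: "is_monic C f"
  show "f \<in> Arr C" using m by (rule monic_arr)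
  fix t assume "t \<in> Arr C" "f \<cdot> t = Zer C (Dom C t) (Cod C f)" "Cod C t = Dom C f"
  then show "t = Zer C (Dom C t) (Dom C f)"
    using m monic_arr[OF m] monicD[OF m, of t "Zer C (Dom C t) (Dom C f)"] by simp
next
  assume [simp]: "f \<in> Arr C"
    and z: "\<forall>t\<in>Arr C. Cod C t = Dom C f \<and> f \<cdot> t = Zer C (Dom C t) (Cod C f) \<longrightarrow>
    t = Zer C (Dom C t) (Dom C f)"
  show "is_monic C f" unfolding is_monic_def
  proof (intro conjI allI ballI impI)
    fix a g h assume h: "g \<in> Hom C a (Dom C f)" "h \<in> Hom C a (Dom C f)" "f \<cdot> g = f \<cdot> h"
    then have "f \<cdot> Diff C g h = Zer C (Dom C (Diff C g h)) (Cod C f)"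
      using diff_eq_zer_iff[of "f \<cdot> g" "f \<cdot> h"] by simp
    then have "Diff C g h = Zer C (Dom C g) (Cod C g)" using z[rule_format, of "Diff C g h"] h
      by simp
    then show "g = h" using h diff_eq_zer_iff[of g h] by simp
  qed simp
qed

lemma epic_iff_zer:
  "is_epic C f \<longleftrightarrow> f \<in> Arr C \<and>
    (\<forall>t\<in>Arr C. Dom C t = Cod C f \<and> t \<cdot> f = Zer C (Dom C f) (Cod C t) \<longrightarrow> t = Zer C (Cod C f) (Cod C
      t))"
proof safe
  assume m: "is_epic C f"
  show "f \<in> Arr C" using m by (rule epic_arr)
  fix t assume "t \<in> Arr C" "t \<cdot> f = Zer C (Dom C f) (Cod C t)" "Dom C t = Cod C f"
  then show "t = Zer C (Cod C f) (Cod C t)"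
    using m epic_arr[OF m] epicD[OF m, of t "Zer C (Cod C f) (Cod C t)"] by simp
next
  assume [simp]: "f \<in> Arr C"
    and z: "\<forall>t\<in>Arr C. Dom C t = Cod C f \<and> t \<cdot> f = Zer C (Dom C f) (Cod C t) \<longrightarrow>
    t = Zer C (Cod C f) (Cod C t)"
  show "is_epic C f" unfolding is_epic_def
  proof (intro conjI allI ballI impI)
    fix a g h assume h: "g \<in> Hom C (Cod C f) a" "h \<in> Hom C (Cod C f) a" "g \<cdot> f = h \<cdot> f"
    then have "Diff C g h \<cdot> f = Zer C (Dom C f) (Cod C (Diff C g h))"
      using diff_eq_zer_iff[of "g \<cdot> f" "h \<cdot> f"] by simp
    then have "Diff C g h = Zer C (Dom C g) (Cod C g)" using z[rule_format, of "Diff C g h"] h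
      by simp
    then show "g = h" using h diff_eq_zer_iff[of g h] by simp
  qed simp
qed

section \<open>Kernels, cokernels and zero objects\<close>

lemma kernel_arr:
  assumes "is_kernel C f k"
  shows "f \<in> Arr C" "k \<in> Arr C" "Cod C k = Dom C f" "f \<cdot> k = Zer C (Dom C k) (Cod C f)"
  using assms by (simp_all add: is_kernel_def)

lemma kernel_lift:
  assumes "is_kernel C f k" "g \<in> Arr C" "Cod C g = Dom C f" "f \<cdot> g = Zer C (Dom C g) (Cod C f)"
  obtains h where "h \<in> Arr C" "Dom C h = Dom C g" "Cod C h = Dom C k" "k \<cdot> h = g"
proof -
  have "\<exists>!h. h \<in> Hom C (Dom C g) (Dom C k) \<and> k \<cdot> h = g"
    using assms unfolding is_kernel_def by (metis in_Hom_iff obj_of_arr(1))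
  then show thesis using that by auto
qed

lemma kernel_monic: assumes "is_kernel C f k" shows "is_monic C k"
  unfolding is_monic_def
proof (intro conjI allI ballI impI)
  note k [simp] = kernel_arr[OF assms]
  fix a g h assume h: "g \<in> Hom C a (Dom C k)" "h \<in> Hom C a (Dom C k)" "k \<cdot> g = k \<cdot> h"
  then have "f \<cdot> k \<cdot> g = Zer C a (Cod C f)" using comp_shift[OF k(4), of g] by auto
  moreover have "k \<cdot> g \<in> Hom C a (Dom C f)" "a \<in> Obj C" using h by auto
  ultimately have "\<exists>!h. h \<in> Hom C a (Dom C k) \<and> k \<cdot> h = k \<cdot> g" using assms unfolding is_kernel_def
    by blast
  then show "g = h" using h by metis
qed (rule kernel_arr[OF assms])

lemma kernelI:
  assumes "is_monic C k" "f \<in> Arr C" "Cod C k = Dom C f" "f \<cdot> k = Zer C (Dom C k) (Cod C f)"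
    "\<And>g. g \<in> Arr C \<Longrightarrow> Cod C g = Dom C f \<Longrightarrow> f \<cdot> g = Zer C (Dom C g) (Cod C f) \<Longrightarrow>
      \<exists>h \<in> Arr C. Dom C h = Dom C g \<and> Cod C h = Dom C k \<and> k \<cdot> h = g"
  shows "is_kernel C f k"
  unfolding is_kernel_def
proof (intro conjI allI ballI impI)
  fix T g assume h: "g \<in> Hom C T (Dom C f)" "f \<cdot> g = Zer C T (Cod C f)"
  then obtain h where "h \<in> Arr C" "Dom C h = Dom C g" "Cod C h = Dom C k" "k \<cdot> h = g"
    using assms(5)[of g] by auto
  moreover have "h' = h" if "h' \<in> Arr C" "Dom C h' = Dom C g" "Cod C h' = Dom C k" "k \<cdot> h' = g"
    for h'
    using monicD[OF assms(1), of h' h] that calculation by simp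
  ultimately show "\<exists>!h. h \<in> Hom C T (Dom C k) \<and> k \<cdot> h = g"
    using h(1) by (metis in_Hom_iff)
qed (use assms monic_arr in auto)

lemma cokernel_arr:
  assumes "is_cokernel C f p"
  shows "f \<in> Arr C" "p \<in> Arr C" "Dom C p = Cod C f" "p \<cdot> f = Zer C (Dom C f) (Cod C p)"
  using assms by (simp_all add: is_cokernel_def)

text \<open>If the identity is zero, every arrow into or out of the object is zero, being its own
  composite with the identity. Zero objects thereby become an equation.\<close>

lemma zero_object_iff:
  assumes "a \<in> Obj C"
  shows "is_zero_object C a \<longleftrightarrow> Ide C a = Zer C a a"
proof
  assume "is_zero_object C a"
  then show "Ide C a = Zer C a a" using assms by (intro zero_object_arr_eq[of a]) auto
next
  assume z: "Ide C a = Zer C a a"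
  have "f = Zer C a b" if "f \<in> Hom C a b" for f b
    using that comp_ide(2)[of f a] comp_zer(2)[of f a a] z assms by (metis in_Hom_iff)
  moreover have "f = Zer C b a" if "f \<in> Hom C b a" for f b
    using that comp_ide(1)[of f a] comp_zer(1)[of f a a] z assms by (metis in_Hom_iff)
  ultimately show "is_zero_object C a" unfolding is_zero_object_def using assms
    by (metis in_Hom_iff zer_arr)
qed

end

subsection \<open>The opposite category\<close>

text \<open>Half of the facts below come by duality. Objects, arrows and sums stay literally the
  same, so \<open>op_op_cat\<close> is an equation and dual statements are read back by the
  simplifier. The arguments of \<open>Zer\<close> swap because it is indexed by domain and
  codomain.\<close>

definition op_cat :: "('o, 'm) cat \<Rightarrow> ('o, 'm) cat" where
  "op_cat C = C\<lparr>Dom := Cod C, Cod := Dom C, Comp := (\<lambda>g f. f \<cdot>\<^bsub>C\<^esub> g), Zer := (\<lambda>a b. Zer C b a)\<rparr>"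

lemma op_cat_sel [simp]:
  "Obj (op_cat C) = Obj C" "Arr (op_cat C) = Arr C" "Dom (op_cat C) = Cod C"
    "Cod (op_cat C) = Dom C"
  "Ide (op_cat C) = Ide C" "g \<cdot>\<^bsub>op_cat C\<^esub> f = f \<cdot>\<^bsub>C\<^esub> g" "Add (op_cat C) = Add C"
    "Zer (op_cat C) a b = Zer C b a"
  by (simp_all add: op_cat_def)

lemma op_op_cat [simp]: "op_cat (op_cat C) = C"
  by (simp add: op_cat_def)

lemma Hom_op_cat: "Hom (op_cat C) a b = Hom C b a"
  by (auto simp: Hom_def)

lemma op_monic [simp]: "is_monic (op_cat C) f \<longleftrightarrow> is_epic C f"
  and op_epic [simp]: "is_epic (op_cat C) f \<longleftrightarrow> is_monic C f"
  by (simp_all add: is_monic_def is_epic_def Hom_op_cat del: in_Hom_iff)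

lemma op_kernel [simp]: "is_kernel (op_cat C) f k \<longleftrightarrow> is_cokernel C f k"
  and op_cokernel [simp]: "is_cokernel (op_cat C) f k \<longleftrightarrow> is_kernel C f k"
  by (simp_all add: is_kernel_def is_cokernel_def Hom_op_cat del: in_Hom_iff)

lemma op_zero_object [simp]: "is_zero_object (op_cat C) z \<longleftrightarrow> is_zero_object C z"
  by (auto simp add: is_zero_object_def Hom_op_cat simp del: in_Hom_iff)

lemma op_pushout [simp]: "is_pushout (op_cat C) f g p q \<longleftrightarrow> is_pullback C f g p q"
  by (auto simp add: is_pushout_def is_pullback_def Hom_op_cat simp del: in_Hom_iff)

lemma op_pullback [simp]: "is_pullback (op_cat C) f g p q \<longleftrightarrow> is_pushout C f g p q"
  by (auto simp add: is_pushout_def is_pullback_def Hom_op_cat simp del: in_Hom_iff)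

lemma hom_group_op: "hom_group (op_cat C) a b = hom_group C b a"
  by (simp add: hom_group_def Hom_op_cat)

section \<open>Duality, images, biproducts, pullbacks and exactness\<close>

context abelian_category
begin

text \<open>The axioms are self-dual or come in dual pairs; a biproduct dualises by exchanging
  injections and projections.\<close>

lemma abelian_op: "abelian_category (op_cat C)"
proof (intro abelian_category.intro preadditive_category.intro category.intro
    preadditive_category_axioms.intro abelian_category_axioms.intro)
  fix a b assume "a \<in> Obj (op_cat C)" "b \<in> Obj (op_cat C)"
  then obtain P i1 i2 p1 p2 where "is_biproduct C a b P i1 i2 p1 p2" using has_biproducts[of a b]
    by auto
  then have "is_biproduct (op_cat C) a b P p1 p2 i1 i2" by (auto simp: is_biproduct_def)
  then show "\<exists>P i1 i2 p1 p2. is_biproduct (op_cat C) a b P i1 i2 p1 p2" by blast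
qed (auto simp: hom_group_op hom_comm_group has_zero_object has_kernels has_cokernels
  monic_is_kernel epic_is_cokernel
    simp del: in_Hom_iff, auto)

lemma cokernel_desc:
  assumes "is_cokernel C f p" "g \<in> Arr C" "Dom C g = Cod C f" "g \<cdot> f = Zer C (Dom C f) (Cod C g)"
  obtains h where "h \<in> Arr C" "Cod C h = Cod C g" "Dom C h = Cod C p" "h \<cdot> p = g"
proof -
  interpret op: abelian_category "op_cat C" by (rule abelian_op)
  show thesis using op.kernel_lift[of f p g] that assms by auto
qed

lemma cokernel_epic: assumes "is_cokernel C f p" shows "is_epic C p"
proof -
  interpret op: abelian_category "op_cat C" by (rule abelian_op)
  show ?thesis using op.kernel_monic[of f p] assms by simp
qed

lemma cokernelI:
  assumes "is_epic C p" "f \<in> Arr C" "Dom C p = Cod C f" "p \<cdot> f = Zer C (Dom C f) (Cod C p)"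
    "\<And>g. g \<in> Arr C \<Longrightarrow> Dom C g = Cod C f \<Longrightarrow> g \<cdot> f = Zer C (Dom C f) (Cod C g) \<Longrightarrow>
      \<exists>h \<in> Arr C. Cod C h = Cod C g \<and> Dom C h = Cod C p \<and> h \<cdot> p = g"
  shows "is_cokernel C f p"
proof -
  interpret op: abelian_category "op_cat C" by (rule abelian_op)
  show ?thesis using op.kernelI[of p f] assms by simp
qed

text \<open>Being a cokernel of some \<open>g\<close>, the arrow \<open>p\<close> kills
  \<open>g\<close>, so \<open>g\<close> factors through \<open>k\<close>. Whatever kills
  \<open>k\<close> then kills \<open>g\<close> and descends along \<open>p\<close>.\<close>

lemma epic_cokernel_of_kernel:
  assumes p: "is_epic C p" and k: "is_kernel C p k"
  shows "is_cokernel C k p"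
proof -
  note [simp] = kernel_arr[OF k]
  obtain g where g: "is_cokernel C g p" using epic_is_cokernel[OF p] by blast
  note [simp] = cokernel_arr[OF g]
  have "Cod C g = Dom C p" by simp
  from kernel_lift[OF k _ this] obtain g' where [simp]: "g' \<in> Arr C" "Dom C g' = Dom C g"
    "Cod C g' = Dom C k" "k \<cdot> g' = g" by auto
  show ?thesis
  proof (rule cokernelI[OF p])
    fix u assume [simp]: "u \<in> Arr C" "Dom C u = Cod C k" and u: "u \<cdot> k = Zer C (Dom C k) (Cod C u)"
    have "u \<cdot> g = Zer C (Dom C g) (Cod C u)" using comp_shift[OF u, of g'] by simp
    then show "\<exists>h\<in>Arr C. Cod C h = Cod C u \<and> Dom C h = Cod C p \<and> h \<cdot> p = u"
      using cokernel_desc[OF g, of u]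
        by (metis \<open>Dom C u = Cod C k\<close> \<open>u \<in> Arr C\<close> kernel_arr(3)[OF k] cokernel_arr(3)[OF g])
  qed simp_all
qed

lemma monic_kernel_of_cokernel:
  assumes "is_monic C k" "is_cokernel C k p"
  shows "is_kernel C p k"
proof -
  interpret op: abelian_category "op_cat C" by (rule abelian_op)
  show ?thesis using op.epic_cokernel_of_kernel[of k p] assms by simp
qed

text \<open>The definition of exactness is lopsided, using the kernel of a cokernel. It is
  nevertheless self-dual because in the situation at hand \<open>k\<close> is a kernel of
  \<open>p\<close> exactly when \<open>p\<close> is a cokernel of \<open>k\<close>.\<close>

lemma op_exact [simp]: "is_exact (op_cat C) g f \<longleftrightarrow> is_exact C f g"
proof -
  have "\<exists>p k. is_cokernel C f p \<and> is_kernel C p k \<and> is_kernel C g k \<Longrightarrow>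
    \<exists>k p. is_kernel C g k \<and> is_cokernel C k p \<and> is_cokernel C f p"
    using cokernel_epic epic_cokernel_of_kernel by blast
  moreover have "\<exists>k p. is_kernel C g k \<and> is_cokernel C k p \<and> is_cokernel C f p \<Longrightarrow>
    \<exists>p k. is_cokernel C f p \<and> is_kernel C p k \<and> is_kernel C g k"
    using kernel_monic monic_kernel_of_cokernel by blast
  ultimately show ?thesis unfolding is_exact_def op_kernel op_cokernel by blast
qed

text \<open>The arrow onto the image is epic. If \<open>u\<close> kills it, it factors through the
  kernel \<open>m\<close> of \<open>u\<close>, so \<open>f\<close> factors through the subobject
  \<open>k \<cdot> m\<close> of the image; minimality of the image makes \<open>m\<close> a split
  epimorphism, whence \<open>u = 0\<close>.\<close>

lemma epi_factor:
  assumes p: "is_cokernel C f p" and k: "is_kernel C p k"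
  obtains f' where "is_epic C f'" "Dom C f' = Dom C f" "Cod C f' = Dom C k" "k \<cdot> f' = f"
proof -
  note [simp] = cokernel_arr[OF p] kernel_arr[OF k]
  have "f \<in> Arr C" "Cod C f = Dom C p" by simp_all
  from kernel_lift[OF k this] obtain f' where [simp]: "f' \<in> Arr C" "Dom C f' = Dom C f"
    "Cod C f' = Dom C k" "k \<cdot> f' = f" by auto
  have "u = Zer C (Cod C f') (Cod C u)" if [simp]: "u \<in> Arr C" "Dom C u = Cod C f'"
    and u0: "u \<cdot> f' = Zer C (Dom C f') (Cod C u)" for u
  proof -
    obtain m where m: "is_kernel C u m" using has_kernels[of u] by auto
    note [simp] = kernel_arr(1-3)[OF m]
    obtain f'' where [simp]: "f'' \<in> Arr C" "Dom C f'' = Dom C f'" "Cod C f'' = Dom C m"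
      "m \<cdot> f'' = f'"
      using kernel_lift[OF m, of f'] u0 by auto
    have km: "is_monic C (k \<cdot> m)" unfolding monic_iff_zer
    proof (intro conjI ballI impI; (elim conjE)?)
      fix t assume [simp]: "t \<in> Arr C" "Cod C t = Dom C (k \<cdot> m)"
        and "(k \<cdot> m) \<cdot> t = Zer C (Dom C t) (Cod C (k \<cdot> m))"
      then have "k \<cdot> (m \<cdot> t) = k \<cdot> Zer C (Dom C t) (Dom C k)" by simp
      from monicD[OF kernel_monic[OF k] this] have "m \<cdot> t = m \<cdot> Zer C (Dom C t) (Dom C m)" by simp
      from monicD[OF kernel_monic[OF m] this] show "t = Zer C (Dom C t) (Dom C (k \<cdot> m))" by simp
    qed simp
    \<comment> \<open>Minimality comes from the axiom that monomorphisms are kernels: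
      \<open>w\<close> kills \<open>f\<close>, hence factors through the cokernel \<open>p\<close>
      and kills \<open>k\<close>, and so \<open>k\<close> factors through
      \<open>k \<cdot> m\<close>.\<close>
    then obtain w where w: "is_kernel C w (k \<cdot> m)" using monic_is_kernel by blast
    note [simp] = kernel_arr(1)[OF w] and kw = kernel_arr(3,4)[OF w]
    have [simp]: "Dom C w = Cod C k" using kw by simp
    have "w \<cdot> f = (w \<cdot> (k \<cdot> m)) \<cdot> f''" by simp
    also have "\<dots> = Zer C (Dom C f) (Cod C w)" by (subst kw(2)) simp
    finally obtain w' where [simp]: "w' \<in> Arr C" "Dom C w' = Cod C p" "Cod C w' = Cod C w"
      and w': "w' \<cdot> p = w"
      using cokernel_desc[OF p, of w] by auto
    have "w \<cdot> k = w' \<cdot> (p \<cdot> k)" using w' comp_assoc[of k p w'] by simp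
    then have "w \<cdot> k = Zer C (Dom C k) (Cod C w)" by simp
    then obtain v where [simp]: "v \<in> Arr C" "Dom C v = Dom C k" "Cod C v = Dom C m"
      and v: "(k \<cdot> m) \<cdot> v = k"
      using kernel_lift[OF w, of k] by auto
    have "k \<cdot> (m \<cdot> v) = k \<cdot> Ide C (Dom C k)" using v by simp
    from monicD[OF kernel_monic[OF k] this] have mv: "m \<cdot> v = Ide C (Dom C k)" by simp
    have "u = u \<cdot> (m \<cdot> v)" by (subst mv) simp
    also have "\<dots> = (u \<cdot> m) \<cdot> v" by simp
    also have "\<dots> = Zer C (Cod C f') (Cod C u)" by (subst kernel_arr(4)[OF m]) simp
    finally show ?thesis .
  qed
  then have "is_epic C f'" unfolding epic_iff_zer by auto
  then show thesis using that by simp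
qed

lemma mono_factor:
  assumes "is_kernel C f k" "is_cokernel C k p"
  obtains f' where "is_monic C f'" "Cod C f' = Cod C f" "Dom C f' = Cod C p" "f' \<cdot> p = f"
proof -
  interpret op: abelian_category "op_cat C" by (rule abelian_op)
  show thesis using op.epi_factor[of f k p] assms that by auto
qed

lemma biproduct_arr:
  assumes "is_biproduct C a b P i1 i2 p1 p2"
  shows "i1 \<in> Arr C" "i2 \<in> Arr C" "p1 \<in> Arr C" "p2 \<in> Arr C"
    "Dom C i1 = a" "Dom C i2 = b" "Cod C i1 = P" "Cod C i2 = P"
    "Cod C p1 = a" "Cod C p2 = b" "Dom C p1 = P" "Dom C p2 = P"
    "p1 \<cdot> i1 = Ide C a" "p2 \<cdot> i2 = Ide C b" "p2 \<cdot> i1 = Zer C a b" "p1 \<cdot> i2 = Zer C b a"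
    "a \<in> Obj C" "b \<in> Obj C" "P \<in> Obj C"
  using assms obj_of_arr by (auto simp: is_biproduct_def)

lemma biproduct_expand:
  assumes b: "is_biproduct C a b P i1 i2 p1 p2" and [simp]: "t \<in> Arr C" "Cod C t = P"
  shows "Add C (i1 \<cdot> p1 \<cdot> t) (i2 \<cdot> p2 \<cdot> t) = t"
proof -
  note [simp] = biproduct_arr[OF b]
  have "Add C (i1 \<cdot> p1) (i2 \<cdot> p2) = Ide C P" using b by (simp add: is_biproduct_def)
  then have "Add C (i1 \<cdot> p1) (i2 \<cdot> p2) \<cdot> t = t" by simp
  then show ?thesis by simp
qed

lemma biproduct_expand':
  assumes b: "is_biproduct C a b P i1 i2 p1 p2" and [simp]: "t \<in> Arr C" "Dom C t = P"
  shows "Add C ((t \<cdot> i1) \<cdot> p1) ((t \<cdot> i2) \<cdot> p2) = t"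
proof -
  note [simp] = biproduct_arr[OF b]
  have "Add C (i1 \<cdot> p1) (i2 \<cdot> p2) = Ide C P" using b by (simp add: is_biproduct_def)
  then have "t \<cdot> Add C (i1 \<cdot> p1) (i2 \<cdot> p2) = t" by simp
  then show ?thesis by simp
qed

lemma biproduct_eqI:
  assumes b: "is_biproduct C a b P i1 i2 p1 p2" and "t \<in> Arr C" "Cod C t = P" "s \<in> Arr C"
    "Cod C s = P"
    "p1 \<cdot> t = p1 \<cdot> s" "p2 \<cdot> t = p2 \<cdot> s"
  shows "t = s"
proof -
  have "t = Add C (i1 \<cdot> p1 \<cdot> t) (i2 \<cdot> p2 \<cdot> t)" using biproduct_expand[OF b assms(2,3)] by simp
  also have "\<dots> = s" unfolding assms(6,7) by (rule biproduct_expand[OF b assms(4,5)])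
  finally show ?thesis .
qed

text \<open>The pullback is the kernel of \<open>f \<cdot> p1 - g \<cdot> p2\<close> on the
  biproduct. Stability of epimorphisms is read off from this construction, so both halves are stated
  together; \<open>pullback_epic\<close> extends it to every pullback.\<close>

lemma ex_pullback_epic:
  assumes [simp]: "f \<in> Arr C" "g \<in> Arr C" "Cod C g = Cod C f"
  obtains p q where "is_pullback C f g p q" "is_epic C f \<Longrightarrow> is_epic C q"
proof -
  obtain P i1 i2 p1 p2 where b: "is_biproduct C (Dom C f) (Dom C g) P i1 i2 p1 p2"
    using has_biproducts[of "Dom C f" "Dom C g"] by auto
  note [simp] = biproduct_arr[OF b]
  define d where "d = Diff C (f \<cdot> p1) (g \<cdot> p2)"
  have [simp]: "d \<in> Arr C" "Dom C d = P" "Cod C d = Cod C f" by (simp_all add: d_def)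
  obtain k where k: "is_kernel C d k" using has_kernels[of d] by auto
  note [simp] = kernel_arr(1-3)[OF k] and dk = kernel_arr(4)[OF k]
  have d_eq: "d \<cdot> t = Diff C (f \<cdot> p1 \<cdot> t) (g \<cdot> p2 \<cdot> t)" if "t \<in> Arr C" "Cod C t = P" for t
    using that by (simp add: d_def)
  have d0: "d \<cdot> t = Zer C (Dom C t) (Cod C f) \<longleftrightarrow> f \<cdot> p1 \<cdot> t = g \<cdot> p2 \<cdot> t" if "t \<in> Arr C"
    "Cod C t = P" for t
    using that d_eq[OF that] diff_eq_zer_iff[of "f \<cdot> p1 \<cdot> t" "g \<cdot> p2 \<cdot> t"] by simp
  have "is_pullback C f g (p1 \<cdot> k) (p2 \<cdot> k)" unfolding is_pullback_def
  proof (intro conjI allI ballI impI)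
    show "f \<cdot> p1 \<cdot> k = g \<cdot> p2 \<cdot> k" using d0[of k] dk by simp
    fix T u v assume "u \<in> Hom C T (Dom C f)" "v \<in> Hom C T (Dom C g)" and e: "f \<cdot> u = g \<cdot> v"
    then have [simp]: "u \<in> Arr C" "v \<in> Arr C" "Dom C u = T" "Dom C v = T" "Cod C u = Dom C f"
      "Cod C v = Dom C g" by auto
    define t where "t = Add C (i1 \<cdot> u) (i2 \<cdot> v)"
    have t0[simp]: "t \<in> Arr C" "Dom C t = T" "Cod C t = P" by (simp_all add: t_def)
    have [simp]: "T \<in> Obj C" using obj_of_arr(1)[of u] by simp
    have t[simp]: "p1 \<cdot> t = u" "p2 \<cdot> t = v"
      by (simp_all add: t_def comp_shift[OF biproduct_arr(13)[OF b]] comp_shift[OF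
      biproduct_arr(14)[OF b]] comp_shift[OF biproduct_arr(15)[OF b]] comp_shift[OF
      biproduct_arr(16)[OF b]])
    have "d \<cdot> t = Zer C T (Cod C d)" using d0[of t] e by simp
    then obtain h where [simp]: "h \<in> Arr C" "Dom C h = T" "Cod C h = Dom C k" and h: "k \<cdot> h = t"
      using kernel_lift[OF k, of t] by auto
    show "\<exists>!h. h \<in> Hom C T (Dom C (p1 \<cdot> k)) \<and> (p1 \<cdot> k) \<cdot> h = u \<and> (p2 \<cdot> k) \<cdot> h = v"
    proof (rule ex1I[of _ h])
      fix h' assume "h' \<in> Hom C T (Dom C (p1 \<cdot> k)) \<and> (p1 \<cdot> k) \<cdot> h' = u \<and> (p2 \<cdot> k) \<cdot> h' = v"
      then have [simp]: "h' \<in> Arr C" "Dom C h' = T" "Cod C h' = Dom C k" and h': "p1 \<cdot> (k \<cdot> h') = u"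
        "p2 \<cdot> (k \<cdot> h') = v" by auto
      have "k \<cdot> h' = k \<cdot> h" using h' h by (intro biproduct_eqI[OF b, of "k \<cdot> h'" "k \<cdot> h"]) simp_all
      from monicD[OF kernel_monic[OF k] this] show "h' = h" by simp
    qed (simp add: h)
  qed (simp_all add: is_pullback_def)
  moreover have "is_epic C (p2 \<cdot> k)" if f: "is_epic C f"
    unfolding epic_iff_zer
  proof (intro conjI ballI impI; (elim conjE)?)
    \<comment> \<open>Since \<open>d\<close> restricts to \<open>f\<close>, it is epic and a
      cokernel of its kernel. An arrow \<open>u \<cdot> p2\<close> that kills \<open>k\<close> is
      thus of the form \<open>v \<cdot> d\<close>; restricting to \<open>i1\<close> gives
      \<open>v = 0\<close>, and then restricting to \<open>i2\<close> gives
      \<open>u = 0\<close>.\<close>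
    have "d \<cdot> i1 = f" using d_eq[of i1] by simp
    then have "is_epic C d" using epic_cancel[of d i1] f by simp
    then have cok: "is_cokernel C k d" using epic_cokernel_of_kernel[OF _ k] by blast
    fix u assume [simp]: "u \<in> Arr C" "Dom C u = Cod C (p2 \<cdot> k)"
      and u: "u \<cdot> p2 \<cdot> k = Zer C (Dom C (p2 \<cdot> k)) (Cod C u)"
    have "(u \<cdot> p2) \<cdot> k = Zer C (Dom C k) (Cod C u)" using u by simp
    then obtain v where [simp]: "v \<in> Arr C" "Dom C v = Cod C f" "Cod C v = Cod C u"
      and v: "v \<cdot> d = u \<cdot> p2"
      using cokernel_desc[OF cok, of "u \<cdot> p2"] by auto
    have "v \<cdot> f = (v \<cdot> d) \<cdot> i1" using \<open>d \<cdot> i1 = f\<close> by simp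
    also have "\<dots> = v \<cdot> Zer C (Dom C f) (Cod C f)" by (subst v) simp
    finally have "v = Zer C (Cod C f) (Cod C u)" using epicD[OF f, of v "Zer C (Cod C f) (Cod C u)"]
      by simp
    then have "u \<cdot> p2 = Zer C P (Cod C u)" using v by simp
    then have "(u \<cdot> p2) \<cdot> i2 = Zer C (Dom C g) (Cod C u)" by simp
    then show "u = Zer C (Cod C (p2 \<cdot> k)) (Cod C u)" by simp
  qed simp
  ultimately show thesis using that by blast
qed

lemma pullback_arr:
  assumes "is_pullback C f g p q"
  shows "f \<in> Arr C" "g \<in> Arr C" "p \<in> Arr C" "q \<in> Arr C" "Cod C g = Cod C f" "Cod C p = Dom C f"
    "Cod C q = Dom C g"
     "Dom C q = Dom C p" "f \<cdot> p = g \<cdot> q"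
  using assms by (simp_all add: is_pullback_def)

lemma pullback_lift:
  assumes "is_pullback C f g p q" "u \<in> Arr C" "v \<in> Arr C" "Dom C u = Dom C v" "Cod C u = Dom C f"
    "Cod C v = Dom C g" "f \<cdot> u = g \<cdot> v"
  obtains h where "h \<in> Arr C" "Dom C h = Dom C v" "Cod C h = Dom C p" "p \<cdot> h = u" "q \<cdot> h = v"
proof -
  have "\<exists>!h. h \<in> Hom C (Dom C v) (Dom C p) \<and> p \<cdot> h = u \<and> q \<cdot> h = v"
    using assms unfolding is_pullback_def by (metis in_Hom_iff obj_of_arr(1))
  then show thesis using that by auto
qed

lemma pullback_eqI:
  assumes "is_pullback C f g p q" "u \<in> Arr C" "v \<in> Arr C" "Dom C u = Dom C v" "Cod C u = Dom C p"
    "Cod C v = Dom C p"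
    "p \<cdot> u = p \<cdot> v" "q \<cdot> u = q \<cdot> v"
  shows "u = v"
proof -
  note [simp] = pullback_arr(1-8)[OF assms(1)]
  have "f \<cdot> p \<cdot> v = g \<cdot> q \<cdot> v" using assms by (intro comp_square pullback_arr[OF assms(1)]) auto
  moreover have "p \<cdot> v \<in> Hom C (Dom C v) (Dom C f)" "q \<cdot> v \<in> Hom C (Dom C v) (Dom C g)" using assms
    by auto
  ultimately have "\<exists>!h. h \<in> Hom C (Dom C v) (Dom C p) \<and> p \<cdot> h = p \<cdot> v \<and> q \<cdot> h = q \<cdot> v"
    using assms(1) obj_of_arr(1)[OF assms(3)] unfolding is_pullback_def by blast
  moreover have "u \<in> Hom C (Dom C v) (Dom C p) \<and> p \<cdot> u = p \<cdot> v \<and> q \<cdot> u = q \<cdot> v"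
    "v \<in> Hom C (Dom C v) (Dom C p) \<and> p \<cdot> v = p \<cdot> v \<and> q \<cdot> v = q \<cdot> v" using assms by simp_all
  ultimately show ?thesis by metis
qed

text \<open>The epic projection of the constructed pullback factors as the comparison arrow followed
  by \<open>q\<close>.\<close>

lemma pullback_epic:
  assumes "is_pullback C f g p q" "is_epic C f"
  shows "is_epic C q"
proof -
  note [simp] = pullback_arr[OF assms(1)]
  obtain p' q' where pq: "is_pullback C f g p' q'" "is_epic C q'"
    using ex_pullback_epic[of f g] assms(2) by auto
  note [simp] = pullback_arr(1-8)[OF pq(1)]
  obtain h where [simp]: "h \<in> Arr C" "Dom C h = Dom C q'" "Cod C h = Dom C p" "q \<cdot> h = q'"
    using pullback_lift[OF assms(1), of p' q'] pullback_arr(9)[OF pq(1)] by auto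
  show ?thesis using epic_cancel[of q h] pq(2) by simp
qed

text \<open>Arrows into an object serve as its elements, and equations between them may be checked after
  composition with an epimorphism; this makes diagram chases possible.\<close>

lemma epi_lift:
  assumes f: "is_epic C f" and [simp]: "t \<in> Arr C" "Cod C t = Cod C f"
  obtains e s where "is_epic C e" "Cod C e = Dom C t" "s \<in> Arr C" "Dom C s = Dom C e"
    "Cod C s = Dom C f" "f \<cdot> s = t \<cdot> e"
proof -
  obtain p q where pq: "is_pullback C f t p q" using ex_pullback_epic[of f t] epic_arr[OF f]
    assms(2,3) by metis
  show thesis using that[of q p] pullback_epic[OF pq f] pullback_arr[OF pq] by auto
qed

lemma exact_arr:
  assumes "is_exact C f g"
  shows "f \<in> Arr C" "g \<in> Arr C" "Dom C g = Cod C f" "g \<cdot> f = Zer C (Dom C f) (Cod C g)"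
proof -
  obtain p k where p: "is_cokernel C f p" and k: "is_kernel C p k" and g: "is_kernel C g k"
    using assms by (auto simp: is_exact_def)
  note [simp] = cokernel_arr[OF p] kernel_arr(1-3)[OF k] kernel_arr[OF g]
  show "f \<in> Arr C" "g \<in> Arr C" by simp_all
  show [simp]: "Dom C g = Cod C f" using kernel_arr(3)[OF g] kernel_arr(3)[OF k] by simp
  obtain f' where [simp]: "f' \<in> Arr C" "Dom C f' = Dom C f" "Cod C f' = Dom C k"
    and f': "k \<cdot> f' = f"
    using epi_factor[OF p k] epic_arr by metis
  show "g \<cdot> f = Zer C (Dom C f) (Cod C g)" using comp_shift[OF kernel_arr(4)[OF g], of f'] f'
    by simp
qed

text \<open>Exactness for elements: a cycle is a boundary after passing to a cover. The cycle lifts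
  to the kernel of \<open>g\<close>, which is also the image of \<open>f\<close>, and from there
  along the epimorphism onto the image.\<close>

lemma exact_lift:
  assumes "is_exact C f g" and [simp]: "t \<in> Arr C" "Cod C t = Dom C g"
    and t0: "g \<cdot> t = Zer C (Dom C t) (Cod C g)"
  obtains e s where "is_epic C e" "Cod C e = Dom C t" "s \<in> Arr C" "Dom C s = Dom C e"
    "Cod C s = Dom C f" "f \<cdot> s = t \<cdot> e"
proof -
  obtain p k where p: "is_cokernel C f p" and k: "is_kernel C p k" and g: "is_kernel C g k"
    using assms by (auto simp: is_exact_def)
  note [simp] = cokernel_arr[OF p] kernel_arr(1-3)[OF k] kernel_arr[OF g]
  obtain f' where e': "is_epic C f'" and [simp]: "Dom C f' = Dom C f" "Cod C f' = Dom C k"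
    and f': "k \<cdot> f' = f"
    using epi_factor[OF p k] by metis
  note [simp] = epic_arr[OF e']
  obtain t' where [simp]: "t' \<in> Arr C" "Dom C t' = Dom C t" "Cod C t' = Dom C k"
    and t': "k \<cdot> t' = t"
    using kernel_lift[OF g _ _ t0] by auto
  obtain e s where e: "is_epic C e" and [simp]: "Cod C e = Dom C t" "s \<in> Arr C" "Dom C s = Dom C e"
    "Cod C s = Dom C f" and s: "f' \<cdot> s = t' \<cdot> e"
    using epi_lift[OF e', of t'] by auto
  note [simp] = epic_arr[OF e]
  have "f \<cdot> s = k \<cdot> f' \<cdot> s" using f' by (intro comp_shift[symmetric]) simp_all
  also have "\<dots> = t \<cdot> e" using t' unfolding s by (intro comp_shift) simp_all
  finally have "f \<cdot> s = t \<cdot> e" .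
  then show thesis by (intro that[OF e]) simp_all
qed

text \<open>Converse of \<open>exact_lift\<close>: lifting cycles locally is enough. If
  \<open>g\<close> kills \<open>t\<close>, the cokernel \<open>p\<close> of \<open>f\<close> kills
  \<open>t\<close> after composition with an epimorphism, hence kills \<open>t\<close>; so the
  kernel of \<open>p\<close> is a kernel of \<open>g\<close>.\<close>

lemma exactI:
  assumes [simp]: "f \<in> Arr C" "g \<in> Arr C" "Dom C g = Cod C f" "g \<cdot> f = Zer C (Dom C f) (Cod C g)"
    and lift: "\<And>t. t \<in> Arr C \<Longrightarrow> Cod C t = Dom C g \<Longrightarrow> g \<cdot> t = Zer C (Dom C t) (Cod C g) \<Longrightarrow>
      \<exists>e s. is_epic C e \<and> Cod C e = Dom C t \<and> s \<in> Arr C \<and> Dom C s = Dom C e \<and> Cod C s = Dom C f \<and> f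
        \<cdot> s = t \<cdot> e"
  shows "is_exact C f g"
proof -
  obtain p where p: "is_cokernel C f p" using has_cokernels[of f] by auto
  note [simp] = cokernel_arr[OF p]
  obtain k where k: "is_kernel C p k" using has_kernels[of p] by auto
  note [simp] = kernel_arr(1-3)[OF k]
  obtain g' where [simp]: "g' \<in> Arr C" "Dom C g' = Cod C p" "Cod C g' = Cod C g"
    and g': "g' \<cdot> p = g"
    using cokernel_desc[OF p, of g] by auto
  have "is_kernel C g k"
  proof (rule kernelI[OF kernel_monic[OF k]])
    show "g \<cdot> k = Zer C (Dom C k) (Cod C g)"
      using comp_assoc[of k p g'] g' kernel_arr(4)[OF k] by simp
    fix t assume [simp]: "t \<in> Arr C" "Cod C t = Dom C g" and t0: "g \<cdot> t = Zer C (Dom C t) (Cod C g)"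
    obtain e s where e: "is_epic C e" and [simp]: "Cod C e = Dom C t" "s \<in> Arr C"
      "Dom C s = Dom C e" "Cod C s = Dom C f" and s: "f \<cdot> s = t \<cdot> e"
      using lift[OF _ _ t0] by auto
    note [simp] = epic_arr[OF e]
    have "(p \<cdot> t) \<cdot> e = p \<cdot> f \<cdot> s" using s by simp
    also have "\<dots> = Zer C (Dom C t) (Cod C p) \<cdot> e" by (subst comp_shift[OF cokernel_arr(4)[OF p]])
      simp_all
    finally have "p \<cdot> t = Zer C (Dom C t) (Cod C p)"
      using epicD[OF e, of "p \<cdot> t" "Zer C (Dom C t) (Cod C p)"] by simp
    then show "\<exists>h\<in>Arr C. Dom C h = Dom C t \<and> Cod C h = Dom C k \<and> k \<cdot> h = t"
      using kernel_lift[OF k, of t]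
        by (metis \<open>t \<in> Arr C\<close> \<open>Cod C t = Dom C g\<close> assms(3) cokernel_arr(3)[OF p])
  qed simp_all
  then show ?thesis using p k by (auto simp: is_exact_def)
qed

lemma short_exactI:
  assumes "is_monic C f" "is_cokernel C f p"
  shows "is_short_exact C f p"
  using assms cokernel_epic monic_kernel_of_cokernel unfolding is_short_exact_def is_exact_def
    by blast

end

section \<open>Extensions and their morphisms\<close>

text \<open>The objects of a sequence, numbered from the left; the right end of \<open>n + 1\<close>
  arrows is vertex \<open>n + 1\<close>. Reading all vertices but the first as codomains treats the
  last one uniformly; for composable arrows the inner ones are domains as well.\<close>

definition vert :: "('o, 'm) cat \<Rightarrow> 'm list \<Rightarrow> nat \<Rightarrow> 'o" where
  "vert C xs k = (case k of 0 \<Rightarrow> Dom C (xs ! 0) | Suc i \<Rightarrow> Cod C (xs ! i))"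

lemma vert_simps [simp]: "vert C xs 0 = Dom C (xs ! 0)" "vert C xs (Suc i) = Cod C (xs ! i)"
  by (simp_all add: vert_def)

text \<open>The part of being an extension on which constructions with morphisms rely. It mentions
  no end objects and is stable under reversal in the opposite category.\<close>

definition cplx :: "('o, 'm) cat \<Rightarrow> 'm list \<Rightarrow> bool" where
  "cplx C xs \<longleftrightarrow> xs \<noteq> [] \<and> set xs \<subseteq> Arr C \<and>
     successively (\<lambda>f g. Cod C f = Dom C g \<and> g \<cdot>\<^bsub>C\<^esub> f = Zer C (Dom C f) (Cod C g)) xs"

text \<open>Equivalence of extensions asks only for some morphism with prescribed ends, so the inner
  components are hidden. A function on vertices replaces the list of components.\<close>

definition ext_mor :: "('o, 'm) cat \<Rightarrow> 'm list \<Rightarrow> 'm list \<Rightarrow> 'm \<Rightarrow> 'm \<Rightarrow> bool" where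
  "ext_mor C xs ys b a \<longleftrightarrow> length ys = length xs \<and> (\<exists>\<phi>.
     (\<forall>k\<le>length xs. \<phi> k \<in> Hom C (vert C xs k) (vert C ys k)) \<and>
     (\<forall>i<length xs. \<phi> (Suc i) \<cdot>\<^bsub>C\<^esub> xs ! i = ys ! i \<cdot>\<^bsub>C\<^esub> \<phi> i) \<and> \<phi> 0 = b \<and> \<phi> (length xs) = a)"

lemma ext_morE:
  assumes "ext_mor C xs ys b a"
  obtains \<phi> where "length ys = length xs" "\<And>k. k \<le> length xs \<Longrightarrow> \<phi> k \<in> Arr C"
    "\<And>k. k \<le> length xs \<Longrightarrow> Dom C (\<phi> k) = vert C xs k" "\<And>k. k \<le> length xs \<Longrightarrow> Cod C (\<phi> k) = vert C ys k"
    "\<And>i. i < length xs \<Longrightarrow> \<phi> (Suc i) \<cdot>\<^bsub>C\<^esub> xs ! i = ys ! i \<cdot>\<^bsub>C\<^esub> \<phi> i" "\<phi> 0 = b" "\<phi> (length xs) = a"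
  using assms unfolding ext_mor_def in_Hom_iff by blast

lemma ext_morI:
  assumes "length ys = length xs" "\<And>k. k \<le> length xs \<Longrightarrow> \<phi> k \<in> Hom C (vert C xs k) (vert C ys k)"
    "\<And>i. i < length xs \<Longrightarrow> \<phi> (Suc i) \<cdot>\<^bsub>C\<^esub> xs ! i = ys ! i \<cdot>\<^bsub>C\<^esub> \<phi> i" "\<phi> 0 = b" "\<phi> (length xs) = a"
  shows "ext_mor C xs ys b a"
  using assms unfolding ext_mor_def by blast

lemma is_ext_morphism_iff:
  "is_ext_morphism C xs ys \<phi>s \<longleftrightarrow> length ys = length xs \<and> length \<phi>s = Suc (length xs) \<and>
     (\<forall>k\<le>length xs. \<phi>s ! k \<in> Hom C (vert C xs k) (vert C ys k)) \<and>
     (\<forall>i<length xs. \<phi>s ! Suc i \<cdot>\<^bsub>C\<^esub> xs ! i = ys ! i \<cdot>\<^bsub>C\<^esub> \<phi>s ! i)"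
proof -
  have "(\<forall>k\<le>length xs. \<phi>s ! k \<in> Hom C (vert C xs k) (vert C ys k)) \<longleftrightarrow>
    \<phi>s ! 0 \<in> Hom C (Dom C (xs ! 0)) (Dom C (ys ! 0)) \<and> (\<forall>i<length xs. \<phi>s ! Suc i \<in> Hom C (Cod C (xs
      ! i)) (Cod C (ys ! i)))"
    unfolding less_Suc_eq_le[symmetric] All_less_Suc2 by (simp add: vert_def)
  then show ?thesis unfolding is_ext_morphism_def by blast
qed

lemma ext_mor_iff:
  "ext_mor C xs ys b a \<longleftrightarrow> (\<exists>\<phi>s. is_ext_morphism C xs ys \<phi>s \<and> \<phi>s ! 0 = b \<and> \<phi>s ! length xs = a)"
proof
  assume "ext_mor C xs ys b a"
  then obtain \<phi> where p: "length ys = length xs"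
    "\<forall>k\<le>length xs. \<phi> k \<in> Hom C (vert C xs k) (vert C ys k)"
     "\<forall>i<length xs. \<phi> (Suc i) \<cdot>\<^bsub>C\<^esub> xs ! i = ys ! i \<cdot>\<^bsub>C\<^esub> \<phi> i" "\<phi> 0 = b" "\<phi> (length xs) = a"
    unfolding ext_mor_def by blast
  have "map \<phi> [0..<Suc (length xs)] ! k = \<phi> k" if "k \<le> length xs" for k
    using that by (simp del: upt_Suc)
  then show "\<exists>\<phi>s. is_ext_morphism C xs ys \<phi>s \<and> \<phi>s ! 0 = b \<and> \<phi>s ! length xs = a"
    using p unfolding is_ext_morphism_iff by (intro exI[of _ "map \<phi> [0..<Suc (length xs)]"])
      (simp del: upt_Suc in_Hom_iff)
next
  assume "\<exists>\<phi>s. is_ext_morphism C xs ys \<phi>s \<and> \<phi>s ! 0 = b \<and> \<phi>s ! length xs = a"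
  then obtain \<phi>s where "is_ext_morphism C xs ys \<phi>s" "\<phi>s ! 0 = b" "\<phi>s ! length xs = a" by blast
  then show "ext_mor C xs ys b a" unfolding is_ext_morphism_iff
    by (intro ext_morI[of _ _ "(!) \<phi>s"]) (simp_all del: in_Hom_iff)
qed

text \<open>In terms of \<open>hd\<close>, \<open>last\<close> and \<open>successively\<close> the
  notion is visibly symmetric under reversal of the list.\<close>

lemma is_extension_iff:
  "is_extension C n A B xs \<longleftrightarrow> length xs = Suc n \<and> set xs \<subseteq> Arr C \<and> Dom C (hd xs) = B \<and>
    Cod C (last xs) = A \<and>
     is_monic C (hd xs) \<and> is_epic C (last xs) \<and> successively (is_exact C) xs"
proof (cases "length xs = Suc n")
  case True
  then have "xs \<noteq> []" by auto
  with True show ?thesis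
    by (simp add: is_extension_def successively_conv_nth hd_conv_nth last_conv_nth)
qed (simp add: is_extension_def)

lemma extension_length: "is_extension C n A B xs \<Longrightarrow> length xs = Suc n"
  by (simp add: is_extension_def)

lemma extension_ends:
  assumes "is_extension C n A B xs"
  shows "Dom C (xs ! 0) = B" "Cod C (xs ! n) = A" "vert C xs (Suc n) = A"
  using assms by (simp_all add: is_extension_def)

lemma ext_step_iff:
  "(xs, ys) \<in> ext_step C n A B \<longleftrightarrow> is_extension C n A B xs \<and> is_extension C n A B ys \<and>
    ext_mor C xs ys (Ide C B) (Ide C A)"
  unfolding ext_step_def ext_mor_iff using extension_length by fastforce

lemma ext_equiv_sym: "(xs, ys) \<in> ext_equiv C n A B \<Longrightarrow> (ys, xs) \<in> ext_equiv C n A B"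
proof -
  have "sym ((ext_step C n A B \<union> (ext_step C n A B)\<inverse>)\<^sup>*)"
    by (intro sym_rtrancl sym_Un_converse)
  then show "(xs, ys) \<in> ext_equiv C n A B \<Longrightarrow> (ys, xs) \<in> ext_equiv C n A B"
    unfolding ext_equiv_def by (auto dest: symD)
qed

lemma ext_equiv_trans [trans]:
  "(xs, ys) \<in> ext_equiv C n A B \<Longrightarrow> (ys, zs) \<in> ext_equiv C n A B \<Longrightarrow> (xs, zs) \<in> ext_equiv C n A B"
  unfolding ext_equiv_def by auto

lemma ext_equiv_step: "(xs, ys) \<in> ext_step C n A B \<Longrightarrow> (xs, ys) \<in> ext_equiv C n A B"
  unfolding ext_equiv_def by (auto simp: ext_step_def)

lemma ext_equiv_refl: "is_extension C n A B xs \<Longrightarrow> (xs, xs) \<in> ext_equiv C n A B"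
  unfolding ext_equiv_def by auto

lemma ext_equiv_extension:
  "(xs, ys) \<in> ext_equiv C n A B \<Longrightarrow> is_extension C n A B xs"
  "(xs, ys) \<in> ext_equiv C n A B \<Longrightarrow> is_extension C n A B ys"
  unfolding ext_equiv_def by auto

lemma equiv_ext_equiv: "equiv {xs. is_extension C n A B xs} (ext_equiv C n A B)"
  by (intro equivI refl_onI symI transI) (auto intro: ext_equiv_refl ext_equiv_sym ext_equiv_trans
    dest: ext_equiv_extension)

text \<open>Pullback acts at the right end of the list, so duality reverses lists as well as arrows.
  Facts on pushouts and pullbacks of extensions then have to be proved on one side only.\<close>

lemma op_ext_pushout [simp]: "is_ext_pushout (op_cat C) b (rev xs) (rev ys) \<longleftrightarrow>
  is_ext_pullback C xs b ys"
proof
  assume "is_ext_pushout (op_cat C) b (rev xs) (rev ys)"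
  then obtain x0 x1 y0 y1 rest k where "rev xs = x0 # x1 # rest" "rev ys = y0 # y1 # rest"
    and r: "is_pullback C x0 b k y0"
     "y1 \<in> Hom C (Dom C x1) (Dom C y0)" "k \<cdot>\<^bsub>C\<^esub> y1 = x1" "y0 \<cdot>\<^bsub>C\<^esub> y1 = Zer C (Dom C x1) (Cod C y0)"
    unfolding is_ext_pushout_def by (auto simp: Hom_op_cat)
  then have "xs = rev rest @ [x1, x0]" "ys = rev rest @ [y1, y0]"
    by (simp_all add: rev_swap[symmetric])
  with r show "is_ext_pullback C xs b ys" unfolding is_ext_pullback_def by blast
next
  assume "is_ext_pullback C xs b ys"
  then obtain x0 x1 y0 y1 rest k where "xs = rest @ [x1, x0]" "ys = rest @ [y1, y0]"
    and r: "is_pullback C x0 b k y0"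
     "y1 \<in> Hom C (Dom C x1) (Dom C y0)" "k \<cdot>\<^bsub>C\<^esub> y1 = x1" "y0 \<cdot>\<^bsub>C\<^esub> y1 = Zer C (Dom C x1) (Cod C y0)"
    unfolding is_ext_pullback_def by blast
  then have "rev xs = x0 # x1 # rev rest" "rev ys = y0 # y1 # rev rest" by simp_all
  with r show "is_ext_pushout (op_cat C) b (rev xs) (rev ys)" unfolding is_ext_pushout_def
    by (simp add: Hom_op_cat) blast
qed

lemma op_ext_pullback [simp]: "is_ext_pullback (op_cat C) (rev xs) b (rev ys) \<longleftrightarrow>
  is_ext_pushout C b xs ys"
  using op_ext_pushout[of "op_cat C" b "rev xs" "rev ys"] by simp

lemma op_cplx [simp]: "cplx (op_cat C) (rev xs) \<longleftrightarrow> cplx C xs"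
  by (simp add: cplx_def eq_commute[of "Dom C _"])

lemma cplx_nth:
  assumes "cplx C xs"
  shows "i < length xs \<Longrightarrow> xs ! i \<in> Arr C" "i < length xs \<Longrightarrow> Dom C (xs ! i) = vert C xs i"
    "Suc i < length xs \<Longrightarrow> xs ! Suc i \<cdot>\<^bsub>C\<^esub> xs ! i = Zer C (Dom C (xs ! i)) (Cod C (xs ! Suc i))"
    "0 < length xs"
proof -
  note c = assms[unfolded cplx_def successively_conv_nth]
  show "i < length xs \<Longrightarrow> xs ! i \<in> Arr C" using c by (auto dest: nth_mem)
  show "i < length xs \<Longrightarrow> Dom C (xs ! i) = vert C xs i" using c by (cases i) auto
  show "Suc i < length xs \<Longrightarrow> xs ! Suc i \<cdot>\<^bsub>C\<^esub> xs ! i = Zer C (Dom C (xs ! i)) (Cod C (xs ! Suc i))"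
    "0 < length xs" using c by auto
qed

lemma op_vert:
  assumes "cplx C xs" "k \<le> length xs"
  shows "vert (op_cat C) (rev xs) k = vert C xs (length xs - k)"
proof (cases k)
  case 0
  then show ?thesis using cplx_nth(4)[OF assms(1)] by (simp add: rev_nth vert_def split: nat.split)
next
  case (Suc i)
  then show ?thesis using assms cplx_nth(2)[OF assms(1), of "length xs - Suc i"]
    by (simp add: rev_nth)
qed

lemma op_ext_mor:
  assumes "ext_mor C xs ys b a" "cplx C xs" "cplx C ys"
  shows "ext_mor (op_cat C) (rev ys) (rev xs) a b"
proof -
  obtain \<phi> where p: "length ys = length xs" "\<And>k. k \<le> length xs \<Longrightarrow> \<phi> k \<in> Arr C"
    "\<And>k. k \<le> length xs \<Longrightarrow> Dom C (\<phi> k) = vert C xs k" "\<And>k. k \<le> length xs \<Longrightarrow> Cod C (\<phi> k) = vert C ys k"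
    "\<And>i. i < length xs \<Longrightarrow> \<phi> (Suc i) \<cdot>\<^bsub>C\<^esub> xs ! i = ys ! i \<cdot>\<^bsub>C\<^esub> \<phi> i" "\<phi> 0 = b" "\<phi> (length xs) = a"
    using ext_morE[OF assms(1)] by metis
  show ?thesis
  proof (rule ext_morI[of _ _ "\<lambda>k. \<phi> (length xs - k)"])
    fix i assume i: "i < length (rev ys)"
    \<comment> \<open>Square \<open>i\<close> of the reversed morphism is square
      \<open>length xs - 1 - i\<close> of the original one.\<close>
    define j where "j = length xs - Suc i"
    have "j < length xs" "length xs - i = Suc j" using i p(1) by (auto simp: j_def)
    then show "\<phi> (length xs - Suc i) \<cdot>\<^bsub>op_cat C\<^esub> rev ys ! i = rev xs ! i \<cdot>\<^bsub>op_cat C\<^esub> \<phi> (length xs -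
      i)"
      using i p(1) p(5)[of j] by (simp add: rev_nth j_def[symmetric])
  qed (use p assms(2,3) in \<open>simp_all add: op_vert\<close>)
qed

context category
begin

lemma cplx_vert_obj: "cplx C xs \<Longrightarrow> k \<le> length xs \<Longrightarrow> vert C xs k \<in> Obj C"
  using cplx_nth(1,4)[of C xs] by (cases k) simp_all

lemma ext_mor_ide:
  assumes "cplx C xs"
  shows "ext_mor C xs xs (Ide C (Dom C (xs ! 0))) (Ide C (Cod C (last xs)))"
proof (rule ext_morI[of _ _ "\<lambda>k. Ide C (vert C xs k)"])
  show "Ide C (vert C xs (length xs)) = Ide C (Cod C (last xs))"
    using cplx_nth(4)[OF assms] by (cases xs rule: rev_cases) auto
next
  fix i assume "i < length xs"
  then show "Ide C (vert C xs (Suc i)) \<cdot> xs ! i = xs ! i \<cdot> Ide C (vert C xs i)"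
    using cplx_nth(1,2)[OF assms, of i] by simp
qed (use cplx_vert_obj[OF assms] in simp_all)

lemma ext_mor_comp:
  assumes "ext_mor C xs ys b a" "ext_mor C ys zs b' a'" "cplx C xs" "cplx C ys" "cplx C zs"
  shows "ext_mor C xs zs (b' \<cdot> b) (a' \<cdot> a)"
proof -
  obtain \<phi> where p: "length ys = length xs" "\<And>k. k \<le> length xs \<Longrightarrow> \<phi> k \<in> Arr C"
    "\<And>k. k \<le> length xs \<Longrightarrow> Dom C (\<phi> k) = vert C xs k" "\<And>k. k \<le> length xs \<Longrightarrow> Cod C (\<phi> k) = vert C ys k"
    "\<And>i. i < length xs \<Longrightarrow> \<phi> (Suc i) \<cdot> xs ! i = ys ! i \<cdot> \<phi> i" "\<phi> 0 = b" "\<phi> (length xs) = a"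
    using ext_morE[OF assms(1)] by metis
  obtain \<psi> where q: "length zs = length ys" "\<And>k. k \<le> length ys \<Longrightarrow> \<psi> k \<in> Arr C"
    "\<And>k. k \<le> length ys \<Longrightarrow> Dom C (\<psi> k) = vert C ys k" "\<And>k. k \<le> length ys \<Longrightarrow> Cod C (\<psi> k) = vert C zs k"
    "\<And>i. i < length ys \<Longrightarrow> \<psi> (Suc i) \<cdot> ys ! i = zs ! i \<cdot> \<psi> i" "\<psi> 0 = b'" "\<psi> (length ys) = a'"
    using ext_morE[OF assms(2)] by metis
  show ?thesis
  proof (rule ext_morI[of _ _ "\<lambda>k. \<psi> k \<cdot> \<phi> k"])
    fix i assume i: "i < length xs"
    note [simp] = p(2)[of i] p(2)[of "Suc i"] p(3)[of i] p(3)[of "Suc i"] p(4)[of i]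
      p(4)[of "Suc i"]
      q(2)[of i] q(2)[of "Suc i"] q(3)[of i] q(3)[of "Suc i"] q(4)[of i] q(4)[of "Suc i"] p(1) q(1)
      cplx_nth(1,2)[OF assms(3), of i] cplx_nth(1,2)[OF assms(4), of i]
        cplx_nth(1,2)[OF assms(5), of i]
    have "(\<psi> (Suc i) \<cdot> \<phi> (Suc i)) \<cdot> xs ! i = \<psi> (Suc i) \<cdot> ys ! i \<cdot> \<phi> i" using i p(5)[of i] by simp
    also have "\<dots> = zs ! i \<cdot> \<psi> i \<cdot> \<phi> i" using i q(5)[of i] by (intro comp_square) simp_all
    finally show "(\<psi> (Suc i) \<cdot> \<phi> (Suc i)) \<cdot> xs ! i = zs ! i \<cdot> \<psi> i \<cdot> \<phi> i" .
  qed (use p q in simp_all)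
qed

end

section \<open>Pushouts and pullbacks of extensions\<close>

context abelian_category
begin

lemma pushout_desc:
  assumes "is_pushout C f g p q" "u \<in> Arr C" "v \<in> Arr C" "Cod C u = Cod C v" "Dom C u = Cod C f"
    "Dom C v = Cod C g" "u \<cdot> f = v \<cdot> g"
  obtains h where "h \<in> Arr C" "Cod C h = Cod C v" "Dom C h = Cod C p" "h \<cdot> p = u" "h \<cdot> q = v"
proof -
  interpret op: abelian_category "op_cat C" by (rule abelian_op)
  show thesis using op.pullback_lift[of f g p q u v] assms that by auto
qed

lemma pushout_eqI:
  assumes "is_pushout C f g p q" "u \<in> Arr C" "v \<in> Arr C" "Cod C u = Cod C v" "Dom C u = Cod C p"
    "Dom C v = Cod C p"
    "u \<cdot> p = v \<cdot> p" "u \<cdot> q = v \<cdot> q"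
  shows "u = v"
proof -
  interpret op: abelian_category "op_cat C" by (rule abelian_op)
  show ?thesis using op.pullback_eqI[of f g p q u v] assms by simp
qed

lemma pushout_arr:
  assumes "is_pushout C f g p q"
  shows "f \<in> Arr C" "g \<in> Arr C" "p \<in> Arr C" "q \<in> Arr C" "Dom C g = Dom C f" "Dom C p = Cod C f"
    "Dom C q = Cod C g"
     "Cod C q = Cod C p" "p \<cdot> f = q \<cdot> g"
  using assms by (simp_all add: is_pushout_def)

lemma monic_cancel:
  assumes "is_monic C (g \<cdot> f)" "f \<in> Arr C" "g \<in> Arr C" "Dom C g = Cod C f"
  shows "is_monic C f"
proof -
  interpret op: abelian_category "op_cat C" by (rule abelian_op)
  show ?thesis using op.epic_cancel[of f g] assms by simp
qed

lemma extension_cplx: "is_extension C n A B xs \<Longrightarrow> cplx C xs"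
  unfolding is_extension_iff cplx_def
  by (auto intro!: successively_mono[of "is_exact C" xs] simp: exact_arr)

lemma op_extension [simp]: "is_extension (op_cat C) n B A (rev xs) \<longleftrightarrow> is_extension C n A B xs"
  unfolding is_extension_iff by (auto simp: hd_rev last_rev)

lemma ext_step_refl: "is_extension C n A B xs \<Longrightarrow> (xs, xs) \<in> ext_step C n A B"
  using ext_mor_ide[OF extension_cplx, of n A B xs]
  by (cases xs) (auto simp: ext_step_iff is_extension_iff)

lemma extension_obj: "is_extension C n A B xs \<Longrightarrow> A \<in> Obj C" "is_extension C n A B xs \<Longrightarrow> B \<in> Obj C"
  unfolding is_extension_iff using epic_arr[of "last xs"] monic_arr[of "hd xs"] by auto

text \<open>The canonical morphism to the pushout has \<open>b\<close> at the left end, the pushout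
  leg \<open>k\<close> next to it, and identities from there on.\<close>

lemma ext_pushout_mor:
  assumes "cplx C xs" "is_ext_pushout C b xs ys"
  shows "ext_mor C xs ys b (Ide C (Cod C (last xs)))"
proof -
  obtain x0 x1 y0 y1 rest k where xs: "xs = x0 # x1 # rest" "ys = y0 # y1 # rest"
    and p: "is_pushout C x0 b k y0"
     and "y1 \<in> Hom C (Cod C y0) (Cod C x1)" and y1: "y1 \<cdot> k = x1"
       "y1 \<cdot> y0 = Zer C (Dom C y0) (Cod C x1)"
    using assms(2) unfolding is_ext_pushout_def by blast
  then have [simp]: "y1 \<in> Arr C" "Dom C y1 = Cod C y0" "Cod C y1 = Cod C x1" by auto
  note [simp] = pushout_arr[OF p] cplx_nth(1,2)[OF assms(1)]
  have c: "i < length xs \<Longrightarrow> vert C xs (Suc i) \<in> Obj C" for i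
    using cplx_vert_obj[OF assms(1), of "Suc i"] by simp
  show ?thesis
  proof (rule ext_morI[of _ _ "\<lambda>i. if i = 0 then b else if i = 1 then k else Ide C (vert C xs i)"])
    fix i assume i: "i \<le> length xs"
    \<comment> \<open>Vertices 0, 1 and 2 are read off from the two replaced arrows; from 3 on both
      lists agree literally.\<close>
    consider "i = 0" | "i = 1" | "i = 2" | j where "i = Suc (Suc (Suc j))"
      by (metis One_nat_def numeral_2_eq_2 not0_implies_Suc)
    then show "(if i = 0 then b else if i = 1 then k else Ide C (vert C xs i)) \<in> Hom C (vert C xs i)
      (vert C ys i)"
      using c[of 1] c[of "i - 1"] i by cases (simp_all add: xs numeral_2_eq_2)
  next
    fix i assume i: "i < length xs"
    consider "i = 0" | "i = 1" | j where "i = Suc (Suc j)" by (metis One_nat_def not0_implies_Suc)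
    then show "(if Suc i = 0 then b else if Suc i = 1 then k else Ide C (vert C xs (Suc i))) \<cdot> xs !
      i
        = ys ! i \<cdot> (if i = 0 then b else if i = 1 then k else Ide C (vert C xs i))"
    proof cases
      case 3
      have "j < length rest" using i xs 3 by simp
      then show ?thesis using cplx_nth(1,2)[OF assms(1), of i] i 3 by (simp add: xs)
    next
      case 2
      have "x1 \<in> Arr C" using cplx_nth(1)[OF assms(1), of 1] by (simp add: xs)
      then show ?thesis using y1 2 by (simp add: xs)
    qed (simp add: xs)
  qed (cases rest rule: rev_cases; simp add: xs)+
qed

text \<open>The universal property of the pushout, for extensions: it turns a morphism whose left
  end factors through \<open>b\<close> into one from the pushout and keeps the right end. Uniqueness
  of pushout classes rests on it.\<close>

lemma ext_pushout_factor:
  assumes xs: "cplx C xs" and zs: "cplx C zs" and "is_ext_pushout C b xs ys"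
    and m: "ext_mor C xs zs (c \<cdot> b) a"
    and c [simp]: "c \<in> Arr C" "Dom C c = Cod C b" "Cod C c = Dom C (zs ! 0)"
  shows "ext_mor C ys zs c a"
proof -
  obtain x0 x1 y0 y1 rest k where x: "xs = x0 # x1 # rest" "ys = y0 # y1 # rest"
    and p: "is_pushout C x0 b k y0"
     and "y1 \<in> Hom C (Cod C y0) (Cod C x1)" and y1: "y1 \<cdot> k = x1"
       "y1 \<cdot> y0 = Zer C (Dom C y0) (Cod C x1)"
    using assms(3) unfolding is_ext_pushout_def by blast
  then have [simp]: "y1 \<in> Arr C" "Dom C y1 = Cod C y0" "Cod C y1 = Cod C x1" by auto
  note [simp] = pushout_arr[OF p]
  obtain \<phi> where q: "length zs = length xs" "\<And>k. k \<le> length xs \<Longrightarrow> \<phi> k \<in> Arr C"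
    "\<And>k. k \<le> length xs \<Longrightarrow> Dom C (\<phi> k) = vert C xs k" "\<And>k. k \<le> length xs \<Longrightarrow> Cod C (\<phi> k) = vert C zs k"
    "\<And>i. i < length xs \<Longrightarrow> \<phi> (Suc i) \<cdot> xs ! i = zs ! i \<cdot> \<phi> i" "\<phi> 0 = c \<cdot> b" "\<phi> (length xs) = a"
    using ext_morE[OF m] by metis
  have l: "length zs = Suc (Suc (length rest))" using q(1) x by simp
  have [simp]: "zs ! 0 \<in> Arr C" "zs ! Suc 0 \<in> Arr C" "Dom C (zs ! Suc 0) = Cod C (zs ! 0)"
    using cplx_nth(1,2)[OF zs, of 0] cplx_nth(1,2)[OF zs, of "Suc 0"] l by simp_all
  have [simp]: "x1 \<in> Arr C" "Dom C x1 = Cod C x0" using cplx_nth(1,2)[OF xs, of "Suc 0"]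
    by (simp_all add: x)
  have f [simp]: "\<phi> (Suc 0) \<in> Arr C" "Dom C (\<phi> (Suc 0)) = Cod C x0"
    "Cod C (\<phi> (Suc 0)) = Cod C (zs ! 0)"
    "\<phi> (Suc (Suc 0)) \<in> Arr C" "Dom C (\<phi> (Suc (Suc 0))) = Cod C x1"
      "Cod C (\<phi> (Suc (Suc 0))) = Cod C (zs ! Suc 0)"
    using q(2-4)[of "Suc 0"] q(2-4)[of "Suc (Suc 0)"] by (simp_all add: x)
  have s0: "\<phi> (Suc 0) \<cdot> x0 = zs ! 0 \<cdot> (c \<cdot> b)"
    and s1: "\<phi> (Suc (Suc 0)) \<cdot> x1 = zs ! Suc 0 \<cdot> \<phi> (Suc 0)"
    using q(5)[of 0] q(5)[of "Suc 0"] q(6) by (simp_all add: x)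
  obtain h where h [simp]: "h \<in> Arr C" "Cod C h = Cod C (zs ! 0)" "Dom C h = Cod C k"
    "h \<cdot> k = \<phi> (Suc 0)" "h \<cdot> y0 = zs ! 0 \<cdot> c"
    using pushout_desc[OF p, of "\<phi> (Suc 0)" "zs ! 0 \<cdot> c"] s0 by auto
  \<comment> \<open>The square following the new component \<open>h\<close> is tested on the two
    legs of the pushout. On \<open>y0\<close> both sides vanish: one because
    \<open>y1 \<cdot> y0 = 0\<close>, the other because \<open>zs\<close> is a complex.\<close>
  have "\<phi> (Suc (Suc 0)) \<cdot> y1 = zs ! Suc 0 \<cdot> h"
  proof (rule pushout_eqI[OF p])
    show "(\<phi> (Suc (Suc 0)) \<cdot> y1) \<cdot> k = (zs ! Suc 0 \<cdot> h) \<cdot> k" using s1 y1 by simp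
    have "(\<phi> (Suc (Suc 0)) \<cdot> y1) \<cdot> y0 = Zer C (Cod C b) (Cod C (zs ! Suc 0))" using y1 by simp
    also have "\<dots> = zs ! Suc 0 \<cdot> (zs ! 0 \<cdot> c)"
      using l by (subst comp_shift[OF cplx_nth(3)[OF zs, of 0]]) simp_all
    finally show "(\<phi> (Suc (Suc 0)) \<cdot> y1) \<cdot> y0 = (zs ! Suc 0 \<cdot> h) \<cdot> y0" by simp
  qed simp_all
  note s1' = this
  show ?thesis
  proof (rule ext_morI[of _ _ "\<lambda>i. if i = 0 then c else if i = 1 then h else \<phi> i"])
    fix i assume i: "i \<le> length ys"
    consider "i = 0" | "i = 1" | "i = 2" | j where "i = Suc (Suc (Suc j))"
      by (metis One_nat_def numeral_2_eq_2 not0_implies_Suc)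
    then show "(if i = 0 then c else if i = 1 then h else \<phi> i) \<in> Hom C (vert C ys i) (vert C zs i)"
      using i q(2-4)[of i] by cases (simp_all add: x numeral_2_eq_2)
  next
    fix i assume i: "i < length ys"
    consider "i = 0" | "i = 1" | j where "i = Suc (Suc j)" by (metis One_nat_def not0_implies_Suc)
    then show "(if Suc i = 0 then c else if Suc i = 1 then h else \<phi> (Suc i)) \<cdot> ys ! i
        = zs ! i \<cdot> (if i = 0 then c else if i = 1 then h else \<phi> i)"
      using i q(5)[of i] s1' by cases (simp_all add: x)
  qed (use l q(7) in \<open>simp_all add: x\<close>)
qed

text \<open>Only the last two arrows change. Lifting of cycles is inherited from \<open>xs\<close>,
  since arrows into the pullback are compared on its legs \<open>k\<close> and
  \<open>y0\<close>.\<close>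

lemma ext_pullback_extension:
  assumes "is_extension C n A B xs" "is_ext_pullback C xs a ys"
  shows "is_extension C n (Dom C a) B ys"
proof -
  obtain x0 x1 y0 y1 rest k where x: "xs = rest @ [x1, x0]" "ys = rest @ [y1, y0]"
    and p: "is_pullback C x0 a k y0"
     and "y1 \<in> Hom C (Dom C x1) (Dom C y0)" and y1: "k \<cdot> y1 = x1"
       "y0 \<cdot> y1 = Zer C (Dom C x1) (Cod C y0)"
    using assms(2) unfolding is_ext_pullback_def by blast
  then have [simp]: "y1 \<in> Arr C" "Dom C y1 = Dom C x1" "Cod C y1 = Dom C y0" by auto
  note e = assms(1)[unfolded is_extension_iff x]
  note [simp] = pullback_arr[OF p]
  from e have e0: "is_exact C x1 x0" and x0: "is_epic C x0"
    by (simp_all add: successively_append_iff)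
  note [simp] = exact_arr[OF e0]
  have y0: "is_epic C y0" using pullback_epic[OF p x0] .
  have f0: "is_exact C y1 y0"
  proof (rule exactI)
    fix t assume [simp]: "t \<in> Arr C" "Cod C t = Dom C y0"
      and t: "y0 \<cdot> t = Zer C (Dom C t) (Cod C y0)"
    have "x0 \<cdot> (k \<cdot> t) = a \<cdot> (y0 \<cdot> t)" by (intro comp_square) simp_all
    then have "x0 \<cdot> (k \<cdot> t) = Zer C (Dom C (k \<cdot> t)) (Cod C x0)" using t by simp
    then obtain e s where e: "is_epic C e" "Cod C e = Dom C t" "s \<in> Arr C" "Dom C s = Dom C e"
      "Cod C s = Dom C x1" "x1 \<cdot> s = (k \<cdot> t) \<cdot> e"
      using exact_lift[OF e0, of "k \<cdot> t"] by auto
    note [simp] = e(2-5) epic_arr[OF e(1)]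
    have "y1 \<cdot> s = t \<cdot> e"
    proof (rule pullback_eqI[OF p])
      show "k \<cdot> y1 \<cdot> s = k \<cdot> t \<cdot> e" using e(6) comp_shift[OF y1(1), of s] by simp
      show "y0 \<cdot> y1 \<cdot> s = y0 \<cdot> t \<cdot> e" using comp_shift[OF y1(2), of s] comp_shift[OF t, of e]
        by simp
    qed simp_all
    then show "\<exists>e s. is_epic C e \<and> Cod C e = Dom C t \<and> s \<in> Arr C \<and> Dom C s = Dom C e \<and>
      Cod C s = Dom C y1 \<and> y1 \<cdot> s = t \<cdot> e"
      using e(1) by (intro exI[of _ e] exI[of _ s]) simp
  qed (simp_all add: y1)
  have m: "is_monic C (hd ys) \<and> Dom C (hd ys) = B \<and> successively (is_exact C) ys"
  \<comment> \<open>If nothing precedes (\<open>n = 1\<close>), \<open>y1\<close> is the leftmost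
    arrow and must be monic; otherwise exactness at its domain is what remains.\<close>
  proof (cases "rest = []")
    case True
    have "is_monic C (k \<cdot> y1)" unfolding y1(1) using e True by simp
    then have "is_monic C y1" by (rule monic_cancel) simp_all
    then show ?thesis using True f0 e by (simp add: x)
  next
    case False
    define r where "r = last rest"
    have e1: "is_exact C r x1" using False e by (simp add: successively_append_iff r_def)
    note [simp] = exact_arr[OF e1]
    have "is_exact C r y1"
    proof (rule exactI)
      show "y1 \<cdot> r = Zer C (Dom C r) (Cod C y1)"
      proof (rule pullback_eqI[OF p])
        show "k \<cdot> y1 \<cdot> r = k \<cdot> Zer C (Dom C r) (Cod C y1)" using comp_shift[OF y1(1), of r] by simp
        show "y0 \<cdot> y1 \<cdot> r = y0 \<cdot> Zer C (Dom C r) (Cod C y1)" using comp_shift[OF y1(2), of r]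
          by simp
      qed simp_all
      fix t assume [simp]: "t \<in> Arr C" "Cod C t = Dom C y1"
        and t: "y1 \<cdot> t = Zer C (Dom C t) (Cod C y1)"
      have "x1 \<cdot> t = Zer C (Dom C t) (Cod C x1)" using comp_shift[OF y1(1), of t] t by simp
      then show "\<exists>e s. is_epic C e \<and> Cod C e = Dom C t \<and> s \<in> Arr C \<and> Dom C s = Dom C e \<and>
        Cod C s = Dom C r \<and> r \<cdot> s = t \<cdot> e"
        using exact_lift[OF e1, of t]
          by (metis \<open>Cod C t = Dom C y1\<close> \<open>Dom C y1 = Dom C x1\<close> \<open>t \<in> Arr C\<close>)
    qed simp_all
    then show ?thesis using False f0 e by (simp add: x successively_append_iff r_def)
  qed
  show ?thesis unfolding is_extension_iff using m e y0 by (auto simp: x)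
qed

text \<open>The bound on \<open>n\<close> provides two arrows to work with; the new left one is the
  lift of \<open>x1\<close> and zero to the pullback.\<close>

lemma ex_ext_pullback:
  assumes e: "is_extension C n A B xs" and n: "n \<ge> 1" and [simp]: "a \<in> Arr C" "Cod C a = A"
  obtains ys where "is_ext_pullback C xs a ys"
proof -
  have l: "length xs = Suc (Suc (n - 1))" using extension_length[OF e] n by simp
  obtain x0 xs' where "xs = xs' @ [x0]" using l by (cases xs rule: rev_cases) auto
  moreover from this obtain x1 rest where "xs' = rest @ [x1]" using l
    by (cases xs' rule: rev_cases) auto
  ultimately have x: "xs = rest @ [x1, x0]" by simp
  then have e0: "is_exact C x1 x0" and x0: "Cod C x0 = A" using e
    by (simp_all add: is_extension_iff successively_append_iff)
  note [simp] = exact_arr[OF e0]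
  obtain k y0 where p: "is_pullback C x0 a k y0"
    using ex_pullback_epic[of x0 a] x0 assms(3,4) exact_arr(2)[OF e0] by metis
  note [simp] = pullback_arr(1-8)[OF p]
  obtain y1 where "y1 \<in> Arr C" "Dom C y1 = Dom C x1" "Cod C y1 = Dom C k" "k \<cdot> y1 = x1"
    "y0 \<cdot> y1 = Zer C (Dom C x1) (Dom C a)"
    using pullback_lift[OF p, of x1 "Zer C (Dom C x1) (Dom C a)"] x0 by auto
  then have "is_ext_pullback C xs a (rest @ [y1, y0])"
    unfolding is_ext_pullback_def x using p by auto
  then show thesis by (rule that)
qed

lemma ext_pullback_arr: "is_ext_pullback C xs a ys \<Longrightarrow> a \<in> Arr C \<and> Cod C a = Cod C (last xs)"
  unfolding is_ext_pullback_def by (auto dest: pullback_arr)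

lemma ext_pushout_arr: "is_ext_pushout C b xs ys \<Longrightarrow> b \<in> Arr C \<and> Dom C b = Dom C (hd xs)"
  unfolding is_ext_pushout_def by (auto dest: pushout_arr)

lemma ext_pushout_extension:
  assumes "is_extension C n A B xs" "is_ext_pushout C b xs ys"
  shows "is_extension C n A (Cod C b) ys"
proof -
  interpret op: abelian_category "op_cat C" by (rule abelian_op)
  show ?thesis using op.ext_pullback_extension[of n B A "rev xs" b "rev ys"] assms by simp
qed

lemma ex_ext_pushout:
  assumes "is_extension C n A B xs" "n \<ge> 1" "b \<in> Arr C" "Dom C b = B"
  obtains ys where "is_ext_pushout C b xs ys"
proof -
  interpret op: abelian_category "op_cat C" by (rule abelian_op)
  obtain ys where "is_ext_pullback (op_cat C) (rev xs) b ys"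
    using op.ex_ext_pullback[of n B A "rev xs" b] assms by auto
  then have "is_ext_pushout C b xs (rev ys)" using op_ext_pullback[of C xs b "rev ys"] by simp
  then show thesis by (rule that)
qed

lemma ext_pullback_mor:
  assumes "is_extension C n A B xs" "is_ext_pullback C xs a ys"
  shows "ext_mor C ys xs (Ide C B) a"
proof -
  interpret op: abelian_category "op_cat C" by (rule abelian_op)
  have c: "cplx C xs" "cplx C ys" using extension_cplx ext_pullback_extension assms by blast+
  have "ext_mor (op_cat C) (rev xs) (rev ys) a (Ide C (Dom C (hd xs)))"
    using op.ext_pushout_mor[of "rev xs" a "rev ys"] assms c by (simp add: last_rev)
  then have "ext_mor (op_cat (op_cat C)) (rev (rev ys)) (rev (rev xs)) (Ide C (Dom C (hd xs))) a"
    by (rule op_ext_mor) (use c in simp_all)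
  then show ?thesis using assms(1) by (simp add: is_extension_iff)
qed

lemma ext_pullback_factor:
  assumes xs: "is_extension C n A B xs" and ws: "cplx C ws" and p: "is_ext_pullback C xs a ys"
    and m: "ext_mor C ws xs b (a \<cdot> c)"
    and c: "c \<in> Arr C" "Cod C c = Dom C a" "Dom C c = Cod C (last ws)"
  shows "ext_mor C ws ys b c"
proof -
  interpret op: abelian_category "op_cat C" by (rule abelian_op)
  have cx: "cplx C xs" "cplx C ys" using extension_cplx ext_pullback_extension xs p by blast+
  have last_nth: "rev ws ! 0 = last ws" using ws
    by (cases ws rule: rev_cases) (simp_all add: cplx_def)
  have "ext_mor (op_cat C) (rev xs) (rev ws) (a \<cdot> c) b" using op_ext_mor[OF m ws cx(1)] .
  then have "ext_mor (op_cat C) (rev ys) (rev ws) c b"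
    using op.ext_pushout_factor[of "rev xs" "rev ws" a "rev ys" c b] ws cx p c
    by (simp add: last_nth)
  then have "ext_mor (op_cat (op_cat C)) (rev (rev ws)) (rev (rev ys)) b c"
    by (rule op_ext_mor) (use ws cx in simp_all)
  then show ?thesis by simp
qed

end

subsection \<open>Classes of extensions\<close>

text \<open>Operations on extensions are relations \<open>G\<close>. Totality gives every member of
  the zigzag from \<open>xs\<close> to \<open>xs'\<close> a partner, and the step hypothesis links
  neighbouring partners. Applied to a reflexive step, it says that partners are unique up to
  equivalence.\<close>

lemma (in abelian_category) ext_equiv_transfer:
  assumes tot: "\<And>xs. is_extension C n A B xs \<Longrightarrow> \<exists>ws. is_extension D n' A' B' ws \<and> G xs ws"
    and step: "\<And>xs xs' ws ws'. (xs, xs') \<in> ext_step C n A B \<Longrightarrow> G xs ws \<Longrightarrow> G xs' ws' \<Longrightarrow>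
      is_extension D n' A' B' ws \<Longrightarrow> is_extension D n' A' B' ws' \<Longrightarrow> (ws, ws') \<in> ext_equiv D n' A' B'"
    and "(xs, xs') \<in> ext_equiv C n A B" "G xs ws" "G xs' ws'" "is_extension D n' A' B' ws"
      "is_extension D n' A' B' ws'"
  shows "(ws, ws') \<in> ext_equiv D n' A' B'"
proof -
  have xs: "is_extension C n A B xs" and "(xs, xs') \<in> (ext_step C n A B \<union> (ext_step C n A B)\<inverse>)\<^sup>*"
    using assms(3) by (auto simp: ext_equiv_def)
  from this(2) assms(5,7) show ?thesis
  proof (induction arbitrary: ws' rule: rtrancl_induct)
    case base
    then show ?case using step[OF ext_step_refl[OF xs] \<open>G xs ws\<close>] assms(6) by blast
  next
    case (step y z)
    from step(2) have "is_extension C n A B y" by (auto simp: ext_step_def)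
    then obtain wy where wy: "is_extension D n' A' B' wy" "G y wy" using tot by blast
    have "(wy, ws') \<in> ext_equiv D n' A' B'"
      using step(2) assms(2)[of y z wy ws'] assms(2)[of z y ws' wy] wy step(4,5)
        by (auto intro: ext_equiv_sym)
    with step(3)[OF wy(2,1)] show ?case by (rule ext_equiv_trans)
  qed
qed

text \<open>Operations on classes are saturations over all representatives; this evaluates them on a
  single one.\<close>

lemma (in abelian_category) ext_class_transfer:
  assumes "\<And>xs. is_extension C n A B xs \<Longrightarrow> \<exists>ws. is_extension D n' A' B' ws \<and> G xs ws"
    and "\<And>xs xs' ws ws'. (xs, xs') \<in> ext_step C n A B \<Longrightarrow> G xs ws \<Longrightarrow> G xs' ws' \<Longrightarrow>
      is_extension D n' A' B' ws \<Longrightarrow> is_extension D n' A' B' ws' \<Longrightarrow> (ws, ws') \<in> ext_equiv D n' A' B'"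
    and "is_extension C n A B xs" "G xs ws" "is_extension D n' A' B' ws"
  shows "ext_equiv D n' A' B' `` {us. \<exists>ys\<in>ext_equiv C n A B `` {xs}. G ys us} =
    ext_equiv D n' A' B' `` {ws}"
proof (intro Set.set_eqI iffI)
  fix vs assume "vs \<in> ext_equiv D n' A' B' `` {us. \<exists>ys\<in>ext_equiv C n A B `` {xs}. G ys us}"
  then obtain us ys where us: "(us, vs) \<in> ext_equiv D n' A' B'"
    and ys: "(xs, ys) \<in> ext_equiv C n A B" "G ys us" by blast
  have "(ws, us) \<in> ext_equiv D n' A' B'"
  proof (rule ext_equiv_transfer[where G = G, OF _ _ ys(1) assms(4) ys(2) assms(5)])
  qed (use assms(1,2) ext_equiv_extension(1)[OF us] in blast)+
  with us show "vs \<in> ext_equiv D n' A' B' `` {ws}" by (auto intro: ext_equiv_trans)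
next
  fix vs assume "vs \<in> ext_equiv D n' A' B' `` {ws}"
  then show "vs \<in> ext_equiv D n' A' B' `` {us. \<exists>ys\<in>ext_equiv C n A B `` {xs}. G ys us}"
    using assms(4) ext_equiv_refl[OF assms(3)] by blast
qed

lemma ext_class_cong: "(xs, ys) \<in> ext_equiv C n A B \<Longrightarrow> ext_equiv C n A B `` {xs} =
  ext_equiv C n A B `` {ys}"
  by (rule equiv_class_eq[OF equiv_ext_equiv])

lemma Ext_carrierE:
  assumes "\<xi> \<in> carrier (Ext C n A B)"
  obtains xs where "is_extension C n A B xs" "\<xi> = ext_equiv C n A B `` {xs}"
  using assms unfolding Ext_def by (auto elim: quotientE)

lemma Ext_carrierI: "is_extension C n A B xs \<Longrightarrow> ext_equiv C n A B `` {xs} \<in> carrier (Ext C n A B)"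
  unfolding Ext_def by (auto intro: quotientI)

context abelian_category
begin

lemma extension_nth:
  assumes "is_extension C n A B xs" "k \<le> n"
  shows "xs ! k \<in> Arr C" "Dom C (xs ! k) = vert C xs k" "Cod C (xs ! k) = vert C xs (Suc k)"
  using cplx_nth(1,2)[OF extension_cplx[OF assms(1)], of k] assms extension_length[OF assms(1)]
    by auto

lemma extension_last: "is_extension C n A B xs \<Longrightarrow> Cod C (last xs) = A"
  by (simp add: is_extension_iff)

text \<open>A step from \<open>us\<close> to \<open>us'\<close> followed by the canonical morphism
  to the pushout \<open>ws'\<close> has left end \<open>b\<close>, so it descends to the pushout
  \<open>ws\<close> and becomes a step from \<open>ws\<close> to \<open>ws'\<close>.\<close>

lemma Ext_push_class:
  assumes xs: "is_extension C n A B xs" and ys: "is_ext_pushout C b xs ys" and n: "n \<ge> 1"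
  shows "Ext_push C n A b (ext_equiv C n A B `` {xs}) = ext_equiv C n A (Cod C b) `` {ys}"
  unfolding Ext_push_def
proof (rule ext_class_transfer[where G = "is_ext_pushout C b", OF _ _ xs ys ext_pushout_extension[OF
  xs ys]])
  have b: "b \<in> Arr C" "Dom C b = B" using ext_pushout_arr[OF ys] xs by (auto simp: is_extension_iff)
  fix us assume us: "is_extension C n A B us"
  then show "\<exists>ws. is_extension C n A (Cod C b) ws \<and> is_ext_pushout C b us ws"
    using ex_ext_pushout[OF us n b] ext_pushout_extension[OF us] by metis
next
  fix us us' ws ws' assume u: "(us, us') \<in> ext_step C n A B" and w: "is_ext_pushout C b us ws"
    "is_ext_pushout C b us' ws'"
    "is_extension C n A (Cod C b) ws" "is_extension C n A (Cod C b) ws'"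
  have b: "b \<in> Arr C" "Dom C b = B" using ext_pushout_arr[OF ys] xs by (auto simp: is_extension_iff)
  have us: "is_extension C n A B us" "is_extension C n A B us'"
    "ext_mor C us us' (Ide C B) (Ide C A)" using u by (auto simp: ext_step_iff)
  note c = us(1,2)[THEN extension_cplx] w(3,4)[THEN extension_cplx]
  have "ext_mor C us ws' b (Ide C A)"
    using ext_mor_comp[OF us(3) ext_pushout_mor[OF c(2) w(2)] c(1,2,4)] b extension_obj[OF us(1)]
      extension_last[OF us(2)] by simp
  then have "ext_mor C us ws' (Ide C (Cod C b) \<cdot> b) (Ide C A)" using b by simp
  then have "ext_mor C ws ws' (Ide C (Cod C b)) (Ide C A)"
    using b extension_ends[OF w(4)] by (intro ext_pushout_factor[OF c(1,4) w(1)]) simp_all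
  then show "(ws, ws') \<in> ext_equiv C n A (Cod C b)" using w
    by (intro ext_equiv_step) (simp add: ext_step_iff)
qed

lemma Ext_pull_class:
  assumes xs: "is_extension C n A B xs" and ys: "is_ext_pullback C xs a ys" and n: "n \<ge> 1"
  shows "Ext_pull C n a B (ext_equiv C n A B `` {xs}) = ext_equiv C n (Dom C a) B `` {ys}"
  unfolding Ext_pull_def
proof (rule ext_class_transfer[where G = "\<lambda>xs ys. is_ext_pullback C xs a ys", OF _ _ xs ys
  ext_pullback_extension[OF xs ys]])
  have a: "a \<in> Arr C" "Cod C a = A" using ext_pullback_arr[OF ys] xs
    by (auto simp: is_extension_iff)
  fix us assume us: "is_extension C n A B us"
  then show "\<exists>ws. is_extension C n (Dom C a) B ws \<and> is_ext_pullback C us a ws"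
    using ex_ext_pullback[OF us n a] ext_pullback_extension[OF us] by metis
next
  fix us us' ws ws' assume u: "(us, us') \<in> ext_step C n A B" and w: "is_ext_pullback C us a ws"
    "is_ext_pullback C us' a ws'"
    "is_extension C n (Dom C a) B ws" "is_extension C n (Dom C a) B ws'"
  have a: "a \<in> Arr C" "Cod C a = A" using ext_pullback_arr[OF ys] xs
    by (auto simp: is_extension_iff)
  have us: "is_extension C n A B us" "is_extension C n A B us'"
    "ext_mor C us us' (Ide C B) (Ide C A)" using u by (auto simp: ext_step_iff)
  note c = us(1,2)[THEN extension_cplx] w(3,4)[THEN extension_cplx]
  have "ext_mor C ws us' (Ide C B) a"
    using ext_mor_comp[OF ext_pullback_mor[OF us(1) w(1)] us(3) c(3,1,2)] a extension_obj[OF us(1)]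
      by simp
  then have "ext_mor C ws us' (Ide C B) (a \<cdot> Ide C (Dom C a))" using a by simp
  then have "ext_mor C ws ws' (Ide C B) (Ide C (Dom C a))"
    using a extension_last[OF w(3)] by (intro ext_pullback_factor[OF us(2) c(3) w(2)]) simp_all
  then show "(ws, ws') \<in> ext_equiv C n (Dom C a) B" using w
    by (intro ext_equiv_step) (simp add: ext_step_iff)
qed

end

subsection \<open>Direct sums of extensions\<close>

context abelian_category
begin

text \<open>A cycle of the sum has two component cycles. They are lifted one after the other, the
  second on the cover chosen for the first, so that the epimorphism \<open>e \<cdot> d\<close>
  serves both.\<close>

lemma direct_sum_exact:
  assumes b: "is_biproduct C a b P i j p q" "is_biproduct C a' b' P' i' j' p' q'"
    "is_biproduct C a'' b'' P'' i'' j'' p'' q''"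
    and z [simp]: "z \<in> Arr C" "Dom C z = P" "Cod C z = P'" "z' \<in> Arr C" "Dom C z' = P'"
      "Cod C z' = P''"
    and f: "is_exact C f f'" and [simp]: "Dom C f = a" "Cod C f = a'" "Cod C f' = a''"
    and g: "is_exact C g g'" and [simp]: "Dom C g = b" "Cod C g = b'" "Cod C g' = b''"
    and sq: "z \<cdot> i = i' \<cdot> f" "p' \<cdot> z = f \<cdot> p" "z \<cdot> j = j' \<cdot> g" "q' \<cdot> z = g \<cdot> q" "p'' \<cdot> z' = f' \<cdot> p'"
      "q'' \<cdot> z' = g' \<cdot> q'"
  shows "is_exact C z z'"
proof (rule exactI)
  note [simp] = biproduct_arr[OF b(1)] biproduct_arr[OF b(2)] biproduct_arr[OF b(3)] exact_arr[OF f]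
    exact_arr[OF g]
  show "z' \<cdot> z = Zer C (Dom C z) (Cod C z')"
  proof (rule biproduct_eqI[OF b(3)])
    have "p'' \<cdot> z' \<cdot> z = f' \<cdot> f \<cdot> p" using comp_square[OF sq(5), of z] sq(2) by simp
    also have "\<dots> = p'' \<cdot> Zer C (Dom C z) (Cod C z')"
      by (subst comp_shift[OF exact_arr(4)[OF f]]) simp_all
    finally show "p'' \<cdot> z' \<cdot> z = p'' \<cdot> Zer C (Dom C z) (Cod C z')" .
    have "q'' \<cdot> z' \<cdot> z = g' \<cdot> g \<cdot> q" using comp_square[OF sq(6), of z] sq(4) by simp
    also have "\<dots> = q'' \<cdot> Zer C (Dom C z) (Cod C z')"
      by (subst comp_shift[OF exact_arr(4)[OF g]]) simp_all
    finally show "q'' \<cdot> z' \<cdot> z = q'' \<cdot> Zer C (Dom C z) (Cod C z')" .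
  qed simp_all
  fix t assume [simp]: "t \<in> Arr C" "Cod C t = Dom C z'" and t: "z' \<cdot> t = Zer C (Dom C t) (Cod C z')"
  have "f' \<cdot> (p' \<cdot> t) = p'' \<cdot> (z' \<cdot> t)" using sq by (intro comp_square) simp_all
  then have "f' \<cdot> (p' \<cdot> t) = Zer C (Dom C (p' \<cdot> t)) (Cod C f')" using t by simp
  then obtain e s where e: "is_epic C e" and es [simp]: "Cod C e = Dom C t" "s \<in> Arr C"
    "Dom C s = Dom C e" "Cod C s = a" and s: "f \<cdot> s = (p' \<cdot> t) \<cdot> e"
    using exact_lift[OF f, of "p' \<cdot> t"] by auto
  note [simp] = epic_arr[OF e]
  have "g' \<cdot> (q' \<cdot> t) = q'' \<cdot> (z' \<cdot> t)" using sq by (intro comp_square) simp_all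
  then have "g' \<cdot> (q' \<cdot> t) = Zer C (Dom C (q' \<cdot> t)) (Cod C g')" using t by simp
  then have "g' \<cdot> (q' \<cdot> t) = Zer C (Dom C t) b''" by simp
  from comp_shift[OF this, of e] have "g' \<cdot> ((q' \<cdot> t) \<cdot> e) = Zer C (Dom C ((q' \<cdot> t) \<cdot> e)) (Cod C
    g')" by simp
  then obtain d r where d: "is_epic C d" and dr [simp]: "Cod C d = Dom C e" "r \<in> Arr C"
    "Dom C r = Dom C d" "Cod C r = b" and r: "g \<cdot> r = ((q' \<cdot> t) \<cdot> e) \<cdot> d"
    using exact_lift[OF g, of "(q' \<cdot> t) \<cdot> e"] by auto
  note [simp] = epic_arr[OF d]
  define m where "m = Add C (i \<cdot> s \<cdot> d) (j \<cdot> r)"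
  have [simp]: "m \<in> Arr C" "Dom C m = Dom C d" "Cod C m = P" by (simp_all add: m_def)
  have "z \<cdot> m = t \<cdot> e \<cdot> d"
  proof -
    have "z \<cdot> m = Add C (z \<cdot> i \<cdot> s \<cdot> d) (z \<cdot> j \<cdot> r)" by (simp add: m_def)
    also have "z \<cdot> i \<cdot> s \<cdot> d = i' \<cdot> f \<cdot> s \<cdot> d" using sq by (intro comp_square) simp_all
    also have "f \<cdot> s \<cdot> d = p' \<cdot> t \<cdot> e \<cdot> d" using comp_shift[OF s, of d] by simp
    also have "z \<cdot> j \<cdot> r = j' \<cdot> g \<cdot> r" using sq by (intro comp_square) simp_all
    also have "g \<cdot> r = q' \<cdot> t \<cdot> e \<cdot> d" using r by simp
    also have "Add C (i' \<cdot> p' \<cdot> t \<cdot> e \<cdot> d) (j' \<cdot> q' \<cdot> t \<cdot> e \<cdot> d) = t \<cdot> e \<cdot> d"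
      by (rule biproduct_expand[OF b(2)]) simp_all
    finally show ?thesis .
  qed
  then show "\<exists>e s. is_epic C e \<and> Cod C e = Dom C t \<and> s \<in> Arr C \<and> Dom C s = Dom C e \<and>
    Cod C s = Dom C z \<and> z \<cdot> s = t \<cdot> e"
    using epic_comp[OF d e] by (intro exI[of _ "e \<cdot> d"] exI[of _ m]) simp
qed (use exact_arr[OF f] in simp_all)

lemma direct_sum_monic:
  assumes b: "is_biproduct C a b P i j p q" "is_biproduct C a' b' P' i' j' p' q'"
    and z [simp]: "z \<in> Arr C" "Dom C z = P" "Cod C z = P'"
    and f: "is_monic C f" and [simp]: "Dom C f = a" "Cod C f = a'"
    and g: "is_monic C g" and [simp]: "Dom C g = b" "Cod C g = b'"
    and sq: "p' \<cdot> z = f \<cdot> p" "q' \<cdot> z = g \<cdot> q"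
  shows "is_monic C z"
  unfolding monic_iff_zer
proof (intro conjI ballI impI; (elim conjE)?)
  note [simp] = biproduct_arr[OF b(1)] biproduct_arr[OF b(2)] monic_arr[OF f] monic_arr[OF g]
  fix t assume [simp]: "t \<in> Arr C" "Cod C t = Dom C z" and t: "z \<cdot> t = Zer C (Dom C t) (Cod C z)"
  have "f \<cdot> (p \<cdot> t) = p' \<cdot> (z \<cdot> t)" using sq by (intro comp_square) simp_all
  then have "f \<cdot> (p \<cdot> t) = f \<cdot> Zer C (Dom C t) a" using t by simp
  from monicD[OF f this] have 1: "p \<cdot> t = Zer C (Dom C t) a" by simp
  have "g \<cdot> (q \<cdot> t) = q' \<cdot> (z \<cdot> t)" using sq by (intro comp_square) simp_all
  then have "g \<cdot> (q \<cdot> t) = g \<cdot> Zer C (Dom C t) b" using t by simp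
  from monicD[OF g this] have 2: "q \<cdot> t = Zer C (Dom C t) b" by simp
  show "t = Zer C (Dom C t) (Dom C z)" using 1 2
    by (intro biproduct_eqI[OF b(1), of t "Zer C (Dom C t) (Dom C z)"]) simp_all
qed simp

lemma op_biproduct: "is_biproduct (op_cat C) a b P p1 p2 i1 i2 \<longleftrightarrow> is_biproduct C a b P i1 i2 p1 p2"
  unfolding is_biproduct_def by auto

lemma direct_sum_epic:
  assumes b: "is_biproduct C a b P i j p q" "is_biproduct C a' b' P' i' j' p' q'"
    and z: "z \<in> Arr C" "Dom C z = P" "Cod C z = P'"
    and f: "is_epic C f" "Dom C f = a" "Cod C f = a'"
    and g: "is_epic C g" "Dom C g = b" "Cod C g = b'"
    and sq: "z \<cdot> i = i' \<cdot> f" "z \<cdot> j = j' \<cdot> g"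
  shows "is_epic C z"
proof -
  interpret op: abelian_category "op_cat C" by (rule abelian_op)
  show ?thesis
    using op.direct_sum_monic[of a' b' P' p' q' i' j' a b P p q i j z f g] assms
      by (simp add: op_biproduct)
qed

lemma direct_sumE:
  assumes d: "is_ext_direct_sum C xs ys zs is js ps qs"
    and xs: "is_extension C n A B xs" and ys: "is_extension C n A' B' ys"
  shows "length zs = Suc n"
    "\<And>k. k \<le> Suc n \<Longrightarrow> is_biproduct C (vert C xs k) (vert C ys k) (vert C zs k) (is ! k) (js ! k) (ps
      ! k) (qs ! k)"
    "\<And>k. k \<le> n \<Longrightarrow> is ! Suc k \<cdot> xs ! k = zs ! k \<cdot> is ! k"
    "\<And>k. k \<le> n \<Longrightarrow> js ! Suc k \<cdot> ys ! k = zs ! k \<cdot> js ! k"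
    "\<And>k. k \<le> n \<Longrightarrow> ps ! Suc k \<cdot> zs ! k = xs ! k \<cdot> ps ! k"
    "\<And>k. k \<le> n \<Longrightarrow> qs ! Suc k \<cdot> zs ! k = ys ! k \<cdot> qs ! k"
proof -
  note l = extension_length[OF xs] extension_length[OF ys]
  note d' = d[unfolded is_ext_direct_sum_def is_ext_morphism_iff in_Hom_iff]
  have "length zs = length xs" using d' by blast
  then show lz: "length zs = Suc n" using l by simp
  have sq: "\<forall>k<length xs. is ! Suc k \<cdot> xs ! k = zs ! k \<cdot> is ! k"
    "\<forall>k<length ys. js ! Suc k \<cdot> ys ! k = zs ! k \<cdot> js ! k"
    "\<forall>k<length zs. ps ! Suc k \<cdot> zs ! k = xs ! k \<cdot> ps ! k"
      "\<forall>k<length zs. qs ! Suc k \<cdot> zs ! k = ys ! k \<cdot> qs ! k"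
    using d' by blast+
  fix k
  show "k \<le> n \<Longrightarrow> is ! Suc k \<cdot> xs ! k = zs ! k \<cdot> is ! k"
    "k \<le> n \<Longrightarrow> js ! Suc k \<cdot> ys ! k = zs ! k \<cdot> js ! k"
    "k \<le> n \<Longrightarrow> ps ! Suc k \<cdot> zs ! k = xs ! k \<cdot> ps ! k" "k \<le> n \<Longrightarrow> qs ! Suc k \<cdot> zs ! k = ys ! k \<cdot> qs ! k"
    using sq l lz by (simp_all add: less_Suc_eq_le)
  assume k: "k \<le> Suc n"
  have "\<forall>k\<le>length xs. Dom C (is ! k) = vert C xs k \<and> Cod C (is ! k) = vert C zs k"
    "\<forall>k\<le>length ys. Dom C (js ! k) = vert C ys k"
    using d' by blast+
  then have "Dom C (is ! k) = vert C xs k" "Cod C (is ! k) = vert C zs k"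
    "Dom C (js ! k) = vert C ys k" using k l by auto
  moreover have "is_biproduct C (Dom C (is ! k)) (Dom C (js ! k)) (Cod C (is ! k)) (is ! k) (js ! k)
    (ps ! k) (qs ! k)"
    using d k lz unfolding is_ext_direct_sum_def by simp
  ultimately show "is_biproduct C (vert C xs k) (vert C ys k) (vert C zs k) (is ! k) (js ! k) (ps !
    k) (qs ! k)" by simp
qed

text \<open>\<open>is_ext_direct_sum\<close> constrains components and squares but does not say that
  the entries of \<open>zs\<close> are composable arrows. Hence the two assumptions on
  \<open>zs\<close>; given them, exactness passes from the summands to the sum.\<close>

lemma direct_sum_extension:
  assumes d: "is_ext_direct_sum C xs ys zs is js ps qs"
    and xs: "is_extension C n A B xs" and ys: "is_extension C n A' B' ys"
    and zs: "\<And>k. k \<le> n \<Longrightarrow> zs ! k \<in> Arr C" "\<And>k. k \<le> n \<Longrightarrow> Dom C (zs ! k) = vert C zs k"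
  shows "is_extension C n (vert C zs (Suc n)) (vert C zs 0) zs"
  unfolding is_extension_def
proof (intro conjI allI impI)
  note D = direct_sumE[OF d xs ys]
  show l: "length zs = Suc n" by (rule D(1))
  show "set zs \<subseteq> Arr C" using zs(1) l by (auto simp: set_conv_nth)
  show "is_monic C (zs ! 0)"
  proof (rule direct_sum_monic[OF D(2)[of 0] D(2)[of "Suc 0"], of _ "xs ! 0" "ys ! 0"])
    show "is_monic C (xs ! 0)" "is_monic C (ys ! 0)" using xs ys by (simp_all add: is_extension_def)
    show "ps ! Suc 0 \<cdot> zs ! 0 = xs ! 0 \<cdot> ps ! 0" "qs ! Suc 0 \<cdot> zs ! 0 = ys ! 0 \<cdot> qs ! 0"
      using D(5,6)[of 0] by simp_all
  qed (use zs[of 0] in simp_all)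
  show "is_epic C (zs ! n)"
  proof (rule direct_sum_epic[OF D(2)[of n] D(2)[of "Suc n"], of _ "xs ! n" "ys ! n"])
    show "is_epic C (xs ! n)" "is_epic C (ys ! n)" using xs ys by (simp_all add: is_extension_def)
    show "zs ! n \<cdot> is ! n = is ! Suc n \<cdot> xs ! n" "zs ! n \<cdot> js ! n = js ! Suc n \<cdot> ys ! n"
      using D(3,4)[of n] by simp_all
    show "Dom C (xs ! n) = vert C xs n" "Dom C (ys ! n) = vert C ys n" using extension_nth(2) xs ys
      by blast+
  qed (use zs[of n] in simp_all)
  fix k assume k: "k < n"
  show "is_exact C (zs ! k) (zs ! Suc k)"
  proof (rule direct_sum_exact[OF D(2)[of k] D(2)[of "Suc k"] D(2)[of "Suc (Suc k)"], of _ _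
    "xs ! k" "xs ! Suc k" "ys ! k" "ys ! Suc k"])
    show "is_exact C (xs ! k) (xs ! Suc k)" "is_exact C (ys ! k) (ys ! Suc k)" using xs ys k
      by (simp_all add: is_extension_def)
  qed (use k zs[of k] zs[of "Suc k"] extension_nth[OF xs, of k] extension_nth[OF ys, of k]
     extension_nth[OF xs, of "Suc k"] extension_nth[OF ys, of "Suc k"] D(3-6)[of k]
       D(3-6)[of "Suc k"] in simp_all)
qed simp_all

lemma ex_direct_sum:
  assumes xs: "is_extension C n A B xs" and ys: "is_extension C n A' B' ys"
  obtains zs "is" js ps qs where "is_ext_direct_sum C xs ys zs is js ps qs"
    "is_extension C n (vert C zs (Suc n)) (vert C zs 0) zs"
proof -
  note l = extension_length[OF xs] extension_length[OF ys]
  have "\<forall>k. \<exists>P i j p q. k \<le> Suc n \<longrightarrow> is_biproduct C (vert C xs k) (vert C ys k) P i j p q"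
    using has_biproducts cplx_vert_obj[OF extension_cplx] xs ys l by metis
  then obtain P i j p q
    where "\<forall>k. k \<le> Suc n \<longrightarrow> is_biproduct C (vert C xs k) (vert C ys k) (P k) (i k) (j k) (p k) (q k)"
    by (auto simp only: choice_iff)
  then have b: "\<And>k. k \<le> Suc n \<Longrightarrow> is_biproduct C (vert C xs k) (vert C ys k) (P k) (i k) (j k) (p k)
    (q k)" by blast
  \<comment> \<open>The diagonal matrix with entries \<open>xs ! k\<close> and
    \<open>ys ! k\<close>.\<close>
  define z where "z k = Add C (i (Suc k) \<cdot> xs ! k \<cdot> p k) (j (Suc k) \<cdot> ys ! k \<cdot> q k)" for k
  define L where "L = (\<lambda>f :: nat \<Rightarrow> 'b. map f [0..<Suc (Suc n)])"
  have [simp]: "L f ! k = f k" if "k \<le> Suc n" for f k using that unfolding L_def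
    by (simp del: upt_Suc)
  define zs where "zs = map z [0..<Suc n]"
  have lz: "length zs = Suc n" and zk: "\<And>k. k \<le> n \<Longrightarrow> zs ! k = z k"
    by (simp_all add: zs_def del: upt_Suc)
  have za: "z k \<in> Arr C" "Dom C (z k) = P k" "Cod C (z k) = P (Suc k)"
    and zi: "i (Suc k) \<cdot> xs ! k = z k \<cdot> i k" "j (Suc k) \<cdot> ys ! k = z k \<cdot> j k"
    and zp: "p (Suc k) \<cdot> z k = xs ! k \<cdot> p k" "q (Suc k) \<cdot> z k = ys ! k \<cdot> q k" if "k \<le> n" for k
  proof -
    have "k \<le> Suc n" "Suc k \<le> Suc n" using that by auto
    note b1 = b[OF this(1)] and b2 = b[OF this(2)]
    note [simp] = biproduct_arr[OF b1] biproduct_arr[OF b2] extension_nth[OF xs that]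
      extension_nth[OF ys that]
    show za: "z k \<in> Arr C" "Dom C (z k) = P k" "Cod C (z k) = P (Suc k)"
      by (simp_all add: z_def del: vert_simps)
    note [simp] = comp_shift[OF biproduct_arr(13)[OF b2]] comp_shift[OF biproduct_arr(14)[OF b2]]
      comp_shift[OF biproduct_arr(15)[OF b2]] comp_shift[OF biproduct_arr(16)[OF b2]]
    show "i (Suc k) \<cdot> xs ! k = z k \<cdot> i k" "j (Suc k) \<cdot> ys ! k = z k \<cdot> j k"
      "p (Suc k) \<cdot> z k = xs ! k \<cdot> p k" "q (Suc k) \<cdot> z k = ys ! k \<cdot> q k"
        by (simp_all add: z_def del: vert_simps)
  qed
  have v: "vert C zs k = P k" if "k \<le> Suc n" for k
    using that za zk by (cases k) auto
  have Pv: "i k \<in> Hom C (vert C xs k) (P k)" "j k \<in> Hom C (vert C ys k) (P k)"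
    "p k \<in> Hom C (P k) (vert C xs k)" "q k \<in> Hom C (P k) (vert C ys k)" if "k \<le> Suc n" for k
    using biproduct_arr[OF b[OF that]] by simp_all
  have d: "is_ext_direct_sum C xs ys zs (L i) (L j) (L p) (L q)"
    unfolding is_ext_direct_sum_def is_ext_morphism_iff
  proof (intro conjI allI impI)
    fix k assume k: "k \<le> length zs"
    show "is_biproduct C (Dom C (L i ! k)) (Dom C (L j ! k)) (Cod C (L i ! k)) (L i ! k) (L j ! k)
      (L p ! k) (L q ! k)"
      using biproduct_arr[OF b, of k] b[of k] k by (simp add: lz)
  qed (use l lz Pv zi zp zk in \<open>simp_all add: v del: in_Hom_iff\<close>, simp_all add: L_def)
  show thesis using that[OF d] direct_sum_extension[OF d xs ys] za zk v by simp
qed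

text \<open>The entries of a direct sum strictly between the two ends that a Baer sum modifies are
  arrows only because the Baer sum itself is an extension.\<close>

lemma baer_sumE:
  assumes ws: "is_extension C n A B ws" and b: "is_baer_sum C n A B xs ys ws"
    and xs: "is_extension C n A B xs" and ys: "is_extension C n A B ys"
  obtains zs "is" js ps qs diag codiag us where "is_ext_direct_sum C xs ys zs is js ps qs"
    "is_extension C n (vert C zs (Suc n)) (vert C zs 0) zs"
    "diag \<in> Arr C" "Dom C diag = A" "Cod C diag = vert C zs (Suc n)" "ps ! Suc n \<cdot> diag = Ide C A"
      "qs ! Suc n \<cdot> diag = Ide C A"
    "codiag \<in> Arr C" "Dom C codiag = vert C zs 0" "Cod C codiag = B" "codiag \<cdot> is ! 0 = Ide C B"
      "codiag \<cdot> js ! 0 = Ide C B"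
    "is_ext_pullback C zs diag us" "is_ext_pushout C codiag us ws"
      "is_extension C n A (vert C zs 0) us"
proof -
  from b obtain zs "is" js ps qs diag codiag us where d: "is_ext_direct_sum C xs ys zs is js ps qs"
    and
     r: "diag \<in> Hom C A (Cod C (zs ! n))" "ps ! Suc n \<cdot> diag = Ide C A"
       "qs ! Suc n \<cdot> diag = Ide C A"
     "codiag \<in> Hom C (Dom C (zs ! 0)) B" "codiag \<cdot> is ! 0 = Ide C B" "codiag \<cdot> js ! 0 = Ide C B" and
     us: "is_ext_pullback C zs diag us" "is_ext_pushout C codiag us ws"
    unfolding is_baer_sum_def by blast
  \<comment> \<open>Composability is carried from \<open>ws\<close> back over the pushout to
    \<open>us\<close>, then over the pullback to \<open>zs\<close>. Entries outside the replaced
    pairs are shared, and the old arrows \<open>a1\<close> and \<open>x1\<close> are composites of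
    the new \<open>b1\<close> and \<open>y1\<close> with a leg.\<close>
  define chain where "chain = (\<lambda>xs. set xs \<subseteq> Arr C \<and> successively (\<lambda>f g. Cod C f = Dom C g) xs)"
  have w: "chain ws" using extension_cplx[OF ws] unfolding cplx_def chain_def
    by (auto intro: successively_mono)
  from us(2) obtain a0 a1 b0 b1 rest k where u: "us = a0 # a1 # rest" "ws = b0 # b1 # rest"
    and p: "is_pushout C a0 codiag k b0"
     and b1: "b1 \<in> Hom C (Cod C b0) (Cod C a1)" "b1 \<cdot> k = a1"
    unfolding is_ext_pushout_def by blast
  note pa = pushout_arr[OF p]
  have "a1 \<in> Arr C" "Dom C a1 = Cod C a0" using b1 pa comp_arr[of k b1] by auto
  then have "chain us" using w pa b1(1) unfolding chain_def u by (auto simp: successively_Cons)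
  from us(1) obtain x0 x1 y0 y1 rest k where u: "zs = rest @ [x1, x0]" "us = rest @ [y1, y0]"
    and p: "is_pullback C x0 diag k y0"
     and y1: "y1 \<in> Hom C (Dom C x1) (Dom C y0)" "k \<cdot> y1 = x1"
    unfolding is_ext_pullback_def by blast
  note pa = pullback_arr[OF p]
  have "x1 \<in> Arr C" "Cod C x1 = Dom C x0" using y1 pa comp_arr[of y1 k] by auto
  then have cz: "chain zs" using \<open>chain us\<close> pa y1(1) unfolding chain_def u
    by (auto simp: successively_append_iff)
  have l: "length zs = Suc n" using direct_sumE(1)[OF d xs ys] .
  have "zs ! k \<in> Arr C" "Dom C (zs ! k) = vert C zs k" if "k \<le> n" for k
    using cz that l unfolding chain_def successively_conv_nth
      by (auto simp: vert_def split: nat.split)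
  then have zs: "is_extension C n (vert C zs (Suc n)) (vert C zs 0) zs"
    by (rule direct_sum_extension[OF d xs ys])
  have "is_extension C n A (vert C zs 0) us" using ext_pullback_extension[OF zs us(1)] r(1) by simp
  with r show thesis by (intro that[OF d zs _ _ _ _ _ _ _ _ _ _ us]) simp_all
qed

lemma ex_baer_sum:
  assumes xs: "is_extension C n A B xs" and ys: "is_extension C n A B ys" and n: "n \<ge> 1"
  obtains ws where "is_baer_sum C n A B xs ys ws" "is_extension C n A B ws"
proof -
  obtain zs "is" js ps qs where d: "is_ext_direct_sum C xs ys zs is js ps qs"
    and zs: "is_extension C n (vert C zs (Suc n)) (vert C zs 0) zs"
    using ex_direct_sum[OF xs ys] by blast
  note D = direct_sumE[OF d xs ys]
  have b0: "is_biproduct C B B (vert C zs 0) (is ! 0) (js ! 0) (ps ! 0) (qs ! 0)"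
    using D(2)[of 0] extension_ends[OF xs] extension_ends[OF ys] by simp
  have b1: "is_biproduct C A A (vert C zs (Suc n)) (is ! Suc n) (js ! Suc n) (ps ! Suc n) (qs ! Suc
    n)"
    using D(2)[of "Suc n"] extension_ends[OF xs] extension_ends[OF ys] by simp
  note [simp] = biproduct_arr[OF b0] biproduct_arr[OF b1]
  define diag where "diag = Add C (is ! Suc n) (js ! Suc n)"
  define codiag where "codiag = Add C (ps ! 0) (qs ! 0)"
  have diag: "diag \<in> Arr C" "Dom C diag = A" "Cod C diag = vert C zs (Suc n)"
    "ps ! Suc n \<cdot> diag = Ide C A" "qs ! Suc n \<cdot> diag = Ide C A"
    by (simp_all add: diag_def)
  have codiag: "codiag \<in> Arr C" "Dom C codiag = vert C zs 0" "Cod C codiag = B"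
    "codiag \<cdot> is ! 0 = Ide C B" "codiag \<cdot> js ! 0 = Ide C B"
    by (simp_all add: codiag_def)
  obtain us where us: "is_ext_pullback C zs diag us" using ex_ext_pullback[OF zs n diag(1,3)] .
  have u: "is_extension C n A (vert C zs 0) us" using ext_pullback_extension[OF zs us] diag by simp
  obtain ws where ws: "is_ext_pushout C codiag us ws" using ex_ext_pushout[OF u n codiag(1,2)] .
  have "is_extension C n A B ws" using ext_pushout_extension[OF u ws] codiag by simp
  moreover have "diag \<in> Hom C A (Cod C (zs ! n))" "codiag \<in> Hom C (Dom C (zs ! 0)) B"
    using diag codiag by simp_all
  then have "is_baer_sum C n A B xs ys ws" unfolding is_baer_sum_def
    using d us ws diag(4,5) codiag(4,5) by blast
  ultimately show thesis using that by blast
qed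

end

subsection \<open>Exact functors and exact adjunctions\<close>

lemma functor_simps:
  assumes "is_functor C D F"
  shows "a \<in> Obj C \<Longrightarrow> fob F a \<in> Obj D" "a \<in> Obj C \<Longrightarrow> far F (Ide C a) = Ide D (fob F a)"
    "f \<in> Arr C \<Longrightarrow> far F f \<in> Arr D" "f \<in> Arr C \<Longrightarrow> Dom D (far F f) = fob F (Dom C f)"
    "f \<in> Arr C \<Longrightarrow> Cod D (far F f) = fob F (Cod C f)"
    "f \<in> Arr C \<Longrightarrow> g \<in> Arr C \<Longrightarrow> Dom C g = Cod C f \<Longrightarrow> far F (g \<cdot>\<^bsub>C\<^esub> f) = far F g \<cdot>\<^bsub>D\<^esub> far F f"
  using assms by (auto simp: is_functor_def)

text \<open>\<open>is_exact_functor\<close> speaks of short exact sequences only. Monomorphisms and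
  epimorphisms are completed to such sequences, and exactness at a middle term is obtained by
  splitting both arrows over the image.\<close>

lemma exact_functor_extension:
  assumes "abelian_category C" "abelian_category D" and F: "is_exact_functor C D F"
    and xs: "is_extension C n A B xs"
  shows "is_extension D n (fob F A) (fob F B) (map (far F) xs)"
proof -
  interpret C: abelian_category C by fact
  interpret D: abelian_category D by fact
  have ftr: "is_functor C D F"
    and se: "\<And>f g. is_short_exact C f g \<Longrightarrow> is_short_exact D (far F f) (far F g)"
    using F by (auto simp: is_exact_functor_def)
  note [simp] = functor_simps[OF ftr]
  have mon: "is_monic D (far F f)" if f: "is_monic C f" for f
  proof -
    obtain p where "is_cokernel C f p" using C.has_cokernels[of f] C.monic_arr[OF f] by auto
    then show ?thesis using se[OF C.short_exactI[OF f]] by (simp add: is_short_exact_def)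
  qed
  have epi: "is_epic D (far F f)" if f: "is_epic C f" for f
  proof -
    obtain k where "is_kernel C f k" using C.has_kernels[of f] C.epic_arr[OF f] by auto
    then have "is_monic C k" "is_cokernel C k f"
      using C.kernel_monic C.epic_cokernel_of_kernel[OF f] by blast+
    then show ?thesis using se[OF C.short_exactI] by (simp add: is_short_exact_def)
  qed
  have exa: "is_exact D (far F f) (far F g)" if fg: "is_exact C f g" for f g
  proof -
    note [simp] = C.exact_arr(1-3)[OF fg]
    obtain p k where p: "is_cokernel C f p" and k: "is_kernel C p k" and gk: "is_kernel C g k"
      using fg by (auto simp: is_exact_def)
    have kp: "is_cokernel C k p" using C.epic_cokernel_of_kernel[OF C.cokernel_epic[OF p] k] .
    note [simp] = C.cokernel_arr(1-3)[OF p] C.kernel_arr(1-3)[OF k]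
    \<comment> \<open>The image inclusion \<open>k\<close> and the cokernel \<open>p\<close> form a
      short exact sequence. With \<open>f = k \<cdot> f'\<close> and \<open>g = m \<cdot> p\<close>,
      the claim for \<open>f\<close> and \<open>g\<close> follows once \<open>F f'\<close> is epic
      and \<open>F m\<close> is monic.\<close>
    have ex: "is_exact D (far F k) (far F p)"
      using se[OF C.short_exactI[OF C.kernel_monic[OF k] kp]] by (simp add: is_short_exact_def)
    obtain f' where f': "is_epic C f'" "Dom C f' = Dom C f" "Cod C f' = Dom C k" "k \<cdot>\<^bsub>C\<^esub> f' = f"
      using C.epi_factor[OF p k] .
    obtain m where m: "is_monic C m" "Cod C m = Cod C g" "Dom C m = Cod C p" "m \<cdot>\<^bsub>C\<^esub> p = g"
      using C.mono_factor[OF gk kp] .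
    note [simp] = f'(2,3) m(2,3) C.epic_arr[OF f'(1)] C.monic_arr[OF m(1)]
    have Ff: "far F f = far F k \<cdot>\<^bsub>D\<^esub> far F f'" using functor_simps(6)[OF ftr, of f' k] f'(4) by simp
    have Fg: "far F g = far F m \<cdot>\<^bsub>D\<^esub> far F p" using functor_simps(6)[OF ftr, of p m] m(4) by simp
    show ?thesis
    proof (rule D.exactI)
      have "far F p \<cdot>\<^bsub>D\<^esub> far F k \<cdot>\<^bsub>D\<^esub> far F f' = Zer D (fob F (Dom C f)) (fob F (Cod C p))"
        by (subst D.comp_shift[OF D.exact_arr(4)[OF ex]]) simp_all
      then show "far F g \<cdot>\<^bsub>D\<^esub> far F f = Zer D (Dom D (far F f)) (Cod D (far F g))" unfolding Ff Fg
        by simp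
      fix t assume [simp]: "t \<in> Arr D" "Cod D t = Dom D (far F g)"
        and t: "far F g \<cdot>\<^bsub>D\<^esub> t = Zer D (Dom D t) (Cod D (far F g))"
      have "far F m \<cdot>\<^bsub>D\<^esub> (far F p \<cdot>\<^bsub>D\<^esub> t) = far F m \<cdot>\<^bsub>D\<^esub> Zer D (Dom D t) (fob F (Cod C p))" using t
        unfolding Fg by simp
      from D.monicD[OF mon[OF m(1)] this] have "far F p \<cdot>\<^bsub>D\<^esub> t = Zer D (Dom D t) (Cod D (far F p))"
        by simp
      then obtain e s where e: "is_epic D e" and [simp]: "Cod D e = Dom D t" "s \<in> Arr D"
        "Dom D s = Dom D e" "Cod D s = fob F (Dom C k)" and s: "far F k \<cdot>\<^bsub>D\<^esub> s = t \<cdot>\<^bsub>D\<^esub> e"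
        using D.exact_lift[OF ex, of t] by auto
      obtain e' s' where e': "is_epic D e'" and [simp]: "Cod D e' = Dom D s" "s' \<in> Arr D"
        "Dom D s' = Dom D e'" "Cod D s' = fob F (Dom C f)" and s': "far F f' \<cdot>\<^bsub>D\<^esub> s' = s \<cdot>\<^bsub>D\<^esub> e'"
        using D.epi_lift[OF epi[OF f'(1)], of s] by auto
      note [simp] = D.epic_arr[OF e] D.epic_arr[OF e']
      have "far F f \<cdot>\<^bsub>D\<^esub> s' = far F k \<cdot>\<^bsub>D\<^esub> (s \<cdot>\<^bsub>D\<^esub> e')" unfolding Ff using s' by simp
      also have "\<dots> = (t \<cdot>\<^bsub>D\<^esub> e) \<cdot>\<^bsub>D\<^esub> e'" by (rule D.comp_shift[OF s]) simp_all
      finally have "far F f \<cdot>\<^bsub>D\<^esub> s' = t \<cdot>\<^bsub>D\<^esub> (e \<cdot>\<^bsub>D\<^esub> e')" by simp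
      then show "\<exists>e s. is_epic D e \<and> Cod D e = Dom D t \<and> s \<in> Arr D \<and> Dom D s = Dom D e \<and>
        Cod D s = Dom D (far F f) \<and> far F f \<cdot>\<^bsub>D\<^esub> s = t \<cdot>\<^bsub>D\<^esub> e"
        using D.epic_comp[OF e' e] by (intro exI[of _ "e \<cdot>\<^bsub>D\<^esub> e'"] exI[of _ s']) simp
    qed simp_all
  qed
  have "xs \<noteq> []" "set xs \<subseteq> Arr C" using xs by (auto simp: is_extension_def)
  then have "hd xs \<in> Arr C" "last xs \<in> Arr C" by auto
  with xs \<open>xs \<noteq> []\<close> show ?thesis unfolding is_extension_iff
    by (auto simp: hd_map last_map successively_map mon epi intro: successively_mono[OF _ exa])
qed

text \<open>The transposition \<Phi> is a parameter, since \<open>is_left_adjoint\<close> only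
  asserts its existence and all constructions have to share one. Additivity of \<open>R\<close>
  enters when Baer sums are compared.\<close>

locale exact_adjunction = C: abelian_category C + D: abelian_category D
  for C :: "('o, 'm) cat" and D :: "('p, 'n) cat" +
  fixes L :: "('o, 'm, 'p, 'n) func" and R :: "('p, 'n, 'o, 'm) func" and \<Phi>
  assumes L_exact: "is_exact_functor C D L" and R_exact: "is_exact_functor D C R"
    and R_add: "f \<in> Arr D \<Longrightarrow> g \<in> Arr D \<Longrightarrow> Dom D g = Dom D f \<Longrightarrow> Cod D g = Cod D f \<Longrightarrow>
      far R (Add D f g) = Add C (far R f) (far R g)"
    and transpose_bij: "X \<in> Obj C \<Longrightarrow> Y \<in> Obj D \<Longrightarrow> bij_betw (\<Phi> X Y) (Hom D (fob L X) Y) (Hom C X (fob R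
      Y))"
    and transpose_natural: "x \<in> Arr C \<Longrightarrow> y \<in> Arr D \<Longrightarrow> h \<in> Hom D (fob L (Cod C x)) (Dom D y) \<Longrightarrow>
      \<Phi> (Dom C x) (Cod D y) (y \<cdot>\<^bsub>D\<^esub> h \<cdot>\<^bsub>D\<^esub> far L x) = far R y \<cdot>\<^bsub>C\<^esub> \<Phi> (Cod C x) (Dom D y) h \<cdot>\<^bsub>C\<^esub> x"
begin

lemma L_functor: "is_functor C D L" and R_functor: "is_functor D C R"
  using L_exact R_exact by (auto simp: is_exact_functor_def)

lemmas [simp] = functor_simps[OF L_functor] functor_simps[OF R_functor]

lemma transpose_arr [simp]:
  assumes "X \<in> Obj C" "h \<in> Arr D" "Dom D h = fob L X" "Cod D h = Y"
  shows "\<Phi> X Y h \<in> Arr C" "Dom C (\<Phi> X Y h) = X" "Cod C (\<Phi> X Y h) = fob R Y"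
  using bij_betwE[OF transpose_bij[of X Y]] assms by auto

lemma transpose_right:
  assumes "X \<in> Obj C" "h \<in> Arr D" "Dom D h = fob L X" "y \<in> Arr D" "Cod D h = Dom D y"
  shows "\<Phi> X (Cod D y) (y \<cdot>\<^bsub>D\<^esub> h) = far R y \<cdot>\<^bsub>C\<^esub> \<Phi> X (Dom D y) h"
  using transpose_natural[of "Ide C X" y h] assms by simp

lemma transpose_left:
  assumes "x \<in> Arr C" "h \<in> Arr D" "Dom D h = fob L (Cod C x)" "Cod D h = Y"
  shows "\<Phi> (Dom C x) Y (h \<cdot>\<^bsub>D\<^esub> far L x) = \<Phi> (Cod C x) Y h \<cdot>\<^bsub>C\<^esub> x"
  using transpose_natural[of x "Ide D Y" h] assms by auto

lemma transpose_inj: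
  assumes "\<Phi> X Y h = \<Phi> X Y h'" "X \<in> Obj C" "h \<in> Hom D (fob L X) Y" "h' \<in> Hom D (fob L X) Y"
  shows "h = h'"
proof -
  have "Y \<in> Obj D" using assms by auto
  from bij_betw_imp_inj_on[OF transpose_bij[OF assms(2) this]] assms show ?thesis
    by (auto dest: inj_onD)
qed

lemma transpose_surj:
  assumes "X \<in> Obj C" "Y \<in> Obj D" "g \<in> Arr C" "Dom C g = X" "Cod C g = fob R Y"
  obtains h where "h \<in> Arr D" "Dom D h = fob L X" "Cod D h = Y" "\<Phi> X Y h = g"
proof -
  have "g \<in> \<Phi> X Y ` Hom D (fob L X) Y"
    using bij_betw_imp_surj_on[OF transpose_bij[OF assms(1,2)]] assms(3-5) by simp
  then show thesis using that by auto
qed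

definition unit where "unit X = \<Phi> X (fob L X) (Ide D (fob L X))"

lemma unit_arr [simp]:
  "X \<in> Obj C \<Longrightarrow> unit X \<in> Arr C" "X \<in> Obj C \<Longrightarrow> Dom C (unit X) = X"
    "X \<in> Obj C \<Longrightarrow> Cod C (unit X) = fob R (fob L X)"
  by (simp_all add: unit_def)



section \<open>Images and transposes of morphisms of extensions\<close>

lemma R_vert: "cplx D xs \<Longrightarrow> k \<le> length xs \<Longrightarrow> vert C (map (far R) xs) k = fob R (vert D xs k)"
  using cplx_nth(1,4)[of D xs] by (cases k) auto

lemma L_vert: "cplx C xs \<Longrightarrow> k \<le> length xs \<Longrightarrow> vert D (map (far L) xs) k = fob L (vert C xs k)"
  using cplx_nth(1,4)[of C xs] by (cases k) auto

lemma R_ext_mor: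
  assumes "ext_mor D xs ys b a" "cplx D xs" "cplx D ys"
  shows "ext_mor C (map (far R) xs) (map (far R) ys) (far R b) (far R a)"
proof -
  obtain \<phi> where p: "length ys = length xs" "\<And>k. k \<le> length xs \<Longrightarrow> \<phi> k \<in> Arr D"
    "\<And>k. k \<le> length xs \<Longrightarrow> Dom D (\<phi> k) = vert D xs k" "\<And>k. k \<le> length xs \<Longrightarrow> Cod D (\<phi> k) = vert D ys k"
    "\<And>i. i < length xs \<Longrightarrow> \<phi> (Suc i) \<cdot>\<^bsub>D\<^esub> xs ! i = ys ! i \<cdot>\<^bsub>D\<^esub> \<phi> i" "\<phi> 0 = b" "\<phi> (length xs) = a"
    using ext_morE[OF assms(1)] by metis
  show ?thesis
  proof (rule ext_morI[of _ _ "\<lambda>k. far R (\<phi> k)"])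
    fix i assume "i < length (map (far R) xs)"
    then have i: "i < length xs" by simp
    have "far R (\<phi> (Suc i) \<cdot>\<^bsub>D\<^esub> xs ! i) = far R (ys ! i \<cdot>\<^bsub>D\<^esub> \<phi> i)" using p(5)[OF i] by simp
    then show "far R (\<phi> (Suc i)) \<cdot>\<^bsub>C\<^esub> map (far R) xs ! i = map (far R) ys ! i \<cdot>\<^bsub>C\<^esub> far R (\<phi> i)"
      using i p(1) p(2-4)[of i] p(2-4)[of "Suc i"] cplx_nth(1,2)[OF assms(2) i]
        cplx_nth(1,2)[OF assms(3), of i] by simp
  qed (use p assms in \<open>simp_all add: R_vert\<close>)
qed

text \<open>By naturality of \<Phi>, the two sides of each square are sent to the two sides of the
  corresponding square. Their common type leads from vertex \<open>i\<close> of \<open>zs\<close> to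
  vertex \<open>Suc i\<close> of \<open>xs\<close>, and \<Phi> is injective there, so commutativity
  passes both ways.\<close>

lemma transpose_ext_mor:
  assumes zs: "cplx C zs" and xs: "cplx D xs"
    and b: "b \<in> Hom D (fob L (vert C zs 0)) (vert D xs 0)"
      and a: "a \<in> Hom D (fob L (vert C zs (length zs))) (vert D xs (length zs))"
  shows "ext_mor D (map (far L) zs) xs b a \<longleftrightarrow>
    ext_mor C zs (map (far R) xs) (\<Phi> (vert C zs 0) (vert D xs 0) b) (\<Phi> (vert C zs (length zs)) (vert
      D xs (length zs)) a)"
proof -
  let ?\<Phi> = "\<lambda>k. \<Phi> (vert C zs k) (vert D xs k)"

  have sq: "\<Phi> (vert C zs i) (vert D xs (Suc i)) (h' \<cdot>\<^bsub>D\<^esub> far L (zs ! i)) = ?\<Phi> (Suc i) h' \<cdot>\<^bsub>C\<^esub> zs !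
    i"
    "\<Phi> (vert C zs i) (vert D xs (Suc i)) (xs ! i \<cdot>\<^bsub>D\<^esub> h) = far R (xs ! i) \<cdot>\<^bsub>C\<^esub> ?\<Phi> i h"
    if "i < length zs" "i < length xs" "h' \<in> Hom D (fob L (vert C zs (Suc i))) (vert D xs (Suc i))"
      "h \<in> Hom D (fob L (vert C zs i)) (vert D xs i)" for i h h'
  proof -
    note [simp] = cplx_nth(1,2)[OF zs that(1)] cplx_nth(1,2)[OF xs that(2)]
    have [simp]: "vert C zs i \<in> Obj C" "vert D xs i \<in> Obj D"
      using C.cplx_vert_obj[OF zs, of i] D.cplx_vert_obj[OF xs, of i] that by auto
    show "\<Phi> (vert C zs i) (vert D xs (Suc i)) (h' \<cdot>\<^bsub>D\<^esub> far L (zs ! i)) = ?\<Phi> (Suc i) h' \<cdot>\<^bsub>C\<^esub> zs ! i"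
      using transpose_left[of "zs ! i" h' "vert D xs (Suc i)"] that by simp
    show "\<Phi> (vert C zs i) (vert D xs (Suc i)) (xs ! i \<cdot>\<^bsub>D\<^esub> h) = far R (xs ! i) \<cdot>\<^bsub>C\<^esub> ?\<Phi> i h"
      using transpose_right[of "vert C zs i" h "xs ! i"] that by simp
  qed
  show ?thesis
  proof
    assume "ext_mor D (map (far L) zs) xs b a"
    then obtain \<phi> where p: "length xs = length zs"
      "\<And>k. k \<le> length zs \<Longrightarrow> \<phi> k \<in> Hom D (vert D (map (far L) zs) k) (vert D xs k)"
      "\<And>i. i < length zs \<Longrightarrow> \<phi> (Suc i) \<cdot>\<^bsub>D\<^esub> far L (zs ! i) = xs ! i \<cdot>\<^bsub>D\<^esub> \<phi> i" "\<phi> 0 = b"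
        "\<phi> (length zs) = a"
      unfolding ext_mor_def by (auto simp del: in_Hom_iff)
    have ph: "k \<le> length zs \<Longrightarrow> \<phi> k \<in> Hom D (fob L (vert C zs k)) (vert D xs k)" for k
      using p(2)[of k] L_vert[OF zs] by simp
    show "ext_mor C zs (map (far R) xs) (?\<Phi> 0 b) (?\<Phi> (length zs) a)"
    proof (rule ext_morI[of _ _ "\<lambda>k. ?\<Phi> k (\<phi> k)"])
      fix k assume k: "k \<le> length zs"
      show "?\<Phi> k (\<phi> k) \<in> Hom C (vert C zs k) (vert C (map (far R) xs) k)"
        using ph[OF k] C.cplx_vert_obj[OF zs k] R_vert[OF xs, of k] k p(1) by simp
    next
      fix i assume i: "i < length zs"
      show "?\<Phi> (Suc i) (\<phi> (Suc i)) \<cdot>\<^bsub>C\<^esub> zs ! i = map (far R) xs ! i \<cdot>\<^bsub>C\<^esub> ?\<Phi> i (\<phi> i)"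
        using sq[of i "\<phi> (Suc i)" "\<phi> i"] ph[of i] ph[of "Suc i"] i p(1) p(3)[OF i]
          by (simp del: in_Hom_iff vert_simps)
    qed (use p in simp_all)
  next
    assume "ext_mor C zs (map (far R) xs) (?\<Phi> 0 b) (?\<Phi> (length zs) a)"
    then obtain \<psi> where "length (map (far R) xs) = length zs"
      and p: "\<And>k. k \<le> length zs \<Longrightarrow> \<psi> k \<in> Hom C (vert C zs k) (vert C (map (far R) xs) k)"
        "\<And>i. i < length zs \<Longrightarrow> \<psi> (Suc i) \<cdot>\<^bsub>C\<^esub> zs ! i = map (far R) xs ! i \<cdot>\<^bsub>C\<^esub> \<psi> i"
        "\<psi> 0 = ?\<Phi> 0 b" "\<psi> (length zs) = ?\<Phi> (length zs) a"
      unfolding ext_mor_def by blast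
    then have p: "length xs = length zs"
      "\<And>k. k \<le> length zs \<Longrightarrow> \<psi> k \<in> Hom C (vert C zs k) (vert C (map (far R) xs) k)"
      "\<And>i. i < length zs \<Longrightarrow> \<psi> (Suc i) \<cdot>\<^bsub>C\<^esub> zs ! i = far R (xs ! i) \<cdot>\<^bsub>C\<^esub> \<psi> i" "\<psi> 0 = ?\<Phi> 0 b"
        "\<psi> (length zs) = ?\<Phi> (length zs) a"
      by (simp_all del: in_Hom_iff vert_simps)
    have "\<exists>h. k \<le> length zs \<longrightarrow> h \<in> Hom D (fob L (vert C zs k)) (vert D xs k) \<and> ?\<Phi> k h = \<psi> k" for k
      using p(1) p(2)[of k] R_vert[OF xs, of k] C.cplx_vert_obj[OF zs, of k]
        D.cplx_vert_obj[OF xs, of k]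
        transpose_surj[of "vert C zs k" "vert D xs k" "\<psi> k"] by (metis in_Hom_iff)
    then obtain \<phi> where ph: "\<And>k. k \<le> length zs \<Longrightarrow> \<phi> k \<in> Hom D (fob L (vert C zs k)) (vert D xs k)"
      "\<And>k. k \<le> length zs \<Longrightarrow> ?\<Phi> k (\<phi> k) = \<psi> k"
      by metis
    show "ext_mor D (map (far L) zs) xs b a"
    proof (rule ext_morI[of _ _ \<phi>])
      fix k assume "k \<le> length (map (far L) zs)"
      then show "\<phi> k \<in> Hom D (vert D (map (far L) zs) k) (vert D xs k)"
        using ph(1)[of k] L_vert[OF zs] by simp
    next
      fix i assume "i < length (map (far L) zs)"
      then have i: "i < length zs" "i < length xs" using p(1) by auto
      note [simp] = cplx_nth(1,2)[OF zs i(1)] cplx_nth(1,2)[OF xs i(2)]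
      have "\<Phi> (vert C zs i) (vert D xs (Suc i)) (\<phi> (Suc i) \<cdot>\<^bsub>D\<^esub> far L (zs ! i)) =
        \<Phi> (vert C zs i) (vert D xs (Suc i)) (xs ! i \<cdot>\<^bsub>D\<^esub> \<phi> i)"
        using sq[of i "\<phi> (Suc i)" "\<phi> i"] ph[of i] ph[of "Suc i"] i p(3)[of i]
          by (simp del: in_Hom_iff vert_simps)
      then have "\<phi> (Suc i) \<cdot>\<^bsub>D\<^esub> far L (zs ! i) = xs ! i \<cdot>\<^bsub>D\<^esub> \<phi> i"
        using ph(1)[of i] ph(1)[of "Suc i"] i C.cplx_vert_obj[OF zs, of i]
          by (elim transpose_inj) simp_all
      then show "\<phi> (Suc i) \<cdot>\<^bsub>D\<^esub> map (far L) zs ! i = xs ! i \<cdot>\<^bsub>D\<^esub> \<phi> i" using i by simp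
    next
      show "\<phi> 0 = b" using ph[of 0] p(4) b C.cplx_vert_obj[OF zs, of 0]
        by (intro transpose_inj[of "vert C zs 0" "vert D xs 0"]) simp_all
      show "\<phi> (length (map (far L) zs)) = a"
        using ph[of "length zs"] p(5) a C.cplx_vert_obj[OF zs, of "length zs"]
        by (intro transpose_inj[of "vert C zs (length zs)" "vert D xs (length zs)"]) simp_all
    qed (use p in simp_all)
  qed
qed

text \<open>A relation instead of the pullback construction itself, so that it can be read equally
  well from the side of \<open>C\<close> and from the side of \<open>D\<close>.\<close>

definition corr where
  "corr n X Y zs xs \<longleftrightarrow> is_extension C n X (fob R Y) zs \<and> is_extension D n (fob L X) Y xs \<and>
     ext_mor C zs (map (far R) xs) (Ide C (fob R Y)) (unit X)"

lemma R_extension: "is_extension D n A B xs \<Longrightarrow> is_extension C n (fob R A) (fob R B) (map (far R) xs)"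
  by (rule exact_functor_extension[OF D.abelian_category_axioms C.abelian_category_axioms R_exact])

lemma L_extension: "is_extension C n A B xs \<Longrightarrow> is_extension D n (fob L A) (fob L B) (map (far L) xs)"
  by (rule exact_functor_extension[OF C.abelian_category_axioms D.abelian_category_axioms L_exact])

text \<open>At the left end the counit \<open>\<epsilon>\<close> transposes to the identity of
  \<open>R Y\<close>; at the right end the identity of \<open>L X\<close> transposes to the
  unit.\<close>

lemma corr_transpose:
  assumes zs: "is_extension C n X (fob R Y) zs" and xs: "is_extension D n (fob L X) Y xs"
    and X: "X \<in> Obj C"
    and e: "\<epsilon> \<in> Arr D" "Dom D \<epsilon> = fob L (fob R Y)" "Cod D \<epsilon> = Y" "\<Phi> (fob R Y) Y \<epsilon> = Ide C (fob R Y)"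
  shows "corr n X Y zs xs \<longleftrightarrow> ext_mor D (map (far L) zs) xs \<epsilon> (Ide D (fob L X))"
  using transpose_ext_mor[OF C.extension_cplx[OF zs] D.extension_cplx[OF xs], of \<epsilon> "Ide D (fob L
    X)"]
    extension_ends[OF zs] extension_ends[OF xs] e extension_length[OF zs] X zs xs
  by (simp add: corr_def unit_def)

lemma ex_counit:
  assumes "Y \<in> Obj D"
  obtains \<epsilon> where "\<epsilon> \<in> Arr D" "Dom D \<epsilon> = fob L (fob R Y)" "Cod D \<epsilon> = Y"
    "\<Phi> (fob R Y) Y \<epsilon> = Ide C (fob R Y)"
  using transpose_surj[of "fob R Y" Y "Ide C (fob R Y)"] assms by auto

lemma ex_corr_left:
  assumes xs: "is_extension D n (fob L X) Y xs" and X: "X \<in> Obj C" and n: "n \<ge> 1"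
  obtains zs where "corr n X Y zs xs"
proof -
  note r = R_extension[OF xs]
  obtain zs where zs: "is_ext_pullback C (map (far R) xs) (unit X) zs"
    using C.ex_ext_pullback[OF r n, of "unit X"] X by auto
  then have "corr n X Y zs xs" unfolding corr_def
    using C.ext_pullback_mor[OF r zs] C.ext_pullback_extension[OF r zs] X xs by simp
  then show thesis by (rule that)
qed

lemma ex_corr_right:
  assumes zs: "is_extension C n X (fob R Y) zs" and Y: "Y \<in> Obj D" and n: "n \<ge> 1"
  obtains xs where "corr n X Y zs xs"
proof -
  note l = L_extension[OF zs]
  obtain \<epsilon> where e: "\<epsilon> \<in> Arr D" "Dom D \<epsilon> = fob L (fob R Y)" "Cod D \<epsilon> = Y"
    "\<Phi> (fob R Y) Y \<epsilon> = Ide C (fob R Y)" using ex_counit[OF Y] .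
  obtain xs where xs: "is_ext_pushout D \<epsilon> (map (far L) zs) xs"
    using D.ex_ext_pushout[OF l n e(1,2)] .
  have x: "is_extension D n (fob L X) Y xs" using D.ext_pushout_extension[OF l xs] e by simp
  have "ext_mor D (map (far L) zs) xs \<epsilon> (Ide D (fob L X))"
    using D.ext_pushout_mor[OF D.extension_cplx[OF l] xs] D.extension_last[OF l] by simp
  then have "corr n X Y zs xs" using corr_transpose[OF zs x C.extension_obj(1)[OF zs] e] by simp
  then show thesis by (rule that)
qed

text \<open>Applying \<open>R\<close> to the step sends both \<open>zs\<close> and
  \<open>zs'\<close> to \<open>R xs'\<close> with the same ends, so each of them maps to the
  pullback of \<open>R xs'\<close> along the unit.\<close>

lemma corr_step_left:
  assumes s: "(xs, xs') \<in> ext_step D n (fob L X) Y" and c: "corr n X Y zs xs" "corr n X Y zs' xs'"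
    and n: "n \<ge> 1"
  shows "(zs, zs') \<in> ext_equiv C n X (fob R Y)"
proof -
  have xs: "is_extension D n (fob L X) Y xs" "is_extension D n (fob L X) Y xs'"
    and m: "ext_mor D xs xs' (Ide D Y) (Ide D (fob L X))"
    using s by (simp_all add: ext_step_iff)
  have zs: "is_extension C n X (fob R Y) zs" "is_extension C n X (fob R Y) zs'"
    and z: "ext_mor C zs (map (far R) xs) (Ide C (fob R Y)) (unit X)"
      "ext_mor C zs' (map (far R) xs') (Ide C (fob R Y)) (unit X)"
    using c by (simp_all add: corr_def)
  note cc = xs[THEN D.extension_cplx] zs[THEN C.extension_cplx]
    xs[THEN R_extension, THEN C.extension_cplx]
  have [simp]: "X \<in> Obj C" "Y \<in> Obj D" using C.extension_obj[OF zs(1)] D.extension_obj[OF xs(1)]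
    by auto
  have "ext_mor C zs (map (far R) xs') (Ide C (fob R Y)) (unit X)"
    using C.ext_mor_comp[OF z(1) R_ext_mor[OF m cc(1,2)] cc(3,5,6)] by simp
  note z' = this z(2)
  obtain ws where ws: "is_ext_pullback C (map (far R) xs') (unit X) ws"
    using C.ex_ext_pullback[OF R_extension[OF xs(2)] n, of "unit X"] by auto
  have w: "is_extension C n X (fob R Y) ws"
    using C.ext_pullback_extension[OF R_extension[OF xs(2)] ws] by simp
  have "(us, ws) \<in> ext_equiv C n X (fob R Y)"
    if us: "is_extension C n X (fob R Y) us"
      "ext_mor C us (map (far R) xs') (Ide C (fob R Y)) (unit X)" for us
  proof -
    have "ext_mor C us (map (far R) xs') (Ide C (fob R Y)) (unit X \<cdot>\<^bsub>C\<^esub> Ide C X)" using us by simp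
    then have "ext_mor C us ws (Ide C (fob R Y)) (Ide C X)"
      using C.extension_last[OF us(1)]
        by (intro C.ext_pullback_factor[OF R_extension[OF xs(2)] C.extension_cplx[OF us(1)] ws])
        simp_all
    then show ?thesis using us w by (intro ext_equiv_step) (simp add: ext_step_iff)
  qed
  then show ?thesis using zs z' ext_equiv_sym ext_equiv_trans by metis
qed

text \<open>Composed with the step, both correspondences become morphisms from \<open>L zs\<close>
  with the same ends, so the pushout of \<open>L zs\<close> along the counit maps to
  \<open>xs\<close> and to \<open>xs'\<close>.\<close>

lemma corr_step_right:
  assumes s: "(zs, zs') \<in> ext_step C n X (fob R Y)" and c: "corr n X Y zs xs" "corr n X Y zs' xs'"
    and n: "n \<ge> 1"
  shows "(xs, xs') \<in> ext_equiv D n (fob L X) Y"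
proof -
  have zs: "is_extension C n X (fob R Y) zs" "is_extension C n X (fob R Y) zs'"
    and m: "ext_mor C zs zs' (Ide C (fob R Y)) (Ide C X)"
    using s by (simp_all add: ext_step_iff)
  have xs: "is_extension D n (fob L X) Y xs" "is_extension D n (fob L X) Y xs'"
    and x: "ext_mor C zs (map (far R) xs) (Ide C (fob R Y)) (unit X)"
      "ext_mor C zs' (map (far R) xs') (Ide C (fob R Y)) (unit X)"
    using c by (simp_all add: corr_def)
  note cc = xs[THEN D.extension_cplx] zs[THEN C.extension_cplx]
    xs[THEN R_extension, THEN C.extension_cplx]
  have [simp]: "X \<in> Obj C" "Y \<in> Obj D" using C.extension_obj[OF zs(1)] D.extension_obj[OF xs(1)]
    by auto
  obtain \<epsilon> where e: "\<epsilon> \<in> Arr D" "Dom D \<epsilon> = fob L (fob R Y)" "Cod D \<epsilon> = Y"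
    "\<Phi> (fob R Y) Y \<epsilon> = Ide C (fob R Y)"
    using ex_counit[OF \<open>Y \<in> Obj D\<close>] .
  have "ext_mor C zs (map (far R) xs') (Ide C (fob R Y)) (unit X)"
    using C.ext_mor_comp[OF m x(2) cc(3,4,6)] by simp
  then have "corr n X Y zs xs'" using zs xs by (simp add: corr_def)
  then have x': "ext_mor D (map (far L) zs) xs \<epsilon> (Ide D (fob L X))"
    "ext_mor D (map (far L) zs) xs' \<epsilon> (Ide D (fob L X))"
    using corr_transpose[OF zs(1) xs(1) _ e] corr_transpose[OF zs(1) xs(2) _ e] c by simp_all
  note l = L_extension[OF zs(1)]
  obtain ws where ws: "is_ext_pushout D \<epsilon> (map (far L) zs) ws"
    using D.ex_ext_pushout[OF l n e(1,2)] .
  have w: "is_extension D n (fob L X) Y ws" using D.ext_pushout_extension[OF l ws] e by simp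
  have "(ws, us) \<in> ext_equiv D n (fob L X) Y"
    if us: "is_extension D n (fob L X) Y us" "ext_mor D (map (far L) zs) us \<epsilon> (Ide D (fob L X))"
      for us
  proof -
    have "ext_mor D (map (far L) zs) us (Ide D Y \<cdot>\<^bsub>D\<^esub> \<epsilon>) (Ide D (fob L X))" using us e by simp
    then have "ext_mor D ws us (Ide D Y) (Ide D (fob L X))"
      using extension_ends[OF us(1)] e
        by (intro D.ext_pushout_factor[OF D.extension_cplx[OF l] D.extension_cplx[OF us(1)] ws])
        simp_all
    then show ?thesis using us w by (intro ext_equiv_step) (simp add: ext_step_iff)
  qed
  then show ?thesis using xs x' ext_equiv_sym ext_equiv_trans by metis
qed

text \<open>The two morphisms are added over the direct sums, and the two halves of the Baer sum are
  followed separately: the pullback half in \<open>D\<close>, after transposition, by the universal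
  property of \<open>us\<close>, the pushout half in \<open>C\<close> by that of \<open>vs\<close>.
  Crossing the adjunction replaces an argument that \<open>L\<close> and \<open>R\<close> preserve
  these squares.\<close>

lemma corr_baer_sum:
  assumes c: "corr n X Y zs xs" "corr n X Y zs' xs'"
    and vs: "is_extension C n X (fob R Y) vs" "is_baer_sum C n X (fob R Y) zs zs' vs"
    and ws: "is_extension D n (fob L X) Y ws" "is_baer_sum D n (fob L X) Y xs xs' ws"
  shows "corr n X Y vs ws"
proof -
  have xs: "is_extension D n (fob L X) Y xs" "is_extension D n (fob L X) Y xs'"
    and zs: "is_extension C n X (fob R Y) zs" "is_extension C n X (fob R Y) zs'"
    and z: "ext_mor C zs (map (far R) xs) (Ide C (fob R Y)) (unit X)"
      "ext_mor C zs' (map (far R) xs') (Ide C (fob R Y)) (unit X)"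
    using c by (simp_all add: corr_def)
  have X: "X \<in> Obj C" and Y: "Y \<in> Obj D" using C.extension_obj[OF zs(1)] D.extension_obj[OF xs(1)]
    by auto
  note l = zs[THEN extension_length] xs[THEN extension_length]
  obtain es i j p q diag codiag ts where e: "is_ext_direct_sum C zs zs' es i j p q"
    "is_extension C n (vert C es (Suc n)) (vert C es 0) es"
    and diag: "diag \<in> Arr C" "Dom C diag = X" "Cod C diag = vert C es (Suc n)"
      "p ! Suc n \<cdot>\<^bsub>C\<^esub> diag = Ide C X" "q ! Suc n \<cdot>\<^bsub>C\<^esub> diag = Ide C X"
    and codiag: "codiag \<in> Arr C" "Dom C codiag = vert C es 0" "Cod C codiag = fob R Y"
      "codiag \<cdot>\<^bsub>C\<^esub> i ! 0 = Ide C (fob R Y)" "codiag \<cdot>\<^bsub>C\<^esub> j ! 0 = Ide C (fob R Y)"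
    and ts: "is_ext_pullback C es diag ts" "is_ext_pushout C codiag ts vs"
      "is_extension C n X (vert C es 0) ts"
    using C.baer_sumE[OF vs zs] .
  obtain ds i' j' p' q' diag' codiag' us where d: "is_ext_direct_sum D xs xs' ds i' j' p' q'"
    "is_extension D n (vert D ds (Suc n)) (vert D ds 0) ds"
    and diag': "diag' \<in> Arr D" "Dom D diag' = fob L X" "Cod D diag' = vert D ds (Suc n)"
      "p' ! Suc n \<cdot>\<^bsub>D\<^esub> diag' = Ide D (fob L X)" "q' ! Suc n \<cdot>\<^bsub>D\<^esub> diag' = Ide D (fob L X)"
    and codiag': "codiag' \<in> Arr D" "Dom D codiag' = vert D ds 0" "Cod D codiag' = Y"
      "codiag' \<cdot>\<^bsub>D\<^esub> i' ! 0 = Ide D Y" "codiag' \<cdot>\<^bsub>D\<^esub> j' ! 0 = Ide D Y"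
    and us: "is_ext_pullback D ds diag' us" "is_ext_pushout D codiag' us ws"
      "is_extension D n (fob L X) (vert D ds 0) us"
    using D.baer_sumE[OF ws xs] .
  note ce = C.direct_sumE[OF e(1) zs] and cd = D.direct_sumE[OF d(1) xs]
  obtain \<phi> where f: "\<And>k. k \<le> Suc n \<Longrightarrow> \<phi> k \<in> Arr C"
    "\<And>k. k \<le> Suc n \<Longrightarrow> Dom C (\<phi> k) = vert C zs k"
      "\<And>k. k \<le> Suc n \<Longrightarrow> Cod C (\<phi> k) = vert C (map (far R) xs) k"
    "\<And>k. k < Suc n \<Longrightarrow> \<phi> (Suc k) \<cdot>\<^bsub>C\<^esub> zs ! k = map (far R) xs ! k \<cdot>\<^bsub>C\<^esub> \<phi> k" "\<phi> 0 = Ide C (fob R Y)"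
      "\<phi> (Suc n) = unit X"
    using ext_morE[OF z(1)] l by metis
  obtain \<phi>' where f': "\<And>k. k \<le> Suc n \<Longrightarrow> \<phi>' k \<in> Arr C"
    "\<And>k. k \<le> Suc n \<Longrightarrow> Dom C (\<phi>' k) = vert C zs' k"
      "\<And>k. k \<le> Suc n \<Longrightarrow> Cod C (\<phi>' k) = vert C (map (far R) xs') k"
    "\<And>k. k < Suc n \<Longrightarrow> \<phi>' (Suc k) \<cdot>\<^bsub>C\<^esub> zs' ! k = map (far R) xs' ! k \<cdot>\<^bsub>C\<^esub> \<phi>' k"
      "\<phi>' 0 = Ide C (fob R Y)" "\<phi>' (Suc n) = unit X"
    using ext_morE[OF z(2)] l by metis
  have Rv: "vert C (map (far R) xs) k = fob R (vert D xs k)"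
    "vert C (map (far R) xs') k = fob R (vert D xs' k)"
    "vert C (map (far R) ds) k = fob R (vert D ds k)" if "k \<le> Suc n" for k
    using R_vert D.extension_cplx xs d(2) l cd(1) that by simp_all
  \<comment> \<open>The sum of \<open>\<phi>\<close> and \<open>\<phi>'\<close>. The injections of
    \<open>ds\<close> are put under \<open>R\<close>, so the target is \<open>R ds\<close> itself
    and not another direct sum of the images of \<open>xs\<close> and \<open>xs'\<close>.\<close>
  define \<psi> where "\<psi> k = Add C (far R (i' ! k) \<cdot>\<^bsub>C\<^esub> \<phi> k \<cdot>\<^bsub>C\<^esub> p ! k) (far R (j' ! k) \<cdot>\<^bsub>C\<^esub> \<phi>' k \<cdot>\<^bsub>C\<^esub> q
    ! k)" for k
  have psi: "\<psi> k \<in> Arr C" "Dom C (\<psi> k) = vert C es k" "Cod C (\<psi> k) = fob R (vert D ds k)"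
    if k: "k \<le> Suc n" for k
    using C.biproduct_arr[OF ce(2)[OF k]] D.biproduct_arr[OF cd(2)[OF k]] f(1-3)[OF k] f'(1-3)[OF k]
      Rv[OF k]
    unfolding \<psi>_def by simp_all
  have "ext_mor C es (map (far R) ds) (\<psi> 0) (\<psi> (Suc n))"
  proof (rule ext_morI[of _ _ \<psi>])
    fix k assume "k < length es"
    then have k: "k \<le> n" "k \<le> Suc n" "Suc k \<le> Suc n" "k < Suc n" using ce(1) by auto
    note [simp] = C.biproduct_arr(1-12)[OF ce(2)[OF k(2)]] D.biproduct_arr(1-12)[OF cd(2)[OF k(2)]]
       C.biproduct_arr(1-12)[OF ce(2)[OF k(3)]] D.biproduct_arr(1-12)[OF cd(2)[OF k(3)]]
       f(1-3)[OF k(2)] f'(1-3)[OF k(2)] Rv[OF k(2)] f(1-3)[OF k(3)] f'(1-3)[OF k(3)] Rv[OF k(3)]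
       C.extension_nth[OF zs(1) k(1)] C.extension_nth[OF zs(2) k(1)] D.extension_nth[OF xs(1) k(1)]
         D.extension_nth[OF xs(2) k(1)]
       C.extension_nth[OF e(2) k(1)] D.extension_nth[OF d(2) k(1)]
    note [simp del] = vert_simps
    have "far R (i' ! Suc k \<cdot>\<^bsub>D\<^esub> xs ! k) = far R (ds ! k \<cdot>\<^bsub>D\<^esub> i' ! k)" using cd(3)[OF k(1)] by simp
    then have ri: "far R (i' ! Suc k) \<cdot>\<^bsub>C\<^esub> far R (xs ! k) = far R (ds ! k) \<cdot>\<^bsub>C\<^esub> far R (i' ! k)"
      by simp
    have "far R (j' ! Suc k \<cdot>\<^bsub>D\<^esub> xs' ! k) = far R (ds ! k \<cdot>\<^bsub>D\<^esub> j' ! k)" using cd(4)[OF k(1)] by simp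
    then have rj: "far R (j' ! Suc k) \<cdot>\<^bsub>C\<^esub> far R (xs' ! k) = far R (ds ! k) \<cdot>\<^bsub>C\<^esub> far R (j' ! k)"
      by simp
    have "far R (i' ! Suc k) \<cdot>\<^bsub>C\<^esub> \<phi> (Suc k) \<cdot>\<^bsub>C\<^esub> p ! Suc k \<cdot>\<^bsub>C\<^esub> es ! k = far R (i' ! Suc k) \<cdot>\<^bsub>C\<^esub>
      \<phi> (Suc k) \<cdot>\<^bsub>C\<^esub> zs ! k \<cdot>\<^bsub>C\<^esub> p ! k"
      using ce(5)[OF k(1)] by simp
    also have "\<phi> (Suc k) \<cdot>\<^bsub>C\<^esub> zs ! k \<cdot>\<^bsub>C\<^esub> p ! k = far R (xs ! k) \<cdot>\<^bsub>C\<^esub> \<phi> k \<cdot>\<^bsub>C\<^esub> p ! k"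
      using f(4)[OF k(4)] l k by (intro C.comp_square) simp_all
    also have "far R (i' ! Suc k) \<cdot>\<^bsub>C\<^esub> far R (xs ! k) \<cdot>\<^bsub>C\<^esub> \<phi> k \<cdot>\<^bsub>C\<^esub> p ! k = far R (ds ! k) \<cdot>\<^bsub>C\<^esub> far
      R (i' ! k) \<cdot>\<^bsub>C\<^esub> \<phi> k \<cdot>\<^bsub>C\<^esub> p ! k"
      using ri by (intro C.comp_square) simp_all
    finally have 1: "far R (i' ! Suc k) \<cdot>\<^bsub>C\<^esub> \<phi> (Suc k) \<cdot>\<^bsub>C\<^esub> p ! Suc k \<cdot>\<^bsub>C\<^esub> es ! k =
      far R (ds ! k) \<cdot>\<^bsub>C\<^esub> far R (i' ! k) \<cdot>\<^bsub>C\<^esub> \<phi> k \<cdot>\<^bsub>C\<^esub> p ! k" .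
    have "far R (j' ! Suc k) \<cdot>\<^bsub>C\<^esub> \<phi>' (Suc k) \<cdot>\<^bsub>C\<^esub> q ! Suc k \<cdot>\<^bsub>C\<^esub> es ! k = far R (j' ! Suc k) \<cdot>\<^bsub>C\<^esub> \<phi>'
      (Suc k) \<cdot>\<^bsub>C\<^esub> zs' ! k \<cdot>\<^bsub>C\<^esub> q ! k"
      using ce(6)[OF k(1)] by simp
    also have "\<phi>' (Suc k) \<cdot>\<^bsub>C\<^esub> zs' ! k \<cdot>\<^bsub>C\<^esub> q ! k = far R (xs' ! k) \<cdot>\<^bsub>C\<^esub> \<phi>' k \<cdot>\<^bsub>C\<^esub> q ! k"
      using f'(4)[OF k(4)] l k by (intro C.comp_square) simp_all
    also have "far R (j' ! Suc k) \<cdot>\<^bsub>C\<^esub> far R (xs' ! k) \<cdot>\<^bsub>C\<^esub> \<phi>' k \<cdot>\<^bsub>C\<^esub> q ! k =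
      far R (ds ! k) \<cdot>\<^bsub>C\<^esub> far R (j' ! k) \<cdot>\<^bsub>C\<^esub> \<phi>' k \<cdot>\<^bsub>C\<^esub> q ! k"
      using rj by (intro C.comp_square) simp_all
    finally have 2: "far R (j' ! Suc k) \<cdot>\<^bsub>C\<^esub> \<phi>' (Suc k) \<cdot>\<^bsub>C\<^esub> q ! Suc k \<cdot>\<^bsub>C\<^esub> es ! k =
      far R (ds ! k) \<cdot>\<^bsub>C\<^esub> far R (j' ! k) \<cdot>\<^bsub>C\<^esub> \<phi>' k \<cdot>\<^bsub>C\<^esub> q ! k" .
    show "\<psi> (Suc k) \<cdot>\<^bsub>C\<^esub> es ! k = map (far R) ds ! k \<cdot>\<^bsub>C\<^esub> \<psi> k"
      using 1 2 cd(1) k by (simp add: \<psi>_def)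
  qed (use ce(1) cd(1) psi Rv in \<open>simp_all del: vert_simps\<close>)
  note ct = ts(3)[THEN C.extension_cplx] and cdr = d(2)[THEN R_extension, THEN C.extension_cplx]
  have Xo: "n \<le> Suc n" "0 \<le> Suc n" "Suc n \<le> Suc n" by auto
  note b0 = ce(2)[OF Xo(2)] cd(2)[OF Xo(2)] and b1 = ce(2)[OF Xo(3)] cd(2)[OF Xo(3)]
  have o: "vert C es 0 \<in> Obj C" "vert D ds (Suc n) \<in> Obj D" "vert D ds 0 \<in> Obj D"
    "vert C es (Suc n) \<in> Obj C"
    using C.biproduct_arr(19)[OF b0(1)] D.biproduct_arr(19)[OF b0(2)] C.biproduct_arr(19)[OF b1(1)]
      D.biproduct_arr(19)[OF b1(2)] by blast+
  have v: "vert C zs 0 = fob R Y" "vert C zs' 0 = fob R Y" "vert D xs 0 = Y" "vert D xs' 0 = Y"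
    "vert C zs (Suc n) = X" "vert C zs' (Suc n) = X" "vert D xs (Suc n) = fob L X"
      "vert D xs' (Suc n) = fob L X"
    using extension_ends[OF zs(1)] extension_ends[OF zs(2)] extension_ends[OF xs(1)]
      extension_ends[OF xs(2)] by simp_all
  note vb0 = b0[unfolded v] and vb1 = b1[unfolded v]
  \<comment> \<open>At the right end \<open>\<phi>\<close> and \<open>\<phi>'\<close> are the unit,
    and on the diagonal both projections are identities. What remains is \<open>R\<close> of the sum
    of the injections, which is \<open>diag'\<close>, after the unit, and that is the transpose of
    \<open>diag'\<close>.\<close>
  have vdiag: "\<psi> (Suc n) \<cdot>\<^bsub>C\<^esub> diag = \<Phi> X (vert D ds (Suc n)) diag'"
  proof -
    note [simp] = C.biproduct_arr(1-12)[OF vb1(1)] D.biproduct_arr(1-12)[OF vb1(2)] diag diag' X o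
    note [simp del] = vert_simps
    have "\<psi> (Suc n) \<cdot>\<^bsub>C\<^esub> diag = Add C (far R (i' ! Suc n)) (far R (j' ! Suc n)) \<cdot>\<^bsub>C\<^esub> unit X"
      by (simp add: \<psi>_def f f')
    also have "\<dots> = far R (Add D (i' ! Suc n) (j' ! Suc n)) \<cdot>\<^bsub>C\<^esub> unit X" by (subst R_add) simp_all
    also have "Add D (i' ! Suc n) (j' ! Suc n) = diag'"
      using D.biproduct_expand[OF vb1(2), of diag'] by simp
    also have "far R diag' \<cdot>\<^bsub>C\<^esub> unit X = \<Phi> X (Cod D diag') diag'"
      using transpose_right[of X "Ide D (fob L X)" diag'] by (simp add: unit_def)
    finally show ?thesis by simp
  qed
  \<comment> \<open>At the left end \<open>\<phi>\<close> and \<open>\<phi>'\<close> are identities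
    and \<open>R codiag'\<close> undoes both injections. What remains is the sum of the projections,
    which is \<open>codiag\<close>.\<close>
  have ucod: "far R codiag' \<cdot>\<^bsub>C\<^esub> \<psi> 0 = codiag"
  proof -
    note [simp] = C.biproduct_arr(1-12)[OF vb0(1)] D.biproduct_arr(1-12)[OF vb0(2)] codiag codiag' Y
      o
    note [simp del] = vert_simps
    have "far R (codiag' \<cdot>\<^bsub>D\<^esub> i' ! 0) = Ide C (fob R Y)" by simp
    then have ci: "far R codiag' \<cdot>\<^bsub>C\<^esub> far R (i' ! 0) = Ide C (fob R Y)"
      by (subst (asm) functor_simps(6)[OF R_functor]) simp_all
    have "far R (codiag' \<cdot>\<^bsub>D\<^esub> j' ! 0) = Ide C (fob R Y)" by simp
    then have cj: "far R codiag' \<cdot>\<^bsub>C\<^esub> far R (j' ! 0) = Ide C (fob R Y)"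
      by (subst (asm) functor_simps(6)[OF R_functor]) simp_all
    have "far R codiag' \<cdot>\<^bsub>C\<^esub> \<psi> 0 = Add C (p ! 0) (q ! 0)"
      using C.comp_shift[OF ci, of "p ! 0"] C.comp_shift[OF cj, of "q ! 0"]
        by (simp add: \<psi>_def f f')
    also have "\<dots> = codiag" using C.biproduct_expand'[OF vb0(1), of codiag] by simp
    finally show ?thesis .
  qed
  \<comment> \<open>\<open>\<psi> 0\<close> is written as a transpose so that the left end, too, can
    cross the adjunction and back.\<close>
  obtain u where u: "u \<in> Arr D" "Dom D u = fob L (vert C es 0)" "Cod D u = vert D ds 0"
    "\<Phi> (vert C es 0) (vert D ds 0) u = \<psi> 0"
    using transpose_surj[OF o(1,3) psi[OF Xo(2)]] .

  have "ext_mor C ts (map (far R) ds) (\<psi> 0 \<cdot>\<^bsub>C\<^esub> Ide C (vert C es 0)) (\<psi> (Suc n) \<cdot>\<^bsub>C\<^esub> diag)"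
    by (rule C.ext_mor_comp[OF C.ext_pullback_mor[OF e(2) ts(1)] \<open>ext_mor C es (map (far R) ds)
      (\<psi> 0) (\<psi> (Suc n))\<close>])
       (use ct cdr C.extension_cplx[OF e(2)] in simp_all)
  then have "ext_mor C ts (map (far R) ds) (\<Phi> (vert C es 0) (vert D ds 0) u) (\<Phi> X (vert D ds (Suc
    n)) diag')"
    using vdiag u psi[OF Xo(2)] by simp
  then have "ext_mor D (map (far L) ts) ds u diag'"
    using transpose_ext_mor[OF ct D.extension_cplx[OF d(2)], of u diag']
      u diag' extension_length[OF ts(3)]
      extension_ends[OF ts(3)] by simp
  then have "ext_mor D (map (far L) ts) ds u (diag' \<cdot>\<^bsub>D\<^esub> Ide D (fob L X))" using diag' by simp
  then have "ext_mor D (map (far L) ts) us u (Ide D (fob L X))"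
    using D.extension_last[OF L_extension[OF ts(3)]] diag' X
    by (intro D.ext_pullback_factor[OF d(2) D.extension_cplx[OF L_extension[OF ts(3)]] us(1)])
      simp_all
  then have "ext_mor C ts (map (far R) us) (\<psi> 0) (unit X)"
    using transpose_ext_mor[OF ct D.extension_cplx[OF us(3)], of u "Ide D (fob L X)"]
      u X extension_length[OF ts(3)]
      extension_ends[OF ts(3)] extension_ends[OF us(3)] by (simp add: unit_def)
  moreover have "ext_mor D us ws codiag' (Ide D (fob L X))"
    using D.ext_pushout_mor[OF D.extension_cplx[OF us(3)] us(2)] D.extension_last[OF us(3)] by simp
  ultimately have "ext_mor C ts (map (far R) ws) (far R codiag' \<cdot>\<^bsub>C\<^esub> \<psi> 0) (far R (Ide D (fob L X))
    \<cdot>\<^bsub>C\<^esub> unit X)"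
    using C.ext_mor_comp R_ext_mor ct D.extension_cplx[OF us(3)] D.extension_cplx[OF ws(1)]
      R_extension[OF us(3), THEN C.extension_cplx] R_extension[OF ws(1), THEN C.extension_cplx]
        by blast
  then have "ext_mor C ts (map (far R) ws) (Ide C (fob R Y) \<cdot>\<^bsub>C\<^esub> codiag) (unit X)"
    using ucod codiag X by simp
  then have "ext_mor C vs (map (far R) ws) (Ide C (fob R Y)) (unit X)"
    using codiag Y extension_ends[OF R_extension[OF ws(1)]]
    by (intro C.ext_pushout_factor[OF ct R_extension[OF ws(1), THEN C.extension_cplx] ts(2)])
      simp_all
  then show ?thesis using vs ws by (simp add: corr_def)
qed

end

section \<open>Baer sums of classes\<close>

context abelian_category
begin

text \<open>For the identity adjunction \<open>corr\<close> becomes \<open>ext_step\<close>, and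
  \<open>corr_baer_sum\<close> says that Baer sums respect steps.\<close>

lemma identity_adjunction: "exact_adjunction C C \<lparr>fob = \<lambda>x. x, far = \<lambda>x. x\<rparr> \<lparr>fob = \<lambda>x. x, far =
  \<lambda>x. x\<rparr> (\<lambda>_ _ h. h)"
  by unfold_locales (auto simp: is_exact_functor_def is_functor_def bij_betw_def)

text \<open>The two zigzags may differ in length and in the directions of their steps, so one
  argument is moved at a time while the other makes a reflexive step.\<close>

lemma baer_sum_equiv:
  assumes n: "n \<ge> 1" and x: "(xs, xs') \<in> ext_equiv C n A B" and y: "(ys, ys') \<in> ext_equiv C n A B"
    and ws: "is_baer_sum C n A B xs ys ws" "is_extension C n A B ws"
      "is_baer_sum C n A B xs' ys' ws'" "is_extension C n A B ws'"
  shows "(ws, ws') \<in> ext_equiv C n A B"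
proof -
  interpret I: exact_adjunction C C "\<lparr>fob = \<lambda>x. x, far = \<lambda>x. x\<rparr>" "\<lparr>fob = \<lambda>x. x, far = \<lambda>x. x\<rparr>"
    "\<lambda>_ _ h. h" by (rule identity_adjunction)
  have corr: "I.corr n A B us vs \<longleftrightarrow> (us, vs) \<in> ext_step C n A B" for us vs
    unfolding I.corr_def I.unit_def ext_step_iff by simp
  have st: "(vs, vs') \<in> ext_equiv C n A B" if "(us, us') \<in> ext_step C n A B"
    "(ts, ts') \<in> ext_step C n A B"
    "is_baer_sum C n A B us ts vs" "is_extension C n A B vs" "is_baer_sum C n A B us' ts' vs'"
      "is_extension C n A B vs'" for us us' ts ts' vs vs'
    using I.corr_baer_sum[of n A B us us' ts ts' vs vs'] that
      by (intro ext_equiv_step) (simp add: corr)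
  note ex = ext_equiv_extension[OF x] ext_equiv_extension[OF y]
  obtain us where us: "is_baer_sum C n A B xs' ys us" "is_extension C n A B us"
    using ex_baer_sum[OF ex(2,3) n] .
  have "(ws, us) \<in> ext_equiv C n A B"
  proof (rule ext_equiv_transfer[where G = "\<lambda>xs. is_baer_sum C n A B xs ys", OF _ _ x ws(1) us(1)
    ws(2) us(2)])
    show "\<exists>ws. is_extension C n A B ws \<and> is_baer_sum C n A B xs ys ws" if "is_extension C n A B xs"
      for xs
      using ex_baer_sum[OF that ex(3) n] by blast
  qed (use st ext_step_refl[OF ex(3)] in blast)
  moreover have "(us, ws') \<in> ext_equiv C n A B"
  proof (rule ext_equiv_transfer[where G = "\<lambda>ys. is_baer_sum C n A B xs' ys", OF _ _ y us(1) ws(3)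
    us(2) ws(4)])
    show "\<exists>ws. is_extension C n A B ws \<and> is_baer_sum C n A B xs' ys ws" if "is_extension C n A B ys"
      for ys
      using ex_baer_sum[OF ex(2) that n] by blast
  qed (use st ext_step_refl[OF ex(2)] in blast)
  ultimately show ?thesis by (rule ext_equiv_trans)
qed

lemma Ext_mult_class:
  assumes n: "n \<ge> 1" and xs: "is_extension C n A B xs" and ys: "is_extension C n A B ys"
    and ws: "is_baer_sum C n A B xs ys ws" "is_extension C n A B ws"
  shows "mult (Ext C n A B) (ext_equiv C n A B `` {xs}) (ext_equiv C n A B `` {ys}) =
    ext_equiv C n A B `` {ws}"
proof -
  have "ext_equiv C n A B `` {vs. \<exists>us\<in>ext_equiv C n A B `` {xs}. \<exists>ts\<in>ext_equiv C n A B `` {ys}.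
    is_baer_sum C n A B us ts vs}
      = ext_equiv C n A B `` {ws}" (is "_ `` ?S = _")
  proof (intro Set.set_eqI iffI)
    fix zs assume "zs \<in> ext_equiv C n A B `` ?S"
    then obtain us ts vs where "(xs, us) \<in> ext_equiv C n A B" "(ys, ts) \<in> ext_equiv C n A B"
      "is_baer_sum C n A B us ts vs"
      and v: "(vs, zs) \<in> ext_equiv C n A B" by blast
    then have "(ws, vs) \<in> ext_equiv C n A B"
      using baer_sum_equiv[OF n _ _ ws] ext_equiv_extension(1)[OF v] by blast
    with v show "zs \<in> ext_equiv C n A B `` {ws}" by (auto intro: ext_equiv_trans)
  next
    fix zs assume z: "zs \<in> ext_equiv C n A B `` {ws}"
    have "ws \<in> ?S" using ws(1) ext_equiv_refl[OF xs] ext_equiv_refl[OF ys] by blast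
    with z show "zs \<in> ext_equiv C n A B `` ?S" by blast
  qed
  then show ?thesis by (simp add: Ext_def)
qed

end

section \<open>The isomorphism on Ext\<close>

context exact_adjunction
begin

lemma corr_class:
  assumes c: "corr n X Y zs xs" and n: "n \<ge> 1"
  shows "ext_equiv C n X (fob R Y) `` {us. \<exists>ys\<in>ext_equiv D n (fob L X) Y `` {xs}. corr n X Y us ys}
    = ext_equiv C n X (fob R Y) `` {zs}"
proof (rule D.ext_class_transfer[where G = "\<lambda>xs zs. corr n X Y zs xs"])
  have e: "is_extension C n X (fob R Y) zs" "is_extension D n (fob L X) Y xs" using c
    by (simp_all add: corr_def)
  then show "is_extension C n X (fob R Y) zs" "is_extension D n (fob L X) Y xs" by auto
  show "\<exists>ws. is_extension C n X (fob R Y) ws \<and> corr n X Y ws us"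
    if "is_extension D n (fob L X) Y us" for us
    using ex_corr_left[OF that C.extension_obj(1)[OF e(1)] n] corr_def by metis
qed (use c corr_step_left n in blast)+

text \<open>Well-definedness in the direction from \<open>C\<close> to \<open>D\<close>, which is
  what makes the map on classes injective.\<close>

lemma corr_equiv:
  assumes c: "corr n X Y zs xs" "corr n X Y zs' xs'" and z: "(zs, zs') \<in> ext_equiv C n X (fob R Y)"
    and n: "n \<ge> 1"
  shows "(xs, xs') \<in> ext_equiv D n (fob L X) Y"
proof (rule C.ext_equiv_transfer[where G = "corr n X Y", OF _ _ z c])
  have e: "is_extension D n (fob L X) Y xs" "is_extension D n (fob L X) Y xs'" using c
    by (simp_all add: corr_def)
  then show "is_extension D n (fob L X) Y xs" "is_extension D n (fob L X) Y xs'" by auto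
  show "\<exists>ws. is_extension D n (fob L X) Y ws \<and> corr n X Y us ws"
    if "is_extension C n X (fob R Y) us" for us
    using ex_corr_right[OF that D.extension_obj(2)[OF e(1)] n] corr_def by metis
qed (use corr_step_right n in blast)

text \<open>The composite of \<open>zs \<rightarrow> R xs\<close> and
  \<open>R xs \<rightarrow> R xs'\<close> has left end \<open>R y\<close>, hence descends to the
  pushout \<open>zs'\<close>.\<close>

lemma corr_push:
  assumes c: "corr n X Y zs xs" and xs': "is_ext_pushout D y xs xs'"
    and zs': "is_ext_pushout C (far R y) zs zs'"
  shows "corr n X (Cod D y) zs' xs'"
proof -
  have e: "is_extension C n X (fob R Y) zs" "is_extension D n (fob L X) Y xs"
    and m: "ext_mor C zs (map (far R) xs) (Ide C (fob R Y)) (unit X)" using c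
      by (simp_all add: corr_def)
  have y: "y \<in> Arr D" "Dom D y = Y" using D.ext_pushout_arr[OF xs'] e(2)
    by (auto simp: is_extension_iff)
  note e' = C.ext_pushout_extension[OF e(1) zs'] D.ext_pushout_extension[OF e(2) xs']
  have o: "X \<in> Obj C" "Y \<in> Obj D" using C.extension_obj[OF e(1)] D.extension_obj[OF e(2)] by auto
  note cc = C.extension_cplx[OF e(1)] R_extension[OF e(2), THEN C.extension_cplx]
    R_extension[OF e'(2), THEN C.extension_cplx]
  have "ext_mor D xs xs' y (Ide D (fob L X))"
    using D.ext_pushout_mor[OF D.extension_cplx[OF e(2)] xs'] D.extension_last[OF e(2)] by simp
  from C.ext_mor_comp[OF m R_ext_mor[OF this] cc]
    have "ext_mor C zs (map (far R) xs') (Ide C (fob R (Cod D y)) \<cdot>\<^bsub>C\<^esub> far R y) (unit X)"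
    using e e' o y D.extension_cplx by simp
  then have "ext_mor C zs' (map (far R) xs') (Ide C (fob R (Cod D y))) (unit X)"
    using y extension_ends[OF R_extension[OF e'(2)]] by (intro C.ext_pushout_factor[OF cc(1,3) zs'])
      simp_all
  then show ?thesis using e' y by (simp add: corr_def)
qed

text \<open>The pullback \<open>xs'\<close> lives in \<open>D\<close>, so the composite of
  \<open>zs' \<rightarrow> zs\<close> and \<open>zs \<rightarrow> R xs\<close> is first transposed.
  Its right end \<open>unit X \<cdot> x\<close> becomes \<open>far L x\<close>, and the transposed
  morphism factors through \<open>xs'\<close>.\<close>

lemma corr_pull:
  assumes c: "corr n X Y zs xs" and xs': "is_ext_pullback D xs (far L x) xs'"
    and zs': "is_ext_pullback C zs x zs'"
  shows "corr n (Dom C x) Y zs' xs'"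
proof -
  have e: "is_extension C n X (fob R Y) zs" "is_extension D n (fob L X) Y xs" using c
    by (simp_all add: corr_def)
  have x: "x \<in> Arr C" "Cod C x = X" using C.ext_pullback_arr[OF zs'] e(1)
    by (auto simp: is_extension_iff)
  note e' = C.ext_pullback_extension[OF e(1) zs'] D.ext_pullback_extension[OF e(2) xs']
  have o: "X \<in> Obj C" "Y \<in> Obj D" using C.extension_obj[OF e(1)] D.extension_obj[OF e(2)] by auto
  note l = L_extension[OF e'(1)]
  obtain \<epsilon> where \<epsilon>: "\<epsilon> \<in> Arr D" "Dom D \<epsilon> = fob L (fob R Y)" "Cod D \<epsilon> = Y"
    "\<Phi> (fob R Y) Y \<epsilon> = Ide C (fob R Y)" using ex_counit[OF o(2)] .
  have e'': "is_extension D n (fob L (Dom C x)) Y xs'" using e'(2) x by simp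
  let ?u = "unit (Dom C x)"
  have m: "ext_mor C zs (map (far R) xs) (Ide C (fob R Y)) (unit X)" using c by (simp add: corr_def)
  have "ext_mor C zs' (map (far R) xs) (Ide C (fob R Y)) (unit X \<cdot>\<^bsub>C\<^esub> x)"
    using C.ext_mor_comp[OF C.ext_pullback_mor[OF e(1) zs'] m] C.extension_cplx[OF e'(1)]
      C.extension_cplx[OF e(1)]
       R_extension[OF e(2), THEN C.extension_cplx] o by simp
  also have "unit X \<cdot>\<^bsub>C\<^esub> x = \<Phi> (Dom C x) (fob L X) (far L x)"
    using transpose_left[of x "Ide D (fob L X)" "fob L X"] x o by (simp add: unit_def)
  finally have "ext_mor D (map (far L) zs') xs \<epsilon> (far L x)"
    using transpose_ext_mor[OF C.extension_cplx[OF e'(1)] D.extension_cplx[OF e(2)], of \<epsilon> "far L x"]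
      \<epsilon> x
      extension_ends[OF e(2)] extension_ends[OF e'(1)] extension_length[OF e'(1)] by simp
  then have "ext_mor D (map (far L) zs') xs \<epsilon> (far L x \<cdot>\<^bsub>D\<^esub> Ide D (fob L (Dom C x)))" using x
    by simp
  then have "ext_mor D (map (far L) zs') xs' \<epsilon> (Ide D (fob L (Dom C x)))"
    using D.extension_last[OF l] x
      by (intro D.ext_pullback_factor[OF e(2) D.extension_cplx[OF l] xs']) simp_all
  then show ?thesis using corr_transpose[OF e'(1) e'' _ \<epsilon>] x by simp
qed

theorem Ext_natural_iso:
  assumes n: "n \<ge> 1"
  shows "Ext_naturally_isomorphic C D L R n"
proof -
  \<comment> \<open>Defined by saturation, so that no representative is chosen; on the class of
    \<open>xs\<close> the value is the class of any corresponding \<open>zs\<close>.\<close>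
  define \<Psi> where "\<Psi> X Y \<xi> = ext_equiv C n X (fob R Y) `` {us. \<exists>ys\<in>\<xi>. corr n X Y us ys}" for X Y \<xi>
  have cls: "\<Psi> X Y (ext_equiv D n (fob L X) Y `` {xs}) = ext_equiv C n X (fob R Y) `` {zs}"
    if "corr n X Y zs xs" for X Y xs zs
    unfolding \<Psi>_def by (rule corr_class[OF that n])
  have corrE: "\<exists>xs zs. is_extension D n (fob L X) Y xs \<and> is_extension C n X (fob R Y) zs \<and>
    corr n X Y zs xs \<and> \<xi> = ext_equiv D n (fob L X) Y `` {xs}"
    if "\<xi> \<in> carrier (Ext D n (fob L X) Y)" "X \<in> Obj C" for X Y \<xi>
    using Ext_carrierE[OF that(1)] ex_corr_left[OF _ that(2) n] corr_def by metis
  show ?thesis unfolding Ext_naturally_isomorphic_def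
  proof (intro exI[of _ \<Psi>] conjI ballI)
    fix X Y assume X: "X \<in> Obj C" and Y: "Y \<in> Obj D"
    let ?E = "Ext D n (fob L X) Y" and ?F = "Ext C n X (fob R Y)"
    have cl: "\<Psi> X Y \<xi> \<in> carrier ?F" if "\<xi> \<in> carrier ?E" for \<xi>
      using corrE[OF that X] cls Ext_carrierI by metis
    have "\<Psi> X Y (mult ?E \<xi> \<zeta>) = mult ?F (\<Psi> X Y \<xi>) (\<Psi> X Y \<zeta>)" if xz: "\<xi> \<in> carrier ?E"
      "\<zeta> \<in> carrier ?E" for \<xi> \<zeta>
    proof -
      obtain xs zs where x: "is_extension D n (fob L X) Y xs" "is_extension C n X (fob R Y) zs"
        "corr n X Y zs xs" "\<xi> = ext_equiv D n (fob L X) Y `` {xs}"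
        using corrE[OF xz(1) X] by blast
      obtain xs' zs' where x': "is_extension D n (fob L X) Y xs'" "is_extension C n X (fob R Y) zs'"
        "corr n X Y zs' xs'" "\<zeta> = ext_equiv D n (fob L X) Y `` {xs'}"
        using corrE[OF xz(2) X] by blast
      obtain ws where ws: "is_baer_sum D n (fob L X) Y xs xs' ws" "is_extension D n (fob L X) Y ws"
        using D.ex_baer_sum[OF x(1) x'(1) n] .
      obtain vs where vs: "is_baer_sum C n X (fob R Y) zs zs' vs" "is_extension C n X (fob R Y) vs"
        using C.ex_baer_sum[OF x(2) x'(2) n] .
      have "corr n X Y vs ws" by (rule corr_baer_sum[OF x(3) x'(3) vs(2,1) ws(2,1)])
      then show ?thesis unfolding x(4) x'(4)
        using D.Ext_mult_class[OF n x(1) x'(1) ws] C.Ext_mult_class[OF n x(2) x'(2) vs]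
          cls x(3) x'(3) by simp
    qed
    moreover have "inj_on (\<Psi> X Y) (carrier ?E)"
    proof (rule inj_onI)
      fix \<xi> \<zeta> assume xz: "\<xi> \<in> carrier ?E" "\<zeta> \<in> carrier ?E" and eq: "\<Psi> X Y \<xi> = \<Psi> X Y \<zeta>"
      obtain xs zs where x: "is_extension D n (fob L X) Y xs" "is_extension C n X (fob R Y) zs"
        "corr n X Y zs xs" "\<xi> = ext_equiv D n (fob L X) Y `` {xs}"
        using corrE[OF xz(1) X] by blast
      obtain xs' zs' where x': "is_extension D n (fob L X) Y xs'" "is_extension C n X (fob R Y) zs'"
        "corr n X Y zs' xs'" "\<zeta> = ext_equiv D n (fob L X) Y `` {xs'}"
        using corrE[OF xz(2) X] by blast
      have "ext_equiv C n X (fob R Y) `` {zs} = ext_equiv C n X (fob R Y) `` {zs'}"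
        using eq x x' cls by simp
      then have "(zs, zs') \<in> ext_equiv C n X (fob R Y)" using ext_equiv_refl[OF x'(2)] by blast
      then show "\<xi> = \<zeta>" unfolding x(4) x'(4) by (intro ext_class_cong corr_equiv[OF x(3) x'(3) _ n])
    qed
    moreover have "carrier ?F \<subseteq> \<Psi> X Y ` carrier ?E"
    proof
      fix \<zeta> assume "\<zeta> \<in> carrier ?F"
      then obtain zs where zs: "is_extension C n X (fob R Y) zs"
        "\<zeta> = ext_equiv C n X (fob R Y) `` {zs}" by (rule Ext_carrierE)
      obtain xs where c: "corr n X Y zs xs" using ex_corr_right[OF zs(1) Y n] .
      then have "ext_equiv D n (fob L X) Y `` {xs} \<in> carrier ?E"
        by (intro Ext_carrierI) (simp add: corr_def)
      then show "\<zeta> \<in> \<Psi> X Y ` carrier ?E" using cls[OF c] zs(2) by blast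
    qed
    ultimately show "\<Psi> X Y \<in> iso ?E ?F" using cl unfolding iso_def hom_def bij_betw_def by auto
  next
    fix X y \<xi> assume X: "X \<in> Obj C" and y: "y \<in> Arr D"
      and "\<xi> \<in> carrier (Ext D n (fob L X) (Dom D y))"
    then obtain xs zs where x: "is_extension D n (fob L X) (Dom D y) xs"
      "is_extension C n X (fob R (Dom D y)) zs" "corr n X (Dom D y) zs xs"
      "\<xi> = ext_equiv D n (fob L X) (Dom D y) `` {xs}"
      using corrE[of \<xi> X "Dom D y"] by blast
    obtain xs' where xs': "is_ext_pushout D y xs xs'" using D.ex_ext_pushout[OF x(1) n y] by auto
    obtain zs' where zs': "is_ext_pushout C (far R y) zs zs'"
      using C.ex_ext_pushout[OF x(2) n, of "far R y"] y by auto
    show "\<Psi> X (Cod D y) (Ext_push D n (fob L X) y \<xi>) = Ext_push C n X (far R y) (\<Psi> X (Dom D y) \<xi>)"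
      unfolding x(4) cls[OF x(3)] D.Ext_push_class[OF x(1) xs' n] C.Ext_push_class[OF x(2) zs' n]
        cls[OF corr_push[OF x(3) xs' zs']]
      using y by simp
  next
    fix x Y \<xi> assume x0: "x \<in> Arr C" and Y: "Y \<in> Obj D"
      and "\<xi> \<in> carrier (Ext D n (fob L (Cod C x)) Y)"
    then obtain xs zs where x: "is_extension D n (fob L (Cod C x)) Y xs"
      "is_extension C n (Cod C x) (fob R Y) zs" "corr n (Cod C x) Y zs xs"
      "\<xi> = ext_equiv D n (fob L (Cod C x)) Y `` {xs}"
      using corrE[of \<xi> "Cod C x" Y] by auto
    obtain xs' where xs': "is_ext_pullback D xs (far L x) xs'"
      using D.ex_ext_pullback[OF x(1) n, of "far L x"] x0 by auto
    obtain zs' where zs': "is_ext_pullback C zs x zs'" using C.ex_ext_pullback[OF x(2) n x0] by auto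
    have "\<Psi> (Dom C x) Y (ext_equiv D n (fob L (Dom C x)) Y `` {xs'}) = ext_equiv C n (Dom C x) (fob
      R Y) `` {zs'}"
      by (rule cls[OF corr_pull[OF x(3) xs' zs']])
    then show "\<Psi> (Dom C x) Y (Ext_pull D n (far L x) Y \<xi>) = Ext_pull C n x (fob R Y) (\<Psi> (Cod C x) Y
      \<xi>)"
      unfolding x(4) cls[OF x(3)] D.Ext_pull_class[OF x(1) xs' n] C.Ext_pull_class[OF x(2) zs' n]
        using x0 by simp
  qed
qed

end

section \<open>Categories of representations\<close>

text \<open>Restricting supports to an ideal \<open>\<I>\<close> of sets of vertices treats \<open>Rep Q C\<close>, where \<open>\<I>\<close> consists of
  all sets, and \<open>Rep_ft Q C\<close> at once.\<close>

locale quiver_reps = abelian_category C for C :: "('o, 'm) cat" (structure) +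
  fixes Q :: "('v, 'e) quiver" and \<I> :: "'v set set"
  assumes quiver: "is_quiver Q"
    and empty_ideal: "{} \<in> \<I>"
    and subset_ideal: "A \<in> \<I> \<Longrightarrow> B \<subseteq> A \<Longrightarrow> B \<in> \<I>"
    and union_ideal: "A \<in> \<I> \<Longrightarrow> B \<in> \<I> \<Longrightarrow> A \<union> B \<in> \<I>"
begin

definition reps :: "(('v, 'e, 'o, 'm) qrep, ('v, 'e, 'o, 'm) qmor) cat" where
  "reps = full_subcat (Rep Q C) {F. Supp Q C F \<in> \<I>}"

lemma reps_sel [simp]:
  "F \<in> Obj reps \<longleftrightarrow> is_rep Q C F \<and> Supp Q C F \<in> \<I>"
  "\<phi> \<in> Arr reps \<longleftrightarrow> is_rep_mor Q C \<phi> \<and> Supp Q C (qdom \<phi>) \<in> \<I> \<and> Supp Q C (qcod \<phi>) \<in> \<I>"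
  "Dom reps = qdom" "Cod reps = qcod"
  "Ide reps F = QMor F F (\<lambda>i\<in>verts Q. Ide C (rv F i))"
  "\<psi> \<cdot>\<^bsub>reps\<^esub> \<phi> = QMor (qdom \<phi>) (qcod \<psi>) (\<lambda>i\<in>verts Q. qcmp \<psi> i \<cdot> qcmp \<phi> i)"
  "Add reps \<phi> \<psi> = QMor (qdom \<phi>) (qcod \<phi>) (\<lambda>i\<in>verts Q. Add C (qcmp \<phi> i) (qcmp \<psi> i))"
  "Zer reps F G = QMor F G (\<lambda>i\<in>verts Q. Zer C (rv F i) (rv G i))"
  by (auto simp: reps_def full_subcat_def Rep_def)

lemma arrow_verts [simp]: "\<alpha> \<in> arrows Q \<Longrightarrow> src Q \<alpha> \<in> verts Q" "\<alpha> \<in> arrows Q \<Longrightarrow> tgt Q \<alpha> \<in> verts Q"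
  using quiver by (auto simp: is_quiver_def)

lemma rep_simps [simp]:
  assumes "is_rep Q C F"
  shows "i \<in> verts Q \<Longrightarrow> rv F i \<in> Obj C" "\<alpha> \<in> arrows Q \<Longrightarrow> ra F \<alpha> \<in> Arr C"
    "\<alpha> \<in> arrows Q \<Longrightarrow> Dom C (ra F \<alpha>) = rv F (src Q \<alpha>)"
      "\<alpha> \<in> arrows Q \<Longrightarrow> Cod C (ra F \<alpha>) = rv F (tgt Q \<alpha>)"
  using assms by (auto simp: is_rep_def PiE_iff)

lemma rep_mor_simps [simp]:
  assumes "is_rep_mor Q C \<phi>"
  shows "is_rep Q C (qdom \<phi>)" "is_rep Q C (qcod \<phi>)" "i \<in> verts Q \<Longrightarrow> qcmp \<phi> i \<in> Arr C"
    "i \<in> verts Q \<Longrightarrow> Dom C (qcmp \<phi> i) = rv (qdom \<phi>) i"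
      "i \<in> verts Q \<Longrightarrow> Cod C (qcmp \<phi> i) = rv (qcod \<phi>) i"
  using assms by (auto simp: is_rep_mor_def PiE_iff)

lemma rep_mor_natural:
  assumes "is_rep_mor Q C \<phi>" "\<alpha> \<in> arrows Q"
  shows "qcmp \<phi> (tgt Q \<alpha>) \<cdot> ra (qdom \<phi>) \<alpha> = ra (qcod \<phi>) \<alpha> \<cdot> qcmp \<phi> (src Q \<alpha>)"
  using assms unfolding is_rep_mor_def by blast

lemma rep_mor_eqI:
  assumes "is_rep_mor Q C \<phi>" "is_rep_mor Q C \<psi>" "qdom \<phi> = qdom \<psi>" "qcod \<phi> = qcod \<psi>"
    "\<And>i. i \<in> verts Q \<Longrightarrow> qcmp \<phi> i = qcmp \<psi> i"
  shows "\<phi> = \<psi>"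
proof (rule qmor.expand, intro conjI)
  have "qcmp \<phi> \<in> extensional (verts Q)" "qcmp \<psi> \<in> extensional (verts Q)"
    using assms(1,2) unfolding is_rep_mor_def PiE_def by blast+
  then show "qcmp \<phi> = qcmp \<psi>" using assms(5) by (rule extensionalityI)
qed (use assms in auto)

text \<open>Components of representations and morphisms are restricted families; with this
  congruence rule the simplifier may use \<open>i \<in> verts Q\<close> inside them.\<close>

lemmas [cong] = restrict_cong

lemma rep_mor_eta [simp]:
  assumes "is_rep_mor Q C \<phi>" "qdom \<phi> = F" "qcod \<phi> = G"
  shows "QMor F G (\<lambda>i\<in>verts Q. qcmp \<phi> i) = \<phi>"
proof (rule qmor.expand, intro conjI)
  have "qcmp \<phi> \<in> extensional (verts Q)" using assms(1) unfolding is_rep_mor_def PiE_def by blast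
  then show "qcmp (QMor F G (\<lambda>i\<in>verts Q. qcmp \<phi> i)) = qcmp \<phi>" by (simp add: extensional_restrict)
qed (use assms in auto)

lemma rep_morI:
  assumes "is_rep Q C F" "is_rep Q C G" "\<And>i. i \<in> verts Q \<Longrightarrow> h i \<in> Hom C (rv F i) (rv G i)"
    "\<And>\<alpha>. \<alpha> \<in> arrows Q \<Longrightarrow> h (tgt Q \<alpha>) \<cdot> ra F \<alpha> = ra G \<alpha> \<cdot> h (src Q \<alpha>)"
  shows "is_rep_mor Q C (QMor F G (\<lambda>i\<in>verts Q. h i))"
  using assms by (auto simp: is_rep_mor_def)

lemma ide_rep_mor [simp]: "is_rep Q C F \<Longrightarrow> is_rep_mor Q C (QMor F F (\<lambda>i\<in>verts Q. Ide C (rv F i)))"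
  by (rule rep_morI) auto

lemma zer_rep_mor [simp]: "is_rep Q C F \<Longrightarrow> is_rep Q C G \<Longrightarrow> is_rep_mor Q C (QMor F G (\<lambda>i\<in>verts Q. Zer C
  (rv F i) (rv G i)))"
  by (rule rep_morI) auto

lemma comp_rep_mor [simp]:
  assumes "is_rep_mor Q C \<phi>" "is_rep_mor Q C \<psi>" "qdom \<psi> = qcod \<phi>" "F = qdom \<phi>" "G = qcod \<psi>"
  shows "is_rep_mor Q C (QMor F G (\<lambda>i\<in>verts Q. qcmp \<psi> i \<cdot> qcmp \<phi> i))"
  unfolding assms(4,5)
proof (rule rep_morI)
  fix \<alpha> assume a: "\<alpha> \<in> arrows Q"
  have "(qcmp \<psi> (tgt Q \<alpha>) \<cdot> qcmp \<phi> (tgt Q \<alpha>)) \<cdot> ra (qdom \<phi>) \<alpha> = qcmp \<psi> (tgt Q \<alpha>) \<cdot> (ra (qcod \<phi>) \<alpha> \<cdot>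
    qcmp \<phi> (src Q \<alpha>))"
    using assms a rep_mor_natural[OF assms(1) a] by simp
  also have "\<dots> = ra (qcod \<psi>) \<alpha> \<cdot> (qcmp \<psi> (src Q \<alpha>) \<cdot> qcmp \<phi> (src Q \<alpha>))"
    using assms a rep_mor_natural[OF assms(2) a] by (intro comp_square) simp_all
  finally show "(qcmp \<psi> (tgt Q \<alpha>) \<cdot> qcmp \<phi> (tgt Q \<alpha>)) \<cdot> ra (qdom \<phi>) \<alpha> = ra (qcod \<psi>) \<alpha> \<cdot> (qcmp \<psi> (src
    Q \<alpha>) \<cdot> qcmp \<phi> (src Q \<alpha>))" .
qed (use assms in simp_all)

lemma add_rep_mor [simp]:
  assumes "is_rep_mor Q C \<phi>" "is_rep_mor Q C \<psi>" "qdom \<psi> = F" "qcod \<psi> = G" "qdom \<phi> = F" "qcod \<phi> = G"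
  shows "is_rep_mor Q C (QMor F G (\<lambda>i\<in>verts Q. Add C (qcmp \<phi> i) (qcmp \<psi> i)))"
proof (rule rep_morI)
  fix \<alpha> assume a: "\<alpha> \<in> arrows Q"
  then show "Add C (qcmp \<phi> (tgt Q \<alpha>)) (qcmp \<psi> (tgt Q \<alpha>)) \<cdot> ra F \<alpha> = ra G \<alpha> \<cdot> Add C (qcmp \<phi> (src Q
    \<alpha>)) (qcmp \<psi> (src Q \<alpha>))"
    using assms rep_mor_natural[OF assms(1) a] rep_mor_natural[OF assms(2) a] by auto
qed (use assms in auto)

lemma neg_rep_mor:
  assumes "is_rep_mor Q C \<phi>"
  shows "is_rep_mor Q C (QMor (qdom \<phi>) (qcod \<phi>) (\<lambda>i\<in>verts Q. Diff C (Zer C (rv (qdom \<phi>) i) (rv (qcod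
    \<phi>) i)) (qcmp \<phi> i)))"
proof (rule rep_morI)
  fix \<alpha> assume a: "\<alpha> \<in> arrows Q"
  then show "Diff C (Zer C (rv (qdom \<phi>) (tgt Q \<alpha>)) (rv (qcod \<phi>) (tgt Q \<alpha>))) (qcmp \<phi> (tgt Q \<alpha>)) \<cdot> ra
    (qdom \<phi>) \<alpha> =
    ra (qcod \<phi>) \<alpha> \<cdot> Diff C (Zer C (rv (qdom \<phi>) (src Q \<alpha>)) (rv (qcod \<phi>) (src Q \<alpha>)))
      (qcmp \<phi> (src Q \<alpha>))"
    using assms rep_mor_natural[OF assms a] by simp
qed (use assms in simp_all)

section \<open>The preadditive category of representations\<close>

lemma category_reps: "category reps"
proof
  fix f g h a b c d assume "f \<in> Hom reps a b" "g \<in> Hom reps b c" "h \<in> Hom reps c d"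
  then show "(h \<cdot>\<^bsub>reps\<^esub> g) \<cdot>\<^bsub>reps\<^esub> f = h \<cdot>\<^bsub>reps\<^esub> (g \<cdot>\<^bsub>reps\<^esub> f)"
    by (auto intro!: ext simp: restrict_def)
next
  fix f a b assume f: "f \<in> Hom reps a b"
  then show "Ide reps b \<cdot>\<^bsub>reps\<^esub> f = f" by auto
  from f show "f \<cdot>\<^bsub>reps\<^esub> Ide reps a = f" by auto
qed auto

lemma comm_group_reps:
  assumes "F \<in> Obj reps" "G \<in> Obj reps"
  shows "comm_group (hom_group reps F G)"
proof (rule comm_groupI)
  let ?H = "hom_group reps F G"
  have carr: "\<phi> \<in> carrier ?H \<longleftrightarrow> is_rep_mor Q C \<phi> \<and> qdom \<phi> = F \<and> qcod \<phi> = G" for \<phi>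
    using assms by (auto simp: hom_group_def)
  have mul: "mult ?H = Add reps" and one: "one ?H = Zer reps F G" by (simp_all add: hom_group_def)
  show "one ?H \<in> carrier ?H" unfolding carr one using assms by simp
  fix x y assume x: "x \<in> carrier ?H" and y: "y \<in> carrier ?H"
  show xy: "mult ?H x y \<in> carrier ?H" using x y unfolding carr mul by simp
  show "mult ?H x y = mult ?H y x" using x y unfolding carr mul
    by (intro rep_mor_eqI) (auto intro: add_commute)
  show "mult ?H (one ?H) x = x" using x assms unfolding carr mul one by (intro rep_mor_eqI) auto
  show "\<exists>y\<in>carrier ?H. mult ?H y x = one ?H"
  proof
    let ?y = "QMor F G (\<lambda>i\<in>verts Q. Diff C (Zer C (rv F i) (rv G i)) (qcmp x i))"
    show y: "?y \<in> carrier ?H" using neg_rep_mor[of x] x unfolding carr by auto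
    show "mult ?H ?y x = one ?H" using x y assms unfolding carr mul one
      by (intro rep_mor_eqI) (auto simp: diff_add)
  qed
  fix z assume z: "z \<in> carrier ?H"
  show "mult ?H (mult ?H x y) z = mult ?H x (mult ?H y z)" using x y z unfolding carr mul
    by (auto intro!: ext simp: restrict_def add_assoc)
qed

lemma preadditive_reps: "preadditive_category reps"
proof (intro preadditive_category.intro preadditive_category_axioms.intro category_reps
  comm_group_reps)
  fix f f' g a b c
  show "f \<in> Hom reps a b \<Longrightarrow> f' \<in> Hom reps a b \<Longrightarrow> g \<in> Hom reps b c \<Longrightarrow>
    g \<cdot>\<^bsub>reps\<^esub> Add reps f f' = Add reps (g \<cdot>\<^bsub>reps\<^esub> f) (g \<cdot>\<^bsub>reps\<^esub> f')"
    by (auto intro!: ext simp: restrict_def)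
  show "f \<in> Hom reps a b \<Longrightarrow> g \<in> Hom reps b c \<Longrightarrow> f' \<in> Hom reps b c \<Longrightarrow>
    Add reps g f' \<cdot>\<^bsub>reps\<^esub> f = Add reps (g \<cdot>\<^bsub>reps\<^esub> f) (f' \<cdot>\<^bsub>reps\<^esub> f)"
    by (auto intro!: ext simp: restrict_def)
qed

section \<open>Kernels and monomorphisms are pointwise\<close>

lemma monic_zero_object:
  assumes "is_monic C k" "is_zero_object C (Cod C k)"
  shows "is_zero_object C (Dom C k)"
proof -
  note [simp] = monic_arr[OF assms(1)]
  have "k \<cdot> Ide C (Dom C k) = k \<cdot> Zer C (Dom C k) (Dom C k)"
    using assms(2) by (intro zero_object_arr_eq[of "Cod C k"]) simp_all
  from monicD[OF assms(1) this] show ?thesis using zero_object_iff[of "Dom C k"] by simp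
qed

lemma Supp_monic:
  assumes "\<And>i. i \<in> verts Q \<Longrightarrow> is_monic C (k i) \<and> Dom C (k i) = rv K i \<and> Cod C (k i) = rv F i"
  shows "Supp Q C K \<subseteq> Supp Q C F"
  using assms monic_zero_object unfolding Supp_def by (smt (verit, best) mem_Collect_eq subsetI)

text \<open>The lifts at the vertices form a morphism of representations: naturality may be checked
  after the component of \<kappa> at the target vertex, which is monic.\<close>

lemma pointwise_kernel:
  assumes f: "\<phi> \<in> Arr reps" and k: "\<kappa> \<in> Arr reps" and q: "qcod \<kappa> = qdom \<phi>"
    and ker: "\<And>i. i \<in> verts Q \<Longrightarrow> is_kernel C (qcmp \<phi> i) (qcmp \<kappa> i)"
  shows "is_kernel reps \<phi> \<kappa>"
proof -
  interpret R: preadditive_category reps by (rule preadditive_reps)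
  show ?thesis
  proof (rule R.kernelI)
    show "is_monic reps \<kappa>" unfolding is_monic_def
    proof (intro conjI allI ballI impI k)
      fix T g h assume g: "g \<in> Hom reps T (Dom reps \<kappa>)" and h: "h \<in> Hom reps T (Dom reps \<kappa>)"
        and e: "\<kappa> \<cdot>\<^bsub>reps\<^esub> g = \<kappa> \<cdot>\<^bsub>reps\<^esub> h"
      show "g = h"
      proof (rule rep_mor_eqI)
        fix i assume i: "i \<in> verts Q"
        have "qcmp (\<kappa> \<cdot>\<^bsub>reps\<^esub> g) i = qcmp (\<kappa> \<cdot>\<^bsub>reps\<^esub> h) i" using e by simp
        then have "qcmp \<kappa> i \<cdot> qcmp g i = qcmp \<kappa> i \<cdot> qcmp h i" using i by simp
        from monicD[OF kernel_monic[OF ker[OF i]] this] show "qcmp g i = qcmp h i" using g h i k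
          by simp
      qed (use g h in auto)
    qed
    show "\<phi> \<cdot>\<^bsub>reps\<^esub> \<kappa> = Zer reps (Dom reps \<kappa>) (Cod reps \<phi>)"
      using f k q kernel_arr(4)[OF ker] by (auto intro!: ext simp: restrict_def)
    fix g assume g: "g \<in> Arr reps" "Cod reps g = Dom reps \<phi>"
      "\<phi> \<cdot>\<^bsub>reps\<^esub> g = Zer reps (Dom reps g) (Cod reps \<phi>)"
    have "\<exists>h. h \<in> Arr C \<and> Dom C h = rv (qdom g) i \<and> Cod C h = rv (qdom \<kappa>) i \<and> qcmp \<kappa> i \<cdot> h =
      qcmp g i" if i: "i \<in> verts Q" for i
    proof -
      have "qcmp (\<phi> \<cdot>\<^bsub>reps\<^esub> g) i = qcmp (Zer reps (Dom reps g) (Cod reps \<phi>)) i" unfolding g(3) ..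
      then have "qcmp \<phi> i \<cdot> qcmp g i = Zer C (rv (qdom g) i) (rv (qcod \<phi>) i)" using i by simp
      then show ?thesis using kernel_lift[OF ker[OF i], of "qcmp g i"] f g k i by auto
    qed
    then obtain h where h: "\<And>i. i \<in> verts Q \<Longrightarrow> h i \<in> Arr C \<and> Dom C (h i) = rv (qdom g) i \<and>
      Cod C (h i) = rv (qdom \<kappa>) i \<and> qcmp \<kappa> i \<cdot> h i = qcmp g i"
      by metis
    have hm: "is_rep_mor Q C (QMor (qdom g) (qdom \<kappa>) (\<lambda>i\<in>verts Q. h i))"
    proof (rule rep_morI)
      fix \<alpha> assume a: "\<alpha> \<in> arrows Q"
      note hs = h[OF arrow_verts(1)[OF a]] h[OF arrow_verts(2)[OF a]]
      have "qcmp \<kappa> (tgt Q \<alpha>) \<cdot> (h (tgt Q \<alpha>) \<cdot> ra (qdom g) \<alpha>) = qcmp g (tgt Q \<alpha>) \<cdot> ra (qdom g) \<alpha>"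
        using a g k hs by (intro comp_shift) simp_all
      also have "\<dots> = ra (qcod \<kappa>) \<alpha> \<cdot> qcmp \<kappa> (src Q \<alpha>) \<cdot> h (src Q \<alpha>)"
        using rep_mor_natural[of g \<alpha>] a g hs q by simp
      also have "\<dots> = qcmp \<kappa> (tgt Q \<alpha>) \<cdot> (ra (qdom \<kappa>) \<alpha> \<cdot> h (src Q \<alpha>))"
        using rep_mor_natural[of \<kappa> \<alpha>] a k hs by (intro comp_square) simp_all
      finally show "h (tgt Q \<alpha>) \<cdot> ra (qdom g) \<alpha> = ra (qdom \<kappa>) \<alpha> \<cdot> h (src Q \<alpha>)"
        using monicD[OF kernel_monic[OF ker[OF arrow_verts(2)[OF a]]], of "h (tgt Q \<alpha>) \<cdot> ra (qdom g)
          \<alpha>" "ra (qdom \<kappa>) \<alpha> \<cdot> h (src Q \<alpha>)"] a g k hs by simp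
    qed (use g k h in auto)
    then show "\<exists>h\<in>Arr reps. Dom reps h = Dom reps g \<and> Cod reps h = Dom reps \<kappa> \<and> \<kappa> \<cdot>\<^bsub>reps\<^esub> h = g"
    proof (intro bexI[of _ "QMor (qdom g) (qdom \<kappa>) (\<lambda>i\<in>verts Q. h i)"] conjI)
      show "\<kappa> \<cdot>\<^bsub>reps\<^esub> QMor (qdom g) (qdom \<kappa>) (\<lambda>i\<in>verts Q. h i) = g"
        using g k q h by simp
    qed (use g k in simp_all)
  qed (use f k q in auto)
qed

text \<open>The arrows of the kernel representation are the induced lifts. The ideal is kept out of
  this statement; membership in \<open>reps\<close> follows afterwards from
  \<open>Supp_monic\<close>, because passing to a subobject shrinks supports.\<close>

lemma ex_pointwise_kernel:
  assumes f: "is_rep_mor Q C \<phi>"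
  obtains \<kappa> where "is_rep_mor Q C \<kappa>" "qcod \<kappa> = qdom \<phi>"
    "\<And>i. i \<in> verts Q \<Longrightarrow> is_kernel C (qcmp \<phi> i) (qcmp \<kappa> i)"
proof -
  have "\<exists>k. i \<in> verts Q \<longrightarrow> is_kernel C (qcmp \<phi> i) k" for i using has_kernels f rep_mor_simps(3)
    by blast
  then obtain k where k: "\<And>i. i \<in> verts Q \<Longrightarrow> is_kernel C (qcmp \<phi> i) (k i)" by metis
  have ks: "k i \<in> Arr C" "Cod C (k i) = rv (qdom \<phi>) i" if "i \<in> verts Q" for i
    using kernel_arr(2,3)[OF k[OF that]] f that by auto
  have "\<exists>a. \<alpha> \<in> arrows Q \<longrightarrow> a \<in> Arr C \<and> Dom C a = Dom C (k (src Q \<alpha>)) \<and>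
    Cod C a = Dom C (k (tgt Q \<alpha>)) \<and> k (tgt Q \<alpha>) \<cdot> a = ra (qdom \<phi>) \<alpha> \<cdot> k (src Q \<alpha>)" for \<alpha>
  proof (cases "\<alpha> \<in> arrows Q")
    case True
    note kk = ks[OF arrow_verts(1)[OF True]] ks[OF arrow_verts(2)[OF True]]
    have "qcmp \<phi> (tgt Q \<alpha>) \<cdot> (ra (qdom \<phi>) \<alpha> \<cdot> k (src Q \<alpha>)) = ra (qcod \<phi>) \<alpha> \<cdot> (qcmp \<phi> (src Q \<alpha>) \<cdot> k
      (src Q \<alpha>))"
      using rep_mor_natural[OF f True] f True kk by (intro comp_square) simp_all
    also have "\<dots> = Zer C (Dom C (k (src Q \<alpha>))) (rv (qcod \<phi>) (tgt Q \<alpha>))"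
      using kernel_arr(4)[OF k[OF arrow_verts(1)[OF True]]] f True kk by simp
    finally show ?thesis
      using kernel_lift[OF k[OF arrow_verts(2)[OF True]], of "ra (qdom \<phi>) \<alpha> \<cdot> k (src Q \<alpha>)"]
      f True kk by auto
  qed simp
  then obtain a where a: "\<And>\<alpha>. \<alpha> \<in> arrows Q \<Longrightarrow> a \<alpha> \<in> Arr C \<and> Dom C (a \<alpha>) = Dom C (k (src Q \<alpha>)) \<and>
    Cod C (a \<alpha>) = Dom C (k (tgt Q \<alpha>)) \<and> k (tgt Q \<alpha>) \<cdot> a \<alpha> = ra (qdom \<phi>) \<alpha> \<cdot> k (src Q \<alpha>)"
    by metis
  define K where "K = QRep (\<lambda>i\<in>verts Q. Dom C (k i)) (\<lambda>\<alpha>\<in>arrows Q. a \<alpha>)"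
  have K: "is_rep Q C K" using ks a by (auto simp: is_rep_def K_def)
  have "is_rep_mor Q C (QMor K (qdom \<phi>) (\<lambda>i\<in>verts Q. k i))"
  proof (rule rep_morI[OF K])
    fix \<alpha> assume "\<alpha> \<in> arrows Q"
    then show "k (tgt Q \<alpha>) \<cdot> ra K \<alpha> = ra (qdom \<phi>) \<alpha> \<cdot> k (src Q \<alpha>)" using a[of \<alpha>]
      by (simp add: K_def)
  qed (use f ks in \<open>simp_all add: K_def\<close>)
  then show thesis by (rule that) (use k in auto)
qed

lemma comp_reps_pointwise:
  assumes "i \<in> verts Q" shows "qcmp (\<psi> \<cdot>\<^bsub>reps\<^esub> \<phi>) i = qcmp \<psi> i \<cdot> qcmp \<phi> i"
  using assms by simp

lemma kernel_iso:
  assumes k: "is_kernel C f k" and [simp]: "u \<in> Arr C" "v \<in> Arr C" "Dom C v = Dom C k"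
    "Cod C v = Dom C u" "Cod C u = Dom C k"
    and uv: "u \<cdot> v = Ide C (Dom C k)" "v \<cdot> u = Ide C (Dom C u)"
  shows "is_kernel C f (k \<cdot> u)"
proof (rule kernelI)
  note [simp] = kernel_arr(1-3)[OF k]
  show "is_monic C (k \<cdot> u)" unfolding is_monic_def
  proof (intro conjI allI ballI impI)
    fix T g h assume h: "g \<in> Hom C T (Dom C (k \<cdot> u))" "h \<in> Hom C T (Dom C (k \<cdot> u))"
      "(k \<cdot> u) \<cdot> g = (k \<cdot> u) \<cdot> h"
    then have "k \<cdot> (u \<cdot> g) = k \<cdot> (u \<cdot> h)" by auto
    from monicD[OF kernel_monic[OF k] this] h have "u \<cdot> g = u \<cdot> h" by auto
    then have e: "v \<cdot> (u \<cdot> g) = v \<cdot> (u \<cdot> h)" by simp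
    have "v \<cdot> (u \<cdot> g) = g" "v \<cdot> (u \<cdot> h) = h"
      using h(1,2) comp_shift[OF uv(2), of g] comp_shift[OF uv(2), of h] by simp_all
    with e show "g = h" by simp
  qed simp
  show "f \<cdot> (k \<cdot> u) = Zer C (Dom C (k \<cdot> u)) (Cod C f)"
    using comp_shift[OF kernel_arr(4)[OF k], of u] by simp
  fix g assume g: "g \<in> Arr C" "Cod C g = Dom C f" "f \<cdot> g = Zer C (Dom C g) (Cod C f)"
  obtain h where h: "h \<in> Arr C" "Dom C h = Dom C g" "Cod C h = Dom C k" "k \<cdot> h = g"
    using kernel_lift[OF k g] .
  then have "(k \<cdot> u) \<cdot> (v \<cdot> h) = g" using comp_shift[OF uv(1), of h] by simp
  then show "\<exists>h\<in>Arr C. Dom C h = Dom C g \<and> Cod C h = Dom C (k \<cdot> u) \<and> (k \<cdot> u) \<cdot> h = g"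
    using h by (intro bexI[of _ "v \<cdot> h"]) simp_all
qed (use kernel_arr[OF k] in simp_all)

text \<open>A kernel in \<open>reps\<close> is isomorphic to the pointwise one, which lies in
  \<open>reps\<close> because the ideal is closed under subsets; \<open>kernel_iso\<close> carries
  the property at \<open>i\<close> across.\<close>

lemma kernel_pointwise:
  assumes k: "is_kernel reps \<phi> \<kappa>" and i: "i \<in> verts Q"
  shows "is_kernel C (qcmp \<phi> i) (qcmp \<kappa> i)"
proof -
  interpret R: preadditive_category reps by (rule preadditive_reps)
  note ka = R.kernel_arr[OF k]
  obtain \<kappa>' where k': "is_rep_mor Q C \<kappa>'" "qcod \<kappa>' = qdom \<phi>"
    "\<And>i. i \<in> verts Q \<Longrightarrow> is_kernel C (qcmp \<phi> i) (qcmp \<kappa>' i)"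
    using ex_pointwise_kernel[of \<phi>] ka(1) by auto
  have "Supp Q C (qdom \<kappa>') \<subseteq> Supp Q C (qdom \<phi>)"
    using k' kernel_monic by (intro Supp_monic[of "qcmp \<kappa>'"]) auto
  then have k'a: "\<kappa>' \<in> Arr reps" using k' ka(1) subset_ideal by auto
  have kk: "is_kernel reps \<phi> \<kappa>'" using pointwise_kernel[OF ka(1) k'a k'(2,3)] .
  note ka' = R.kernel_arr[OF kk]
  obtain u where u: "u \<in> Arr reps" "Dom reps u = Dom reps \<kappa>" "Cod reps u = Dom reps \<kappa>'"
    "\<kappa>' \<cdot>\<^bsub>reps\<^esub> u = \<kappa>"
    using R.kernel_lift[OF kk ka(2,3,4)] .
  obtain v where v: "v \<in> Arr reps" "Dom reps v = Dom reps \<kappa>'" "Cod reps v = Dom reps \<kappa>"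
    "\<kappa> \<cdot>\<^bsub>reps\<^esub> v = \<kappa>'"
    using R.kernel_lift[OF k ka'(2,3,4)] .
  \<comment> \<open>From here on \<open>reps\<close> is treated as an abstract category, whose
    operations have to stay folded.\<close>
  note [simp del] = reps_sel
  have "\<kappa>' \<cdot>\<^bsub>reps\<^esub> (u \<cdot>\<^bsub>reps\<^esub> v) = \<kappa>' \<cdot>\<^bsub>reps\<^esub> Ide reps (Dom reps \<kappa>')"
    using R.comp_shift[OF u(4), of v] u v ka' by simp
  then have uv: "u \<cdot>\<^bsub>reps\<^esub> v = Ide reps (Dom reps \<kappa>')"
    using R.monicD[OF R.kernel_monic[OF kk], of "u \<cdot>\<^bsub>reps\<^esub> v" "Ide reps (Dom reps \<kappa>')"] u v ka'
    by simp
  have "\<kappa> \<cdot>\<^bsub>reps\<^esub> (v \<cdot>\<^bsub>reps\<^esub> u) = \<kappa> \<cdot>\<^bsub>reps\<^esub> Ide reps (Dom reps \<kappa>)"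
    using R.comp_shift[OF v(4), of u] u v ka by simp
  then have vu: "v \<cdot>\<^bsub>reps\<^esub> u = Ide reps (Dom reps \<kappa>)"
    using R.monicD[OF R.kernel_monic[OF k], of "v \<cdot>\<^bsub>reps\<^esub> u" "Ide reps (Dom reps \<kappa>)"] u v ka by simp
  note [simp] = reps_sel
  have "qcmp \<kappa>' i \<cdot> qcmp u i = qcmp \<kappa> i" "qcmp u i \<cdot> qcmp v i = Ide C (rv (qdom \<kappa>') i)"
    "qcmp v i \<cdot> qcmp u i = Ide C (rv (qdom \<kappa>) i)"
    using comp_reps_pointwise[OF i, of \<kappa>' u] comp_reps_pointwise[OF i, of u v]
      comp_reps_pointwise[OF i, of v u] u(4) uv vu i
    by (simp_all del: reps_sel(6))
  then show ?thesis using kernel_iso[OF k'(3)[OF i], of "qcmp u i" "qcmp v i"] i u(1-3) v(1-3) k'(1)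
    by simp
qed

text \<open>For a monic morphism the pointwise kernel, which lies in \<open>reps\<close>, is a zero
  arrow; so every arrow killed by one of the components is zero.\<close>

lemma monic_pointwise:
  assumes f: "\<phi> \<in> Arr reps"
  shows "is_monic reps \<phi> \<longleftrightarrow> (\<forall>i\<in>verts Q. is_monic C (qcmp \<phi> i))"
proof (intro iffI ballI)
  interpret R: preadditive_category reps by (rule preadditive_reps)
  fix i assume m: "is_monic reps \<phi>" and i: "i \<in> verts Q"
  obtain \<kappa>' where k': "is_rep_mor Q C \<kappa>'" "qcod \<kappa>' = qdom \<phi>"
    "\<And>i. i \<in> verts Q \<Longrightarrow> is_kernel C (qcmp \<phi> i) (qcmp \<kappa>' i)"
    using ex_pointwise_kernel[of \<phi>] f by auto
  have "Supp Q C (qdom \<kappa>') \<subseteq> Supp Q C (qdom \<phi>)"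
    using k' kernel_monic by (intro Supp_monic[of "qcmp \<kappa>'"]) auto
  then have k'a: "\<kappa>' \<in> Arr reps" using k' f subset_ideal by auto
  note kk = R.kernel_arr[OF pointwise_kernel[OF f k'a k'(2,3)]]
  from m have "\<kappa>' = Zer reps (Dom reps \<kappa>') (Dom reps \<phi>)" unfolding R.monic_iff_zer using kk by blast
  then have "qcmp \<kappa>' i = qcmp (Zer reps (Dom reps \<kappa>') (Dom reps \<phi>)) i" by (rule arg_cong)
  then have z: "qcmp \<kappa>' i = Zer C (rv (qdom \<kappa>') i) (rv (qdom \<phi>) i)" using i by simp
  show "is_monic C (qcmp \<phi> i)" unfolding monic_iff_zer
  proof (intro conjI ballI impI; (elim conjE)?)
    fix t assume t: "t \<in> Arr C" "Cod C t = Dom C (qcmp \<phi> i)"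
      "qcmp \<phi> i \<cdot> t = Zer C (Dom C t) (Cod C (qcmp \<phi> i))"
    obtain h where "h \<in> Arr C" "Dom C h = Dom C t" "Cod C h = Dom C (qcmp \<kappa>' i)" "qcmp \<kappa>' i \<cdot> h = t"
      using kernel_lift[OF k'(3)[OF i] t] .
    then show "t = Zer C (Dom C t) (Dom C (qcmp \<phi> i))" using z i f k'a by auto
  qed (use f i in simp)
next
  assume m: "\<forall>i\<in>verts Q. is_monic C (qcmp \<phi> i)"
  show "is_monic reps \<phi>" unfolding is_monic_def
  proof (intro conjI allI ballI impI f)
    fix T g h assume g: "g \<in> Hom reps T (Dom reps \<phi>)" and h: "h \<in> Hom reps T (Dom reps \<phi>)"
      and e: "\<phi> \<cdot>\<^bsub>reps\<^esub> g = \<phi> \<cdot>\<^bsub>reps\<^esub> h"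
    show "g = h"
    proof (rule rep_mor_eqI)
      fix i assume i: "i \<in> verts Q"
      have "qcmp (\<phi> \<cdot>\<^bsub>reps\<^esub> g) i = qcmp (\<phi> \<cdot>\<^bsub>reps\<^esub> h) i" using e by simp
      then have "qcmp \<phi> i \<cdot> qcmp g i = qcmp \<phi> i \<cdot> qcmp h i" using i by simp
      from monicD[OF bspec[OF m i] this] show "qcmp g i = qcmp h i" using g h i f by simp
    qed (use g h in auto)
  qed
qed

end

text \<open>Representations of the opposite quiver in the opposite category form the opposite of
  \<open>reps\<close> only up to exchanging \<open>qdom\<close> and \<open>qcod\<close> inside each
  morphism. An involution on arrows compatible with all the structure transports kernels and
  monomorphisms, which is the form of duality used for \<open>reps\<close>.\<close>

lemma involution_kernel:
  assumes inv: "\<And>f. \<theta> (\<theta> f) = f" and obj: "Obj H = Obj G" and arr: "\<And>f. \<theta> f \<in> Arr H \<longleftrightarrow> f \<in> Arr G"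
    and dom: "\<And>f. Dom H (\<theta> f) = Dom G f" and cod: "\<And>f. Cod H (\<theta> f) = Cod G f"
    and comp: "\<And>f g. \<theta> g \<cdot>\<^bsub>H\<^esub> \<theta> f = \<theta> (g \<cdot>\<^bsub>G\<^esub> f)" and zer: "\<And>a b. Zer H a b = \<theta> (Zer G a b)"
  shows "is_kernel H (\<theta> f) (\<theta> k) \<longleftrightarrow> is_kernel G f k" and "is_monic H (\<theta> f) \<longleftrightarrow> is_monic G f"
proof -
  have eq: "\<theta> x = \<theta> y \<longleftrightarrow> x = y" for x y using inv by metis
  have hom: "\<theta> h \<in> Hom H a b \<longleftrightarrow> h \<in> Hom G a b" for h a b using arr dom cod by simp
  have ball: "(\<forall>g\<in>Hom H a b. P g) \<longleftrightarrow> (\<forall>g\<in>Hom G a b. P (\<theta> g))" for a b P using hom inv by metis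
  have ex1: "(\<exists>!h. h \<in> Hom H a b \<and> \<theta> k \<cdot>\<^bsub>H\<^esub> h = \<theta> g) \<longleftrightarrow> (\<exists>!h. h \<in> Hom G a b \<and> k \<cdot>\<^bsub>G\<^esub> h = g)"
    for a b k g
  proof -
    have "(\<exists>!h. P h) \<longleftrightarrow> (\<exists>!h. P (\<theta> h))" for P using inv by metis
    from this[of "\<lambda>h. h \<in> Hom H a b \<and> \<theta> k \<cdot>\<^bsub>H\<^esub> h = \<theta> g"] show ?thesis by (simp only: hom comp eq)
  qed
  show "is_kernel H (\<theta> f) (\<theta> k) \<longleftrightarrow> is_kernel G f k"
    unfolding is_kernel_def by (simp only: ball ex1 dom cod obj arr comp zer eq)
  show "is_monic H (\<theta> f) \<longleftrightarrow> is_monic G f"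
    unfolding is_monic_def by (simp only: ball dom cod obj arr comp zer eq)
qed

definition op_quiver :: "('v, 'e) quiver \<Rightarrow> ('v, 'e) quiver" where
  "op_quiver Q = Q\<lparr>src := tgt Q, tgt := src Q\<rparr>"

lemma op_quiver_sel [simp]:
  "verts (op_quiver Q) = verts Q" "arrows (op_quiver Q) = arrows Q" "src (op_quiver Q) = tgt Q"
    "tgt (op_quiver Q) = src Q"
  by (simp_all add: op_quiver_def)

definition flip :: "('v, 'e, 'o, 'm) qmor \<Rightarrow> ('v, 'e, 'o, 'm) qmor" where
  "flip \<phi> = QMor (qcod \<phi>) (qdom \<phi>) (qcmp \<phi>)"

lemma flip_sel [simp]: "qdom (flip \<phi>) = qcod \<phi>" "qcod (flip \<phi>) = qdom \<phi>" "qcmp (flip \<phi>) = qcmp \<phi>"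
  "flip (flip \<phi>) = \<phi>"
  by (simp_all add: flip_def)

lemma is_rep_op [simp]: "is_rep (op_quiver Q) (op_cat C) F \<longleftrightarrow> is_rep Q C F"
  by (simp add: is_rep_def Hom_op_cat del: in_Hom_iff)

lemma is_rep_mor_flip [simp]: "is_rep_mor (op_quiver Q) (op_cat C) (flip \<phi>) \<longleftrightarrow> is_rep_mor Q C \<phi>"
  unfolding is_rep_mor_def by (auto simp add: Hom_op_cat simp del: in_Hom_iff)

lemma Supp_op [simp]: "Supp (op_quiver Q) (op_cat C) F = Supp Q C F"
  by (simp add: Supp_def)

section \<open>Duality, biproducts and exactness of evaluation\<close>

context quiver_reps
begin

lemma op_quiver_reps: "quiver_reps (op_cat C) (op_quiver Q) \<I>"
proof (intro quiver_reps.intro quiver_reps_axioms.intro abelian_op empty_ideal)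
  show "is_quiver (op_quiver Q)" using quiver by (auto simp: is_quiver_def)
qed (fact subset_ideal union_ideal)+

lemma flip_reps:
  shows "is_kernel (quiver_reps.reps (op_cat C) (op_quiver Q) \<I>) (flip \<phi>) (flip \<kappa>) \<longleftrightarrow>
    is_cokernel reps \<phi> \<kappa>"
    and "is_monic (quiver_reps.reps (op_cat C) (op_quiver Q) \<I>) (flip \<phi>) \<longleftrightarrow> is_epic reps \<phi>"
proof -
  interpret O: quiver_reps "op_cat C" "op_quiver Q" \<I> by (rule op_quiver_reps)
  note inv = involution_kernel[of flip O.reps "op_cat reps"]
  have obj: "Obj O.reps = Obj (op_cat reps)" by auto
  have arr: "flip \<phi> \<in> Arr O.reps \<longleftrightarrow> \<phi> \<in> Arr (op_cat reps)" for \<phi> by auto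
  have cmp: "flip g \<cdot>\<^bsub>O.reps\<^esub> flip f = flip (g \<cdot>\<^bsub>op_cat reps\<^esub> f)" for f g by (simp add: flip_def)
  have zer: "Zer O.reps a b = flip (Zer (op_cat reps) a b)" for a b by (simp add: flip_def)
  show "is_kernel O.reps (flip \<phi>) (flip \<kappa>) \<longleftrightarrow> is_cokernel reps \<phi> \<kappa>"
    using inv(1)[OF _ obj arr _ _ cmp zer, of \<phi> \<kappa>] by simp
  show "is_monic O.reps (flip \<phi>) \<longleftrightarrow> is_epic reps \<phi>"
    using inv(2)[OF _ obj arr _ _ cmp zer, of \<phi>] by simp
qed

lemma pointwise_cokernel:
  assumes "\<phi> \<in> Arr reps" "\<kappa> \<in> Arr reps" "qdom \<kappa> = qcod \<phi>"
    "\<And>i. i \<in> verts Q \<Longrightarrow> is_cokernel C (qcmp \<phi> i) (qcmp \<kappa> i)"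
  shows "is_cokernel reps \<phi> \<kappa>"
proof -
  interpret O: quiver_reps "op_cat C" "op_quiver Q" \<I> by (rule op_quiver_reps)
  show ?thesis using O.pointwise_kernel[of "flip \<phi>" "flip \<kappa>"] assms unfolding flip_reps(1) by simp
qed

lemma cokernel_pointwise:
  assumes "is_cokernel reps \<phi> \<kappa>" "i \<in> verts Q"
  shows "is_cokernel C (qcmp \<phi> i) (qcmp \<kappa> i)"
proof -
  interpret O: quiver_reps "op_cat C" "op_quiver Q" \<I> by (rule op_quiver_reps)
  show ?thesis using O.kernel_pointwise[of "flip \<phi>" "flip \<kappa>" i] assms unfolding flip_reps(1) by simp
qed

lemma epic_pointwise:
  assumes "\<phi> \<in> Arr reps"
  shows "is_epic reps \<phi> \<longleftrightarrow> (\<forall>i\<in>verts Q. is_epic C (qcmp \<phi> i))"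
proof -
  interpret O: quiver_reps "op_cat C" "op_quiver Q" \<I> by (rule op_quiver_reps)
  show ?thesis using O.monic_pointwise[of "flip \<phi>"] assms unfolding flip_reps(2) by simp
qed

lemma ex_kernel_reps:
  assumes "\<phi> \<in> Arr reps"
  obtains \<kappa> where "\<kappa> \<in> Arr reps" "qcod \<kappa> = qdom \<phi>"
    "\<And>i. i \<in> verts Q \<Longrightarrow> is_kernel C (qcmp \<phi> i) (qcmp \<kappa> i)" "is_kernel reps \<phi> \<kappa>"
proof -
  obtain \<kappa> where k: "is_rep_mor Q C \<kappa>" "qcod \<kappa> = qdom \<phi>"
    "\<And>i. i \<in> verts Q \<Longrightarrow> is_kernel C (qcmp \<phi> i) (qcmp \<kappa> i)"
    using ex_pointwise_kernel[of \<phi>] assms by auto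
  have "Supp Q C (qdom \<kappa>) \<subseteq> Supp Q C (qdom \<phi>)"
    using k kernel_monic by (intro Supp_monic[of "qcmp \<kappa>"]) auto
  then have "\<kappa> \<in> Arr reps" using k assms subset_ideal by auto
  then show thesis using that k pointwise_kernel[OF assms] by blast
qed

lemma ex_cokernel_reps:
  assumes "\<phi> \<in> Arr reps"
  obtains \<kappa> where "\<kappa> \<in> Arr reps" "qdom \<kappa> = qcod \<phi>"
    "\<And>i. i \<in> verts Q \<Longrightarrow> is_cokernel C (qcmp \<phi> i) (qcmp \<kappa> i)" "is_cokernel reps \<phi> \<kappa>"
proof -
  interpret O: quiver_reps "op_cat C" "op_quiver Q" \<I> by (rule op_quiver_reps)
  obtain \<kappa> where k: "\<kappa> \<in> Arr O.reps" "qcod \<kappa> = qdom (flip \<phi>)"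
    "\<And>i. i \<in> verts (op_quiver Q) \<Longrightarrow> is_kernel (op_cat C) (qcmp (flip \<phi>) i) (qcmp \<kappa> i)"
      "is_kernel O.reps (flip \<phi>) \<kappa>"
    using O.ex_kernel_reps[of "flip \<phi>"] assms by auto
  show thesis
  proof (rule that[of "flip \<kappa>"])
    show "flip \<kappa> \<in> Arr reps" using k(1) is_rep_mor_flip[of Q C "flip \<kappa>"] by simp
    show "is_cokernel reps \<phi> (flip \<kappa>)" using flip_reps(1)[of \<phi> "flip \<kappa>"] k(4) by simp
  qed (use k in simp_all)
qed

lemma ex_zero_reps: "\<exists>Z. is_zero_object reps Z"
proof -
  interpret R: preadditive_category reps by (rule preadditive_reps)
  obtain z where z: "is_zero_object C z" using has_zero_object by blast
  have zo: "z \<in> Obj C" using z by (simp add: is_zero_object_def)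
  have iz: "Ide C z = Zer C z z" using z zero_object_iff[OF zo] by simp
  define Z :: "('v, 'e, 'o, 'm) qrep" where "Z = QRep (\<lambda>i\<in>verts Q. z) (\<lambda>\<alpha>\<in>arrows Q. Ide C z)"
  have "is_rep Q C Z" using zo by (auto simp: is_rep_def Z_def)
  moreover have "Supp Q C Z = {}" using z by (auto simp: Supp_def Z_def)
  ultimately have Z: "Z \<in> Obj reps" using empty_ideal by simp
  have "Ide reps Z = Zer reps Z Z" using iz by (simp add: Z_def)
  then show ?thesis using R.zero_object_iff[OF Z] by blast
qed

lemma biproduct_zero_object:
  assumes b: "is_biproduct C a b P i1 i2 p1 p2" and "is_zero_object C a" "is_zero_object C b"
  shows "is_zero_object C P"
proof -
  note [simp] = biproduct_arr[OF b]
  have "Ide C P = Zer C P P"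
  proof (rule biproduct_eqI[OF b])
    show "p1 \<cdot> Ide C P = p1 \<cdot> Zer C P P" using assms(2) by (intro zero_object_arr_eq[of a]) simp_all
    show "p2 \<cdot> Ide C P = p2 \<cdot> Zer C P P" using assms(3) by (intro zero_object_arr_eq[of b]) simp_all
  qed simp_all
  then show ?thesis using zero_object_iff by simp
qed

text \<open>Formed vertex by vertex, with diagonal arrows. Its support lies in the union of the two
  supports, so closure of the ideal under unions puts it into \<open>reps\<close>.\<close>

lemma ex_biproduct_reps:
  assumes F: "F \<in> Obj reps" and G: "G \<in> Obj reps"
  shows "\<exists>P i1 i2 p1 p2. is_biproduct reps F G P i1 i2 p1 p2"
proof -
  have "\<forall>k. \<exists>P i1 i2 p1 p2. k \<in> verts Q \<longrightarrow> is_biproduct C (rv F k) (rv G k) P i1 i2 p1 p2"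
    using F G has_biproducts by (metis rep_simps(1) reps_sel(1))
  then obtain P i j p q
    where "\<forall>k. k \<in> verts Q \<longrightarrow> is_biproduct C (rv F k) (rv G k) (P k) (i k) (j k) (p k) (q k)"
    by (auto simp only: choice_iff)
  then have b: "\<And>k. k \<in> verts Q \<Longrightarrow> is_biproduct C (rv F k) (rv G k) (P k) (i k) (j k) (p k) (q k)"
    by blast

  have Fr [simp]: "is_rep Q C F" "is_rep Q C G" using F G by simp_all
  define B where "B = QRep (\<lambda>k\<in>verts Q. P k)
    (\<lambda>\<alpha>\<in>arrows Q. Add C (i (tgt Q \<alpha>) \<cdot> ra F \<alpha> \<cdot> p (src Q \<alpha>)) (j (tgt Q \<alpha>) \<cdot> ra G \<alpha> \<cdot> q (src Q \<alpha>)))"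
  have t: "i (tgt Q \<alpha>) \<cdot> ra F \<alpha> \<cdot> p (src Q \<alpha>) \<in> Hom C (P (src Q \<alpha>)) (P (tgt Q \<alpha>))"
    "j (tgt Q \<alpha>) \<cdot> ra G \<alpha> \<cdot> q (src Q \<alpha>) \<in> Hom C (P (src Q \<alpha>)) (P (tgt Q \<alpha>))" if "\<alpha> \<in> arrows Q" for \<alpha>
    using that biproduct_arr[OF b] by simp_all
  have "Add C (i (tgt Q \<alpha>) \<cdot> ra F \<alpha> \<cdot> p (src Q \<alpha>)) (j (tgt Q \<alpha>) \<cdot> ra G \<alpha> \<cdot> q (src Q \<alpha>)) \<in> Hom C (P
    (src Q \<alpha>)) (P (tgt Q \<alpha>))"
    if "\<alpha> \<in> arrows Q" for \<alpha>
    using t[OF that] by simp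
  then have B [simp]: "is_rep Q C B" using biproduct_arr(19)[OF b] by (auto simp: is_rep_def B_def)
  have Bv [simp]: "\<And>k. k \<in> verts Q \<Longrightarrow> rv B k = P k"
    "\<And>\<alpha>. \<alpha> \<in> arrows Q \<Longrightarrow> ra B \<alpha> = Add C (i (tgt Q \<alpha>) \<cdot> ra F \<alpha> \<cdot> p (src Q \<alpha>)) (j (tgt Q \<alpha>) \<cdot> ra G \<alpha> \<cdot>
      q (src Q \<alpha>))"
    by (simp_all add: B_def)
  have "Supp Q C F \<in> \<I>" "Supp Q C G \<in> \<I>" using F G by simp_all
  moreover have "Supp Q C B \<subseteq> Supp Q C F \<union> Supp Q C G" using biproduct_zero_object[OF b]
    by (auto simp: Supp_def)
  ultimately have S: "Supp Q C B \<in> \<I>" "Supp Q C F \<in> \<I>" "Supp Q C G \<in> \<I>"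
    using subset_ideal[OF union_ideal, of "Supp Q C F" "Supp Q C G"] by blast+
  have m: "is_rep_mor Q C (QMor F B (\<lambda>k\<in>verts Q. i k))"
    "is_rep_mor Q C (QMor G B (\<lambda>k\<in>verts Q. j k))"
    "is_rep_mor Q C (QMor B F (\<lambda>k\<in>verts Q. p k))" "is_rep_mor Q C (QMor B G (\<lambda>k\<in>verts Q. q k))"
  proof -
    have nat: "i (tgt Q \<alpha>) \<cdot> ra F \<alpha> = ra B \<alpha> \<cdot> i (src Q \<alpha>)"
      "j (tgt Q \<alpha>) \<cdot> ra G \<alpha> = ra B \<alpha> \<cdot> j (src Q \<alpha>)"
      "p (tgt Q \<alpha>) \<cdot> ra B \<alpha> = ra F \<alpha> \<cdot> p (src Q \<alpha>)" "q (tgt Q \<alpha>) \<cdot> ra B \<alpha> = ra G \<alpha> \<cdot> q (src Q \<alpha>)"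
        if a: "\<alpha> \<in> arrows Q" for \<alpha>
    proof -
      note b1 = b[OF arrow_verts(1)[OF a]] and b2 = b[OF arrow_verts(2)[OF a]]
      note [simp] = biproduct_arr[OF b1] biproduct_arr[OF b2]
        comp_shift[OF biproduct_arr(13)[OF b2]]
        comp_shift[OF biproduct_arr(14)[OF b2]] comp_shift[OF biproduct_arr(15)[OF b2]]
          comp_shift[OF biproduct_arr(16)[OF b2]]
      show "i (tgt Q \<alpha>) \<cdot> ra F \<alpha> = ra B \<alpha> \<cdot> i (src Q \<alpha>)"
        "j (tgt Q \<alpha>) \<cdot> ra G \<alpha> = ra B \<alpha> \<cdot> j (src Q \<alpha>)"
        "p (tgt Q \<alpha>) \<cdot> ra B \<alpha> = ra F \<alpha> \<cdot> p (src Q \<alpha>)" "q (tgt Q \<alpha>) \<cdot> ra B \<alpha> = ra G \<alpha> \<cdot> q (src Q \<alpha>)"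
          using a by simp_all
    qed
    show "is_rep_mor Q C (QMor F B (\<lambda>k\<in>verts Q. i k))"
      by (rule rep_morI[OF Fr(1) B _ nat(1)]) (use biproduct_arr(1-12)[OF b] in simp_all)
    show "is_rep_mor Q C (QMor G B (\<lambda>k\<in>verts Q. j k))"
      by (rule rep_morI[OF Fr(2) B _ nat(2)]) (use biproduct_arr(1-12)[OF b] in simp_all)
    show "is_rep_mor Q C (QMor B F (\<lambda>k\<in>verts Q. p k))"
      by (rule rep_morI[OF B Fr(1) _ nat(3)]) (use biproduct_arr(1-12)[OF b] in simp_all)
    show "is_rep_mor Q C (QMor B G (\<lambda>k\<in>verts Q. q k))"
      by (rule rep_morI[OF B Fr(2) _ nat(4)]) (use biproduct_arr(1-12)[OF b] in simp_all)
  qed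
  have "Add C (i k \<cdot> p k) (j k \<cdot> q k) = Ide C (P k)" if "k \<in> verts Q" for k using b[OF that]
    by (simp add: is_biproduct_def)
  then have "is_biproduct reps F G B (QMor F B (\<lambda>k\<in>verts Q. i k)) (QMor G B (\<lambda>k\<in>verts Q. j k)) (QMor
    B F (\<lambda>k\<in>verts Q. p k)) (QMor B G (\<lambda>k\<in>verts Q. q k))"
    unfolding is_biproduct_def using m S biproduct_arr[OF b] by simp
  then show ?thesis by blast
qed

lemma abelian_reps: "abelian_category reps"
proof (intro abelian_category.intro abelian_category_axioms.intro preadditive_reps ex_zero_reps
  ex_biproduct_reps)
  interpret R: preadditive_category reps by (rule preadditive_reps)
  fix f
  show "f \<in> Arr reps \<Longrightarrow> \<exists>k. is_kernel reps f k" using ex_kernel_reps by metis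
  show "f \<in> Arr reps \<Longrightarrow> \<exists>k. is_cokernel reps f k" using ex_cokernel_reps by metis
  show "\<exists>g. is_kernel reps g f" if m: "is_monic reps f"
  proof -
    have f: "f \<in> Arr reps" using R.monic_arr[OF m] .
    obtain p where p: "p \<in> Arr reps" "qdom p = qcod f"
      "\<And>i. i \<in> verts Q \<Longrightarrow> is_cokernel C (qcmp f i) (qcmp p i)"
      using ex_cokernel_reps[OF f] by metis
    have "is_kernel reps p f" using p f m monic_kernel_of_cokernel unfolding monic_pointwise[OF f]
      by (intro pointwise_kernel) auto
    then show ?thesis by blast
  qed
  show "\<exists>g. is_cokernel reps g f" if m: "is_epic reps f"
  proof -
    have f: "f \<in> Arr reps" using R.epic_arr[OF m] .
    obtain p where p: "p \<in> Arr reps" "qcod p = qdom f"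
      "\<And>i. i \<in> verts Q \<Longrightarrow> is_kernel C (qcmp f i) (qcmp p i)"
      using ex_kernel_reps[OF f] by metis
    have "is_cokernel reps p f" using p f m epic_cokernel_of_kernel unfolding epic_pointwise[OF f]
      by (intro pointwise_cokernel) auto
    then show ?thesis by blast
  qed
qed

lemma eval_functor_reps: "i \<in> verts Q \<Longrightarrow> is_functor reps C (eval_functor i)"
  unfolding is_functor_def eval_functor_def by auto

text \<open>Monomorphisms, epimorphisms, kernels and cokernels of \<open>reps\<close> are all
  pointwise, so a short exact sequence is one at every vertex.\<close>

lemma eval_exact:
  assumes i: "i \<in> verts Q"
  shows "is_exact_functor reps C (eval_functor i)"
  unfolding is_exact_functor_def
proof (intro conjI allI impI eval_functor_reps[OF i])
  interpret R: abelian_category reps by (rule abelian_reps)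
  fix f g assume s: "is_short_exact reps f g"
  then have a: "f \<in> Arr reps" "g \<in> Arr reps" using R.monic_arr R.epic_arr
    unfolding is_short_exact_def by blast+
  show "is_short_exact C (far (eval_functor i) f) (far (eval_functor i) g)"
    using s i kernel_pointwise[OF _ i] cokernel_pointwise[OF _ i]
    unfolding is_short_exact_def monic_pointwise[OF a(1)] epic_pointwise[OF a(2)] is_exact_def
      eval_functor_def func.simps
    by blast
qed

end

section \<open>Coproducts\<close>

context category
begin

lemma coproduct_arr:
  assumes "is_coproduct C I X P \<iota>"
  shows "P \<in> Obj C" "i \<in> I \<Longrightarrow> \<iota> i \<in> Arr C" "i \<in> I \<Longrightarrow> Dom C (\<iota> i) = X i" "i \<in> I \<Longrightarrow> Cod C (\<iota> i) = P"
  using assms by (auto simp: is_coproduct_def)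

lemma coproduct_ex1:
  assumes "is_coproduct C I X P \<iota>" "T \<in> Obj C" "\<And>i. i \<in> I \<Longrightarrow> g i \<in> Hom C (X i) T"
  shows "\<exists>!h. h \<in> Hom C P T \<and> (\<forall>i\<in>I. h \<cdot> \<iota> i = g i)"
  using assms unfolding is_coproduct_def by blast

lemma coproduct_desc:
  assumes "is_coproduct C I X P \<iota>" "T \<in> Obj C" "\<And>i. i \<in> I \<Longrightarrow> g i \<in> Hom C (X i) T"
  obtains h where "h \<in> Arr C" "Dom C h = P" "Cod C h = T" "\<And>i. i \<in> I \<Longrightarrow> h \<cdot> \<iota> i = g i"
  using ex1_implies_ex[OF coproduct_ex1[OF assms]] by auto

lemma coproduct_eqI:
  assumes c: "is_coproduct C I X P \<iota>" and u: "u \<in> Arr C" "Dom C u = P" and v: "v \<in> Arr C"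
    "Dom C v = P" "Cod C v = Cod C u"
    and e: "\<And>i. i \<in> I \<Longrightarrow> u \<cdot> \<iota> i = v \<cdot> \<iota> i"
  shows "u = v"
proof -
  have "\<exists>!h. h \<in> Hom C P (Cod C u) \<and> (\<forall>i\<in>I. h \<cdot> \<iota> i = v \<cdot> \<iota> i)"
    using u v coproduct_arr[OF c] by (intro coproduct_ex1[OF c]) simp_all
  moreover have "u \<in> Hom C P (Cod C u) \<and> (\<forall>i\<in>I. u \<cdot> \<iota> i = v \<cdot> \<iota> i)"
    "v \<in> Hom C P (Cod C u) \<and> (\<forall>i\<in>I. v \<cdot> \<iota> i = v \<cdot> \<iota> i)"
    using u v e by simp_all
  ultimately show ?thesis by blast
qed

lemma coproduct_the_eq:
  assumes "is_coproduct C I X P \<iota>" "h \<in> Hom C P T" "\<And>i. i \<in> I \<Longrightarrow> h \<cdot> \<iota> i = g i"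
  shows "(THE h. h \<in> Hom C P T \<and> (\<forall>i\<in>I. h \<cdot> \<iota> i = g i)) = h"
proof (rule the_equality)
  fix h' assume h': "h' \<in> Hom C P T \<and> (\<forall>i\<in>I. h' \<cdot> \<iota> i = g i)"
  show "h' = h" by (rule coproduct_eqI[OF assms(1)]) (use h' assms in simp_all)
qed (use assms in blast)

lemma coproductI:
  assumes "P \<in> Obj C" "\<And>i. i \<in> I \<Longrightarrow> \<iota> i \<in> Hom C (X i) P"
    and "\<And>T g. T \<in> Obj C \<Longrightarrow> (\<And>i. i \<in> I \<Longrightarrow> g i \<in> Hom C (X i) T) \<Longrightarrow> \<exists>h. h \<in> Hom C P T \<and> (\<forall>i\<in>I. h \<cdot> \<iota> i =
      g i)"
    and "\<And>T u v. u \<in> Hom C P T \<Longrightarrow> v \<in> Hom C P T \<Longrightarrow> (\<And>i. i \<in> I \<Longrightarrow> u \<cdot> \<iota> i = v \<cdot> \<iota> i) \<Longrightarrow> u = v"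
  shows "is_coproduct C I X P \<iota>"
  unfolding is_coproduct_def
proof (intro conjI ballI allI impI)
  fix T g assume "T \<in> Obj C" "\<forall>i\<in>I. g i \<in> Hom C (X i) T"
  then obtain h where h: "h \<in> Hom C P T" "\<forall>i\<in>I. h \<cdot> \<iota> i = g i" using assms(3) by blast
  show "\<exists>!h. h \<in> Hom C P T \<and> (\<forall>i\<in>I. h \<cdot> \<iota> i = g i)"
  proof (rule ex1I)
    show "h \<in> Hom C P T \<and> (\<forall>i\<in>I. h \<cdot> \<iota> i = g i)" using h by blast
    fix h' assume "h' \<in> Hom C P T \<and> (\<forall>i\<in>I. h' \<cdot> \<iota> i = g i)"
    then show "h' = h" using h by (intro assms(4)[of h' T h]) (blast, blast, metis)
  qed
qed (use assms in blast)+

lemma coproduct_transport: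
  assumes c: "is_coproduct C I X P \<iota>" and u: "u \<in> Arr C" "Dom C u = P" "Cod C u = P'"
    and v: "v \<in> Arr C" "Dom C v = P'" "Cod C v = P"
    and uv: "u \<cdot> v = Ide C P'" "v \<cdot> u = Ide C P"
  shows "is_coproduct C I X P' (\<lambda>i. u \<cdot> \<iota> i)"
proof (rule coproductI)
  note [simp] = coproduct_arr[OF c] u v
  show "P' \<in> Obj C" using obj_of_arr(2)[of u] by simp
  fix T g assume "T \<in> Obj C" "\<And>i. i \<in> I \<Longrightarrow> g i \<in> Hom C (X i) T"
  then obtain h where h: "h \<in> Arr C" "Dom C h = P" "Cod C h = T" "\<And>i. i \<in> I \<Longrightarrow> h \<cdot> \<iota> i = g i"
    using coproduct_desc[OF c] by metis
  have "(h \<cdot> v) \<cdot> (u \<cdot> \<iota> i) = g i" if "i \<in> I" for i using that h comp_shift[OF uv(2), of "\<iota> i"]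
    by simp
  then show "\<exists>h. h \<in> Hom C P' T \<and> (\<forall>i\<in>I. h \<cdot> (u \<cdot> \<iota> i) = g i)" using h
    by (intro exI[of _ "h \<cdot> v"]) simp
next
  note [simp] = coproduct_arr[OF c] u v
  fix T s t assume s: "s \<in> Hom C P' T" and t: "t \<in> Hom C P' T"
    and e: "\<And>i. i \<in> I \<Longrightarrow> s \<cdot> (u \<cdot> \<iota> i) = t \<cdot> (u \<cdot> \<iota> i)"
  have "s \<cdot> u = t \<cdot> u" by (rule coproduct_eqI[OF c]) (use s t e in simp_all)
  then have "(s \<cdot> u) \<cdot> v = (t \<cdot> u) \<cdot> v" by simp
  then show "s = t" using s t uv by simp
qed (use coproduct_arr[OF c] u in simp_all)

lemma coproduct_unique:
  assumes c: "is_coproduct C I X P \<iota>" and c': "is_coproduct C I X P' \<iota>'"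
  obtains u v where "u \<in> Arr C" "Dom C u = P" "Cod C u = P'" "v \<in> Arr C" "Dom C v = P'"
    "Cod C v = P"
    "u \<cdot> v = Ide C P'" "v \<cdot> u = Ide C P" "\<And>i. i \<in> I \<Longrightarrow> u \<cdot> \<iota> i = \<iota>' i"
proof -
  note [simp] = coproduct_arr[OF c] coproduct_arr[OF c']
  obtain u where u: "u \<in> Arr C" "Dom C u = P" "Cod C u = P'" "\<And>i. i \<in> I \<Longrightarrow> u \<cdot> \<iota> i = \<iota>' i"
    using coproduct_desc[OF c, of P' \<iota>'] by auto
  obtain v where v: "v \<in> Arr C" "Dom C v = P'" "Cod C v = P" "\<And>i. i \<in> I \<Longrightarrow> v \<cdot> \<iota>' i = \<iota> i"
    using coproduct_desc[OF c', of P \<iota>] by auto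
  have "u \<cdot> v = Ide C P'" by (rule coproduct_eqI[OF c']) (use u v in simp_all)
  moreover have "v \<cdot> u = Ide C P" by (rule coproduct_eqI[OF c]) (use u v in simp_all)
  ultimately show thesis using that u v by blast
qed

lemma coproduct_reindex:
  assumes f: "inj_on f I" and c: "is_coproduct C (f ` I) (\<lambda>k. X (inv_into I f k)) P \<iota>"
  shows "is_coproduct C I X P (\<lambda>i. \<iota> (f i))"
proof (rule coproductI)
  note [simp] = coproduct_arr[OF c] inv_into_f_f[OF f]
  show "P \<in> Obj C" by simp
  fix i assume i: "i \<in> I"
  then show "\<iota> (f i) \<in> Hom C (X i) P" using coproduct_arr(2-4)[OF c, of "f i"] by simp
next
  note [simp] = inv_into_f_f[OF f]
  fix T g assume T: "T \<in> Obj C" "\<And>i. i \<in> I \<Longrightarrow> g i \<in> Hom C (X i) T"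
  obtain h where "h \<in> Arr C" "Dom C h = P" "Cod C h = T"
    "\<And>k. k \<in> f ` I \<Longrightarrow> h \<cdot> \<iota> k = g (inv_into I f k)"
    using coproduct_desc[OF c T(1), of "\<lambda>k. g (inv_into I f k)"] T(2) inv_into_into by metis
  then show "\<exists>h. h \<in> Hom C P T \<and> (\<forall>i\<in>I. h \<cdot> \<iota> (f i) = g i)" by (intro exI[of _ h]) simp
next
  fix T u v assume "u \<in> Hom C P T" "v \<in> Hom C P T" "\<And>i. i \<in> I \<Longrightarrow> u \<cdot> \<iota> (f i) = v \<cdot> \<iota> (f i)"
  then show "u = v" by (intro coproduct_eqI[OF c, of u v]) auto
qed

end

text \<open>The empty family is included: a coproduct over no paths is a zero object, which bounds
  the supports of free representations.\<close>

lemma (in preadditive_category) coproduct_zero_object: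
  assumes c: "is_coproduct C I X P \<iota>" and "\<And>i. i \<in> I \<Longrightarrow> is_zero_object C (X i)"
  shows "is_zero_object C P"
proof -
  note [simp] = coproduct_arr[OF c]
  have "Ide C P = Zer C P P"
  proof (rule coproduct_eqI[OF c])
    fix i assume "i \<in> I"
    then show "Ide C P \<cdot> \<iota> i = Zer C P P \<cdot> \<iota> i"
      using assms(2)[of i] obj_of_arr(1)[of "\<iota> i"] by (intro zero_object_arr_eq[of "X i"]) simp_all
  qed simp_all
  then show ?thesis using zero_object_iff by simp
qed

section \<open>Cardinals\<close>

text \<open>Justifies the choice in \<open>card_sup\<close>: the cardinality of the whole type is an
  upper bound, and a nonempty collection of cardinals has a least member.\<close>

lemma card_sup:
  fixes X :: "'a rel set"
  assumes "\<And>x. x \<in> X \<Longrightarrow> Card_order x"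
  shows "Card_order (card_sup X)" and "x \<in> X \<Longrightarrow> x \<le>o card_sup X"
proof -
  let ?B = "{s :: 'a rel. Card_order s \<and> (\<forall>x\<in>X. x \<le>o s)}"
  have "x \<le>o |UNIV :: 'a set|" if "x \<in> X" for x
    using card_of_Field_ordIso[OF assms[OF that]] card_of_mono1[of "Field x" UNIV] ordIso_symmetric
      ordIso_ordLeq_trans by blast
  then have ne: "?B \<noteq> {}" using card_of_Card_order by blast
  obtain r where r: "r \<in> ?B" "\<forall>s\<in>?B. r \<le>o s" using exists_minim_Card_order[OF ne] by blast
  then have "Card_order r \<and> (\<forall>x\<in>X. x \<le>o r) \<and> (\<forall>s::'a rel. Card_order s \<and> (\<forall>x\<in>X. x \<le>o s) \<longrightarrow> r \<le>o s)"
    by simp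
  then have "\<exists>r::'a rel. Card_order r \<and> (\<forall>x\<in>X. x \<le>o r) \<and> (\<forall>s::'a rel. Card_order s \<and>
    (\<forall>x\<in>X. x \<le>o s) \<longrightarrow> r \<le>o s)"
    by (rule exI)
  from someI_ex[OF this] show "Card_order (card_sup X)" "x \<in> X \<Longrightarrow> x \<le>o card_sup X"
    unfolding card_sup_def by blast+
qed

text \<open>In both branches of its definition the size lies strictly above every member, matching
  the strict bound in \<open>AB3\<close>.\<close>

lemma card_size:
  fixes X :: "'a rel set"
  assumes X: "\<And>x. x \<in> X \<Longrightarrow> Card_order x"
  shows "Card_order (card_size X)" and "x \<in> X \<Longrightarrow> x <o card_size X"
proof -
  have s: "Card_order (card_sup X)" "\<And>x. x \<in> X \<Longrightarrow> x \<le>o card_sup X" using card_sup[of X] X by blast+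
  have eq: "card_sup X =o |(\<lambda>a. {a}) ` Field (card_sup X)|"
  proof -
    have "bij_betw (\<lambda>a. {a}) (Field (card_sup X)) ((\<lambda>a. {a}) ` Field (card_sup X))"
      by (auto simp: bij_betw_def inj_on_def)
    then have "|Field (card_sup X)| =o |(\<lambda>a. {a}) ` Field (card_sup X)|" using card_of_ordIso
      by blast
    then show ?thesis using card_of_Field_ordIso[OF s(1)] ordIso_symmetric ordIso_transitive
      by blast
  qed
  show "Card_order (card_size X)"
  proof (cases "\<forall>x\<in>X. x <o card_sup X")
    case True
    show ?thesis unfolding card_size_def if_P[OF True] by (rule card_of_Card_order)
  next
    case False
    show ?thesis unfolding card_size_def if_not_P[OF False] by (rule cardSuc_Card_order[OF s(1)])
  qed
  assume x: "x \<in> X"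
  show "x <o card_size X"
  proof (cases "\<forall>x\<in>X. x <o card_sup X")
    case True
    then show ?thesis unfolding card_size_def using x ordLess_ordIso_trans[OF _ eq] by auto
  next
    case False
    then show ?thesis unfolding card_size_def
      using ordLeq_ordLess_trans[OF s(2)[OF x] cardSuc_greater[OF s(1)]] by auto
  qed
qed

text \<open>\<open>AB3\<close> speaks of subsets of the type of \<kappa>. An index set of any type
  embeds into the field of \<kappa>, and the coproduct is reindexed along the embedding.\<close>

lemma AB3_coproduct:
  assumes C: "category C" and k: "Card_order \<kappa>" and ab: "AB3 \<kappa> C" and I: "|I| <o \<kappa>"
    and X: "\<And>i. i \<in> I \<Longrightarrow> X i \<in> Obj C"
  obtains P \<iota> where "is_coproduct C I X P \<iota>"
proof -
  have "|I| \<le>o |Field \<kappa>|"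
    by (rule ordLeq_ordIso_trans[OF ordLess_imp_ordLeq[OF I] ordIso_symmetric[OF
      card_of_Field_ordIso[OF k]]])
  then have "\<exists>f. inj_on f I \<and> f ` I \<subseteq> Field \<kappa>" by (rule iffD2[OF card_of_ordLeq])
  then obtain f where "inj_on f I \<and> f ` I \<subseteq> Field \<kappa>" by (rule exE)
  then have f: "inj_on f I" by (rule conjunct1)
  then have "bij_betw f I (f ` I)" by (rule inj_on_imp_bij_betw)
  then have "|I| =o |f ` I|" by (rule card_of_ordIsoI)
  then have "|f ` I| <o \<kappa>" by (rule ordIso_ordLess_trans[OF ordIso_symmetric I])
  moreover have "\<forall>k\<in>f ` I. X (inv_into I f k) \<in> Obj C" using X inv_into_into by metis
  ultimately obtain P \<iota> where "is_coproduct C (f ` I) (\<lambda>k. X (inv_into I f k)) P \<iota>"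
    using ab[unfolded AB3_def, rule_format, of "f ` I" "\<lambda>k. X (inv_into I f k)"] by blast
  then show thesis using that category.coproduct_reindex[OF C f] by blast
qed

lemma card_paths_less:
  fixes Q :: "('v, 'e) quiver"
  assumes "i \<in> verts Q" "j \<in> verts Q" "rccn Q \<le>o \<kappa>"
  shows "|paths Q i j| <o \<kappa>"
proof -
  let ?X = "(\<lambda>j. |paths Q i j| ) ` verts Q"
  have X: "\<And>x. x \<in> (\<lambda>j. |paths Q i j| ) ` verts Q \<Longrightarrow> Card_order x" for i
    by (erule imageE) (simp only: card_of_Card_order)
  have "|paths Q i j| <o card_size ?X"
    by (rule card_size(2)[OF X imageI[OF assms(2)]])
  also have "card_size ?X \<le>o rccn Q" unfolding rccn_def
  proof (rule card_sup(2))
    show "Card_order x" if "x \<in> (\<lambda>i. card_size ((\<lambda>j. |paths Q i j| ) ` verts Q)) ` verts Q" for x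
      using that by (elim imageE) (simp only: card_size(1)[OF X])
  qed (use assms(1) in \<open>rule imageI\<close>)
  finally have "|paths Q i j| <o rccn Q" .
  then show ?thesis using assms(3) ordLess_ordLeq_trans by blast
qed

lemma card_paths_to_less:
  assumes "j \<in> verts Q" "ltccn Q \<le>o \<kappa>"
  shows "|paths_to Q j| <o \<kappa>"
proof -
  have "|paths_to Q j| <o ltccn Q" unfolding ltccn_def
  proof (rule card_size(2))
    show "Card_order x" if "x \<in> (\<lambda>j. |paths_to Q j| ) ` verts Q" for x
      using that by (elim imageE) (simp only: card_of_Card_order)
  qed (use assms(1) in blast)
  then show ?thesis using assms(2) ordLess_ordLeq_trans by blast
qed

section \<open>Free representations\<close>

lemma mem_paths [simp]: "(i', as) \<in> paths Q i j \<longleftrightarrow> i' = i \<and> walk Q i as j"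
  by (auto simp: paths_def)

lemma ball_paths: "(\<forall>\<rho>\<in>paths Q i j. P \<rho>) \<longleftrightarrow> (\<forall>as. walk Q i as j \<longrightarrow> P (i, as))"
  by (auto simp: paths_def)

lemma walk_start: "walk Q i as j \<Longrightarrow> i \<in> verts Q"
  by (induction as arbitrary: j) auto

lemma walk_end: "is_quiver Q \<Longrightarrow> walk Q i as j \<Longrightarrow> j \<in> verts Q"
  by (cases as) (auto simp: is_quiver_def)

lemma walk_append: "walk Q i as j \<Longrightarrow> walk Q j bs k \<Longrightarrow> walk Q i (bs @ as) k"
  by (induction bs arbitrary: k) auto

text \<open>Lists begin with the last arrow of a path, so the final list entry is the first arrow.
  Splitting it off is what \<open>free_arrow\<close> and \<open>path_sum\<close> require.\<close>

lemma walk_snoc: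
  "is_quiver Q \<Longrightarrow> walk Q i (as @ [\<rho>]) k \<longleftrightarrow> \<rho> \<in> arrows Q \<and> src Q \<rho> = i \<and> walk Q (tgt Q \<rho>) as k"
  by (induction as arbitrary: k) (auto simp: is_quiver_def)

context quiver_reps
begin

lemma rep_walk_arr [simp]:
  assumes "is_rep Q C F" "walk Q i as j"
  shows "rep_walk C F i as \<in> Arr C" "Dom C (rep_walk C F i as) = rv F i"
    "Cod C (rep_walk C F i as) = rv F j"
proof -
  have "rep_walk C F i as \<in> Arr C \<and> Dom C (rep_walk C F i as) = rv F i \<and> Cod C (rep_walk C F i as) =
    rv F j"
    using assms(2)
  proof (induction as arbitrary: j)
    case (Cons \<alpha> as)
    then show ?case using assms(1) by auto
  qed (use assms(1) in auto)
  then show "rep_walk C F i as \<in> Arr C" "Dom C (rep_walk C F i as) = rv F i"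
    "Cod C (rep_walk C F i as) = rv F j" by auto
qed

lemma rep_mor_walk:
  assumes f: "is_rep_mor Q C \<phi>" and "walk Q i as j"
  shows "qcmp \<phi> j \<cdot> rep_walk C (qdom \<phi>) i as = rep_walk C (qcod \<phi>) i as \<cdot> qcmp \<phi> i"
  using assms(2)
proof (induction as arbitrary: j)
  case Nil
  then show ?case using f by simp
next
  case (Cons \<alpha> as)
  then have a: "\<alpha> \<in> arrows Q" "tgt Q \<alpha> = j" and w: "walk Q i as (src Q \<alpha>)" by auto
  note v = walk_start[OF w]
  note [simp] = rep_walk_arr[OF _ w]
  have "qcmp \<phi> j \<cdot> (ra (qdom \<phi>) \<alpha> \<cdot> rep_walk C (qdom \<phi>) i as) = ra (qcod \<phi>) \<alpha> \<cdot> (qcmp \<phi> (src Q \<alpha>) \<cdot>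
    rep_walk C (qdom \<phi>) i as)"
    using rep_mor_natural[OF f a(1)] f a by (intro comp_square) auto
  also have "\<dots> = ra (qcod \<phi>) \<alpha> \<cdot> (rep_walk C (qcod \<phi>) i as \<cdot> qcmp \<phi> i)" using Cons.IH[OF w] by simp
  finally show ?case using f a v by simp
qed

end

text \<open>Confines the cardinals to one consequence: existence of the copowers over paths between
  two fixed vertices, from which free representations are built.\<close>

locale path_copowers = quiver_reps +
  assumes copowers: "i \<in> verts Q \<Longrightarrow> j \<in> verts Q \<Longrightarrow> X \<in> Obj C \<Longrightarrow> \<exists>P \<iota>. is_coproduct C (paths Q i j) (\<lambda>_.
    X) P \<iota>"
begin

lemma free_coproduct:
  assumes "i \<in> verts Q" "j \<in> verts Q" "X \<in> Obj C"
  shows "is_coproduct C (paths Q i j) (\<lambda>_. X) (free_ob Q C i X j) (incl Q C i X j)"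
proof -
  have "\<exists>c. case c of (P, \<iota>) \<Rightarrow> is_coproduct C (paths Q i j) (\<lambda>_. X) P \<iota>" using copowers[OF assms]
    by auto
  from someI_ex[OF this] have "case copower C X (paths Q i j) of (P, \<iota>) \<Rightarrow> is_coproduct C (paths Q i
    j) (\<lambda>_. X) P \<iota>"
    unfolding copower_def .
  moreover have "incl Q C i X j = snd (copower C X (paths Q i j))"
    by (rule ext) (simp add: incl_def)
  ultimately show ?thesis by (simp add: free_ob_def case_prod_unfold)
qed

lemma free_ob_obj [simp]: "i \<in> verts Q \<Longrightarrow> j \<in> verts Q \<Longrightarrow> X \<in> Obj C \<Longrightarrow> free_ob Q C i X j \<in> Obj C"
  using coproduct_arr(1)[OF free_coproduct] .

lemma incl_arr [simp]:
  assumes "walk Q i as j" "X \<in> Obj C"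
  shows "incl Q C i X j (i, as) \<in> Arr C" "Dom C (incl Q C i X j (i, as)) = X"
    "Cod C (incl Q C i X j (i, as)) = free_ob Q C i X j"
  using coproduct_arr(2-4)[OF free_coproduct[of i j X], of "(i, as)"] assms walk_start[OF assms(1)]
    walk_end[OF quiver assms(1)] by auto

lemma free_ob_eqI:
  assumes "i \<in> verts Q" "j \<in> verts Q" "X \<in> Obj C" "u \<in> Arr C" "Dom C u = free_ob Q C i X j"
    "v \<in> Arr C" "Dom C v = free_ob Q C i X j" "Cod C v = Cod C u"
    "\<And>as. walk Q i as j \<Longrightarrow> u \<cdot> incl Q C i X j (i, as) = v \<cdot> incl Q C i X j (i, as)"
  shows "u = v"
  by (rule coproduct_eqI[OF free_coproduct[OF assms(1-3)]])
    (use assms(4-9) in \<open>auto simp: paths_def\<close>)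

lemma free_rep_rv [simp]: "j \<in> verts Q \<Longrightarrow> rv (free_rep Q C i X) j = free_ob Q C i X j"
  by (simp add: free_rep_def)

lemma free_rep_ra:
  assumes i: "i \<in> verts Q" and X: "X \<in> Obj C" and a: "\<alpha> \<in> arrows Q"
  shows "ra (free_rep Q C i X) \<alpha> \<in> Hom C (free_ob Q C i X (src Q \<alpha>)) (free_ob Q C i X (tgt Q \<alpha>))"
    and "walk Q i as (src Q \<alpha>) \<Longrightarrow> ra (free_rep Q C i X) \<alpha> \<cdot> incl Q C i X (src Q \<alpha>) (i, as) =
      incl Q C i X (tgt Q \<alpha>) (i, \<alpha> # as)"
proof -
  have "\<exists>!h. h \<in> Hom C (free_ob Q C i X (src Q \<alpha>)) (free_ob Q C i X (tgt Q \<alpha>)) \<and>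
    (\<forall>\<rho>\<in>paths Q i (src Q \<alpha>).
           h \<cdot> incl Q C i X (src Q \<alpha>) \<rho> = incl Q C i X (tgt Q \<alpha>) (after_path \<alpha> \<rho>))"
    by (rule coproduct_ex1[OF free_coproduct]) (use i X a in \<open>auto simp: paths_def after_path_def\<close>)
  from theI'[OF this] show "ra (free_rep Q C i X) \<alpha> \<in> Hom C (free_ob Q C i X (src Q \<alpha>)) (free_ob Q C
    i X (tgt Q \<alpha>))"
    "walk Q i as (src Q \<alpha>) \<Longrightarrow> ra (free_rep Q C i X) \<alpha> \<cdot> incl Q C i X (src Q \<alpha>) (i, as) =
      incl Q C i X (tgt Q \<alpha>) (i, \<alpha> # as)"
    using a by (simp_all add: free_rep_def ball_paths after_path_def del: in_Hom_iff)
qed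

lemma free_rep_is_rep [simp]:
  assumes "i \<in> verts Q" "X \<in> Obj C"
  shows "is_rep Q C (free_rep Q C i X)"
  unfolding is_rep_def
proof (intro conjI PiE_I)
  fix \<alpha> assume a: "\<alpha> \<in> arrows Q"
  show "ra (free_rep Q C i X) \<alpha> \<in> Hom C (rv (free_rep Q C i X) (src Q \<alpha>)) (rv (free_rep Q C i X)
    (tgt Q \<alpha>))"
    using free_rep_ra(1)[OF assms a] a by simp
qed (use assms in \<open>auto simp: free_rep_def\<close>)

text \<open>Acting by \<open>bs\<close> prolongs the path. In particular every inclusion arises from
  that of the trivial path, which therefore generates the free representation.\<close>

lemma free_rep_walk:
  assumes X: "X \<in> Obj C" and w: "walk Q i as j" and "walk Q j bs k"
  shows "rep_walk C (free_rep Q C i X) j bs \<cdot> incl Q C i X j (i, as) = incl Q C i X k (i, bs @ as)"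
  using assms(3)
proof (induction bs arbitrary: k)
  case Nil
  then show ?case using X w by simp
next
  case (Cons \<alpha> bs)
  then have a: "\<alpha> \<in> arrows Q" "tgt Q \<alpha> = k" and w': "walk Q j bs (src Q \<alpha>)" by auto
  have i: "i \<in> verts Q" using walk_start[OF w] .
  have "rep_walk C (free_rep Q C i X) j (\<alpha> # bs) \<cdot> incl Q C i X j (i, as) = ra (free_rep Q C i X) \<alpha>
    \<cdot> incl Q C i X (src Q \<alpha>) (i, bs @ as)"
    using Cons.IH[OF w'] X w a(1) i rep_walk_arr[OF free_rep_is_rep[OF i X] w']
      walk_end[OF quiver w] by simp
  also have "\<dots> = incl Q C i X k (i, \<alpha> # bs @ as)"
    using free_rep_ra(2)[OF i X a(1) walk_append[OF w w']] a(2) by simp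
  finally show ?case by simp
qed

lemma free_mor_incl:
  assumes f: "is_rep_mor Q C \<phi>" "qdom \<phi> = free_rep Q C i X" and X: "X \<in> Obj C"
    and w: "walk Q i as j"
  shows "qcmp \<phi> j \<cdot> incl Q C i X j (i, as) = rep_walk C (qcod \<phi>) i as \<cdot> (qcmp \<phi> i \<cdot> incl Q C i X i
    (i, []))"
proof -
  have i: "i \<in> verts Q" and j: "j \<in> verts Q" using walk_start[OF w] walk_end[OF quiver w] .
  have n: "walk Q i [] i" using i by simp
  have "qcmp \<phi> j \<cdot> incl Q C i X j (i, as) = qcmp \<phi> j \<cdot> (rep_walk C (qdom \<phi>) i as \<cdot> incl Q C i X i
    (i, []))"
    using free_rep_walk[OF X n w] f by simp
  also have "\<dots> = rep_walk C (qcod \<phi>) i as \<cdot> (qcmp \<phi> i \<cdot> incl Q C i X i (i, []))"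
    using rep_mor_walk[OF f(1) w] rep_walk_arr[OF _ w] f i j X by (intro comp_square) simp_all
  finally show ?thesis .
qed

lemma free_mor_eqI:
  assumes i: "i \<in> verts Q" and X: "X \<in> Obj C" and f: "is_rep_mor Q C \<phi>" "qdom \<phi> = free_rep Q C i X"
    and g: "is_rep_mor Q C \<psi>" "qdom \<psi> = free_rep Q C i X"
    and e: "qcod \<phi> = qcod \<psi>" "qcmp \<phi> i \<cdot> incl Q C i X i (i, []) = qcmp \<psi> i \<cdot> incl Q C i X i (i, [])"
  shows "\<phi> = \<psi>"
proof (rule rep_mor_eqI[OF f(1) g(1)])
  fix j assume j: "j \<in> verts Q"
  show "qcmp \<phi> j = qcmp \<psi> j"
  proof (rule free_ob_eqI[OF i j X])
    fix as assume w: "walk Q i as j"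
    show "qcmp \<phi> j \<cdot> incl Q C i X j (i, as) = qcmp \<psi> j \<cdot> incl Q C i X j (i, as)"
      unfolding free_mor_incl[OF f X w] free_mor_incl[OF g X w] e ..
  qed (use f g e j in simp_all)
qed (use f g e in simp_all)

text \<open>Existence half of the adjunction: on the summand of \<open>as\<close> the morphism is
  \<open>x\<close> followed by the action of \<open>as\<close>. Inclusions are jointly epic, so
  naturality is checked on them, where it says that the action of a prolonged path is a
  composite.\<close>

lemma ex_free_desc:
  assumes i: "i \<in> verts Q" and F: "is_rep Q C F" and x: "x \<in> Arr C" "Cod C x = rv F i"
  obtains \<phi> where "is_rep_mor Q C \<phi>" "qdom \<phi> = free_rep Q C i (Dom C x)" "qcod \<phi> = F"
    "\<And>j as. walk Q i as j \<Longrightarrow> qcmp \<phi> j \<cdot> incl Q C i (Dom C x) j (i, as) = rep_walk C F i as \<cdot> x"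
proof -
  let ?X = "Dom C x"
  have X: "?X \<in> Obj C" using x by simp
  have "\<exists>h. j \<in> verts Q \<longrightarrow> h \<in> Arr C \<and> Dom C h = free_ob Q C i ?X j \<and> Cod C h = rv F j \<and>
      (\<forall>as. walk Q i as j \<longrightarrow> h \<cdot> incl Q C i ?X j (i, as) = rep_walk C F i as \<cdot> x)" for j
  proof (cases "j \<in> verts Q")
    case True
    have "\<exists>!h. h \<in> Hom C (free_ob Q C i ?X j) (rv F j) \<and> (\<forall>\<rho>\<in>paths Q i j. h \<cdot> incl Q C i ?X j \<rho> =
      rep_walk C F i (snd \<rho>) \<cdot> x)"
    proof (rule coproduct_ex1[OF free_coproduct[OF i True X]])
      fix \<rho> assume "\<rho> \<in> paths Q i j"
      then show "rep_walk C F i (snd \<rho>) \<cdot> x \<in> Hom C ?X (rv F j)" using x rep_walk_arr[OF F]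
        by (auto simp: paths_def)
    qed (use F True in simp)
    then show ?thesis unfolding ball_paths by auto
  qed simp
  then obtain h where h: "\<And>j. j \<in> verts Q \<Longrightarrow> h j \<in> Arr C \<and> Dom C (h j) = free_ob Q C i ?X j \<and>
    Cod C (h j) = rv F j \<and>
      (\<forall>as. walk Q i as j \<longrightarrow> h j \<cdot> incl Q C i ?X j (i, as) = rep_walk C F i as \<cdot> x)" by metis
  have m: "is_rep_mor Q C (QMor (free_rep Q C i ?X) F (\<lambda>j\<in>verts Q. h j))"
  proof (rule rep_morI)
    fix \<alpha> assume a: "\<alpha> \<in> arrows Q"
    note hs = h[OF arrow_verts(1)[OF a]] and ht = h[OF arrow_verts(2)[OF a]]
      and fr = free_rep_ra(1)[OF i X a]
    show "h (tgt Q \<alpha>) \<cdot> ra (free_rep Q C i ?X) \<alpha> = ra F \<alpha> \<cdot> h (src Q \<alpha>)"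
    proof (rule free_ob_eqI[OF i arrow_verts(1)[OF a] X])
      fix as assume w: "walk Q i as (src Q \<alpha>)"
      have "(h (tgt Q \<alpha>) \<cdot> ra (free_rep Q C i ?X) \<alpha>) \<cdot> incl Q C i ?X (src Q \<alpha>) (i, as) =
        h (tgt Q \<alpha>) \<cdot> incl Q C i ?X (tgt Q \<alpha>) (i, \<alpha> # as)"
        using free_rep_ra(2)[OF i X a w] ht fr w X by simp
      also have "\<dots> = rep_walk C F i (\<alpha> # as) \<cdot> x" using ht w a by simp
      also have "\<dots> = ra F \<alpha> \<cdot> (rep_walk C F i as \<cdot> x)" using F a x rep_walk_arr[OF F w] by simp
      also have "\<dots> = ra F \<alpha> \<cdot> (h (src Q \<alpha>) \<cdot> incl Q C i ?X (src Q \<alpha>) (i, as))" using hs w by simp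
      also have "\<dots> = (ra F \<alpha> \<cdot> h (src Q \<alpha>)) \<cdot> incl Q C i ?X (src Q \<alpha>) (i, as)" using F a hs w X
        by simp
      finally show "(h (tgt Q \<alpha>) \<cdot> ra (free_rep Q C i ?X) \<alpha>) \<cdot> incl Q C i ?X (src Q \<alpha>) (i, as) =
        (ra F \<alpha> \<cdot> h (src Q \<alpha>)) \<cdot> incl Q C i ?X (src Q \<alpha>) (i, as)" .
    qed (use a hs ht fr F in simp_all)
  qed (use i X F h in simp_all)
  show thesis
  proof (rule that[OF m])
    fix j as assume "walk Q i as j"
    then show "qcmp (QMor (free_rep Q C i ?X) F (\<lambda>j\<in>verts Q. h j)) j \<cdot> incl Q C i ?X j (i, as) =
      rep_walk C F i as \<cdot> x"
      using h[of j] walk_end[OF quiver] by simp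
  qed simp_all
qed

text \<open>\<open>free_mor\<close>, \<open>counit\<close> and \<open>free_arrow\<close> are
  families of definite descriptions; this identifies them with any morphism having the right values
  on inclusions. \<open>T\<close> is kept apart from \<open>rv F\<close> because two of these
  definitions write the codomain as \<open>free_ob\<close>.\<close>

lemma free_the_eq:
  assumes "i \<in> verts Q" "X \<in> Obj C" "is_rep_mor Q C \<phi>" "qdom \<phi> = free_rep Q C i X" "qcod \<phi> = F"
    and "\<And>j as. walk Q i as j \<Longrightarrow> qcmp \<phi> j \<cdot> incl Q C i X j (i, as) = g j (i, as)"
    and "\<And>j. j \<in> verts Q \<Longrightarrow> T j = rv F j"
  shows "QMor (free_rep Q C i X) F (\<lambda>j\<in>verts Q. THE h. h \<in> Hom C (free_ob Q C i X j) (T j) \<and>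
    (\<forall>\<rho>\<in>paths Q i j. h \<cdot> incl Q C i X j \<rho> = g j \<rho>)) = \<phi>"
proof -
  have "(THE h. h \<in> Hom C (free_ob Q C i X j) (T j) \<and> (\<forall>\<rho>\<in>paths Q i j. h \<cdot> incl Q C i X j \<rho> =
    g j \<rho>)) = qcmp \<phi> j" if "j \<in> verts Q" for j
    by (rule coproduct_the_eq[OF free_coproduct]) (use assms that in \<open>auto simp: paths_def\<close>)
  then show ?thesis using assms(3-5) by (simp cong: restrict_cong)
qed

lemma free_mor:
  assumes i: "i \<in> verts Q" and x: "x \<in> Arr C"
  shows "is_rep_mor Q C (free_mor Q C i x)" "qdom (free_mor Q C i x) = free_rep Q C i (Dom C x)"
    "qcod (free_mor Q C i x) = free_rep Q C i (Cod C x)"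
    "walk Q i as j \<Longrightarrow> qcmp (free_mor Q C i x) j \<cdot> incl Q C i (Dom C x) j (i, as) =
      incl Q C i (Cod C x) j (i, as) \<cdot> x"
proof -
  have n: "walk Q i [] i" using i by simp
  have X: "Dom C x \<in> Obj C" "Cod C x \<in> Obj C" using x by auto
  note [simp] = incl_arr[OF n X(2)]
  define y where "y = incl Q C i (Cod C x) i (i, []) \<cdot> x"
  have y: "y \<in> Arr C" "Cod C y = rv (free_rep Q C i (Cod C x)) i" "Dom C y = Dom C x" using x i
    by (simp_all add: y_def)
  obtain \<phi> where f: "is_rep_mor Q C \<phi>" "qdom \<phi> = free_rep Q C i (Dom C y)"
    "qcod \<phi> = free_rep Q C i (Cod C x)"
    "\<And>j as. walk Q i as j \<Longrightarrow> qcmp \<phi> j \<cdot> incl Q C i (Dom C y) j (i, as) = rep_walk C (free_rep Q C i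
      (Cod C x)) i as \<cdot> y"
    using ex_free_desc[OF i free_rep_is_rep[OF i X(2)] y(1,2)] by blast
  note f = f[unfolded y(3)]
  have fi: "qcmp \<phi> j \<cdot> incl Q C i (Dom C x) j (i, as) = incl Q C i (Cod C x) j (i, as) \<cdot> x"
    if w: "walk Q i as j" for j as
  proof -
    have "qcmp \<phi> j \<cdot> incl Q C i (Dom C x) j (i, as) = rep_walk C (free_rep Q C i (Cod C x)) i as \<cdot>
      (incl Q C i (Cod C x) i (i, []) \<cdot> x)"
      using f(4)[OF w] by (simp add: y_def)
    also have "\<dots> = incl Q C i (Cod C x) j (i, as) \<cdot> x"
      using free_rep_walk[OF X(2) n w] rep_walk_arr[OF free_rep_is_rep[OF i X(2)] w] x i
        by (intro comp_shift) simp_all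
    finally show ?thesis .
  qed
  have "free_mor Q C i x = \<phi>" unfolding free_mor_def
    by (rule free_the_eq[where g = "\<lambda>j \<rho>. incl Q C i (Cod C x) j \<rho> \<cdot> x"])
      (use i X x f fi in simp_all)
  then show "is_rep_mor Q C (free_mor Q C i x)" "qdom (free_mor Q C i x) = free_rep Q C i (Dom C x)"
    "qcod (free_mor Q C i x) = free_rep Q C i (Cod C x)"
    "walk Q i as j \<Longrightarrow> qcmp (free_mor Q C i x) j \<cdot> incl Q C i (Dom C x) j (i, as) =
      incl Q C i (Cod C x) j (i, as) \<cdot> x"
    using f fi x by simp_all
qed

lemma counit_mor:
  assumes i: "i \<in> verts Q" and F: "is_rep Q C F"
  shows "is_rep_mor Q C (counit Q C i F)" "qdom (counit Q C i F) = free_rep Q C i (rv F i)"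
    "qcod (counit Q C i F) = F"
    "walk Q i as j \<Longrightarrow> qcmp (counit Q C i F) j \<cdot> incl Q C i (rv F i) j (i, as) = rep_walk C F i as"
proof -
  have X: "rv F i \<in> Obj C" using i F by simp
  have y: "Ide C (rv F i) \<in> Arr C" "Cod C (Ide C (rv F i)) = rv F i" using X by simp_all
  obtain \<phi> where "is_rep_mor Q C \<phi>" "qdom \<phi> = free_rep Q C i (Dom C (Ide C (rv F i)))" "qcod \<phi> = F"
    "\<And>j as. walk Q i as j \<Longrightarrow> qcmp \<phi> j \<cdot> incl Q C i (Dom C (Ide C (rv F i))) j (i, as) =
      rep_walk C F i as \<cdot> Ide C (rv F i)"
    using ex_free_desc[OF i F y] by blast
  then have f': "is_rep_mor Q C \<phi>" "qdom \<phi> = free_rep Q C i (rv F i)" "qcod \<phi> = F"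
    "\<And>j as. walk Q i as j \<Longrightarrow> qcmp \<phi> j \<cdot> incl Q C i (rv F i) j (i, as) = rep_walk C F i as"
    using X rep_walk_arr[OF F] by simp_all
  have "counit Q C i F = \<phi>" unfolding counit_def
    by (rule free_the_eq[where g = "\<lambda>j \<rho>. rep_walk C F i (snd \<rho>)"]) (use i X f' in simp_all)
  then show "is_rep_mor Q C (counit Q C i F)" "qdom (counit Q C i F) = free_rep Q C i (rv F i)"
    "qcod (counit Q C i F) = F"
    "walk Q i as j \<Longrightarrow> qcmp (counit Q C i F) j \<cdot> incl Q C i (rv F i) j (i, as) = rep_walk C F i as"
    using f' by simp_all
qed

lemma free_arrow_mor:
  assumes r: "\<rho> \<in> arrows Q" and X: "X \<in> Obj C"
  shows "is_rep_mor Q C (free_arrow Q C \<rho> X)" "qdom (free_arrow Q C \<rho> X) = free_rep Q C (tgt Q \<rho>) X"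
    "qcod (free_arrow Q C \<rho> X) = free_rep Q C (src Q \<rho>) X"
    "walk Q (tgt Q \<rho>) as k \<Longrightarrow> qcmp (free_arrow Q C \<rho> X) k \<cdot> incl Q C (tgt Q \<rho>) X k (tgt Q \<rho>, as) =
      incl Q C (src Q \<rho>) X k (src Q \<rho>, as @ [\<rho>])"
proof -
  have v: "src Q \<rho> \<in> verts Q" "tgt Q \<rho> \<in> verts Q" using r by simp_all
  have w1: "walk Q (src Q \<rho>) [\<rho>] (tgt Q \<rho>)" using r v by simp
  \<comment> \<open>Under the adjunction \<open>free_arrow\<close> corresponds to the inclusion of
    the path consisting of \<open>\<rho>\<close> alone.\<close>
  let ?x = "incl Q C (src Q \<rho>) X (tgt Q \<rho>) (src Q \<rho>, [\<rho>])"
  note ix = incl_arr[OF w1 X]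
  have "Cod C ?x = rv (free_rep Q C (src Q \<rho>) X) (tgt Q \<rho>)" using ix v by simp
  from ex_free_desc[OF v(2) free_rep_is_rep[OF v(1) X] ix(1) this]
  obtain \<phi> where f: "is_rep_mor Q C \<phi>" "qdom \<phi> = free_rep Q C (tgt Q \<rho>) (Dom C ?x)"
    "qcod \<phi> = free_rep Q C (src Q \<rho>) X"
    "\<And>j as. walk Q (tgt Q \<rho>) as j \<Longrightarrow> qcmp \<phi> j \<cdot> incl Q C (tgt Q \<rho>) (Dom C ?x) j (tgt Q \<rho>, as) =
      rep_walk C (free_rep Q C (src Q \<rho>) X) (tgt Q \<rho>) as \<cdot> ?x" by blast
  have f': "qcmp \<phi> j \<cdot> incl Q C (tgt Q \<rho>) X j (tgt Q \<rho>, as) = incl Q C (src Q \<rho>) X j (src Q \<rho>, as @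
    [\<rho>])" if w: "walk Q (tgt Q \<rho>) as j" for j as
    using f(4)[OF w] free_rep_walk[OF X w1 w] ix by simp
  have "free_arrow Q C \<rho> X = \<phi>" unfolding free_arrow_def
    by (rule free_the_eq[where g = "\<lambda>k \<sigma>. incl Q C (src Q \<rho>) X k (before_path Q \<sigma> \<rho>)"])
       (use v X f(1-3) f' ix in \<open>simp_all add: before_path_def\<close>)
  then show "is_rep_mor Q C (free_arrow Q C \<rho> X)"
    "qdom (free_arrow Q C \<rho> X) = free_rep Q C (tgt Q \<rho>) X"
    "qcod (free_arrow Q C \<rho> X) = free_rep Q C (src Q \<rho>) X"
    "walk Q (tgt Q \<rho>) as k \<Longrightarrow> qcmp (free_arrow Q C \<rho> X) k \<cdot> incl Q C (tgt Q \<rho>) X k (tgt Q \<rho>, as) =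
      incl Q C (src Q \<rho>) X k (src Q \<rho>, as @ [\<rho>])"
    using f f' ix by simp_all
qed

text \<open>For a vertex \<open>i\<close> this is \<open>i\<close> together with
  \<open>plus_set Q {i}\<close>.\<close>

definition reach where "reach i = {j \<in> verts Q. paths Q i j \<noteq> {}}"

lemma Supp_free_rep:
  assumes i: "i \<in> verts Q" and X: "X \<in> Obj C"
  shows "Supp Q C (free_rep Q C i X) \<subseteq> reach i"
proof
  fix j assume "j \<in> Supp Q C (free_rep Q C i X)"
  then have j: "j \<in> verts Q" "\<not> is_zero_object C (free_ob Q C i X j)" by (auto simp: Supp_def)
  then show "j \<in> reach i" using coproduct_zero_object[OF free_coproduct[OF i j(1) X]]
    by (auto simp: reach_def)
qed

lemma free_rep_obj:
  assumes "i \<in> verts Q" "reach i \<in> \<I>" "X \<in> Obj C"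
  shows "free_rep Q C i X \<in> Obj reps"
  using subset_ideal[OF assms(2) Supp_free_rep[OF assms(1,3)]] assms by simp

lemma free_functor_reps:
  assumes i: "i \<in> verts Q" and r: "reach i \<in> \<I>"
  shows "is_functor C reps (free_functor Q C i)"
  unfolding is_functor_def
proof (intro conjI ballI impI)
  have n: "walk Q i [] i" using i by simp
  note o = free_rep_obj[OF i r]
  fix a assume a: "a \<in> Obj C"
  show "fob (free_functor Q C i) a \<in> Obj reps" using o[OF a] by (simp add: free_functor_def)
  have "free_mor Q C i (Ide C a) = Ide reps (free_rep Q C i a)"
  proof (rule free_mor_eqI[OF i a])
    show "is_rep_mor Q C (Ide reps (free_rep Q C i a))" unfolding reps_sel
      by (rule ide_rep_mor[OF free_rep_is_rep[OF i a]])
  qed (use free_mor(1-3)[OF i, of "Ide C a"] free_mor(4)[OF i _ n, of "Ide C a"] a i incl_arr[OF n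
    a] in simp_all)
  then show "far (free_functor Q C i) (Ide C a) = Ide reps (fob (free_functor Q C i) a)"
    by (simp add: free_functor_def)
next
  have n: "walk Q i [] i" using i by simp
  note o = free_rep_obj[OF i r]
  fix f assume f: "f \<in> Arr C"
  have "Dom C f \<in> Obj C" "Cod C f \<in> Obj C" using f by auto
  then show "far (free_functor Q C i) f \<in> Hom reps (fob (free_functor Q C i) (Dom C f)) (fob
    (free_functor Q C i) (Cod C f))"
    using free_mor[OF i f] o by (simp add: free_functor_def)
  fix g assume g: "g \<in> Arr C" "Dom C g = Cod C f"
  have X: "Dom C f \<in> Obj C" "Cod C f \<in> Obj C" "Cod C g \<in> Obj C" using f g by auto
  have gf: "g \<cdot> f \<in> Arr C" "Dom C (g \<cdot> f) = Dom C f" "Cod C (g \<cdot> f) = Cod C g" using f g by simp_all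
  note mf = free_mor[OF i f] and mg = free_mor[OF i g(1)] and mgf = free_mor[OF i gf(1)]
  note inc = incl_arr[OF n X(1)] incl_arr[OF n X(2)] incl_arr[OF n X(3)]
  have "free_mor Q C i (g \<cdot> f) = free_mor Q C i g \<cdot>\<^bsub>reps\<^esub> free_mor Q C i f"
  proof (rule free_mor_eqI[OF i X(1)])
    have "qcmp (free_mor Q C i g) i \<cdot> qcmp (free_mor Q C i f) i \<cdot> incl Q C i (Dom C f) i (i, []) =
      qcmp (free_mor Q C i g) i \<cdot> (incl Q C i (Cod C f) i (i, []) \<cdot> f)"
      using mf(4)[OF n] by simp
    also have "\<dots> = (incl Q C i (Cod C g) i (i, []) \<cdot> g) \<cdot> f"
      using mg(4)[OF n] mg(1-3) g f i inc by (intro comp_shift) simp_all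
    also have "\<dots> = qcmp (free_mor Q C i (g \<cdot> f)) i \<cdot> incl Q C i (Dom C f) i (i, [])"
      using mgf(4)[OF n] gf g f inc by simp
    finally show "qcmp (free_mor Q C i (g \<cdot> f)) i \<cdot> incl Q C i (Dom C f) i (i, []) =
      qcmp (free_mor Q C i g \<cdot>\<^bsub>reps\<^esub> free_mor Q C i f) i \<cdot> incl Q C i (Dom C f) i (i, [])"
      using mf mg i g inc by simp
  qed (use mf mg mgf gf g i in simp_all)
  then show "far (free_functor Q C i) (g \<cdot> f) = far (free_functor Q C i) g \<cdot>\<^bsub>reps\<^esub> far (free_functor
    Q C i) f" by (simp add: free_functor_def del: reps_sel)
qed

lemma free_left_adjoint:
  assumes i: "i \<in> verts Q" and r: "reach i \<in> \<I>"
  shows "is_left_adjoint C reps (free_functor Q C i) (eval_functor i)"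
  unfolding is_left_adjoint_def
proof (intro conjI free_functor_reps[OF i r] eval_functor_reps[OF i])
  have n: "walk Q i [] i" using i by simp
  note o = free_rep_obj[OF i r]
  let ?\<Phi> = "\<lambda>X (Y :: ('c, 'd, 'a, 'b) qrep) \<phi>. qcmp \<phi> i \<cdot> incl Q C i X i (i, [])"
  show "\<exists>\<Phi>. (\<forall>X\<in>Obj C. \<forall>Y\<in>Obj reps. bij_betw (\<Phi> X Y) (Hom reps (fob (free_functor Q C i) X) Y) (Hom
    C X (fob (eval_functor i) Y))) \<and>
        (\<forall>x\<in>Arr C. \<forall>y\<in>Arr reps. \<forall>h\<in>Hom reps (fob (free_functor Q C i) (Cod C x)) (Dom reps y).
           \<Phi> (Dom C x) (Cod reps y) (y \<cdot>\<^bsub>reps\<^esub> h \<cdot>\<^bsub>reps\<^esub> far (free_functor Q C i) x)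
             = far (eval_functor i) y \<cdot> \<Phi> (Cod C x) (Dom reps y) h \<cdot> x)"
  proof (intro exI[of _ ?\<Phi>] conjI ballI)
    fix X and Y :: "('c, 'd, 'a, 'b) qrep" assume X: "X \<in> Obj C" and Y: "Y \<in> Obj reps"
    show "bij_betw (?\<Phi> X Y) (Hom reps (fob (free_functor Q C i) X) Y) (Hom C X (fob (eval_functor i)
      Y))"
      unfolding bij_betw_def
    proof (intro conjI equalityI subsetI)
      show "inj_on (?\<Phi> X Y) (Hom reps (fob (free_functor Q C i) X) Y)"
        by (rule inj_onI, rule free_mor_eqI[OF i X]) (auto simp: free_functor_def)
      fix x assume "x \<in> ?\<Phi> X Y ` Hom reps (fob (free_functor Q C i) X) Y"
      then show "x \<in> Hom C X (fob (eval_functor i) Y)" using i incl_arr[OF n X]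
        by (auto simp: free_functor_def eval_functor_def)
    next
      fix x assume "x \<in> Hom C X (fob (eval_functor i) Y)"
      then have x: "x \<in> Arr C" "Dom C x = X" "Cod C x = rv Y i" by (simp_all add: eval_functor_def)
      obtain \<phi> where f: "is_rep_mor Q C \<phi>" "qdom \<phi> = free_rep Q C i (Dom C x)" "qcod \<phi> = Y"
        "\<And>j as. walk Q i as j \<Longrightarrow> qcmp \<phi> j \<cdot> incl Q C i (Dom C x) j (i, as) = rep_walk C Y i as \<cdot> x"
        using ex_free_desc[OF i _ x(1,3)] Y by auto
      have "?\<Phi> X Y \<phi> = x" using f(4)[OF n] x by simp
      moreover have "\<phi> \<in> Hom reps (fob (free_functor Q C i) X) Y" using f x Y o[OF X]
        by (simp add: free_functor_def)
      ultimately show "x \<in> ?\<Phi> X Y ` Hom reps (fob (free_functor Q C i) X) Y" by blast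
    qed
  next
    fix x y h assume x: "x \<in> Arr C" and y: "y \<in> Arr reps"
      and "h \<in> Hom reps (fob (free_functor Q C i) (Cod C x)) (Dom reps y)"
    then have h: "is_rep_mor Q C h" "qdom h = free_rep Q C i (Cod C x)" "qcod h = qdom y"
      by (simp_all add: free_functor_def)
    have X: "Dom C x \<in> Obj C" "Cod C x \<in> Obj C" using x by auto
    note inc = incl_arr[OF n X(1)] incl_arr[OF n X(2)] and mx = free_mor[OF i x]
    have "qcmp h i \<cdot> (qcmp (free_mor Q C i x) i \<cdot> incl Q C i (Dom C x) i (i, [])) =
      qcmp h i \<cdot> (incl Q C i (Cod C x) i (i, []) \<cdot> x)"
      using mx(4)[OF n] by simp
    then show "qcmp (y \<cdot>\<^bsub>reps\<^esub> h \<cdot>\<^bsub>reps\<^esub> far (free_functor Q C i) x) i \<cdot> incl Q C i (Dom C x) i (i,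
      [])
      = far (eval_functor i) y \<cdot> (qcmp h i \<cdot> incl Q C i (Cod C x) i (i, [])) \<cdot> x"
      using x y h i inc mx(1-3) by (simp add: free_functor_def eval_functor_def)
  qed
qed

text \<open>Fixes one transposition out of the adjunction; evaluation is exact by
  \<open>eval_exact\<close>, and additive because sums of morphisms are defined at each
  vertex.\<close>

lemma free_Ext_iso:
  assumes i: "i \<in> verts Q" and r: "reach i \<in> \<I>"
    and ex: "is_exact_functor C reps (free_functor Q C i)" and n: "n \<ge> 1"
  shows "Ext_naturally_isomorphic C reps (free_functor Q C i) (eval_functor i) n"
proof -
  obtain \<Phi> where P: "\<forall>X\<in>Obj C. \<forall>Y\<in>Obj reps. bij_betw (\<Phi> X Y) (Hom reps (fob (free_functor Q C i) X)
    Y) (Hom C X (fob (eval_functor i) Y))"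
     "\<forall>x\<in>Arr C. \<forall>y\<in>Arr reps. \<forall>h\<in>Hom reps (fob (free_functor Q C i) (Cod C x)) (Dom reps y).
           \<Phi> (Dom C x) (Cod reps y) (y \<cdot>\<^bsub>reps\<^esub> h \<cdot>\<^bsub>reps\<^esub> far (free_functor Q C i) x)
             = far (eval_functor i) y \<cdot> \<Phi> (Cod C x) (Dom reps y) h \<cdot> x"
    using free_left_adjoint[OF i r] unfolding is_left_adjoint_def by blast
  interpret A: exact_adjunction C reps "free_functor Q C i" "eval_functor i" \<Phi>
  proof (intro exact_adjunction.intro exact_adjunction_axioms.intro abelian_category_axioms
    abelian_reps ex eval_exact[OF i])
    show "far (eval_functor i) (Add reps f g) = Add C (far (eval_functor i) f) (far (eval_functor i)
      g)" for f g :: "('c, 'd, 'a, 'b) qmor"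
      using i by (simp add: eval_functor_def)
  qed (use P in blast)+
  show ?thesis by (rule A.Ext_natural_iso[OF n])
qed

end

section \<open>The canonical presentation\<close>

lemma is_coproduct_cong:
  assumes "\<And>i. i \<in> I \<Longrightarrow> X i = X' i" "\<And>i. i \<in> I \<Longrightarrow> \<iota> i = \<iota>' i"
  shows "is_coproduct C I X P \<iota> \<longleftrightarrow> is_coproduct C I X' P \<iota>'"
  unfolding is_coproduct_def using assms by (simp cong: ball_cong)

text \<open>With the inclusions of the summands for \<open>l\<close> and \<open>0\<close> for \<open>z\<close>, this is the retraction of the first
  map of the presentation at a vertex: on the summand of a path \<open>\<sigma> \<rho>\<close> it is the inclusion of the
  summand \<open>(\<rho>, \<sigma>)\<close> plus the retraction on \<open>\<sigma>\<close> composed with \<open>F\<^sub>\<rho>\<close>. The list is read from the first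
  arrow on, i.e. it is the reverse of the one in a path.\<close>

primrec path_sum :: "('o, 'm) cat \<Rightarrow> ('v, 'e, 'o, 'm) qrep \<Rightarrow> 'm \<Rightarrow> ('e \<Rightarrow> 'e list \<Rightarrow> 'm) \<Rightarrow> 'e list \<Rightarrow> 'm"
  where
  "path_sum C F z l [] = z"
| "path_sum C F z l (\<rho> # bs) = Add C (l \<rho> bs) (path_sum C F z l bs \<cdot>\<^bsub>C\<^esub> ra F \<rho>)"

section \<open>Coproducts of free representations\<close>

context path_copowers
begin

text \<open>The double coproduct over indices and paths is taken in one step, and an arrow of the
  quiver prolongs the path in each pair. The second conjunct records this shape, on which all
  pointwise arguments about the presentation rest.\<close>

lemma ex_coproduct_free:
  assumes U: "\<I> = UNIV" and a: "\<And>j. j \<in> J \<Longrightarrow> a j \<in> verts Q" and X: "\<And>j. j \<in> J \<Longrightarrow> X j \<in> Obj C"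
    and cop: "\<And>k. k \<in> verts Q \<Longrightarrow> \<exists>P \<iota>. is_coproduct C (Sigma J (\<lambda>j. paths Q (a j) k)) (\<lambda>c. X (fst c))
      P \<iota>"
  shows "\<exists>P \<iota>. is_coproduct reps J (\<lambda>j. free_rep Q C (a j) (X j)) P \<iota> \<and>
    (\<forall>k\<in>verts Q. is_coproduct C (Sigma J (\<lambda>j. paths Q (a j) k)) (\<lambda>c. X (fst c)) (rv P k)
       (\<lambda>c. qcmp (\<iota> (fst c)) k \<cdot> incl Q C (a (fst c)) (X (fst c)) k (snd c)))"
proof -
  interpret R: abelian_category reps by (rule abelian_reps)
  have "\<forall>k. \<exists>P \<iota>. k \<in> verts Q \<longrightarrow> is_coproduct C (Sigma J (\<lambda>j. paths Q (a j) k)) (\<lambda>c. X (fst c)) P \<iota>"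
    using cop by blast
  then obtain P l where "\<forall>k. k \<in> verts Q \<longrightarrow> is_coproduct C (Sigma J (\<lambda>j. paths Q (a j) k)) (\<lambda>c. X
    (fst c)) (P k) (l k)"
    by (auto simp only: choice_iff)
  then have c: "\<And>k. k \<in> verts Q \<Longrightarrow> is_coproduct C (Sigma J (\<lambda>j. paths Q (a j) k)) (\<lambda>c. X (fst c)) (P
    k) (l k)" by blast
  have la: "l k (j, a j, as) \<in> Arr C" "Dom C (l k (j, a j, as)) = X j"
    "Cod C (l k (j, a j, as)) = P k"
    if "j \<in> J" "walk Q (a j) as k" for j k as
    using coproduct_arr(2-4)[OF c[OF walk_end[OF quiver that(2)]], of "(j, a j, as)"] that by auto
  have Po: "k \<in> verts Q \<Longrightarrow> P k \<in> Obj C" for k using coproduct_arr(1)[OF c] .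
  have "\<exists>h. \<alpha> \<in> arrows Q \<longrightarrow> h \<in> Arr C \<and> Dom C h = P (src Q \<alpha>) \<and> Cod C h = P (tgt Q \<alpha>) \<and>
      (\<forall>j\<in>J. \<forall>as. walk Q (a j) as (src Q \<alpha>) \<longrightarrow> h \<cdot> l (src Q \<alpha>) (j, a j, as) = l (tgt Q \<alpha>) (j, a j, \<alpha>
        # as))" for \<alpha>
  proof (cases "\<alpha> \<in> arrows Q")
    case True
    obtain h where "h \<in> Arr C" "Dom C h = P (src Q \<alpha>)" "Cod C h = P (tgt Q \<alpha>)"
      "\<And>c. c \<in> Sigma J (\<lambda>j. paths Q (a j) (src Q \<alpha>)) \<Longrightarrow> h \<cdot> l (src Q \<alpha>) c =
        l (tgt Q \<alpha>) (fst c, after_path \<alpha> (snd c))"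
    proof (rule coproduct_desc[OF c[OF arrow_verts(1)[OF True]], of "P (tgt Q \<alpha>)" "\<lambda>c. l (tgt Q \<alpha>)
      (fst c, after_path \<alpha> (snd c))"])
      fix c assume "c \<in> Sigma J (\<lambda>j. paths Q (a j) (src Q \<alpha>))"
      then obtain j as where j: "c = (j, a j, as)" "j \<in> J" "walk Q (a j) as (src Q \<alpha>)"
        by (auto simp: paths_def)
      then show "l (tgt Q \<alpha>) (fst c, after_path \<alpha> (snd c)) \<in> Hom C (X (fst c)) (P (tgt Q \<alpha>))"
        using la[OF j(2), of "\<alpha> # as" "tgt Q \<alpha>"] True by (simp add: after_path_def)
    qed (use Po True in auto)
    then show ?thesis by (intro exI[of _ h]) (auto simp: after_path_def)
  qed simp
  then obtain A where A: "\<And>\<alpha>. \<alpha> \<in> arrows Q \<Longrightarrow> A \<alpha> \<in> Arr C \<and> Dom C (A \<alpha>) = P (src Q \<alpha>) \<and> Cod C (A \<alpha>) =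
    P (tgt Q \<alpha>) \<and>
      (\<forall>j\<in>J. \<forall>as. walk Q (a j) as (src Q \<alpha>) \<longrightarrow> A \<alpha> \<cdot> l (src Q \<alpha>) (j, a j, as) = l (tgt Q \<alpha>) (j, a j,
        \<alpha> # as))" by metis
  define S where "S = QRep (\<lambda>k\<in>verts Q. P k) (\<lambda>\<alpha>\<in>arrows Q. A \<alpha>)"
  have Sv: "k \<in> verts Q \<Longrightarrow> rv S k = P k" "\<alpha> \<in> arrows Q \<Longrightarrow> ra S \<alpha> = A \<alpha>" for k \<alpha>
    by (simp_all add: S_def)
  have S: "is_rep Q C S" unfolding is_rep_def using A Po by (auto simp: S_def)
  \<comment> \<open>As in a free representation, the inclusion of every pair comes from that of the
    trivial path; this gives the values of the inclusions of the free summands.\<close>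
  have walk: "rep_walk C S (a j) as \<cdot> l (a j) (j, a j, []) = l k (j, a j, as)" if j: "j \<in> J"
    and "walk Q (a j) as k" for j as k
    using that(2)
  proof (induction as arbitrary: k)
    case Nil
    then show ?case using la[OF j, of "[]" "a j"] Sv by simp
  next
    case (Cons \<alpha> as)
    then have al: "\<alpha> \<in> arrows Q" "tgt Q \<alpha> = k" and w: "walk Q (a j) as (src Q \<alpha>)" by auto
    have n: "walk Q (a j) [] (a j)" using a[OF j] by simp
    have "rep_walk C S (a j) (\<alpha> # as) \<cdot> l (a j) (j, a j, []) = ra S \<alpha> \<cdot> l (src Q \<alpha>) (j, a j, as)"
      using Cons.IH[OF w] rep_walk_arr[OF S w] la[OF j n] S al a[OF j] Sv(1) by simp
    also have "\<dots> = l k (j, a j, \<alpha> # as)" using A[OF al(1)] j w al Sv(2) by simp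
    finally show ?case .
  qed
  have "\<exists>\<phi>. j \<in> J \<longrightarrow> is_rep_mor Q C \<phi> \<and> qdom \<phi> = free_rep Q C (a j) (X j) \<and> qcod \<phi> = S \<and>
      (\<forall>k as. walk Q (a j) as k \<longrightarrow> qcmp \<phi> k \<cdot> incl Q C (a j) (X j) k (a j, as) = l k (j, a j,
        as))" for j
  proof (cases "j \<in> J")
    case True
    have n: "walk Q (a j) [] (a j)" using a[OF True] by simp
    note ln = la[OF True n]
    obtain \<phi> where "is_rep_mor Q C \<phi>" "qdom \<phi> = free_rep Q C (a j) (Dom C (l (a j) (j, a j, [])))"
      "qcod \<phi> = S"
      "\<And>k as. walk Q (a j) as k \<Longrightarrow> qcmp \<phi> k \<cdot> incl Q C (a j) (Dom C (l (a j) (j, a j, []))) k (a j,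
        as) = rep_walk C S (a j) as \<cdot> l (a j) (j, a j, [])"
      using ex_free_desc[OF a[OF True] S ln(1)] ln(3) Sv(1)[OF a[OF True]] by metis
    then show ?thesis using walk[OF True] ln(2) by (intro exI[of _ \<phi>]) simp
  qed simp
  then obtain \<iota> where io: "\<And>j. j \<in> J \<Longrightarrow> is_rep_mor Q C (\<iota> j) \<and> qdom (\<iota> j) = free_rep Q C (a j) (X j)
    \<and> qcod (\<iota> j) = S \<and>
      (\<forall>k as. walk Q (a j) as k \<longrightarrow> qcmp (\<iota> j) k \<cdot> incl Q C (a j) (X j) k (a j, as) = l k (j, a j,
        as))" by metis
  have U': "A \<in> \<I>" for A using U by simp
  show ?thesis
  proof (intro exI[of _ S] exI[of _ \<iota>] conjI ballI)
    fix k assume k: "k \<in> verts Q"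
    have "is_coproduct C (Sigma J (\<lambda>j. paths Q (a j) k)) (\<lambda>c. X (fst c)) (rv S k)
       (\<lambda>c. qcmp (\<iota> (fst c)) k \<cdot> incl Q C (a (fst c)) (X (fst c)) k (snd c)) \<longleftrightarrow>
       is_coproduct C (Sigma J (\<lambda>j. paths Q (a j) k)) (\<lambda>c. X (fst c)) (P k) (l k)"
      unfolding Sv(1)[OF k] by (rule is_coproduct_cong) (use io in \<open>auto simp: paths_def\<close>)
    then show "is_coproduct C (Sigma J (\<lambda>j. paths Q (a j) k)) (\<lambda>c. X (fst c)) (rv S k)
       (\<lambda>c. qcmp (\<iota> (fst c)) k \<cdot> incl Q C (a (fst c)) (X (fst c)) k (snd c))" using c[OF k] by simp
  next
    show "is_coproduct reps J (\<lambda>j. free_rep Q C (a j) (X j)) S \<iota>"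
    proof (rule R.coproductI)
      show "S \<in> Obj reps" using S U' by simp
      show "\<iota> j \<in> Hom reps (free_rep Q C (a j) (X j)) S" if "j \<in> J" for j using io[OF that] U'
        by simp
    next
      fix T g assume T: "T \<in> Obj reps"
        and g: "\<And>j. j \<in> J \<Longrightarrow> g j \<in> Hom reps (free_rep Q C (a j) (X j)) T"
      have T': "is_rep Q C T" using T by simp
      have g': "is_rep_mor Q C (g j)" "qdom (g j) = free_rep Q C (a j) (X j)" "qcod (g j) = T"
        if "j \<in> J" for j
        using g[OF that] by simp_all
      have gi: "qcmp (g j) k \<cdot> incl Q C (a j) (X j) k (a j, as) \<in> Hom C (X j) (rv T k)"
        if "j \<in> J" "walk Q (a j) as k" for j k as
        using g'[OF that(1)] X[OF that(1)] that(2) walk_end[OF quiver that(2)] by simp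
      have "\<exists>h. k \<in> verts Q \<longrightarrow> h \<in> Arr C \<and> Dom C h = P k \<and> Cod C h = rv T k \<and>
        (\<forall>j\<in>J. \<forall>as. walk Q (a j) as k \<longrightarrow> h \<cdot> l k (j, a j, as) = qcmp (g j) k \<cdot> incl Q C (a j) (X j) k
          (a j, as))" for k
      proof (cases "k \<in> verts Q")
        case True
        obtain h where "h \<in> Arr C" "Dom C h = P k" "Cod C h = rv T k"
          "\<And>c. c \<in> Sigma J (\<lambda>j. paths Q (a j) k) \<Longrightarrow> h \<cdot> l k c = qcmp (g (fst c)) k \<cdot> incl Q C (a (fst
            c)) (X (fst c)) k (snd c)"
        proof (rule coproduct_desc[OF c[OF True], of "rv T k" "\<lambda>c. qcmp (g (fst c)) k \<cdot> incl Q C (a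
          (fst c)) (X (fst c)) k (snd c)"])
          fix c assume "c \<in> Sigma J (\<lambda>j. paths Q (a j) k)"
          then show "qcmp (g (fst c)) k \<cdot> incl Q C (a (fst c)) (X (fst c)) k (snd c) \<in> Hom C (X (fst
            c)) (rv T k)"
            using gi by (auto simp: paths_def simp del: in_Hom_iff)
        qed (use T' True in auto)
        then show ?thesis by (intro exI[of _ h]) auto
      qed simp
      then obtain h where h: "\<And>k. k \<in> verts Q \<Longrightarrow> h k \<in> Arr C \<and> Dom C (h k) = P k \<and> Cod C (h k) =
        rv T k \<and>
        (\<forall>j\<in>J. \<forall>as. walk Q (a j) as k \<longrightarrow> h k \<cdot> l k (j, a j, as) = qcmp (g j) k \<cdot> incl Q C (a j) (X j)
          k (a j, as))" by metis
      have m: "is_rep_mor Q C (QMor S T (\<lambda>k\<in>verts Q. h k))"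
      proof (rule rep_morI[OF S T'])
        fix \<alpha> assume al: "\<alpha> \<in> arrows Q"
        note s = h[OF arrow_verts(1)[OF al]] and t = h[OF arrow_verts(2)[OF al]] and A' = A[OF al]
        show "h (tgt Q \<alpha>) \<cdot> ra S \<alpha> = ra T \<alpha> \<cdot> h (src Q \<alpha>)"
        proof (rule coproduct_eqI[OF c[OF arrow_verts(1)[OF al]]])
          fix c assume "c \<in> Sigma J (\<lambda>j. paths Q (a j) (src Q \<alpha>))"
          then obtain j as where cj: "c = (j, a j, as)" and j: "j \<in> J"
            and w: "walk Q (a j) as (src Q \<alpha>)" by (auto simp: paths_def)
          have w': "walk Q (a j) (\<alpha> # as) (tgt Q \<alpha>)" using w al by simp
          note gj = g'[OF j] and lw = la[OF j w] and Xj = X[OF j] and aj = a[OF j]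
          have "(h (tgt Q \<alpha>) \<cdot> ra S \<alpha>) \<cdot> l (src Q \<alpha>) c = h (tgt Q \<alpha>) \<cdot> l (tgt Q \<alpha>) (j, a j, \<alpha> # as)"
            using A' t lw j w Sv(2)[OF al] by (simp add: cj)
          also have "\<dots> = qcmp (g j) (tgt Q \<alpha>) \<cdot> (ra (free_rep Q C (a j) (X j)) \<alpha> \<cdot> incl Q C (a j) (X
            j) (src Q \<alpha>) (a j, as))"
            using t j w' free_rep_ra(2)[OF aj Xj al w] by simp
          also have "\<dots> = ra T \<alpha> \<cdot> (qcmp (g j) (src Q \<alpha>) \<cdot> incl Q C (a j) (X j) (src Q \<alpha>) (a j, as))"
            using rep_mor_natural[OF gj(1) al] gj free_rep_ra(1)[OF aj Xj al] incl_arr[OF w Xj]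
              T' al aj Xj
            by (intro comp_square) simp_all
          also have "\<dots> = (ra T \<alpha> \<cdot> h (src Q \<alpha>)) \<cdot> l (src Q \<alpha>) c"
            using s j w lw T' al by (simp add: cj)
          finally show "(h (tgt Q \<alpha>) \<cdot> ra S \<alpha>) \<cdot> l (src Q \<alpha>) c = (ra T \<alpha> \<cdot> h (src Q \<alpha>)) \<cdot> l (src Q
            \<alpha>) c" .
        qed (use s t A' T' al Sv(2)[OF al] in simp_all)
      qed (use h Sv in simp)
      have "QMor S T (\<lambda>k\<in>verts Q. h k) \<cdot>\<^bsub>reps\<^esub> \<iota> j = g j" if j: "j \<in> J" for j
      proof (rule free_mor_eqI[OF a[OF j] X[OF j]])
        have n: "walk Q (a j) [] (a j)" using a[OF j] by simp
        note i = io[OF j] and incn = incl_arr[OF n X[OF j]] and hk = h[OF a[OF j]]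
        have "h (a j) \<cdot> (qcmp (\<iota> j) (a j) \<cdot> incl Q C (a j) (X j) (a j) (a j, [])) =
          qcmp (g j) (a j) \<cdot> incl Q C (a j) (X j) (a j) (a j, [])"
          using i hk n j by simp
        then show "qcmp (QMor S T (\<lambda>k\<in>verts Q. h k) \<cdot>\<^bsub>reps\<^esub> \<iota> j) (a j) \<cdot> incl Q C (a j) (X j) (a j)
          (a j, []) = qcmp (g j) (a j) \<cdot> incl Q C (a j) (X j) (a j) (a j, [])"
          using i hk incn a[OF j] Sv(1)[OF a[OF j]] by simp
        show "is_rep_mor Q C (QMor S T (\<lambda>k\<in>verts Q. h k) \<cdot>\<^bsub>reps\<^esub> \<iota> j)" unfolding reps_sel
          by (rule comp_rep_mor) (use i m in simp_all)
      qed (use io[OF j] g'[OF j] in simp_all)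
      then show "\<exists>h. h \<in> Hom reps S T \<and> (\<forall>j\<in>J. h \<cdot>\<^bsub>reps\<^esub> \<iota> j = g j)"
        using m U' by (intro exI[of _ "QMor S T (\<lambda>k\<in>verts Q. h k)"]) (simp del: reps_sel(6))
    next
      fix T u v assume u: "u \<in> Hom reps S T" and v: "v \<in> Hom reps S T"
        and e: "\<And>j. j \<in> J \<Longrightarrow> u \<cdot>\<^bsub>reps\<^esub> \<iota> j = v \<cdot>\<^bsub>reps\<^esub> \<iota> j"
      have u': "is_rep_mor Q C u" "qdom u = S" "qcod u = T" and v': "is_rep_mor Q C v" "qdom v = S"
        "qcod v = T" using u v by simp_all
      show "u = v"
      proof (rule rep_mor_eqI[OF u'(1) v'(1)])
        fix k assume k: "k \<in> verts Q"
        show "qcmp u k = qcmp v k"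
        proof (rule coproduct_eqI[OF c[OF k]])
          fix c assume "c \<in> Sigma J (\<lambda>j. paths Q (a j) k)"
          then obtain j as where cj: "c = (j, a j, as)" and j: "j \<in> J" and w: "walk Q (a j) as k"
            by (auto simp: paths_def)
          note i = io[OF j] and inc = incl_arr[OF w X[OF j]]
          have "qcmp (u \<cdot>\<^bsub>reps\<^esub> \<iota> j) k = qcmp (v \<cdot>\<^bsub>reps\<^esub> \<iota> j) k" using e[OF j] by simp
          then have ek: "qcmp u k \<cdot> qcmp (\<iota> j) k = qcmp v k \<cdot> qcmp (\<iota> j) k" using k by simp
          have "qcmp u k \<cdot> (qcmp (\<iota> j) k \<cdot> incl Q C (a j) (X j) k (a j, as)) =
            qcmp v k \<cdot> (qcmp (\<iota> j) k \<cdot> incl Q C (a j) (X j) k (a j, as))"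
            using ek i inc k u' v' by (intro comp_square) simp_all
          then show "qcmp u k \<cdot> l k c = qcmp v k \<cdot> l k c" using i w by (simp add: cj)
        qed (use u' v' k Sv in simp_all)
      qed (use u' v' in simp_all)
    qed
  qed
qed

text \<open>A canonical presentation may use any coproducts of representations; by uniqueness up to
  isomorphism each has the pointwise shape of the constructed one.\<close>

lemma coproduct_free_pointwise:
  assumes U: "\<I> = UNIV" and a: "\<And>j. j \<in> J \<Longrightarrow> a j \<in> verts Q" and X: "\<And>j. j \<in> J \<Longrightarrow> X j \<in> Obj C"
    and cop: "\<And>k. k \<in> verts Q \<Longrightarrow> \<exists>P \<iota>. is_coproduct C (Sigma J (\<lambda>j. paths Q (a j) k)) (\<lambda>c. X (fst c))
      P \<iota>"
    and c: "is_coproduct reps J (\<lambda>j. free_rep Q C (a j) (X j)) P \<iota>" and k: "k \<in> verts Q"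
  shows "is_coproduct C (Sigma J (\<lambda>j. paths Q (a j) k)) (\<lambda>c. X (fst c)) (rv P k)
       (\<lambda>c. qcmp (\<iota> (fst c)) k \<cdot> incl Q C (a (fst c)) (X (fst c)) k (snd c))"
proof -
  interpret R: abelian_category reps by (rule abelian_reps)
  obtain P' \<iota>' where c': "is_coproduct reps J (\<lambda>j. free_rep Q C (a j) (X j)) P' \<iota>'"
    and pw: "is_coproduct C (Sigma J (\<lambda>j. paths Q (a j) k)) (\<lambda>c. X (fst c)) (rv P' k)
       (\<lambda>c. qcmp (\<iota>' (fst c)) k \<cdot> incl Q C (a (fst c)) (X (fst c)) k (snd c))"
    using ex_coproduct_free[of J a X, OF U a X cop] k by blast
  obtain u v where u: "u \<in> Arr reps" "Dom reps u = P'" "Cod reps u = P" and v: "v \<in> Arr reps"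
    "Dom reps v = P" "Cod reps v = P'"
    and uv: "u \<cdot>\<^bsub>reps\<^esub> v = Ide reps P" "v \<cdot>\<^bsub>reps\<^esub> u = Ide reps P'"
      and ui: "\<And>j. j \<in> J \<Longrightarrow> u \<cdot>\<^bsub>reps\<^esub> \<iota>' j = \<iota> j"
    using R.coproduct_unique[OF c' c] by blast
  have i': "is_rep_mor Q C (\<iota>' j)" "qdom (\<iota>' j) = free_rep Q C (a j) (X j)" "qcod (\<iota>' j) = P'"
    if "j \<in> J" for j
    using R.coproduct_arr(2-4)[OF c' that] by simp_all
  have "qcmp (u \<cdot>\<^bsub>reps\<^esub> v) k = qcmp (Ide reps P) k" "qcmp (v \<cdot>\<^bsub>reps\<^esub> u) k = qcmp (Ide reps P') k"
    using uv by simp_all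
  then have uvk: "qcmp u k \<cdot> qcmp v k = Ide C (rv P k)" "qcmp v k \<cdot> qcmp u k = Ide C (rv P' k)"
    using k by simp_all
  have "is_coproduct C (Sigma J (\<lambda>j. paths Q (a j) k)) (\<lambda>c. X (fst c)) (rv P k)
       (\<lambda>c. qcmp u k \<cdot> (qcmp (\<iota>' (fst c)) k \<cdot> incl Q C (a (fst c)) (X (fst c)) k (snd c)))"
    by (rule coproduct_transport[OF pw, of "qcmp u k" "rv P k" "qcmp v k"])
      (use u v uvk k in simp_all)
  moreover have "qcmp u k \<cdot> (qcmp (\<iota>' (fst c)) k \<cdot> incl Q C (a (fst c)) (X (fst c)) k (snd c)) =
      qcmp (\<iota> (fst c)) k \<cdot> incl Q C (a (fst c)) (X (fst c)) k (snd c)" if mem: "c \<in> Sigma J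
        (\<lambda>j. paths Q (a j) k)" for c
  proof -
    obtain j as where cj: "c = (j, a j, as)" and j: "j \<in> J" and w: "walk Q (a j) as k" using mem
      by (auto simp: paths_def)
    have "qcmp (u \<cdot>\<^bsub>reps\<^esub> \<iota>' j) k = qcmp (\<iota> j) k" using ui[OF j] by simp
    then have "qcmp u k \<cdot> qcmp (\<iota>' j) k = qcmp (\<iota> j) k" using k by simp
    then show ?thesis unfolding cj fst_conv snd_conv
      by (rule comp_shift) (use incl_arr[OF w X[OF j]] i'[OF j] u k in simp_all)
  qed
  ultimately show ?thesis by (subst (asm) is_coproduct_cong[OF refl]) auto
qed

text \<open>The counit is the identity on the summand of the trivial path, so a morphism out of
  \<open>F\<close> is recovered from its composites with the counits.\<close>

lemma counit_eval:
  assumes i: "i \<in> verts Q" and g: "is_rep_mor Q C g" "qdom g = F"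
  shows "qcmp (g \<cdot>\<^bsub>reps\<^esub> counit Q C i F) i \<cdot> incl Q C i (rv F i) i (i, []) = qcmp g i"
proof -
  have F: "is_rep Q C F" using g by auto
  have n: "walk Q i [] i" using i by simp
  have X: "rv F i \<in> Obj C" using F i by simp
  note c = counit_mor[OF i F]
  have "qcmp g i \<cdot> (qcmp (counit Q C i F) i \<cdot> incl Q C i (rv F i) i (i, [])) = qcmp g i"
    using c(4)[OF n] g i by simp
  then show ?thesis using c(1-3) g i incl_arr[OF n X] by simp
qed

section \<open>The maps of the presentation and their exactness\<close>

lemma presentation_arr:
  assumes U: "\<I> = UNIV" and F: "is_rep Q C F"
  shows "i \<in> verts Q \<Longrightarrow> counit Q C i F \<in> Arr reps"
    "i \<in> verts Q \<Longrightarrow> Dom reps (counit Q C i F) = free_rep Q C i (rv F i)"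
    "i \<in> verts Q \<Longrightarrow> Cod reps (counit Q C i F) = F"
    and "\<rho> \<in> arrows Q \<Longrightarrow> free_arrow Q C \<rho> (rv F (src Q \<rho>)) \<in> Arr reps"
    "\<rho> \<in> arrows Q \<Longrightarrow> Dom reps (free_arrow Q C \<rho> (rv F (src Q \<rho>))) = free_rep Q C (tgt Q \<rho>) (rv F (src
      Q \<rho>))"
    "\<rho> \<in> arrows Q \<Longrightarrow> Cod reps (free_arrow Q C \<rho> (rv F (src Q \<rho>))) = free_rep Q C (src Q \<rho>) (rv F (src
      Q \<rho>))"
    "\<rho> \<in> arrows Q \<Longrightarrow> free_mor Q C (tgt Q \<rho>) (ra F \<rho>) \<in> Arr reps"
    "\<rho> \<in> arrows Q \<Longrightarrow> Dom reps (free_mor Q C (tgt Q \<rho>) (ra F \<rho>)) = free_rep Q C (tgt Q \<rho>) (rv F (src Q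
      \<rho>))"
    "\<rho> \<in> arrows Q \<Longrightarrow> Cod reps (free_mor Q C (tgt Q \<rho>) (ra F \<rho>)) = free_rep Q C (tgt Q \<rho>) (rv F (tgt Q
      \<rho>))"
proof -
  have U': "A \<in> \<I>" for A using U by simp
  show "i \<in> verts Q \<Longrightarrow> counit Q C i F \<in> Arr reps"
    "i \<in> verts Q \<Longrightarrow> Dom reps (counit Q C i F) = free_rep Q C i (rv F i)"
    "i \<in> verts Q \<Longrightarrow> Cod reps (counit Q C i F) = F"
    using counit_mor(1-3)[of i F] F U' by simp_all
  assume r: "\<rho> \<in> arrows Q"
  have X: "rv F (src Q \<rho>) \<in> Obj C" using F r by simp
  show "free_arrow Q C \<rho> (rv F (src Q \<rho>)) \<in> Arr reps"
    "Dom reps (free_arrow Q C \<rho> (rv F (src Q \<rho>))) = free_rep Q C (tgt Q \<rho>) (rv F (src Q \<rho>))"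
    "Cod reps (free_arrow Q C \<rho> (rv F (src Q \<rho>))) = free_rep Q C (src Q \<rho>) (rv F (src Q \<rho>))"
    using free_arrow_mor(1-3)[OF r X] U' by simp_all
  show "free_mor Q C (tgt Q \<rho>) (ra F \<rho>) \<in> Arr reps"
    "Dom reps (free_mor Q C (tgt Q \<rho>) (ra F \<rho>)) = free_rep Q C (tgt Q \<rho>) (rv F (src Q \<rho>))"
    "Cod reps (free_mor Q C (tgt Q \<rho>) (ra F \<rho>)) = free_rep Q C (tgt Q \<rho>) (rv F (tgt Q \<rho>))"
    using free_mor(1-3)[of "tgt Q \<rho>" "ra F \<rho>"] r F U' by simp_all
qed

text \<open>\<open>free_arrow\<close> sends the trivial path at the target of \<open>\<rho>\<close>
  to the path \<open>\<rho>\<close>, and there \<open>g\<close> is determined by its value on the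
  trivial path at the source.\<close>

lemma free_arrow_eval:
  assumes r: "\<rho> \<in> arrows Q" and X: "X \<in> Obj C" and g: "is_rep_mor Q C g"
    "qdom g = free_rep Q C (src Q \<rho>) X"
  shows "qcmp (g \<cdot>\<^bsub>reps\<^esub> free_arrow Q C \<rho> X) (tgt Q \<rho>) \<cdot> incl Q C (tgt Q \<rho>) X (tgt Q \<rho>) (tgt Q \<rho>,
    [])
    = ra (qcod g) \<rho> \<cdot> (qcmp g (src Q \<rho>) \<cdot> incl Q C (src Q \<rho>) X (src Q \<rho>) (src Q \<rho>, []))"
proof -
  have v: "src Q \<rho> \<in> verts Q" "tgt Q \<rho> \<in> verts Q" using r by simp_all
  have n: "walk Q (tgt Q \<rho>) [] (tgt Q \<rho>)" "walk Q (src Q \<rho>) [\<rho>] (tgt Q \<rho>)"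
    "walk Q (src Q \<rho>) [] (src Q \<rho>)" using r v by simp_all
  note fa = free_arrow_mor[OF r X]
  have "qcmp g (tgt Q \<rho>) \<cdot> (qcmp (free_arrow Q C \<rho> X) (tgt Q \<rho>) \<cdot> incl Q C (tgt Q \<rho>) X (tgt Q \<rho>)
    (tgt Q \<rho>, [])) =
    qcmp g (tgt Q \<rho>) \<cdot> incl Q C (src Q \<rho>) X (tgt Q \<rho>) (src Q \<rho>, [\<rho>])" using fa(4)[OF n(1)] by simp
  also have "\<dots> = rep_walk C (qcod g) (src Q \<rho>) [\<rho>] \<cdot> (qcmp g (src Q \<rho>) \<cdot> incl Q C (src Q \<rho>) X (src Q
    \<rho>) (src Q \<rho>, []))"
    by (rule free_mor_incl[OF g X n(2)])
  also have "rep_walk C (qcod g) (src Q \<rho>) [\<rho>] = ra (qcod g) \<rho>" using g r by simp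
  finally show ?thesis using fa(1-3) g v incl_arr[OF n(1) X] by simp
qed

lemma free_mor_eval:
  assumes i: "i \<in> verts Q" and x: "x \<in> Arr C" and g: "is_rep_mor Q C g"
    "qdom g = free_rep Q C i (Cod C x)"
  shows "qcmp (g \<cdot>\<^bsub>reps\<^esub> free_mor Q C i x) i \<cdot> incl Q C i (Dom C x) i (i, [])
    = (qcmp g i \<cdot> incl Q C i (Cod C x) i (i, [])) \<cdot> x"
proof -
  have n: "walk Q i [] i" using i by simp
  have X: "Dom C x \<in> Obj C" "Cod C x \<in> Obj C" using x by auto
  note fm = free_mor[OF i x]
  have "qcmp g i \<cdot> (qcmp (free_mor Q C i x) i \<cdot> incl Q C i (Dom C x) i (i, [])) =
    qcmp g i \<cdot> (incl Q C i (Cod C x) i (i, []) \<cdot> x)"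
    using fm(4)[OF n] by simp
  then show ?thesis using fm(1-3) g i x incl_arr[OF n X(1)] incl_arr[OF n X(2)] by simp
qed

text \<open>On the trivial path both sides equal \<open>ra F \<rho>\<close>. This is the vanishing
  of \<open>p \<cdot> d\<close> on the summand of \<open>\<rho>\<close>.\<close>

lemma presentation_relation:
  assumes U: "\<I> = UNIV" and F: "is_rep Q C F" and r: "\<rho> \<in> arrows Q"
  shows "counit Q C (src Q \<rho>) F \<cdot>\<^bsub>reps\<^esub> free_arrow Q C \<rho> (rv F (src Q \<rho>)) =
    counit Q C (tgt Q \<rho>) F \<cdot>\<^bsub>reps\<^esub> free_mor Q C (tgt Q \<rho>) (ra F \<rho>)"
proof -
  interpret R: abelian_category reps by (rule abelian_reps)
  note pa = presentation_arr[OF U F]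
  have v: "src Q \<rho> \<in> verts Q" "tgt Q \<rho> \<in> verts Q" using r by simp_all
  have X: "rv F (src Q \<rho>) \<in> Obj C" "rv F (tgt Q \<rho>) \<in> Obj C" using F v by simp_all
  have n: "walk Q (tgt Q \<rho>) [] (tgt Q \<rho>)" "walk Q (src Q \<rho>) [] (src Q \<rho>)" using v by simp_all
  note cs = counit_mor[OF v(1) F] and ct = counit_mor[OF v(2) F]
  have A: "counit Q C (src Q \<rho>) F \<cdot>\<^bsub>reps\<^esub> free_arrow Q C \<rho> (rv F (src Q \<rho>)) \<in> Arr reps"
    using R.comp_arr(1)[of "free_arrow Q C \<rho> (rv F (src Q \<rho>))" "counit Q C (src Q \<rho>) F"] pa(1-6) v r
      by (simp del: reps_sel)
  have B: "counit Q C (tgt Q \<rho>) F \<cdot>\<^bsub>reps\<^esub> free_mor Q C (tgt Q \<rho>) (ra F \<rho>) \<in> Arr reps"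
    using R.comp_arr(1)[of "free_mor Q C (tgt Q \<rho>) (ra F \<rho>)" "counit Q C (tgt Q \<rho>) F"] pa v r
      by (simp del: reps_sel)
  show ?thesis
  proof (rule free_mor_eqI[OF v(2) X(1)])
    have "qcmp (counit Q C (src Q \<rho>) F \<cdot>\<^bsub>reps\<^esub> free_arrow Q C \<rho> (rv F (src Q \<rho>))) (tgt Q \<rho>) \<cdot> incl Q
      C (tgt Q \<rho>) (rv F (src Q \<rho>)) (tgt Q \<rho>) (tgt Q \<rho>, []) = ra F \<rho>"
      unfolding free_arrow_eval[OF r X(1) cs(1,2)] using cs(3) cs(4)[OF n(2)] F r by simp
    moreover have "qcmp (counit Q C (tgt Q \<rho>) F \<cdot>\<^bsub>reps\<^esub> free_mor Q C (tgt Q \<rho>) (ra F \<rho>)) (tgt Q \<rho>) \<cdot>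
      incl Q C (tgt Q \<rho>) (rv F (src Q \<rho>)) (tgt Q \<rho>) (tgt Q \<rho>, []) = ra F \<rho>"
      using free_mor_eval[OF v(2), of "ra F \<rho>" "counit Q C (tgt Q \<rho>) F"] ct(1-3) ct(4)[OF n(1)] F r
        by (simp del: reps_sel)
    ultimately show "qcmp (counit Q C (src Q \<rho>) F \<cdot>\<^bsub>reps\<^esub> free_arrow Q C \<rho> (rv F (src Q \<rho>))) (tgt Q
      \<rho>) \<cdot> incl Q C (tgt Q \<rho>) (rv F (src Q \<rho>)) (tgt Q \<rho>) (tgt Q \<rho>, []) =
      qcmp (counit Q C (tgt Q \<rho>) F \<cdot>\<^bsub>reps\<^esub> free_mor Q C (tgt Q \<rho>) (ra F \<rho>)) (tgt Q \<rho>) \<cdot> incl Q C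
        (tgt Q \<rho>) (rv F (src Q \<rho>)) (tgt Q \<rho>) (tgt Q \<rho>, [])" by simp
  qed (use A B pa v r in simp_all)
qed

lemma path_sum_arr:
  assumes F: "is_rep Q C F" and z: "z \<in> Hom C (rv F k) P"
    and l: "\<And>\<rho> bs. \<rho> \<in> arrows Q \<Longrightarrow> walk Q (tgt Q \<rho>) (rev bs) k \<Longrightarrow> l \<rho> bs \<in> Hom C (rv F (src Q \<rho>)) P"
  shows "walk Q i (rev bs) k \<Longrightarrow> path_sum C F z l bs \<in> Hom C (rv F i) P"
proof (induction bs arbitrary: i)
  case Nil
  then show ?case using z by simp
next
  case (Cons \<rho> bs)
  then have r: "\<rho> \<in> arrows Q" "src Q \<rho> = i" and w: "walk Q (tgt Q \<rho>) (rev bs) k"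
    using walk_snoc[OF quiver] by auto
  show ?case using l[OF r(1) w] Cons.IH[OF w] F r by auto
qed

text \<open>At each vertex \<open>d\<close> has a left inverse. These are not claimed to form a
  morphism of representations; monomorphisms being pointwise, that suffices. Both coproducts enter
  in pointwise form because the left inverse is defined on the summands of \<open>P0\<close> at one
  vertex.\<close>

lemma presentation_monic:
  assumes U: "\<I> = UNIV" and F: "is_rep Q C F"
    and c1: "\<And>k. k \<in> verts Q \<Longrightarrow> is_coproduct C (Sigma (arrows Q) (\<lambda>\<rho>. paths Q (tgt Q \<rho>) k)) (\<lambda>c. rv F
      (src Q (fst c))) (rv P1 k)
       (\<lambda>c. qcmp (\<iota> (fst c)) k \<cdot> incl Q C (tgt Q (fst c)) (rv F (src Q (fst c))) k (snd c))"
    and c0: "\<And>k. k \<in> verts Q \<Longrightarrow> is_coproduct C (Sigma (verts Q) (\<lambda>i. paths Q i k)) (\<lambda>c. rv F (fst c))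
      (rv P0 k)
       (\<lambda>c. qcmp (\<mu> (fst c)) k \<cdot> incl Q C (fst c) (rv F (fst c)) k (snd c))"
    and i: "\<And>\<rho>. \<rho> \<in> arrows Q \<Longrightarrow> \<iota> \<rho> \<in> Hom reps (free_rep Q C (tgt Q \<rho>) (rv F (src Q \<rho>))) P1"
    and m: "\<And>i. i \<in> verts Q \<Longrightarrow> \<mu> i \<in> Hom reps (free_rep Q C i (rv F i)) P0"
    and d: "d \<in> Hom reps P1 P0"
    and di: "\<And>\<rho>. \<rho> \<in> arrows Q \<Longrightarrow> d \<cdot>\<^bsub>reps\<^esub> \<iota> \<rho> = Diff reps (\<mu> (src Q \<rho>) \<cdot>\<^bsub>reps\<^esub> free_arrow Q C \<rho> (rv
      F (src Q \<rho>)))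
                       (\<mu> (tgt Q \<rho>) \<cdot>\<^bsub>reps\<^esub> free_mor Q C (tgt Q \<rho>) (ra F \<rho>))"
  shows "is_monic reps d"
proof -
  interpret R: abelian_category reps by (rule abelian_reps)
  have da: "d \<in> Arr reps" using d unfolding in_Hom_iff by blast
  have d': "is_rep_mor Q C d" "qdom d = P1" "qcod d = P0" using d by simp_all
  have P: "is_rep Q C P1" "is_rep Q C P0" using d' rep_mor_simps(1,2)[OF d'(1)] by simp_all
  have i': "is_rep_mor Q C (\<iota> \<rho>)" "qdom (\<iota> \<rho>) = free_rep Q C (tgt Q \<rho>) (rv F (src Q \<rho>))"
    "qcod (\<iota> \<rho>) = P1" if "\<rho> \<in> arrows Q" for \<rho>
    using i[OF that] by simp_all
  have m': "is_rep_mor Q C (\<mu> i)" "qdom (\<mu> i) = free_rep Q C i (rv F i)" "qcod (\<mu> i) = P0"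
    if "i \<in> verts Q" for i
    using m[OF that] by simp_all
  note pa = presentation_arr[OF U F]
  have "is_monic C (qcmp d k)" if k: "k \<in> verts Q" for k
  proof -
    \<comment> \<open>Inclusions at the vertex \<open>k\<close>: \<open>l1\<close> for pairs of an
      arrow and a path in \<open>P1\<close>, \<open>l0\<close> for pairs of a vertex and a path in
      \<open>P0\<close>.\<close>
    define l1 where "l1 \<rho> as = qcmp (\<iota> \<rho>) k \<cdot> incl Q C (tgt Q \<rho>) (rv F (src Q \<rho>)) k (tgt Q \<rho>, as)"
      for \<rho> as
    define l0 where "l0 i as = qcmp (\<mu> i) k \<cdot> incl Q C i (rv F i) k (i, as)" for i as
    have l1: "l1 \<rho> as \<in> Arr C" "Dom C (l1 \<rho> as) = rv F (src Q \<rho>)" "Cod C (l1 \<rho> as) = rv P1 k"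
      if "\<rho> \<in> arrows Q" "walk Q (tgt Q \<rho>) as k" for \<rho> as
      using i'[OF that(1)] incl_arr[OF that(2), of "rv F (src Q \<rho>)"] k F that(1)
        by (simp_all add: l1_def)
    have l0: "l0 i as \<in> Arr C" "Dom C (l0 i as) = rv F i" "Cod C (l0 i as) = rv P0 k"
      if "walk Q i as k" for i as
      using m'[OF walk_start[OF that]] incl_arr[OF that, of "rv F i"] k F walk_start[OF that]
        by (simp_all add: l0_def)
    \<comment> \<open>The formula for \<open>d\<close> at \<open>k\<close>: the summand of
      \<open>\<rho>\<close> and \<open>as\<close> goes to the summand of the prolonged path minus
      \<open>ra F \<rho>\<close> followed by the summand of \<open>as\<close>. Written as a sum, it
      can be fed directly into the recursion.\<close>
    have step: "Add C (qcmp d k \<cdot> l1 \<rho> as) (l0 (tgt Q \<rho>) as \<cdot> ra F \<rho>) = l0 (src Q \<rho>) (as @ [\<rho>])"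
      if r: "\<rho> \<in> arrows Q" and w: "walk Q (tgt Q \<rho>) as k" for \<rho> as
    proof -
      have v: "src Q \<rho> \<in> verts Q" "tgt Q \<rho> \<in> verts Q" using r by simp_all
      have X: "rv F (src Q \<rho>) \<in> Obj C" "rv F (tgt Q \<rho>) \<in> Obj C" using F v by simp_all
      have ws: "walk Q (src Q \<rho>) (as @ [\<rho>]) k" using walk_snoc[OF quiver] r w by blast
      let ?fa = "free_arrow Q C \<rho> (rv F (src Q \<rho>))" and ?fm = "free_mor Q C (tgt Q \<rho>) (ra F \<rho>)"
      let ?A = "\<mu> (src Q \<rho>) \<cdot>\<^bsub>reps\<^esub> ?fa" and ?B = "\<mu> (tgt Q \<rho>) \<cdot>\<^bsub>reps\<^esub> ?fm"
      have AB: "?A \<in> Arr reps" "Dom reps ?A = free_rep Q C (tgt Q \<rho>) (rv F (src Q \<rho>))"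
        "Cod reps ?A = P0"
        "?B \<in> Arr reps" "Dom reps ?B = free_rep Q C (tgt Q \<rho>) (rv F (src Q \<rho>))" "Cod reps ?B = P0"
        using R.comp_arr[of ?fa "\<mu> (src Q \<rho>)"] R.comp_arr[of ?fm "\<mu> (tgt Q \<rho>)"] pa(4-9)[OF r]
          m[OF v(1)] m[OF v(2)]
        by (simp_all del: reps_sel)
      have "Add reps (d \<cdot>\<^bsub>reps\<^esub> \<iota> \<rho>) ?B = ?A" unfolding di[OF r]
        by (rule R.diff_add) (use AB in \<open>simp_all del: reps_sel\<close>)
      then have "qcmp (Add reps (d \<cdot>\<^bsub>reps\<^esub> \<iota> \<rho>) ?B) k \<cdot> incl Q C (tgt Q \<rho>) (rv F (src Q \<rho>)) k (tgt Q
        \<rho>, as) = qcmp ?A k \<cdot> incl Q C (tgt Q \<rho>) (rv F (src Q \<rho>)) k (tgt Q \<rho>, as)"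
        by (rule arg_cong)
      then have e: "Add C (qcmp d k \<cdot> qcmp (\<iota> \<rho>) k) (qcmp (\<mu> (tgt Q \<rho>)) k \<cdot> qcmp ?fm k) \<cdot> incl Q C
        (tgt Q \<rho>) (rv F (src Q \<rho>)) k (tgt Q \<rho>, as)
         = (qcmp (\<mu> (src Q \<rho>)) k \<cdot> qcmp ?fa k) \<cdot> incl Q C (tgt Q \<rho>) (rv F (src Q \<rho>)) k
           (tgt Q \<rho>, as)"
        using k by simp
      note fa = free_arrow_mor[OF r X(1)] and fm = free_mor[OF v(2) rep_simps(2)[OF F r]]
      note mm = m'[OF v(1)] m'[OF v(2)] i'[OF r]
      note inc = incl_arr[OF w X(1)] incl_arr[OF w X(2)]
      have L: "Add C (qcmp d k \<cdot> qcmp (\<iota> \<rho>) k) (qcmp (\<mu> (tgt Q \<rho>)) k \<cdot> qcmp ?fm k) \<cdot> incl Q C (tgt Q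
        \<rho>) (rv F (src Q \<rho>)) k (tgt Q \<rho>, as)
        = Add C (qcmp d k \<cdot> l1 \<rho> as) (qcmp (\<mu> (tgt Q \<rho>)) k \<cdot> (qcmp ?fm k \<cdot> incl Q C (tgt Q \<rho>) (rv F
          (src Q \<rho>)) k (tgt Q \<rho>, as)))"
        using d' mm inc fm(1-3) k F r by (simp add: l1_def)
      have M: "qcmp ?fm k \<cdot> incl Q C (tgt Q \<rho>) (rv F (src Q \<rho>)) k (tgt Q \<rho>, as) =
        incl Q C (tgt Q \<rho>) (rv F (tgt Q \<rho>)) k (tgt Q \<rho>, as) \<cdot> ra F \<rho>"
        using fm(4)[OF w] F r by simp
      have N: "qcmp (\<mu> (tgt Q \<rho>)) k \<cdot> (incl Q C (tgt Q \<rho>) (rv F (tgt Q \<rho>)) k (tgt Q \<rho>, as) \<cdot> ra F \<rho>)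
        = l0 (tgt Q \<rho>) as \<cdot> ra F \<rho>"
        using mm inc k F r by (simp add: l0_def)
      have O: "(qcmp (\<mu> (src Q \<rho>)) k \<cdot> qcmp ?fa k) \<cdot> incl Q C (tgt Q \<rho>) (rv F (src Q \<rho>)) k (tgt Q \<rho>,
        as) = l0 (src Q \<rho>) (as @ [\<rho>])"
        using mm inc fa(1-3) fa(4)[OF w] k by (simp add: l0_def)
      show ?thesis using e unfolding L M N O .
    qed
    \<comment> \<open>The lists of paths begin with the last arrow, whereas \<open>path_sum\<close>
      consumes the first arrow first; hence the reversals here and in \<open>r\<close>.\<close>
    define S where "S = path_sum C F (Zer C (rv F k) (rv P1 k)) (\<lambda>\<rho> bs. l1 \<rho> (rev bs))"
    have Sa: "walk Q i (rev bs) k \<Longrightarrow> S bs \<in> Hom C (rv F i) (rv P1 k)" for i bs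
      unfolding S_def by (rule path_sum_arr[OF F]) (use l1 k F P in simp_all)
    obtain r where r: "r \<in> Arr C" "Dom C r = rv P0 k" "Cod C r = rv P1 k"
      "\<And>c. c \<in> Sigma (verts Q) (\<lambda>i. paths Q i k) \<Longrightarrow> r \<cdot> (qcmp (\<mu> (fst c)) k \<cdot> incl Q C (fst c) (rv F
        (fst c)) k (snd c)) = S (rev (snd (snd c)))"
    proof (rule coproduct_desc[OF c0[OF k], of "rv P1 k" "\<lambda>c. S (rev (snd (snd c)))"])
      fix c assume "c \<in> Sigma (verts Q) (\<lambda>i. paths Q i k)"
      then show "S (rev (snd (snd c))) \<in> Hom C (rv F (fst c)) (rv P1 k)" using Sa
        by (auto simp: paths_def simp del: in_Hom_iff)
    qed (use P k in auto)
    have rl: "r \<cdot> l0 i as = S (rev as)" if "walk Q i as k" for i as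
      using r(4)[of "(i, i, as)"] that walk_start[OF that] by (simp add: l0_def)
    have "r \<cdot> qcmp d k = Ide C (rv P1 k)"
    proof (rule coproduct_eqI[OF c1[OF k]])
      fix c assume "c \<in> Sigma (arrows Q) (\<lambda>\<rho>. paths Q (tgt Q \<rho>) k)"
      then obtain \<rho> as where c: "c = (\<rho>, tgt Q \<rho>, as)" and rh: "\<rho> \<in> arrows Q"
        and w: "walk Q (tgt Q \<rho>) as k" by (auto simp: paths_def)
      have ws: "walk Q (src Q \<rho>) (as @ [\<rho>]) k" using walk_snoc[OF quiver] rh w by blast
      note L = l1[OF rh w] l0[OF w] l0[OF ws]
      have S': "S (rev as) \<in> Arr C" "Dom C (S (rev as)) = rv F (tgt Q \<rho>)"
        "Cod C (S (rev as)) = rv P1 k" using Sa[of "tgt Q \<rho>" "rev as"] w by simp_all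
      \<comment> \<open>Applying \<open>r\<close> to \<open>step\<close> and unfolding the recursion
        once produces the same second summand on both sides, and it cancels.\<close>
      have "Add C (r \<cdot> qcmp d k \<cdot> l1 \<rho> as) ((r \<cdot> l0 (tgt Q \<rho>) as) \<cdot> ra F \<rho>) =
        r \<cdot> Add C (qcmp d k \<cdot> l1 \<rho> as) (l0 (tgt Q \<rho>) as \<cdot> ra F \<rho>)"
        using L r(1-3) d' k F rh by simp
      also have "\<dots> = S (rev (as @ [\<rho>]))" unfolding step[OF rh w] by (rule rl[OF ws])
      also have "\<dots> = Add C (l1 \<rho> as) (S (rev as) \<cdot> ra F \<rho>)" by (simp add: S_def)
      finally have "Add C (r \<cdot> qcmp d k \<cdot> l1 \<rho> as) (S (rev as) \<cdot> ra F \<rho>) = Add C (l1 \<rho> as) (S (rev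
        as) \<cdot> ra F \<rho>)" unfolding rl[OF w] .
      then have "r \<cdot> qcmp d k \<cdot> l1 \<rho> as = l1 \<rho> as"
        by (subst (asm) add_right_cancel) (use L S' r(1-3) d' k F rh in simp_all)
      then have "(r \<cdot> qcmp d k) \<cdot> l1 \<rho> as = Ide C (rv P1 k) \<cdot> l1 \<rho> as" using L r(1-3) d' k by simp
      then show "(r \<cdot> qcmp d k) \<cdot> (qcmp (\<iota> (fst c)) k \<cdot> incl Q C (tgt Q (fst c)) (rv F (src Q (fst
        c))) k (snd c))
        = Ide C (rv P1 k) \<cdot> (qcmp (\<iota> (fst c)) k \<cdot> incl Q C (tgt Q (fst c)) (rv F (src Q (fst c))) k
          (snd c))"
        by (simp only: c l1_def fst_conv snd_conv)
    qed (use r d' k P in simp_all)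
    then show ?thesis using monic_cancel[of r "qcmp d k"] monic_ide[of "rv P1 k"] r(1-3) d' k P
      by simp
  qed
  then show ?thesis using monic_pointwise[OF da] by blast
qed

text \<open>Argued with universal properties and not vertex by vertex. A morphism \<open>g\<close>
  out of \<open>P0\<close> has values \<open>h i\<close> on the trivial paths, and
  \<open>g \<cdot> d = 0\<close> on the summand of \<open>\<rho>\<close> is precisely naturality of
  \<open>h\<close> at \<open>\<rho>\<close>.\<close>

lemma presentation_cokernel:
  assumes U: "\<I> = UNIV" and F: "is_rep Q C F"
    and c1: "is_coproduct reps (arrows Q) (\<lambda>\<rho>. free_rep Q C (tgt Q \<rho>) (rv F (src Q \<rho>))) P1 \<iota>"
    and c0: "is_coproduct reps (verts Q) (\<lambda>i. free_rep Q C i (rv F i)) P0 \<mu>"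
    and d: "d \<in> Hom reps P1 P0"
    and di: "\<And>\<rho>. \<rho> \<in> arrows Q \<Longrightarrow> d \<cdot>\<^bsub>reps\<^esub> \<iota> \<rho> = Diff reps (\<mu> (src Q \<rho>) \<cdot>\<^bsub>reps\<^esub> free_arrow Q C \<rho> (rv
      F (src Q \<rho>)))
                       (\<mu> (tgt Q \<rho>) \<cdot>\<^bsub>reps\<^esub> free_mor Q C (tgt Q \<rho>) (ra F \<rho>))"
    and p: "p \<in> Hom reps P0 F" and pm: "\<And>i. i \<in> verts Q \<Longrightarrow> p \<cdot>\<^bsub>reps\<^esub> \<mu> i = counit Q C i F"
  shows "is_cokernel reps d p"
proof -
  interpret R: abelian_category reps by (rule abelian_reps)
  have U': "A \<in> \<I>" for A using U by simp
  note pa = presentation_arr[OF U F]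
  note ca = R.coproduct_arr[OF c1] R.coproduct_arr[OF c0]
  have d': "d \<in> Arr reps" "Dom reps d = P1" "Cod reps d = P0" and p': "p \<in> Arr reps"
    "Dom reps p = P0" "Cod reps p = F"
    using d p unfolding in_Hom_iff by blast+
  have gA: "g \<cdot>\<^bsub>reps\<^esub> (d \<cdot>\<^bsub>reps\<^esub> \<iota> \<rho>) = Diff reps ((g \<cdot>\<^bsub>reps\<^esub> \<mu> (src Q \<rho>)) \<cdot>\<^bsub>reps\<^esub> free_arrow Q C
    \<rho> (rv F (src Q \<rho>))) ((g \<cdot>\<^bsub>reps\<^esub> \<mu> (tgt Q \<rho>)) \<cdot>\<^bsub>reps\<^esub> free_mor Q C (tgt Q \<rho>) (ra F \<rho>))"
    if r: "\<rho> \<in> arrows Q" and g: "g \<in> Arr reps" "Dom reps g = P0" for g \<rho>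
    unfolding di[OF r] using pa(4-9)[OF r] ca(6-8) g r by (simp del: reps_sel)
  have epi: "is_epic reps p" unfolding is_epic_def
  proof (intro conjI allI ballI impI p')
    fix T g h assume "g \<in> Hom reps (Cod reps p) T" "h \<in> Hom reps (Cod reps p) T"
      and e: "g \<cdot>\<^bsub>reps\<^esub> p = h \<cdot>\<^bsub>reps\<^esub> p"
    then have g: "g \<in> Arr reps" "Dom reps g = F" "Cod reps g = T" and h: "h \<in> Arr reps"
      "Dom reps h = F" "Cod reps h = T"
      unfolding in_Hom_iff using p'(3) by metis+
    have g': "is_rep_mor Q C g" "qdom g = F" "qcod g = T" and h': "is_rep_mor Q C h" "qdom h = F"
      "qcod h = T" using g h by simp_all
    show "g = h"
    proof (rule rep_mor_eqI[OF g'(1) h'(1)])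
      fix i assume i: "i \<in> verts Q"
      have "g \<cdot>\<^bsub>reps\<^esub> (p \<cdot>\<^bsub>reps\<^esub> \<mu> i) = h \<cdot>\<^bsub>reps\<^esub> (p \<cdot>\<^bsub>reps\<^esub> \<mu> i)"
        using e g h p' ca(6-8)[OF i] by (intro R.comp_square) (simp_all del: reps_sel)
      then have "g \<cdot>\<^bsub>reps\<^esub> counit Q C i F = h \<cdot>\<^bsub>reps\<^esub> counit Q C i F" unfolding pm[OF i] .
      then show "qcmp g i = qcmp h i" using counit_eval[OF i g'(1,2)] counit_eval[OF i h'(1,2)]
        by simp
    qed (use g' h' in simp_all)
  qed
  show ?thesis
  proof (rule R.cokernelI[OF epi d'(1)])
    show "Dom reps p = Cod reps d" using p' d' by metis
    show "p \<cdot>\<^bsub>reps\<^esub> d = Zer reps (Dom reps d) (Cod reps p)"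
    proof (rule R.coproduct_eqI[OF c1])
      fix \<rho> assume r: "\<rho> \<in> arrows Q"
      have v: "src Q \<rho> \<in> verts Q" "tgt Q \<rho> \<in> verts Q" using r by simp_all
      have "(p \<cdot>\<^bsub>reps\<^esub> d) \<cdot>\<^bsub>reps\<^esub> \<iota> \<rho> = p \<cdot>\<^bsub>reps\<^esub> (d \<cdot>\<^bsub>reps\<^esub> \<iota> \<rho>)" using p' d' ca(2-4)[OF r]
        by (simp del: reps_sel)
      also have "\<dots> = Zer reps (free_rep Q C (tgt Q \<rho>) (rv F (src Q \<rho>))) F"
        unfolding gA[OF r p'(1,2)] pm[OF v(1)] pm[OF v(2)] presentation_relation[OF U F r]
        using R.diff_eq_zer_iff[of "counit Q C (tgt Q \<rho>) F \<cdot>\<^bsub>reps\<^esub> free_mor Q C (tgt Q \<rho>) (ra F \<rho>)"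
          "counit Q C (tgt Q \<rho>) F \<cdot>\<^bsub>reps\<^esub> free_mor Q C (tgt Q \<rho>) (ra F \<rho>)"]
          pa(1-3)[OF v(2)] pa(7-9)[OF r] by (simp del: reps_sel)
      also have "\<dots> = Zer reps (Dom reps d) (Cod reps p) \<cdot>\<^bsub>reps\<^esub> \<iota> \<rho>"
        using p' d' ca(2-4)[OF r] R.obj_of_arr(2)[OF p'(1)] by (simp del: reps_sel)
      finally show "(p \<cdot>\<^bsub>reps\<^esub> d) \<cdot>\<^bsub>reps\<^esub> \<iota> \<rho> = Zer reps (Dom reps d) (Cod reps p) \<cdot>\<^bsub>reps\<^esub> \<iota> \<rho>" .
    qed (use p' d' R.obj_of_arr(2)[OF p'(1)] R.obj_of_arr(1)[OF d'(1)] in \<open>simp_all del: reps_sel\<close>)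
    fix g assume "g \<in> Arr reps" "Dom reps g = Cod reps d"
      and g0: "g \<cdot>\<^bsub>reps\<^esub> d = Zer reps (Dom reps d) (Cod reps g)"
    then have g: "g \<in> Arr reps" "Dom reps g = P0" using d' by simp_all
    define T where "T = Cod reps g"
    have T: "is_rep Q C T" using g by (simp add: T_def)
    have gm: "g \<cdot>\<^bsub>reps\<^esub> \<mu> i \<in> Arr reps" "Dom reps (g \<cdot>\<^bsub>reps\<^esub> \<mu> i) = free_rep Q C i (rv F i)"
      "Cod reps (g \<cdot>\<^bsub>reps\<^esub> \<mu> i) = T" if "i \<in> verts Q" for i
      using g ca(6-8)[OF that] by (simp_all add: T_def del: reps_sel)
    have gm': "is_rep_mor Q C (g \<cdot>\<^bsub>reps\<^esub> \<mu> i)" "qdom (g \<cdot>\<^bsub>reps\<^esub> \<mu> i) = free_rep Q C i (rv F i)"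
      "qcod (g \<cdot>\<^bsub>reps\<^esub> \<mu> i) = T" if "i \<in> verts Q" for i
      using gm[OF that] unfolding reps_sel(2-4) by blast+
    define h where "h i = qcmp (g \<cdot>\<^bsub>reps\<^esub> \<mu> i) i \<cdot> incl Q C i (rv F i) i (i, [])" for i
    have h: "h i \<in> Arr C" "Dom C (h i) = rv F i" "Cod C (h i) = rv T i" if i: "i \<in> verts Q" for i
    proof -
      have n: "walk Q i [] i" using i by simp
      have X: "rv F i \<in> Obj C" using F i by simp
      show "h i \<in> Arr C" "Dom C (h i) = rv F i" "Cod C (h i) = rv T i"
        unfolding h_def using rep_mor_simps(3-5)[OF gm'(1)[OF i] i] gm'(2,3)[OF i] incl_arr[OF n X]
          i by (simp_all del: reps_sel)
    qed
    have H: "is_rep_mor Q C (QMor F T (\<lambda>i\<in>verts Q. h i))"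
    proof (rule rep_morI[OF F T])
      fix \<rho> assume r: "\<rho> \<in> arrows Q"
      have v: "src Q \<rho> \<in> verts Q" "tgt Q \<rho> \<in> verts Q" using r by simp_all
      have X: "rv F (src Q \<rho>) \<in> Obj C" "rv F (tgt Q \<rho>) \<in> Obj C" using F v by simp_all
      have "g \<cdot>\<^bsub>reps\<^esub> (d \<cdot>\<^bsub>reps\<^esub> \<iota> \<rho>) = Zer reps (Dom reps d) (Cod reps g) \<cdot>\<^bsub>reps\<^esub> \<iota> \<rho>"
        using g0 g d' ca(2-4)[OF r] by (intro R.comp_shift) (simp_all del: reps_sel)
      also have "\<dots> = Zer reps (free_rep Q C (tgt Q \<rho>) (rv F (src Q \<rho>))) T"
        using d' ca(2-4)[OF r] R.obj_of_arr(2)[OF g(1)] by (simp add: T_def del: reps_sel)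
      finally have z: "g \<cdot>\<^bsub>reps\<^esub> (d \<cdot>\<^bsub>reps\<^esub> \<iota> \<rho>) = Zer reps (free_rep Q C (tgt Q \<rho>) (rv F (src Q
        \<rho>))) T" .
      have eq: "(g \<cdot>\<^bsub>reps\<^esub> \<mu> (src Q \<rho>)) \<cdot>\<^bsub>reps\<^esub> free_arrow Q C \<rho> (rv F (src Q \<rho>)) =
        (g \<cdot>\<^bsub>reps\<^esub> \<mu> (tgt Q \<rho>)) \<cdot>\<^bsub>reps\<^esub> free_mor Q C (tgt Q \<rho>) (ra F \<rho>)"
        using R.diff_eq_zer_iff[of "(g \<cdot>\<^bsub>reps\<^esub> \<mu> (src Q \<rho>)) \<cdot>\<^bsub>reps\<^esub> free_arrow Q C \<rho> (rv F (src Q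
          \<rho>))" "(g \<cdot>\<^bsub>reps\<^esub> \<mu> (tgt Q \<rho>)) \<cdot>\<^bsub>reps\<^esub> free_mor Q C (tgt Q \<rho>) (ra F \<rho>)"]
          z[unfolded gA[OF r g]] R.comp_arr[OF pa(4)[OF r] gm(1)[OF v(1)]]
            R.comp_arr[OF pa(7)[OF r] gm(1)[OF v(2)]] gm(2,3)[OF v(1)] gm(2,3)[OF v(2)]
            pa(5,6,8,9)[OF r]
        by (simp del: reps_sel R.comp_assoc)
      \<comment> \<open>Evaluated on the trivial path at the target of \<open>\<rho>\<close>, the
        two terms of the difference become the two sides of the naturality square.\<close>
      have "ra T \<rho> \<cdot> h (src Q \<rho>) = qcmp ((g \<cdot>\<^bsub>reps\<^esub> \<mu> (src Q \<rho>)) \<cdot>\<^bsub>reps\<^esub> free_arrow Q C \<rho> (rv F (src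
        Q \<rho>))) (tgt Q \<rho>) \<cdot> incl Q C (tgt Q \<rho>) (rv F (src Q \<rho>)) (tgt Q \<rho>) (tgt Q \<rho>, [])"
        unfolding free_arrow_eval[OF r X(1) gm'(1,2)[OF v(1)]] gm'(3)[OF v(1)] h_def ..
      also have "\<dots> = h (tgt Q \<rho>) \<cdot> ra F \<rho>"
        unfolding eq using free_mor_eval[OF v(2) rep_simps(2)[OF F r] gm'(1)[OF v(2)]]
          gm'(2)[OF v(2)] F r by (simp add: h_def del: reps_sel)
      finally show "h (tgt Q \<rho>) \<cdot> ra F \<rho> = ra T \<rho> \<cdot> h (src Q \<rho>)" by simp
    qed (use h in simp)
    let ?H = "QMor F T (\<lambda>i\<in>verts Q. h i)"
    have Ha: "?H \<in> Arr reps" "Dom reps ?H = F" "Cod reps ?H = T" using H U' by simp_all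
    have "?H \<cdot>\<^bsub>reps\<^esub> p = g"
    proof (rule R.coproduct_eqI[OF c0])
      fix i assume i: "i \<in> verts Q"
      have "(?H \<cdot>\<^bsub>reps\<^esub> p) \<cdot>\<^bsub>reps\<^esub> \<mu> i = ?H \<cdot>\<^bsub>reps\<^esub> (p \<cdot>\<^bsub>reps\<^esub> \<mu> i)" using Ha p' ca(6-8)[OF i]
        by (simp del: reps_sel)
      also have "\<dots> = ?H \<cdot>\<^bsub>reps\<^esub> counit Q C i F" unfolding pm[OF i] ..
      also have "\<dots> = g \<cdot>\<^bsub>reps\<^esub> \<mu> i"
      proof (rule free_mor_eqI[OF i])
        show "rv F i \<in> Obj C" using F i by simp
        have "?H \<cdot>\<^bsub>reps\<^esub> counit Q C i F \<in> Arr reps"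
          "Dom reps (?H \<cdot>\<^bsub>reps\<^esub> counit Q C i F) = free_rep Q C i (rv F i)"
          "Cod reps (?H \<cdot>\<^bsub>reps\<^esub> counit Q C i F) = T"
          using Ha pa(1-3)[OF i] by (simp_all del: reps_sel)
        then show "is_rep_mor Q C (?H \<cdot>\<^bsub>reps\<^esub> counit Q C i F)"
          "qdom (?H \<cdot>\<^bsub>reps\<^esub> counit Q C i F) = free_rep Q C i (rv F i)"
          "qcod (?H \<cdot>\<^bsub>reps\<^esub> counit Q C i F) = qcod (g \<cdot>\<^bsub>reps\<^esub> \<mu> i)"
          unfolding gm'(3)[OF i] reps_sel(2-4) by blast+
        have "qcmp (?H \<cdot>\<^bsub>reps\<^esub> counit Q C i F) i \<cdot> incl Q C i (rv F i) i (i, []) = qcmp ?H i"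
          by (rule counit_eval[OF i H]) simp
        also have "\<dots> = qcmp (g \<cdot>\<^bsub>reps\<^esub> \<mu> i) i \<cdot> incl Q C i (rv F i) i (i, [])" using i
          by (simp add: h_def del: reps_sel)
        finally show "qcmp (?H \<cdot>\<^bsub>reps\<^esub> counit Q C i F) i \<cdot> incl Q C i (rv F i) i (i, []) =
          qcmp (g \<cdot>\<^bsub>reps\<^esub> \<mu> i) i \<cdot> incl Q C i (rv F i) i (i, [])" .
      qed (use gm'[OF i] in \<open>simp_all del: reps_sel\<close>)
      finally show "(?H \<cdot>\<^bsub>reps\<^esub> p) \<cdot>\<^bsub>reps\<^esub> \<mu> i = g \<cdot>\<^bsub>reps\<^esub> \<mu> i" .
    qed (use Ha p' g T_def in \<open>simp_all del: reps_sel\<close>)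
    then show "\<exists>h\<in>Arr reps. Cod reps h = Cod reps g \<and> Dom reps h = Cod reps p \<and> h \<cdot>\<^bsub>reps\<^esub> p = g"
      using Ha p' T_def by (intro bexI[of _ ?H]) (simp_all del: reps_sel)
  qed
qed

lemma ex_presentation_maps:
  assumes U: "\<I> = UNIV" and F: "is_rep Q C F"
    and c1: "is_coproduct reps (arrows Q) (\<lambda>\<rho>. free_rep Q C (tgt Q \<rho>) (rv F (src Q \<rho>))) P1 \<iota>"
    and c0: "is_coproduct reps (verts Q) (\<lambda>i. free_rep Q C i (rv F i)) P0 \<mu>"
  obtains d p where "d \<in> Hom reps P1 P0"
    "\<And>\<rho>. \<rho> \<in> arrows Q \<Longrightarrow> d \<cdot>\<^bsub>reps\<^esub> \<iota> \<rho> = Diff reps (\<mu> (src Q \<rho>) \<cdot>\<^bsub>reps\<^esub> free_arrow Q C \<rho> (rv F (src Q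
      \<rho>)))
                       (\<mu> (tgt Q \<rho>) \<cdot>\<^bsub>reps\<^esub> free_mor Q C (tgt Q \<rho>) (ra F \<rho>))"
    "p \<in> Hom reps P0 F" "\<And>i. i \<in> verts Q \<Longrightarrow> p \<cdot>\<^bsub>reps\<^esub> \<mu> i = counit Q C i F"
proof -
  interpret R: abelian_category reps by (rule abelian_reps)
  note pa = presentation_arr[OF U F]
  note ca = R.coproduct_arr[OF c1] R.coproduct_arr[OF c0]
  have Fo: "F \<in> Obj reps" using F U reps_sel(1) by blast
  let ?D = "\<lambda>\<rho>. Diff reps (\<mu> (src Q \<rho>) \<cdot>\<^bsub>reps\<^esub> free_arrow Q C \<rho> (rv F (src Q \<rho>))) (\<mu> (tgt Q \<rho>)
    \<cdot>\<^bsub>reps\<^esub> free_mor Q C (tgt Q \<rho>) (ra F \<rho>))"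
  have "\<exists>!d. d \<in> Hom reps P1 P0 \<and> (\<forall>\<rho>\<in>arrows Q. d \<cdot>\<^bsub>reps\<^esub> \<iota> \<rho> = ?D \<rho>)"
  proof (rule R.coproduct_ex1[OF c1 ca(5)])
    fix \<rho> assume r: "\<rho> \<in> arrows Q"
    have v: "src Q \<rho> \<in> verts Q" "tgt Q \<rho> \<in> verts Q" using r by simp_all
    show "?D \<rho> \<in> Hom reps (free_rep Q C (tgt Q \<rho>) (rv F (src Q \<rho>))) P0"
      using pa(4-9)[OF r] ca(6-8)[OF v(1)] ca(6-8)[OF v(2)] by (simp del: reps_sel)
  qed
  moreover have "\<exists>!p. p \<in> Hom reps P0 F \<and> (\<forall>i\<in>verts Q. p \<cdot>\<^bsub>reps\<^esub> \<mu> i = counit Q C i F)"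
    by (rule R.coproduct_ex1[OF c0 Fo]) (use pa(1-3) in \<open>simp del: reps_sel\<close>)
  ultimately show thesis using that by blast
qed

text \<open>Serves both terms. For \<open>P1\<close>, \<open>F\<close> is evaluated at the source
  \<open>b\<close> of an arrow and paths start at its target \<open>a\<close>; for \<open>P0\<close>
  the two vertices coincide. A nonzero summand at \<open>k\<close> thus comes from a vertex in the
  support of \<open>F\<close> that reaches \<open>k\<close>.\<close>

lemma Supp_coproduct_free:
  assumes c: "\<And>k. k \<in> verts Q \<Longrightarrow> is_coproduct C (Sigma J (\<lambda>j. paths Q (a j) k)) (\<lambda>c. rv F (b (fst
    c))) (rv P k) (\<lambda>c. f k c)"
    and J: "\<And>j. j \<in> J \<Longrightarrow> b j \<in> verts Q" and ab: "\<And>j. j \<in> J \<Longrightarrow> \<exists>as. walk Q (b j) as (a j)"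
  shows "Supp Q C P \<subseteq> {k \<in> verts Q. \<exists>i\<in>Supp Q C F. paths Q i k \<noteq> {}}"
proof
  fix k assume "k \<in> Supp Q C P"
  then have k: "k \<in> verts Q" "\<not> is_zero_object C (rv P k)" by (auto simp: Supp_def)
  then obtain c where "c \<in> Sigma J (\<lambda>j. paths Q (a j) k)" "\<not> is_zero_object C (rv F (b (fst c)))"
    using coproduct_zero_object[OF c[OF k(1)]] by blast
  then obtain j as where j: "j \<in> J" "walk Q (a j) as k" "\<not> is_zero_object C (rv F (b j))"
    by (auto simp: paths_def)
  obtain bs where "walk Q (b j) bs (a j)" using ab[OF j(1)] by blast
  then have "(b j, as @ bs) \<in> paths Q (b j) k" using walk_append j(2) by simp
  then have "paths Q (b j) k \<noteq> {}" by blast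
  moreover have "b j \<in> Supp Q C F" using J[OF j(1)] j(3) by (simp add: Supp_def)
  ultimately show "k \<in> {k \<in> verts Q. \<exists>i\<in>Supp Q C F. paths Q i k \<noteq> {}}" using k(1) by blast
qed

end

section \<open>Finiteness and cardinality of reachable sets, and the conclusion\<close>

lemma (in quiver_reps) reps_UNIV: "\<I> = UNIV \<Longrightarrow> reps = Rep Q C"
  unfolding reps_def by (simp add: full_subcat_def Rep_def)

text \<open>What \<open>A\<close> reaches lies in \<open>A\<close> or in
  \<open>plus_set Q A\<close>, and going on from there reaches nothing new. With \<open>A\<close> a
  single vertex this bounds the support of a free representation, with \<open>A\<close> the support
  of \<open>F\<close> the terms of the presentation.\<close>

lemma finite_reachable:
  assumes "finite A" "finite (plus_set Q A)" and B: "B \<subseteq> {k \<in> verts Q. \<exists>i\<in>A. paths Q i k \<noteq> {}}"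
  shows "finite B" "finite (plus_set Q B)"
proof -
  have R: "{k \<in> verts Q. \<exists>i\<in>A. paths Q i k \<noteq> {}} \<subseteq> A \<union> plus_set Q A" by (auto simp: plus_set_def)
  then show "finite B" using assms by (meson finite_UnI finite_subset)
  have "plus_set Q B \<subseteq> {k \<in> verts Q. \<exists>i\<in>A. paths Q i k \<noteq> {}}"
  proof
    fix k assume "k \<in> plus_set Q B"
    then obtain j bs where k: "k \<in> verts Q" "j \<in> B" "walk Q j bs k"
      by (auto simp: plus_set_def paths_def)
    then obtain i as where i: "i \<in> A" "walk Q i as j" using B by (auto simp: paths_def)
    have "(i, bs @ as) \<in> paths Q i k" using walk_append[OF i(2) k(3)] by simp
    then show "k \<in> {k \<in> verts Q. \<exists>i\<in>A. paths Q i k \<noteq> {}}" using k(1) i(1) by blast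
  qed
  then show "finite (plus_set Q B)" using R assms by (meson finite_UnI finite_subset)
qed

text \<open>The pair of \<open>\<rho>\<close> and \<open>\<sigma>\<close> is encoded by the path
  \<open>\<sigma>\<rho>\<close>, whose first arrow gives \<open>\<rho>\<close> back; so
  \<open>ltccn\<close> also bounds the coproduct over arrows.\<close>

lemma card_arrow_paths:
  assumes Q: "is_quiver Q"
  shows "|Sigma (arrows Q) (\<lambda>\<rho>. paths Q (tgt Q \<rho>) k)| \<le>o |paths_to Q k|"
proof (rule card_of_ordLeqI[of "\<lambda>c. before_path Q (snd c) (fst c)"])
  show "inj_on (\<lambda>c. before_path Q (snd c) (fst c)) (Sigma (arrows Q) (\<lambda>\<rho>. paths Q (tgt Q \<rho>) k))"
    by (rule inj_onI) (auto simp: paths_def before_path_def)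
  fix c assume "c \<in> Sigma (arrows Q) (\<lambda>\<rho>. paths Q (tgt Q \<rho>) k)"
  then show "before_path Q (snd c) (fst c) \<in> paths_to Q k"
    using Q walk_snoc[OF Q] by (auto simp: paths_def before_path_def paths_to_def is_quiver_def)
qed

lemma card_vertex_paths: "|Sigma (verts Q) (\<lambda>i. paths Q i k)| \<le>o |paths_to Q k|"
proof (rule card_of_ordLeqI[of snd])
  show "inj_on snd (Sigma (verts Q) (\<lambda>i. paths Q i k))" by (rule inj_onI) (auto simp: paths_def)
qed (auto simp: paths_to_def)

theorem proposition5p6:
  fixes Q :: "('v, 'e) quiver" and C :: "('o, 'm) cat" and \<kappa> :: "'k rel"
  assumes "is_quiver Q" and "abelian_category C"
    and "Cinfinite \<kappa>" and "rccn Q \<le>o \<kappa>" and "AB3 \<kappa> C"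
  shows "(\<forall>i\<in>TQ0 Q. \<forall>X\<in>Obj C. fob (free_functor Q C i) X \<in> Obj (Rep_ft Q C)) \<and>
    (ltccn Q \<le>o \<kappa> \<longrightarrow> (\<forall>F\<in>Obj (Rep_ft Q C).
       (\<exists>P1 P0 d p. is_canonical_presentation Q C F P1 P0 d p) \<and>
       (\<forall>P1 P0 d p. is_canonical_presentation Q C F P1 P0 d p \<longrightarrow>
          is_short_exact (Rep Q C) d p \<and>
          P1 \<in> Obj (Rep_ft Q C) \<and> P0 \<in> Obj (Rep_ft Q C)))) \<and>
    (\<forall>i\<in>TQ0 Q. is_left_adjoint C (Rep_ft Q C) (free_functor Q C i) (eval_functor i)) \<and>
    ((\<forall>i\<in>TQ0 Q. is_exact_functor C (Rep_ft Q C) (free_functor Q C i)) \<longrightarrow>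
     (\<forall>i\<in>TQ0 Q. \<forall>n\<ge>1.
        Ext_naturally_isomorphic C (Rep_ft Q C) (free_functor Q C i) (eval_functor i) n))"
proof -
  interpret C: abelian_category C by fact
  have \<kappa>: "Card_order \<kappa>" using assms(3) by blast
  let ?I = "{A. finite A \<and> finite (plus_set Q A)}"
  have copow: "\<exists>P \<iota>. is_coproduct C (paths Q i j) (\<lambda>_. X) P \<iota>" if "i \<in> verts Q" "j \<in> verts Q"
    "X \<in> Obj C" for i j X
    using AB3_coproduct[OF C.category_axioms \<kappa> assms(5) card_paths_less[OF that(1,2) assms(4)], of
      "\<lambda>_. X"] that(3) by blast
  \<comment> \<open>Two instances of the same development: all supports, where the presentation is
    formed and shown exact, and supports of finite top, where the adjunction and Ext are
    taken.\<close>
  interpret W: path_copowers C Q UNIV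
    by unfold_locales (use assms(1) copow in auto)
  interpret T: path_copowers C Q ?I
  proof (intro path_copowers.intro quiver_reps.intro quiver_reps_axioms.intro
    path_copowers_axioms.intro C.abelian_category_axioms assms(1) copow)
    show "{} \<in> ?I" by (simp add: plus_set_def)
    show "B \<in> ?I" if "A \<in> ?I" "B \<subseteq> A" for A B
    proof -
      \<comment> \<open>A vertex reached from \<open>B\<close> may lie in \<open>A\<close> outside
        \<open>B\<close>, hence the extra \<open>A\<close>.\<close>
      have "plus_set Q B \<subseteq> A \<union> plus_set Q A" using that(2) by (auto simp: plus_set_def)
      then show ?thesis using that by (auto intro: finite_subset)
    qed
    show "A \<union> B \<in> ?I" if "A \<in> ?I" "B \<in> ?I" for A B
    proof -
      have "plus_set Q (A \<union> B) \<subseteq> plus_set Q A \<union> plus_set Q B" by (auto simp: plus_set_def)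
      then show ?thesis using that by (auto intro: finite_subset)
    qed
  qed
  have ft: "T.reps = Rep_ft Q C" by (simp add: T.reps_def Rep_ft_def)
  have full: "W.reps = Rep Q C" by (rule W.reps_UNIV) simp
  have reach: "i \<in> verts Q" "T.reach i \<in> ?I" if "i \<in> TQ0 Q" for i
  proof -
    have "finite {i}" "finite (plus_set Q {i})" using that by (auto simp: TQ0_def)
    from finite_reachable[OF this, of "T.reach i"] show "T.reach i \<in> ?I" by (auto simp: T.reach_def)
  qed (use that in \<open>simp add: TQ0_def\<close>)
  have a: "fob (free_functor Q C i) X \<in> Obj (Rep_ft Q C)" if "i \<in> TQ0 Q" "X \<in> Obj C" for i X
    using T.free_rep_obj[OF reach[OF that(1)] that(2)] unfolding ft by (simp add: free_functor_def)
  have b: "(\<exists>P1 P0 d p. is_canonical_presentation Q C F P1 P0 d p) \<and>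
       (\<forall>P1 P0 d p. is_canonical_presentation Q C F P1 P0 d p \<longrightarrow>
          is_short_exact (Rep Q C) d p \<and> P1 \<in> Obj (Rep_ft Q C) \<and> P0 \<in> Obj (Rep_ft Q C))"
    if l: "ltccn Q \<le>o \<kappa>" and F: "F \<in> Obj (Rep_ft Q C)" for F
  proof (intro conjI allI impI)
    have Fr: "is_rep Q C F" and Fs: "finite (Supp Q C F)" "finite (plus_set Q (Supp Q C F))"
      using F unfolding ft[symmetric] T.reps_sel(1) by blast+
    have card: "|paths_to Q k| <o \<kappa>" if "k \<in> verts Q" for k using card_paths_to_less[OF that l] .
    have cop1: "\<exists>P \<iota>. is_coproduct C (Sigma (arrows Q) (\<lambda>\<rho>. paths Q (tgt Q \<rho>) k)) (\<lambda>c. rv F (src Q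
      (fst c))) P \<iota>" if "k \<in> verts Q" for k
      using AB3_coproduct[OF C.category_axioms \<kappa> assms(5) ordLeq_ordLess_trans[OF
        card_arrow_paths[OF assms(1)] card[OF that]], of "\<lambda>c. rv F (src Q (fst c))"]
        Fr by fastforce
    have cop0: "\<exists>P \<iota>. is_coproduct C (Sigma (verts Q) (\<lambda>i. paths Q i k)) (\<lambda>c. rv F (fst c)) P \<iota>"
      if "k \<in> verts Q" for k
      using AB3_coproduct[OF C.category_axioms \<kappa> assms(5) ordLeq_ordLess_trans[OF card_vertex_paths
        card[OF that]], of "\<lambda>c. rv F (fst c)"]
        Fr by fastforce
    have v1: "\<rho> \<in> arrows Q \<Longrightarrow> tgt Q \<rho> \<in> verts Q" "\<rho> \<in> arrows Q \<Longrightarrow> rv F (src Q \<rho>) \<in> Obj C"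
      "\<rho> \<in> arrows Q \<Longrightarrow> src Q \<rho> \<in> verts Q"
      and v0: "i \<in> verts Q \<Longrightarrow> rv F i \<in> Obj C" for \<rho> i using Fr by simp_all
    show "\<exists>P1 P0 d p. is_canonical_presentation Q C F P1 P0 d p"
    proof -
      obtain P1 \<iota> where c1: "is_coproduct W.reps (arrows Q) (\<lambda>\<rho>. free_rep Q C (tgt Q \<rho>) (rv F (src Q
        \<rho>))) P1 \<iota>"
        using W.ex_coproduct_free[of "arrows Q" "tgt Q" "\<lambda>\<rho>. rv F (src Q \<rho>)", OF refl v1(1,2) cop1]
          by blast
      obtain P0 \<mu> where c0: "is_coproduct W.reps (verts Q) (\<lambda>i. free_rep Q C i (rv F i)) P0 \<mu>"
        using W.ex_coproduct_free[of "verts Q" "\<lambda>i. i" "rv F", OF refl _ v0 cop0] by blast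
      obtain d p where "d \<in> Hom W.reps P1 P0"
        "\<And>\<rho>. \<rho> \<in> arrows Q \<Longrightarrow> d \<cdot>\<^bsub>W.reps\<^esub> \<iota> \<rho> = Diff W.reps (\<mu> (src Q \<rho>) \<cdot>\<^bsub>W.reps\<^esub> free_arrow Q C
          \<rho> (rv F (src Q \<rho>)))
                           (\<mu> (tgt Q \<rho>) \<cdot>\<^bsub>W.reps\<^esub> free_mor Q C (tgt Q \<rho>) (ra F \<rho>))"
        "p \<in> Hom W.reps P0 F" "\<And>i. i \<in> verts Q \<Longrightarrow> p \<cdot>\<^bsub>W.reps\<^esub> \<mu> i = counit Q C i F"
        using W.ex_presentation_maps[OF refl Fr c1 c0] by blast
      then have "is_canonical_presentation Q C F P1 P0 d p"
        unfolding is_canonical_presentation_def full[symmetric] using c1 c0 by blast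
      then show ?thesis by blast
    qed
    fix P1 P0 d p assume "is_canonical_presentation Q C F P1 P0 d p"
    then obtain \<iota> \<mu> where c1: "is_coproduct W.reps (arrows Q) (\<lambda>\<rho>. free_rep Q C (tgt Q \<rho>) (rv F (src
      Q \<rho>))) P1 \<iota>"
      and c0: "is_coproduct W.reps (verts Q) (\<lambda>i. free_rep Q C i (rv F i)) P0 \<mu>"
      and d: "d \<in> Hom W.reps P1 P0"
        "\<And>\<rho>. \<rho> \<in> arrows Q \<Longrightarrow> d \<cdot>\<^bsub>W.reps\<^esub> \<iota> \<rho> = Diff W.reps (\<mu> (src Q \<rho>) \<cdot>\<^bsub>W.reps\<^esub> free_arrow Q C
          \<rho> (rv F (src Q \<rho>)))
                           (\<mu> (tgt Q \<rho>) \<cdot>\<^bsub>W.reps\<^esub> free_mor Q C (tgt Q \<rho>) (ra F \<rho>))"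
      and p: "p \<in> Hom W.reps P0 F" "\<And>i. i \<in> verts Q \<Longrightarrow> p \<cdot>\<^bsub>W.reps\<^esub> \<mu> i = counit Q C i F"
      unfolding is_canonical_presentation_def full[symmetric] by blast
    interpret R: abelian_category W.reps by (rule W.abelian_reps)
    note pw1 = W.coproduct_free_pointwise[of "arrows Q" "tgt Q" "\<lambda>\<rho>. rv F (src Q \<rho>)", OF refl
      v1(1,2) cop1 c1]
    note pw0 = W.coproduct_free_pointwise[of "verts Q" "\<lambda>i. i" "rv F", OF refl _ v0 cop0 c0]
    have i: "\<rho> \<in> arrows Q \<Longrightarrow> \<iota> \<rho> \<in> Hom W.reps (free_rep Q C (tgt Q \<rho>) (rv F (src Q \<rho>))) P1"
      and m: "i \<in> verts Q \<Longrightarrow> \<mu> i \<in> Hom W.reps (free_rep Q C i (rv F i)) P0" for \<rho> i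
      using c1 c0 unfolding is_coproduct_def by blast+
    have "is_monic W.reps d"
      by (rule W.presentation_monic[OF refl Fr pw1 pw0 i m d]) assumption+
    moreover have "is_cokernel W.reps d p"
      by (rule W.presentation_cokernel[OF refl Fr c1 c0 d p])
    ultimately show "is_short_exact (Rep Q C) d p" unfolding full[symmetric]
      by (rule R.short_exactI)
    have P: "is_rep Q C P1" "is_rep Q C P0"
      using R.coproduct_arr(1)[OF c1] R.coproduct_arr(1)[OF c0] unfolding W.reps_sel(1) by blast+
    have "Supp Q C P1 \<subseteq> {k \<in> verts Q. \<exists>i\<in>Supp Q C F. paths Q i k \<noteq> {}}"
    proof (rule W.Supp_coproduct_free[where J = "arrows Q" and a = "tgt Q" and b = "src Q", OF pw1
      v1(3)])
      show "\<exists>as. walk Q (src Q \<rho>) as (tgt Q \<rho>)" if "\<rho> \<in> arrows Q" for \<rho>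
        by (rule exI[of _ "[\<rho>]"]) (use that in simp)
    qed
    with finite_reachable[OF Fs] have "Supp Q C P1 \<in> ?I" by blast
    then show "P1 \<in> Obj (Rep_ft Q C)" using P unfolding ft[symmetric] T.reps_sel(1) by blast
    have "Supp Q C P0 \<subseteq> {k \<in> verts Q. \<exists>i\<in>Supp Q C F. paths Q i k \<noteq> {}}"
    proof (rule W.Supp_coproduct_free[where J = "verts Q" and a = "\<lambda>i. i" and b = "\<lambda>i. i", OF pw0])
      show "\<exists>as. walk Q i as i" if "i \<in> verts Q" for i by (rule exI[of _ "[]"]) (use that in simp)
    qed
    with finite_reachable[OF Fs] have "Supp Q C P0 \<in> ?I" by blast
    then show "P0 \<in> Obj (Rep_ft Q C)" using P unfolding ft[symmetric] T.reps_sel(1) by blast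
  qed
  have c: "is_left_adjoint C (Rep_ft Q C) (free_functor Q C i) (eval_functor i)" if "i \<in> TQ0 Q"
    for i
    using T.free_left_adjoint[OF reach[OF that]] unfolding ft .
  have d: "Ext_naturally_isomorphic C (Rep_ft Q C) (free_functor Q C i) (eval_functor i) n"
    if "is_exact_functor C (Rep_ft Q C) (free_functor Q C i)" "i \<in> TQ0 Q" "n \<ge> 1" for i n
    using T.free_Ext_iso[OF reach[OF that(2)] _ that(3)] that(1) unfolding ft by blast
  show ?thesis using a b c d by blast
qed

end
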